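(* Let $w$ be an annular web of degree $n$. Then for any radial cut $I$ of $w$, $$\mathrm{LLT}_{w,I}[\mathbf x;q]=(q-q^{-1})^n\,X_w\!\left[\frac{\mathbf x}{q-q^{-1}};q\right].$$ Consequently, $\mathrm{LLT}_{w,I}$ is symmetric in $x_1,x_2,\dots$ and independent of $I$.
   Context: **Annular webs.** Let $\mathbb A=[0,1]\times[0,1]/\big((x,0)\sim(x,1)\big)$ be the annulus; left/right refer to the first coordinate, upward to the second. An annular web $w$ is a finite trivalent graph embedded in $\mathbb A$ (vertex-free essential circles are allowed as edges), all of whose edges are oriented upward (the second coordinate increases along each edge), together with a thickness $t(e)\in\mathbb Z_{>0}$ for each edge $e$, such that at every vertex the total incoming thickness equals the total outgoing thickness. Every vertex is a merge (two incoming edges, one outgoing) or a split (one incoming, two outgoing). The degree $\deg(w)$ is $\sum t(e)$ over the edges crossed by any radial (horizontal) segment transverse to $w$ and avoiding vertices. **$X_w$.** Let $\mathbb N=\{1,2,\dots\}$. A coloring $c$ of $w$ assigns to each edge $e$ a finite set $c(e)\subset\mathbb N$ with $|c(e)|=t(e)$ such that at every vertex the union of the color sets on incoming edges equals the union on outgoing edges; $\mathcal C(w)$ is the set of colorings. Put $\mathrm{inv}_w(c)=\sum_m\sum_{a\in c(e_R),\,b\in c(e_L)}\mathrm{sgn}(a-b)$ over all merges $m$, with $e_L,e_R$ the left and right incoming edges of $m$. $\Gamma_i(c)$ is the union of the edges $e$ with $i\in c(e)$ (a disjoint union of circles), $x^c=\prod_ix_i^{|\Gamma_i(c)|}$ with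 $|\cdot|$ the number of components, and $X_w[\mathbf x;q]=\sum_{c\in\mathcal C(w)}q^{\mathrm{inv}_w(c)}x^c$, which is a symmetric function. The plethystic substitution $f\!\left[\frac{\mathbf x}{q-q^{-1}};q\right]$ is the $\mathbb Q(q)$-algebra endomorphism of symmetric functions with $p_m\mapsto\frac{p_m}{q^m-q^{-m}}$ for all power sums $p_m$, $m\ge1$. **Radial cut, labeled loop decompositions.** A radial cut $I$ is a radial (horizontal) segment across $\mathbb A$ transverse to $w$ and disjoint from its vertices. Let $e_1,\dots,e_r$ be the edges meeting $I$, from left to right; the initial thickness is $t(I)=(t(e_1),\dots,t(e_r))$. For a composition $\alpha=(\alpha_1,\dots,\alpha_r)$, $[\alpha]!=[\alpha_1]!\cdots[\alpha_r]!$ with $[k]!=[1]\cdots[k]$ and $[k]=\frac{q^k-q^{-k}}{q-q^{-1}}$. Let $B_j=\{t(e_1)+\cdots+t(e_{j-1})+1,\dots,t(e_1)+\cdots+t(e_j)\}\subset[n]=\{1,\dots,n\}$. A standard labeled loop decomposition of $(w,I)$ is a map $\mathcal L$ from edges of $w$ to subsets of $[n]$ with (1) $\mathcal L(e_j)=B_j$ for all $j$; (2) $|\mathcal L(e)|=t(e)$ for all $e$; (3) at every merge or split, the label set of the single edge on one side is the disjoint union of the label sets of the two edges on the other side. $\mathrm{SLD}(w,I)$ is the set of these. For $u\in[n]$, $L_u$ is the loop formed by the edges whose label set contains $u$. **Web LLT function.** For $\mathcal L\in\mathrm{SLD}(w,I)$, the multiset $\mathsf A_I(\mathcal L)$ of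 ordered attacking pairs consists of: one pair $(u,v)$ for each block $B_j$ and each $u<v$ in $B_j$; and, for each merge, one pair $(u,v)$ whenever $L_u$ enters the merge from the left and $L_v$ from the right (all counted with multiplicity). For an arbitrary map $\sigma:[n]\to\mathbb Z_{>0}$ put $\epsilon_\sigma(u,v)=+1$ if $\sigma(v)>\sigma(u)$, or $\sigma(v)=\sigma(u)$ and $v<u$; and $\epsilon_\sigma(u,v)=-1$ otherwise. Put $\mathrm{inv}_{\mathcal L}(\sigma)=\sum_{(u,v)\in\mathsf A_I(\mathcal L)}\epsilon_\sigma(u,v)$ and $x^\sigma=\prod_{u=1}^nx_{\sigma(u)}$. The web LLT function of $w$ relative to $I$ is $$\mathrm{LLT}_{w,I}[\mathbf x;q]=\frac1{[t(I)]!}\sum_{\mathcal L\in\mathrm{SLD}(w,I)}\ \sum_{\sigma:[n]\to\mathbb Z_{>0}}q^{\mathrm{inv}_{\mathcal L}(\sigma)}x^\sigma .$$ *)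

theory Defs
  imports
    "HOL-Analysis.Analysis"
    "HOL-Library.Poly_Mapping"
    "HOL-Library.Multiset"
    "HOL-Library.FuncSet"
    "HOL-Computational_Algebra.Polynomial"
    "HOL-Computational_Algebra.Fraction_Field"
    "HOL-Combinatorics.Permutations"
begin

section \<open>Symmetric functions over the field of rational functions in q\<close>

type_synonym qfield = "rat poly fract"

definition q :: qfield where
  "q = Fract [:0, 1:] 1"

definition qint :: "nat \<Rightarrow> qfield" where
  "qint k = (q ^ k - inverse q ^ k) / (q - inverse q)"

definition qfact :: "nat \<Rightarrow> qfield" where
  "qfact k = (\<Prod>i = 1..k. qint i)"

definition qfact_comp :: "nat list \<Rightarrow> qfield" where
  "qfact_comp \<alpha> = prod_list (map qfact \<alpha>)"

text \<open>A formal power series is given by its coefficients: \<open>f \<mu>\<close> is the coefficient of the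
  monomial whose exponent of \<open>x\<^sub>i\<close> is \<open>lookup \<mu> i\<close>.  The variables are
  \<open>x\<^sub>1, x\<^sub>2, \<dots>\<close>; the index 0 is not used.\<close>

type_synonym series = "(nat \<Rightarrow>\<^sub>0 nat) \<Rightarrow> qfield"

definition series_one :: series where
  "series_one = (\<lambda>\<mu>. if \<mu> = 0 then 1 else 0)"

definition series_add :: "series \<Rightarrow> series \<Rightarrow> series" where
  "series_add f g = (\<lambda>\<mu>. f \<mu> + g \<mu>)"

definition series_mult :: "series \<Rightarrow> series \<Rightarrow> series" where
  "series_mult f g = (\<lambda>\<mu>. \<Sum>(\<alpha>, \<beta>) \<in> {(\<alpha>, \<beta>). \<alpha> + \<beta> = \<mu>}. f \<alpha> * g \<beta>)"

definition series_scale :: "qfield \<Rightarrow> series \<Rightarrow> series" where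
  "series_scale a f = (\<lambda>\<mu>. a * f \<mu>)"

text \<open>The algebra of symmetric functions: series of bounded degree in \<open>x\<^sub>1, x\<^sub>2, \<dots>\<close>
  that are invariant under permutations of the variables.\<close>

definition sym_functions :: "series set" where
  "sym_functions = {f.
     (\<forall>\<mu>. f \<mu> \<noteq> 0 \<longrightarrow> Poly_Mapping.keys \<mu> \<subseteq> {1..}) \<and>
     (\<exists>d. \<forall>\<mu>. f \<mu> \<noteq> 0 \<longrightarrow> (\<Sum>i \<in> Poly_Mapping.keys \<mu>. Poly_Mapping.lookup \<mu> i) \<le> d) \<and>
     (\<forall>\<pi> \<mu>. \<pi> permutes {1..} \<longrightarrow> f (Poly_Mapping.map_key \<pi> \<mu>) = f \<mu>)}"

definition power_sum :: "nat \<Rightarrow> series" where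
  "power_sum m = (\<lambda>\<mu>. if \<exists>i\<ge>1. \<mu> = Poly_Mapping.single i m then 1 else 0)"

definition sym_alg_endo :: "(series \<Rightarrow> series) \<Rightarrow> bool" where
  "sym_alg_endo \<phi> \<longleftrightarrow>
     \<phi> \<in> sym_functions \<rightarrow>\<^sub>E sym_functions \<and>
     \<phi> series_one = series_one \<and>
     (\<forall>f\<in>sym_functions. \<forall>g\<in>sym_functions.
        \<phi> (series_add f g) = series_add (\<phi> f) (\<phi> g) \<and>
        \<phi> (series_mult f g) = series_mult (\<phi> f) (\<phi> g)) \<and>
     (\<forall>a. \<forall>f\<in>sym_functions. \<phi> (series_scale a f) = series_scale a (\<phi> f))"

text \<open>The substitution \<open>f \<mapsto> f[x / (q - q\<^sup>-\<^sup>1)]\<close>.  It is unique because the power sums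
  generate the algebra; outside \<open>sym_functions\<close> its value is \<open>undefined\<close>.\<close>

definition plethysm :: "series \<Rightarrow> series" where
  "plethysm = (THE \<phi>. sym_alg_endo \<phi> \<and>
     (\<forall>m\<ge>1. \<phi> (power_sum m) = series_scale (1 / (q ^ m - inverse q ^ m)) (power_sum m)))"


section \<open>Annular webs\<close>

text \<open>The annulus is realised as \<open>[0,1] \<times> S\<^sup>1\<close>; the real \<open>y\<close> is a lift of the circular
  coordinate to the line, so that \<open>ann x y = ann x (y + 1)\<close>.\<close>

definition ann :: "real \<Rightarrow> real \<Rightarrow> real \<times> complex" where
  "ann x y = (x, cis (2 * pi * y))"

text \<open>Since the height increases along every edge, an edge \<open>e\<close> is parametrised by its (lifted)
  height: it is the curve \<open>y \<mapsto> ann (pos w e y) y\<close>, for \<open>y\<close> from \<open>lo w e\<close> to \<open>hi w e\<close>.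
  In particular every horizontal segment is transverse to a web.\<close>

record 'e web =
  verts :: "(real \<times> complex) set"
  edges :: "'e set"
  lo :: "'e \<Rightarrow> real"
  hi :: "'e \<Rightarrow> real"
  pos :: "'e \<Rightarrow> real \<Rightarrow> real"
  thick :: "'e \<Rightarrow> nat"

definition edge_pt :: "'e web \<Rightarrow> 'e \<Rightarrow> real \<Rightarrow> real \<times> complex" where
  "edge_pt w e y = ann (pos w e y) y"

definition edge_start :: "'e web \<Rightarrow> 'e \<Rightarrow> real \<times> complex" where
  "edge_start w e = edge_pt w e (lo w e)"

definition edge_end :: "'e web \<Rightarrow> 'e \<Rightarrow> real \<times> complex" where
  "edge_end w e = edge_pt w e (hi w e)"

definition edge_curve :: "'e web \<Rightarrow> 'e \<Rightarrow> (real \<times> complex) set" where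
  "edge_curve w e = edge_pt w e ` {lo w e..hi w e}"

text \<open>The parameters at which the edge is not at a vertex.  For a vertex-free circle, the common
  start and end point is counted once.\<close>

definition edge_dom :: "'e web \<Rightarrow> 'e \<Rightarrow> real set" where
  "edge_dom w e =
     (if edge_start w e \<in> verts w then {lo w e<..<hi w e} else {lo w e..<hi w e})"

definition in_edges :: "'e web \<Rightarrow> real \<times> complex \<Rightarrow> 'e set" where
  "in_edges w v = {e \<in> edges w. edge_end w e = v}"

definition out_edges :: "'e web \<Rightarrow> real \<times> complex \<Rightarrow> 'e set" where
  "out_edges w v = {e \<in> edges w. edge_start w e = v}"

definition merges :: "'e web \<Rightarrow> (real \<times> complex) set" where
  "merges w = {v \<in> verts w. card (in_edges w v) = 2 \<and> card (out_edges w v) = 1}"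

definition splits :: "'e web \<Rightarrow> (real \<times> complex) set" where
  "splits w = {v \<in> verts w. card (in_edges w v) = 1 \<and> card (out_edges w v) = 2}"

definition annular_web :: "'e web \<Rightarrow> bool" where
  "annular_web w \<longleftrightarrow>
     finite (verts w) \<and> finite (edges w) \<and>
     (\<forall>e\<in>edges w.
        lo w e < hi w e \<and>
        continuous_on {lo w e..hi w e} (pos w e) \<and>
        pos w e ` {lo w e..hi w e} \<subseteq> {0..1} \<and>
        thick w e > 0 \<and>
        (edge_start w e \<in> verts w \<and> edge_end w e \<in> verts w \<or>
         edge_start w e \<notin> verts w \<and> edge_end w e = edge_start w e)) \<and>
     \<comment> \<open>embeddedness\<close>
     (\<forall>e\<in>edges w. \<forall>y\<in>edge_dom w e. edge_pt w e y \<notin> verts w) \<and>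
     inj_on (\<lambda>(e, y). edge_pt w e y) (SIGMA e:edges w. edge_dom w e) \<and>
     verts w = merges w \<union> splits w \<and>
     (\<forall>v\<in>verts w. (\<Sum>e\<in>in_edges w v. thick w e) = (\<Sum>e\<in>out_edges w v. thick w e))"

text \<open>The left one of the edges coming into \<open>v\<close>: just below \<open>v\<close> it has the smaller first
  coordinate.  The heights are compared after translating both upper ends to 0, as the lifts of the
  two edges may differ by an integer.\<close>

definition left_of_below :: "'e web \<Rightarrow> 'e \<Rightarrow> 'e \<Rightarrow> bool" where
  "left_of_below w e e' \<longleftrightarrow>
     (\<forall>\<^sub>F s in at_right 0. pos w e (hi w e - s) < pos w e' (hi w e' - s))"

definition left_in :: "'e web \<Rightarrow> real \<times> complex \<Rightarrow> 'e" where
  "left_in w v = (THE e. e \<in> in_edges w v \<and> (\<forall>e'\<in>in_edges w v - {e}. left_of_below w e e'))"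

definition right_in :: "'e web \<Rightarrow> real \<times> complex \<Rightarrow> 'e" where
  "right_in w v = (THE e. e \<in> in_edges w v \<and> (\<forall>e'\<in>in_edges w v - {e}. left_of_below w e' e))"


section \<open>Radial cuts and degree\<close>

text \<open>The radial cut at height \<open>h\<close> is the segment of all \<open>ann x h\<close> with \<open>0 \<le> x \<le> 1\<close>.\<close>

definition radial_cut :: "'e web \<Rightarrow> real \<Rightarrow> bool" where
  "radial_cut w h \<longleftrightarrow> (\<forall>x\<in>{0..1}. ann x h \<notin> verts w)"

definition cut_edges :: "'e web \<Rightarrow> real \<Rightarrow> 'e list" where
  "cut_edges w h =
     map (\<lambda>x. THE e. e \<in> edges w \<and> ann x h \<in> edge_curve w e)
       (sorted_list_of_set {x \<in> {0..1}. \<exists>e\<in>edges w. ann x h \<in> edge_curve w e})"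

definition cut_thickness :: "'e web \<Rightarrow> real \<Rightarrow> nat list" where
  "cut_thickness w h = map (thick w) (cut_edges w h)"

definition web_degree :: "'e web \<Rightarrow> nat" where
  "web_degree w = (THE n. \<forall>h. radial_cut w h \<longrightarrow> n = sum_list (cut_thickness w h))"


section \<open>Colorings and the function X\<close>

definition colorings :: "'e web \<Rightarrow> ('e \<Rightarrow> nat set) set" where
  "colorings w = {c \<in> extensional (edges w).
     (\<forall>e\<in>edges w. finite (c e) \<and> c e \<subseteq> {1..} \<and> card (c e) = thick w e) \<and>
     (\<forall>v\<in>verts w. (\<Union>e\<in>in_edges w v. c e) = (\<Union>e\<in>out_edges w v. c e))}"

definition coloring_inv :: "'e web \<Rightarrow> ('e \<Rightarrow> nat set) \<Rightarrow> int" where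
  "coloring_inv w c =
     (\<Sum>m\<in>merges w. \<Sum>a\<in>c (right_in w m). \<Sum>b\<in>c (left_in w m). sgn (int a - int b))"

definition color_curves :: "'e web \<Rightarrow> ('e \<Rightarrow> nat set) \<Rightarrow> nat \<Rightarrow> (real \<times> complex) set" where
  "color_curves w c i = (\<Union>e\<in>{e \<in> edges w. i \<in> c e}. edge_curve w e)"

text \<open>The coefficient at \<open>\<mu>\<close> sums over the finitely many colorings \<open>c\<close> with
  \<open>x\<^sup>c = x\<^sup>\<mu>\<close>.\<close>

definition X_web :: "'e web \<Rightarrow> series" where
  "X_web w = (\<lambda>\<mu>. \<Sum>c \<in> {c \<in> colorings w.
       \<forall>i. Poly_Mapping.lookup \<mu> i = card (components (color_curves w c i))}.
     q powi coloring_inv w c)"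


section \<open>Labeled loop decompositions and the web LLT function\<close>

text \<open>Blocks are indexed from 0: \<open>cut_block w h j\<close> is the set of labels of the edge
  \<open>cut_edges w h ! j\<close>.\<close>

definition cut_block :: "'e web \<Rightarrow> real \<Rightarrow> nat \<Rightarrow> nat set" where
  "cut_block w h j =
     {sum_list (take j (cut_thickness w h))<..sum_list (take (Suc j) (cut_thickness w h))}"

definition SLD :: "'e web \<Rightarrow> real \<Rightarrow> ('e \<Rightarrow> nat set) set" where
  "SLD w h = {L \<in> edges w \<rightarrow>\<^sub>E Pow {1..web_degree w}.
     (\<forall>j < length (cut_edges w h). L (cut_edges w h ! j) = cut_block w h j) \<and>
     (\<forall>e\<in>edges w. card (L e) = thick w e) \<and>
     (\<forall>v\<in>verts w. (\<Union>e\<in>in_edges w v. L e) = (\<Union>e\<in>out_edges w v. L e) \<and>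
        disjoint_family_on L (in_edges w v) \<and> disjoint_family_on L (out_edges w v))}"

definition attacking_pairs :: "'e web \<Rightarrow> real \<Rightarrow> ('e \<Rightarrow> nat set) \<Rightarrow> (nat \<times> nat) multiset" where
  "attacking_pairs w h L =
     (\<Sum>j < length (cut_edges w h).
        mset_set {(u, v). u \<in> cut_block w h j \<and> v \<in> cut_block w h j \<and> u < v}) +
     (\<Sum>m\<in>merges w. mset_set (L (left_in w m) \<times> L (right_in w m)))"

definition attack_sign :: "(nat \<Rightarrow> nat) \<Rightarrow> nat \<times> nat \<Rightarrow> int" where
  "attack_sign \<sigma> = (\<lambda>(u, v). if \<sigma> v > \<sigma> u \<or> \<sigma> v = \<sigma> u \<and> v < u then 1 else -1)"

definition loop_inv :: "'e web \<Rightarrow> real \<Rightarrow> ('e \<Rightarrow> nat set) \<Rightarrow> (nat \<Rightarrow> nat) \<Rightarrow> int" where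
  "loop_inv w h L \<sigma> = (\<Sum>p \<in># attacking_pairs w h L. attack_sign \<sigma> p)"

text \<open>The coefficient at \<open>\<mu>\<close> sums over the maps \<open>\<sigma>\<close> with \<open>x\<^sup>\<sigma> = x\<^sup>\<mu>\<close>.\<close>

definition LLT_web :: "'e web \<Rightarrow> real \<Rightarrow> series" where
  "LLT_web w h = (\<lambda>\<mu>. 1 / qfact_comp (cut_thickness w h) *
     (\<Sum>L\<in>SLD w h.
        \<Sum>\<sigma> \<in> {\<sigma> \<in> {1..web_degree w} \<rightarrow>\<^sub>E {1..}.
              (\<Sum>u = 1..web_degree w. Poly_Mapping.single (\<sigma> u) 1) = \<mu>}.
          q powi loop_inv w h L \<sigma>))"

end

theory Submission
 imports Defs "HOL-Library.Function_Algebras"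
begin

text \<open>Colourings and labelled loop decompositions are both decompositions of the thickness function into
 conserved weights on the edges (flows).  Weighted by \<open>q\<close> to the number of signed crossings at the merges,
 functions on flows form an associative algebra, and the coefficient of \<open>X\<^sub>w\<close> at \<open>x\<^sup>\<mu>\<close> is the product of
 the \<open>X (\<mu> i)\<close>, where \<open>X n\<close> is the indicator of the flows of degree \<open>n\<close> with values in \<open>{0, 1}\<close>.
 Exchanging a thin flow with a single strand shows that the \<open>X n\<close> commute.  So they are the
 elementary-type elements of a commutative algebra with power sums \<open>N m\<close>, and the substitution multiplies
 the \<open>N m\<close> by \<open>1 / (q\<^sup>m - q\<^sup>-\<^sup>m)\<close>.  The elements \<open>H n\<close> obtained in this way satisfy a recursion that
 peels off one strand through the leftmost edge of the cut; this is the effect of deleting the smallest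
 label from a labelled loop decomposition.\<close>

section \<open>Symmetric functions and the substitution\<close>

text \<open>The strand exchange is a relation for the leftmost edge \<open>e\<close> of a flow in a
  slice, and its factor q^(2 a e) is what makes the proof work. Multiplication by q^(2 f e) respects
  the twisted product, so the relations of \<open>X\<close> and of \<open>H\<close> with a strand
  through \<open>e\<close> can be combined. With X(u) and H(u) the series of the \<open>X n\<close>
  and \<open>H n\<close>, this gives H(q^2 u) = H(u) X((q^2 - 1) u). Logarithmic derivatives then
  attach to \<open>N m\<close> the factor (q^2 - 1)^m / (q^(2m) - 1) = (q - q^-1)^m / (q^m - q^-m).
  This is the weight of p_m under the substitution times the share of p_m in the prefactor (q -
  q^-1)^n, which is where that prefactor comes from. The geometric obstacle is that an edge given by
  heights could a priori wind round the annulus several times and meet a cut repeatedly. The weight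
  to the left of an edge is constant along it, and positive thickness then rules out a second
  meeting. The same invariant, applied to one colour, separates the circles of that colour.\<close>

lemma sum_apply: "(\<Sum>i\<in>A. f i) x = (\<Sum>i\<in>A. f i x)"
 for f :: "'a => 'b => 'c::comm_monoid_add"
 by (induction A rule: infinite_finite_induct) auto

text \<open>In the ordered field of rational functions a polynomial is positive when its leading
  coefficient is, so \<open>q\<close> is infinitely large. The non-vanishing of q^n - 1 and q^n -
  q^-n is read off from this order.\<close>

lemma q_gt_1: "q > 1"
proof -
 have "[:0, 1:] - 1 = ([:-1, 1:] :: rat poly)" by (simp add: one_pCons)
 then have "Fract [:0, 1:] 1 - 1 = Fract ([:-1, 1:] :: rat poly) 1"
  by (simp add: One_fract_def)
 moreover have "0 < Fract ([:-1, 1:] :: rat poly) 1"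
  by (simp add: zero_less_Fract_iff less_poly_def pos_poly_def)
 ultimately have "0 < q - 1" unfolding q_def by simp
 then show ?thesis by simp
qed

lemma q_pos [simp]: "q > 0" and q_nz [simp]: "q ~= 0"
 using q_gt_1 by (auto intro: less_trans[of 0 1])

lemma q_pow_gt_1: "n > 0 ==> q ^ n > 1"
 using q_gt_1 by (simp add: one_less_power)

lemma q_pow_minus_1_nz: "n > 0 ==> q ^ n - 1 ~= 0"
 using q_pow_gt_1[of n] by auto

lemma q_diff_nz: "n > 0 ==> q ^ n - inverse q ^ n ~= 0"
proof -
 assume "n > 0"
 then have "q ^ n > 1" by (rule q_pow_gt_1)
 moreover then have "inverse q ^ n < 1" by (simp add: power_inverse inverse_less_1_iff)
 ultimately show ?thesis by auto
qed

abbreviation lkp :: "('a \<Rightarrow>\<^sub>0 nat) => 'a => nat" where "lkp \<equiv> Poly_Mapping.lookup"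
abbreviation sgl :: "'a => nat => 'a \<Rightarrow>\<^sub>0 nat" where "sgl \<equiv> Poly_Mapping.single"
abbreviation pkeys :: "('a \<Rightarrow>\<^sub>0 nat) => 'a set" where "pkeys \<equiv> Poly_Mapping.keys"

section \<open>The commutative algebra of series\<close>

definition splits_of :: "(nat \<Rightarrow>\<^sub>0 nat) => ((nat \<Rightarrow>\<^sub>0 nat) \<times> (nat \<Rightarrow>\<^sub>0 nat)) set" where
 "splits_of \<mu> = {(\<alpha>, \<beta>). \<alpha> + \<beta> = \<mu>}"

lemma finite_pm_le: "finite {\<alpha> :: nat \<Rightarrow>\<^sub>0 nat. \<exists>\<beta>. \<alpha> + \<beta> = \<mu>}"
proof -
 let ?N = "\<Sum>i\<in>pkeys \<mu>. lkp \<mu> i"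
 let ?F = "{f. \<forall>x. (x \<in> pkeys \<mu> --> f x \<in> {..?N}) \<and> (x \<notin> pkeys \<mu> --> f x = (0::nat))}"
 have "finite ?F" by (rule finite_set_of_finite_funs) auto
 moreover have "Poly_Mapping.lookup ` {\<alpha>. \<exists>\<beta>. \<alpha> + \<beta> = \<mu>} \<subseteq> ?F"
 proof clarify
  fix \<alpha> \<beta> :: "nat \<Rightarrow>\<^sub>0 nat" and x assume e: "\<mu> = \<alpha> + \<beta>"
  have "lkp \<alpha> x \<le> lkp (\<alpha> + \<beta>) x" by (simp add: lookup_add)
  moreover have "x \<in> pkeys (\<alpha> + \<beta>) ==> lkp (\<alpha> + \<beta>) x \<le> (\<Sum>i\<in>pkeys (\<alpha> + \<beta>). lkp (\<alpha> + \<beta>) i)"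
   by (rule member_le_sum) auto
  ultimately show "(x \<in> pkeys (\<alpha> + \<beta>) --> lkp \<alpha> x \<in> {..\<Sum>i\<in>pkeys (\<alpha> + \<beta>). lkp (\<alpha> + \<beta>) i}) \<and>
     (x \<notin> pkeys (\<alpha> + \<beta>) --> lkp \<alpha> x = 0)"
   by (auto simp: in_keys_iff)
 qed
 ultimately have "finite (Poly_Mapping.lookup ` {\<alpha>. \<exists>\<beta>. \<alpha> + \<beta> = \<mu>})" by (rule rev_finite_subset)
 then show ?thesis by (rule finite_imageD) (auto simp: inj_on_def poly_mapping_eqI)
qed

lemma finite_splits_of [simp]: "finite (splits_of \<mu>)"
proof -
 have "splits_of \<mu> \<subseteq> {\<alpha>. \<exists>\<beta>. \<alpha> + \<beta> = \<mu>} \<times> {\<alpha>. \<exists>\<beta>. \<alpha> + \<beta> = \<mu>}"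
  by (auto simp: splits_of_def) (metis add.commute)
 then show ?thesis using finite_pm_le by (meson finite_SigmaI finite_subset)
qed

lemma series_mult_eq: "series_mult f g \<mu> = (\<Sum>(\<alpha>, \<beta>)\<in>splits_of \<mu>. f \<alpha> * g \<beta>)"
 by (simp add: series_mult_def splits_of_def)

lemma series_mult_commute: "series_mult f g = series_mult g f"
proof
 fix \<mu>
 show "series_mult f g \<mu> = series_mult g f \<mu>"
  unfolding series_mult_eq
  by (rule sum.reindex_bij_witness[where i = prod.swap and j = prod.swap])
    (auto simp: splits_of_def add.commute mult.commute)
qed

lemma series_mult_assoc: "series_mult (series_mult f g) h = series_mult f (series_mult g h)"
proof
 fix \<mu>
 have "series_mult (series_mult f g) h \<mu> =
   (\<Sum>(p, c)\<in>splits_of \<mu>. \<Sum>(a, b)\<in>splits_of p. f a * g b * h c)"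
  by (simp add: series_mult_eq sum_distrib_right split_def)
 also have "\<dots> = (\<Sum>(x, y)\<in>(SIGMA x:splits_of \<mu>. splits_of (fst x)). f (fst y) * g (snd y) * h (snd x))"
  by (simp add: sum.Sigma split_def)
 also have "\<dots> = (\<Sum>(x, y)\<in>(SIGMA x:splits_of \<mu>. splits_of (snd x)). f (fst x) * g (fst y) * h (snd y))"
  by (rule sum.reindex_bij_witness[where
    i = "%((a, p), (b, c)). ((a + b, c), (a, b))" and
    j = "%((p, c), (a, b)). ((a, b + c), (b, c))"])
    (auto simp: splits_of_def add.assoc)
 also have "\<dots> = (\<Sum>(a, p)\<in>splits_of \<mu>. \<Sum>(b, c)\<in>splits_of p. f a * g b * h c)"
  by (simp add: sum.Sigma split_def)
 also have "\<dots> = series_mult f (series_mult g h) \<mu>"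
  by (simp add: series_mult_eq sum_distrib_left split_def mult.assoc)
 finally show "series_mult (series_mult f g) h \<mu> = series_mult f (series_mult g h) \<mu>" .
qed

lemma series_mult_one [simp]: "series_mult series_one f = f"
proof
 fix \<mu>
 have "series_mult series_one f \<mu> = (\<Sum>x\<in>splits_of \<mu>. if x = (0, \<mu>) then f \<mu> else 0)"
  unfolding series_mult_eq by (rule sum.cong) (auto simp: series_one_def splits_of_def split: if_splits)
 also have "\<dots> = f \<mu>" by (subst sum.delta[OF finite_splits_of]) (auto simp: splits_of_def)
 finally show "series_mult series_one f \<mu> = f \<mu>" .
qed

lemma series_add_eq: "series_add f g = f + g"
 by (simp add: series_add_def fun_eq_iff)

lemma series_mult_add_left: "series_mult (f + g) h = series_mult f h + series_mult g h"
 by (auto simp: fun_eq_iff series_mult_eq sum.distrib[symmetric] algebra_simps intro!: sum.cong)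

lemma series_mult_scale_left: "series_mult (series_scale a f) h = series_scale a (series_mult f h)"
 by (auto simp: fun_eq_iff series_mult_eq series_scale_def sum_distrib_left algebra_simps intro!: sum.cong)

lemma series_mult_add_right: "series_mult h (f + g) = series_mult h f + series_mult h g"
 by (metis series_mult_add_left series_mult_commute)

lemma series_mult_scale_right: "series_mult h (series_scale a f) = series_scale a (series_mult h f)"
 by (metis series_mult_scale_left series_mult_commute)

lemma series_mult_zero [simp]: "series_mult 0 h = 0" "series_mult h 0 = 0"
 by (auto simp: fun_eq_iff series_mult_eq)

interpretation sv: vector_space series_scale
 by standard (auto simp: series_scale_def fun_eq_iff algebra_simps)

interpretation sp: vector_space_pair series_scale series_scale ..

interpretation sm: comm_monoid_mset series_mult series_one
proof
 show "series_mult a series_one = a" for a by (metis series_mult_commute series_mult_one)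
qed (rule series_mult_assoc, rule series_mult_commute)

section \<open>Power sum products and their triangularity\<close>

lemma power_sum_mult:
 assumes "m \<ge> 1"
 shows "series_mult (power_sum m) g \<mu> =
   (\<Sum>i \<in> {i \<in> pkeys \<mu>. i \<ge> 1 \<and> m \<le> lkp \<mu> i}. g (\<mu> - sgl i m))"
proof -
 let ?I = "{i \<in> pkeys \<mu>. i \<ge> 1 \<and> m \<le> lkp \<mu> i}"
 have *: "sgl i m + (\<mu> - sgl i m) = \<mu>" if "m \<le> lkp \<mu> i" for i
  by (rule poly_mapping_eqI) (use that in \<open>auto simp: lookup_add lookup_minus lookup_single when_def\<close>)
 \<comment> \<open>This fails for m = 0, where \<open>sgl i 0\<close> is 0 for every
   \<open>i\<close>.\<close>
 have inj: "i = j" if "sgl i m = sgl j m" for i j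
  using that assms by (metis lookup_single_eq lookup_single_not_eq not_one_le_zero)
 have "series_mult (power_sum m) g \<mu> =
   (\<Sum>x\<in>(%i. (sgl i m, \<mu> - sgl i m)) ` ?I. power_sum m (fst x) * g (snd x))"
  unfolding series_mult_eq split_def
 proof (rule sum.mono_neutral_right)
  show "(%i. (sgl i m, \<mu> - sgl i m)) ` ?I \<subseteq> splits_of \<mu>"
   using * by (auto simp: splits_of_def)
  show "\<forall>x\<in>splits_of \<mu> - (%i. (sgl i m, \<mu> - sgl i m)) ` ?I. power_sum m (fst x) * g (snd x) = 0"
  proof
   fix x assume x: "x \<in> splits_of \<mu> - (%i. (sgl i m, \<mu> - sgl i m)) ` ?I"
   show "power_sum m (fst x) * g (snd x) = 0"
   proof (rule ccontr)
    assume "\<not> ?thesis"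
    then obtain i where i: "i \<ge> 1" "fst x = sgl i m" by (auto simp: power_sum_def split: if_splits)
    with x have s: "sgl i m + snd x = \<mu>" by (cases x) (auto simp: splits_of_def)
    then have l: "m \<le> lkp \<mu> i" by (auto simp: lookup_add)
    with assms have "i \<in> ?I" using i by (auto simp: in_keys_iff)
    moreover have "snd x = \<mu> - sgl i m" using s by (metis add_diff_cancel_left')
    ultimately show False using x i by (metis (no_types, lifting) DiffD2 image_eqI prod.collapse)
   qed
  qed
 qed simp
 also have "\<dots> = (\<Sum>i\<in>?I. power_sum m (sgl i m) * g (\<mu> - sgl i m))"
  by (subst sum.reindex) (auto simp: inj_on_def o_def dest: inj)
 also have "\<dots> = (\<Sum>i\<in>?I. g (\<mu> - sgl i m))"
  by (rule sum.cong) (auto simp: power_sum_def)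
 finally show ?thesis .
qed

text \<open>The power sum product p_\<lambda>, with \<lambda> encoded by the multiset of its parts
  minus 1, so that every multiset of naturals is a legal index. \<open>parts_of\<close> uses the
  same shift.\<close>

definition ppart :: "nat multiset => series" where
 "ppart \<rho> = sm.F (image_mset (%m. power_sum (Suc m)) \<rho>)"

lemma ppart_empty [simp]: "ppart {#} = series_one"
 by (simp add: ppart_def)

lemma ppart_add_mset: "ppart (add_mset m \<rho>) = series_mult (power_sum (Suc m)) (ppart \<rho>)"
 by (simp add: ppart_def)

lemma ppart_union: "ppart (\<rho> + \<nu>) = series_mult (ppart \<rho>) (ppart \<nu>)"
 by (simp add: ppart_def sm.union)

definition parts_of :: "(nat \<Rightarrow>\<^sub>0 nat) => nat multiset" where
 "parts_of \<mu> = image_mset (%i. lkp \<mu> i - 1) (mset_set (pkeys \<mu>))"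

lemma size_parts_of: "size (parts_of \<mu>) = card (pkeys \<mu>)"
 by (simp add: parts_of_def)

lemma keys_minus_single:
 fixes \<mu> :: "nat \<Rightarrow>\<^sub>0 nat"
 shows "pkeys \<mu> \<subseteq> insert i (pkeys (\<mu> - sgl i m))" "pkeys (\<mu> - sgl i m) \<subseteq> pkeys \<mu>"
 by (auto simp: in_keys_iff lookup_minus lookup_single when_def split: if_splits)

lemma parts_of_remove:
 fixes \<mu> :: "nat \<Rightarrow>\<^sub>0 nat"
 assumes "lkp \<mu> i = Suc m"
 shows "parts_of \<mu> = add_mset m (parts_of (\<mu> - sgl i (Suc m)))"
proof -
 have k: "pkeys \<mu> = insert i (pkeys (\<mu> - sgl i (Suc m)))" "i \<notin> pkeys (\<mu> - sgl i (Suc m))"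
  using assms by (auto simp: in_keys_iff lookup_minus lookup_single when_def split: if_splits)
 show ?thesis unfolding parts_of_def k(1)
  using k(2) assms
  by (auto simp: lookup_minus lookup_single when_def intro!: image_mset_cong)
qed

text \<open>Expanding p_\<lambda> chooses one variable for each part, and several parts may choose
  the same one. So a monomial has at most as many variables as \<lambda> has parts, and equality
  forces all choices to differ, hence exponents \<lambda>.\<close>

lemma ppart_triangular:
 assumes "ppart \<rho> \<mu> ~= 0"
 shows "pkeys \<mu> \<subseteq> {1..} \<and> card (pkeys \<mu>) \<le> size \<rho> \<and> (card (pkeys \<mu>) = size \<rho> --> parts_of \<mu> = \<rho>)"
 using assms
proof (induction \<rho> arbitrary: \<mu>)
 case empty
 then show ?case by (auto simp: series_one_def parts_of_def split: if_splits)
next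
 case (add m \<rho>)
 then obtain i where i: "i \<in> pkeys \<mu>" "i \<ge> 1" "Suc m \<le> lkp \<mu> i" "ppart \<rho> (\<mu> - sgl i (Suc m)) ~= 0"
  unfolding ppart_add_mset power_sum_mult[of "Suc m", simplified]
  by (auto elim!: sum.not_neutral_contains_not_neutral)
 let ?\<nu> = "\<mu> - sgl i (Suc m)"
 note IH = add.IH[OF i(4)]
 have sub: "pkeys \<mu> \<subseteq> insert i (pkeys ?\<nu>)" by (rule keys_minus_single)
 have le: "card (pkeys \<mu>) \<le> card (insert i (pkeys ?\<nu>))" by (rule card_mono) (use sub in auto)
 also have "\<dots> \<le> Suc (card (pkeys ?\<nu>))" by (simp add: card_insert_if)
 finally have le': "card (pkeys \<mu>) \<le> Suc (card (pkeys ?\<nu>))" .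
 have "parts_of \<mu> = add_mset m \<rho>" if eq: "card (pkeys \<mu>) = Suc (size \<rho>)"
 proof -
  have c: "card (pkeys ?\<nu>) = size \<rho>" using eq le' IH by linarith
  have "i \<notin> pkeys ?\<nu>"
  proof
   assume "i \<in> pkeys ?\<nu>"
   then have "card (pkeys \<mu>) \<le> card (pkeys ?\<nu>)" using le by (simp add: insert_absorb)
   then show False using eq c by simp
  qed
  then have "lkp \<mu> i = Suc m" using i(3) by (auto simp: in_keys_iff lookup_minus)
  then show ?thesis using parts_of_remove[of \<mu> i m] IH c by simp
 qed
 then show ?case using le' IH sub i(2) by auto
qed

lemma ppart_nonneg: "ppart \<rho> \<mu> \<ge> 0"
proof (induction \<rho> arbitrary: \<mu>)
 case empty
 then show ?case by (simp add: series_one_def)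
next
 case (add m \<rho>)
 then show ?case unfolding ppart_add_mset power_sum_mult[of "Suc m", simplified] by (intro sum_nonneg)
qed

text \<open>All coefficients of a power sum product are non-negative, so one term that puts the
  parts on distinct variables is enough for positivity.\<close>

lemma ppart_diag:
 assumes "pkeys \<mu> \<subseteq> {1..}"
 shows "ppart (parts_of \<mu>) \<mu> > 0"
 using assms
proof (induction "parts_of \<mu>" arbitrary: \<mu>)
 case empty
 then have "\<mu> = 0" by (simp add: parts_of_def mset_set_empty_iff)
 then show ?case by (simp add: parts_of_def series_one_def)
next
 case (add m \<rho>)
 have "m \<in># parts_of \<mu>" using add(2) by (metis union_single_eq_member)
 then obtain i where i: "i \<in> pkeys \<mu>" "lkp \<mu> i - 1 = m" by (auto simp: parts_of_def)
 then have l: "lkp \<mu> i = Suc m" by (auto simp: in_keys_iff)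
 let ?\<nu> = "\<mu> - sgl i (Suc m)"
 have p: "parts_of \<mu> = add_mset m (parts_of ?\<nu>)" by (rule parts_of_remove[OF l])
 then have "\<rho> = parts_of ?\<nu>" using add(2) by simp
 then have pos: "ppart (parts_of ?\<nu>) ?\<nu> > 0"
  by (rule add(1)) (use add(3) keys_minus_single(2) in blast)
 have "ppart (parts_of \<mu>) \<mu> =
   (\<Sum>i \<in> {i \<in> pkeys \<mu>. i \<ge> 1 \<and> Suc m \<le> lkp \<mu> i}. ppart (parts_of ?\<nu>) (\<mu> - sgl i (Suc m)))"
  unfolding p ppart_add_mset by (rule power_sum_mult) simp
 also have "\<dots> > 0"
  by (rule sum_pos2[where i = i]) (use i l add(3) pos ppart_nonneg in auto)
 finally show ?case .
qed

lemma ex_parts_of: "\<exists>\<mu>. parts_of \<mu> = \<rho> \<and> pkeys \<mu> \<subseteq> {1..}"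
proof (induction \<rho>)
 case empty
 show ?case by (rule exI[of _ 0]) (simp add: parts_of_def)
next
 case (add m \<rho>)
 then obtain \<mu> where \<mu>: "parts_of \<mu> = \<rho>" "pkeys \<mu> \<subseteq> {1..}" by blast
 obtain i where i: "i \<notin> insert 0 (pkeys \<mu>)" using ex_new_if_finite[of "insert 0 (pkeys \<mu>)"] by auto
 let ?\<nu> = "\<mu> + sgl i (Suc m)"
 have "lkp ?\<nu> i = Suc m" using i by (simp add: lookup_add in_keys_iff)
 from parts_of_remove[OF this] have "parts_of ?\<nu> = add_mset m \<rho>" using \<mu> by simp
 moreover have "pkeys ?\<nu> \<subseteq> {1..}"
  using \<mu>(2) i by (force simp: in_keys_iff lookup_add lookup_single when_def subset_iff split: if_splits)
 ultimately show ?case by blast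
qed

text \<open>Monomials with the same multiset of exponents form one orbit under permutations of the
  variables. A symmetric function is therefore determined by one coefficient per multiset of
  parts.\<close>

lemma parts_of_eq_permutes:
 assumes "parts_of \<mu> = parts_of \<nu>" "pkeys \<mu> \<subseteq> {1..}" "pkeys \<nu> \<subseteq> {1..}"
 obtains \<pi> where "\<pi> permutes {1..}" "\<mu> = Poly_Mapping.map_key \<pi> \<nu>"
proof -
 let ?A = "pkeys \<mu> \<union> pkeys \<nu>"
 \<comment> \<open>Over the joint support both exponent multisets are padded with zeros. The numbers
   of occurring variables agree, so the paddings agree as well.\<close>
 have *: "image_mset (lkp \<alpha>) (mset_set ?A) =
    image_mset Suc (parts_of \<alpha>) + replicate_mset (card ?A - card (pkeys \<alpha>)) 0"
  if "\<alpha> \<in> {\<mu>, \<nu>}" for \<alpha>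
 proof -
  have A: "?A = pkeys \<alpha> \<union> (?A - pkeys \<alpha>)" using that by auto
  have "mset_set ?A = mset_set (pkeys \<alpha>) + mset_set (?A - pkeys \<alpha>)"
   by (subst A, subst mset_set_Union) auto
  moreover have "image_mset (lkp \<alpha>) (mset_set (pkeys \<alpha>)) = image_mset Suc (parts_of \<alpha>)"
   unfolding parts_of_def multiset.map_comp
   by (rule image_mset_cong) (auto simp: in_keys_iff)
  moreover have "image_mset (lkp \<alpha>) (mset_set (?A - pkeys \<alpha>)) =
    image_mset (%_. 0) (mset_set (?A - pkeys \<alpha>))"
   by (rule image_mset_cong) (auto simp: in_keys_iff)
  moreover have "card (?A - pkeys \<alpha>) = card ?A - card (pkeys \<alpha>)"
   by (rule card_Diff_subset) (use that in auto)
  ultimately show ?thesis by (simp add: image_mset_const_eq)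
 qed
 have "card (pkeys \<mu>) = card (pkeys \<nu>)" using assms(1) by (metis size_parts_of)
 then have "image_mset (lkp \<mu>) (mset_set ?A) = image_mset (lkp \<nu>) (mset_set ?A)"
  using *[of \<mu>] *[of \<nu>] assms(1) by simp
 then obtain p where p: "p permutes ?A" "\<forall>x\<in>?A. lkp \<mu> x = lkp \<nu> (p x)"
  by (rule image_mset_eq_implies_permutes[rotated]) auto
 have "p permutes {1..}" by (rule permutes_subset[OF p(1)]) (use assms in auto)
 moreover have "\<mu> = Poly_Mapping.map_key p \<nu>"
 proof (rule poly_mapping_eqI)
  fix x
  have inj: "inj p" using p(1) by (rule permutes_inj)
  show "lkp \<mu> x = lkp (Poly_Mapping.map_key p \<nu>) x"
  proof (cases "x \<in> ?A")
   case True
   then show ?thesis using p inj by (simp add: map_key.rep_eq)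
  next
   case False
   then have "p x = x" using p(1) by (simp add: permutes_def)
   then show ?thesis using False inj by (simp add: map_key.rep_eq in_keys_iff)
  qed
 qed
 ultimately show ?thesis by (rule that)
qed

section \<open>Symmetric functions as the span of the power sum products\<close>

lemma sym_functionsD:
 assumes "f \<in> sym_functions"
 shows "f \<mu> ~= 0 ==> pkeys \<mu> \<subseteq> {1..}"
  and "\<exists>d. \<forall>\<mu>. f \<mu> ~= 0 --> (\<Sum>i \<in> pkeys \<mu>. lkp \<mu> i) \<le> d"
  and "\<pi> permutes {1..} ==> f (Poly_Mapping.map_key \<pi> \<mu>) = f \<mu>"
 using assms unfolding sym_functions_def by blast+

lemma sym_functions_add: "f \<in> sym_functions ==> g \<in> sym_functions ==> f + g \<in> sym_functions"
proof -
 assume f: "f \<in> sym_functions" and g: "g \<in> sym_functions"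
 obtain d e where d: "\<And>\<mu>. f \<mu> ~= 0 ==> (\<Sum>i \<in> pkeys \<mu>. lkp \<mu> i) \<le> d"
  and e: "\<And>\<mu>. g \<mu> ~= 0 ==> (\<Sum>i \<in> pkeys \<mu>. lkp \<mu> i) \<le> e"
  using sym_functionsD(2)[OF f] sym_functionsD(2)[OF g] by blast
 have nz: "f \<mu> ~= 0 \<or> g \<mu> ~= 0" if "(f + g) \<mu> ~= 0" for \<mu> using that by auto
 have "(\<Sum>i \<in> pkeys \<mu>. lkp \<mu> i) \<le> max d e" if "(f + g) \<mu> ~= 0" for \<mu>
  using nz[OF that] d[of \<mu>] e[of \<mu>] by linarith
 moreover have "pkeys \<mu> \<subseteq> {1..}" if "(f + g) \<mu> ~= 0" for \<mu>
  using nz[OF that] sym_functionsD(1)[OF f] sym_functionsD(1)[OF g] by blast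
 ultimately show ?thesis
  unfolding sym_functions_def using sym_functionsD(3)[OF f] sym_functionsD(3)[OF g]
  by (intro CollectI conjI allI impI exI[of _ "max d e"]) auto
qed

lemma sym_functions_scale: "f \<in> sym_functions ==> series_scale a f \<in> sym_functions"
 unfolding sym_functions_def series_scale_def by auto

lemma sym_functions_zero: "0 \<in> sym_functions"
 unfolding sym_functions_def by auto

lemma sym_functions_sum: "(\<And>i. i \<in> I ==> f i \<in> sym_functions) ==> sum f I \<in> sym_functions"
 by (induction I rule: infinite_finite_induct) (auto intro: sym_functions_add sym_functions_zero)

lemma sym_functions_one: "series_one \<in> sym_functions"
proof -
 have "Poly_Mapping.map_key \<pi> \<mu> = 0 \<longleftrightarrow> \<mu> = 0" if "\<pi> permutes {1..}" for \<pi> :: "nat => nat" and \<mu> :: "nat \<Rightarrow>\<^sub>0 nat"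
 proof
  assume z: "Poly_Mapping.map_key \<pi> \<mu> = 0"
  have inj: "inj \<pi>" and surj: "surj \<pi>" using that by (auto simp: permutes_inj permutes_surj)
  show "\<mu> = 0"
  proof (rule poly_mapping_eqI)
   fix x
   obtain y where "x = \<pi> y" using surj by blast
   then show "lkp \<mu> x = lkp 0 x" using z inj by (metis comp_apply lookup_zero map_key.rep_eq)
  qed
 next
  assume "\<mu> = 0"
  then show "Poly_Mapping.map_key \<pi> \<mu> = 0"
   using that permutes_inj by (intro poly_mapping_eqI) (auto simp: map_key.rep_eq permutes_inj)
 qed
 then show ?thesis unfolding sym_functions_def by (auto simp: series_one_def)
qed

lemma map_key_minus:
 fixes \<mu> \<nu> :: "nat \<Rightarrow>\<^sub>0 nat"
 assumes "inj \<pi>"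
 shows "Poly_Mapping.map_key \<pi> (\<mu> - \<nu>) = Poly_Mapping.map_key \<pi> \<mu> - Poly_Mapping.map_key \<pi> \<nu>"
 by (rule poly_mapping_eqI) (use assms in \<open>auto simp: map_key.rep_eq lookup_minus\<close>)

lemma sym_functions_power_sum_mult:
 assumes m: "m \<ge> 1" and f: "f \<in> sym_functions"
 shows "series_mult (power_sum m) f \<in> sym_functions"
proof -
 have nz: "\<exists>i\<ge>1. i \<in> pkeys \<mu> \<and> m \<le> lkp \<mu> i \<and> f (\<mu> - sgl i m) ~= 0" if "series_mult (power_sum m) f \<mu> ~= 0" for \<mu>
  using that unfolding power_sum_mult[OF m] by (auto elim!: sum.not_neutral_contains_not_neutral)
 obtain d where d: "\<And>\<mu>. f \<mu> ~= 0 ==> (\<Sum>i \<in> pkeys \<mu>. lkp \<mu> i) \<le> d" using sym_functionsD(2)[OF f] by blast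
 show ?thesis unfolding sym_functions_def
 proof (intro CollectI conjI allI impI exI[of _ "d + m"])
  fix \<mu> assume "series_mult (power_sum m) f \<mu> ~= 0"
  then obtain i where i: "i \<ge> 1" "i \<in> pkeys \<mu>" "m \<le> lkp \<mu> i" "f (\<mu> - sgl i m) ~= 0" using nz by blast
  show "pkeys \<mu> \<subseteq> {1..}" using i(1) sym_functionsD(1)[OF f i(4)] keys_minus_single(1)[of \<mu> i m] by auto
  have "(\<Sum>j \<in> pkeys \<mu>. lkp \<mu> j) = (\<Sum>j \<in> pkeys \<mu>. lkp (\<mu> - sgl i m) j + (if j = i then m else 0))"
   by (rule sum.cong) (use i in \<open>auto simp: lookup_minus lookup_single when_def\<close>)
  also have "\<dots> = (\<Sum>j \<in> pkeys \<mu>. lkp (\<mu> - sgl i m) j) + m" using i by (simp add: sum.distrib)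
  also have "(\<Sum>j \<in> pkeys \<mu>. lkp (\<mu> - sgl i m) j) = (\<Sum>j \<in> pkeys (\<mu> - sgl i m). lkp (\<mu> - sgl i m) j)"
   by (rule sum.mono_neutral_right) (use keys_minus_single(2)[of \<mu> i m] in \<open>auto simp: in_keys_iff\<close>)
  also have "\<dots> \<le> d" by (rule d) fact
  finally show "(\<Sum>j \<in> pkeys \<mu>. lkp \<mu> j) \<le> d + m" by simp
 next
  fix \<pi> :: "nat => nat" and \<mu> assume p: "\<pi> permutes {1..}"
  have inj: "inj \<pi>" using p by (rule permutes_inj)
  have ge1: "\<pi> i \<ge> 1 \<longleftrightarrow> i \<ge> 1" for i using permutes_in_image[OF p, of i] by simp
  have l: "lkp (Poly_Mapping.map_key \<pi> \<mu>) i = lkp \<mu> (\<pi> i)" for i using inj by (simp add: map_key.rep_eq)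
  have sur: "\<exists>i. j = \<pi> i" for j using permutes_surj[OF p] by blast
  have im: "{i \<in> pkeys \<mu>. i \<ge> 1 \<and> m \<le> lkp \<mu> i} =
    \<pi> ` {i \<in> pkeys (Poly_Mapping.map_key \<pi> \<mu>). i \<ge> 1 \<and> m \<le> lkp (Poly_Mapping.map_key \<pi> \<mu>) i}" (is "?L = \<pi> ` ?R")
  proof (intro equalityI subsetI)
   fix j assume j: "j \<in> ?L"
   obtain i where "j = \<pi> i" using sur by blast
   then show "j \<in> \<pi> ` ?R" using j using ge1[of i] by (auto simp: in_keys_iff l)
  qed (use ge1[simplified] in \<open>auto simp: in_keys_iff l\<close>)
  have "series_mult (power_sum m) f \<mu> = (\<Sum>i \<in> ?R. f (\<mu> - sgl (\<pi> i) m))"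
   unfolding power_sum_mult[OF m] im by (subst sum.reindex) (use inj in \<open>auto simp: inj_on_def\<close>)
  also have "\<dots> = series_mult (power_sum m) f (Poly_Mapping.map_key \<pi> \<mu>)"
   unfolding power_sum_mult[OF m]
  proof (rule sum.cong[OF refl])
   fix i
   have "f (\<mu> - sgl (\<pi> i) m) = f (Poly_Mapping.map_key \<pi> (\<mu> - sgl (\<pi> i) m))"
    using sym_functionsD(3)[OF f p] by simp
   also have "Poly_Mapping.map_key \<pi> (\<mu> - sgl (\<pi> i) m) = Poly_Mapping.map_key \<pi> \<mu> - sgl i m"
    using inj by (simp add: map_key_minus)
   finally show "f (\<mu> - sgl (\<pi> i) m) = f (Poly_Mapping.map_key \<pi> \<mu> - sgl i m)" .
  qed
  finally show "series_mult (power_sum m) f (Poly_Mapping.map_key \<pi> \<mu>) = series_mult (power_sum m) f \<mu>" ..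
 qed
qed

lemma ppart_sym: "ppart \<rho> \<in> sym_functions"
 by (induction \<rho>) (auto simp: ppart_add_mset sym_functions_one intro: sym_functions_power_sum_mult)

lemma power_sum_ppart: "power_sum (Suc m) = ppart {#m#}"
 by (simp add: ppart_def)

lemma power_sum_sym: "m \<ge> 1 ==> power_sum m \<in> sym_functions"
 using ppart_sym[of "{#m - 1#}"] by (simp flip: power_sum_ppart)

lemma inj_ppart: "inj ppart"
proof (rule injI)
 have key: "\<sigma> = \<rho>" if eq: "ppart \<rho> = ppart \<sigma>" and le: "size \<sigma> \<le> size \<rho>" for \<rho> \<sigma>
 proof -
  obtain \<mu> where \<mu>: "parts_of \<mu> = \<rho>" "pkeys \<mu> \<subseteq> {1..}" using ex_parts_of by blast
  have "ppart \<sigma> \<mu> ~= 0" using ppart_diag[OF \<mu>(2)] \<mu> eq by auto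
  from ppart_triangular[OF this] le \<mu> size_parts_of[of \<mu>] show ?thesis by simp
 qed
 fix \<rho> \<sigma> assume "ppart \<rho> = ppart \<sigma>"
 then show "\<rho> = \<sigma>" using key[of \<rho> \<sigma>] key[of \<sigma> \<rho>] by (metis nat_le_linear)
qed

text \<open>In a vanishing combination, evaluate at the diagonal monomial of a longest product that
  occurs: by triangularity every other term vanishes there.\<close>

lemma independent_ppart: "sv.independent (range ppart)"
 unfolding sv.dependent_explicit
proof (clarify)
 fix t u v assume t: "finite t" "t \<subseteq> range ppart" and s: "(\<Sum>v\<in>t. series_scale (u v) v) = 0"
  and v: "v \<in> t" "u v ~= 0"
 define M where "M = {\<rho>. ppart \<rho> \<in> t \<and> u (ppart \<rho>) ~= 0}"
 have "finite M" by (rule finite_subset[OF _ finite_vimageI[OF t(1) inj_ppart]]) (auto simp: M_def)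
 moreover have "M ~= {}" using v t by (auto simp: M_def)
 ultimately have "Max (size ` M) \<in> size ` M" by simp
 then obtain \<rho> where \<rho>0: "\<rho> \<in> M" "Max (size ` M) = size \<rho>" by blast
 have \<rho>: "\<rho> \<in> M" "\<And>\<sigma>. \<sigma> \<in> M ==> size \<sigma> \<le> size \<rho>"
  using \<rho>0 \<open>finite M\<close> by (metis Max_ge finite_imageI imageI)+
 obtain \<mu> where \<mu>: "parts_of \<mu> = \<rho>" "pkeys \<mu> \<subseteq> {1..}" using ex_parts_of by blast
 have z: "series_scale (u w) w \<mu> = 0" if w: "w \<in> t" "w ~= ppart \<rho>" for w
 proof (cases "u w = 0")
  case False
  obtain \<sigma> where \<sigma>: "w = ppart \<sigma>" using w t by blast
  then have "\<sigma> \<in> M" using w False by (simp add: M_def)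
  then have "size \<sigma> \<le> size \<rho>" by (rule \<rho>)
  then have "ppart \<sigma> \<mu> = 0" using ppart_triangular[of \<sigma> \<mu>] \<mu> size_parts_of[of \<mu>] w(2) \<sigma> by force
  then show ?thesis by (simp add: \<sigma> series_scale_def)
 qed (simp add: series_scale_def)
 have "0 = (\<Sum>v\<in>t. series_scale (u v) v \<mu>)" using s[THEN fun_cong, of \<mu>] by (simp add: sum_apply)
 also have "\<dots> = series_scale (u (ppart \<rho>)) (ppart \<rho>) \<mu>"
  by (rule sum.mono_neutral_right[where S = "{ppart \<rho>}", simplified, OF t(1)])
    (use \<rho>(1) z in \<open>auto simp: M_def\<close>)
 also have "\<dots> ~= 0" using \<rho>(1) ppart_diag[OF \<mu>(2)] \<mu>(1) by (simp add: series_scale_def M_def)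
 finally show False by simp
qed

lemma card_keys_le_deg: "card (pkeys \<mu>) \<le> (\<Sum>i \<in> pkeys \<mu>. lkp \<mu> i)" for \<mu> :: "nat \<Rightarrow>\<^sub>0 nat"
proof -
 have "(\<Sum>i\<in>pkeys \<mu>. 1) \<le> (\<Sum>i \<in> pkeys \<mu>. lkp \<mu> i)" by (rule sum_mono) (auto simp: in_keys_iff Suc_le_eq)
 then show ?thesis by simp
qed

text \<open>Induction on a strict bound for the number of variables in the monomials of
  \<open>f\<close>. Those with the largest number of variables are cancelled by multiples of power
  sum products of that length; the bound on the degree leaves only finitely many products to
  subtract.\<close>

lemma sym_functions_span_aux:
 assumes "f \<in> sym_functions" "\<And>\<mu>. f \<mu> ~= 0 ==> card (pkeys \<mu>) < k"
 shows "f \<in> sv.span (range ppart)"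
 using assms
proof (induction k arbitrary: f)
 case 0
 then have "f = 0" by (auto simp only: fun_eq_iff zero_fun_apply)
 then show ?case using sv.span_zero by metis
next
 case (Suc k)
 note f = \<open>f \<in> sym_functions\<close>
 obtain d where d: "\<And>\<mu>. f \<mu> ~= 0 ==> (\<Sum>i \<in> pkeys \<mu>. lkp \<mu> i) \<le> d"
  using sym_functionsD(2)[OF f] by blast
 define R where "R = {parts_of \<mu> |\<mu>. f \<mu> ~= 0 \<and> card (pkeys \<mu>) = k}"
 have "finite R"
 proof (rule finite_subset)
  show "R \<subseteq> mset ` {xs. set xs \<subseteq> {..d} \<and> length xs = k}"
  proof
   fix \<rho> assume "\<rho> \<in> R"
   then obtain \<mu> where \<mu>: "\<rho> = parts_of \<mu>" "f \<mu> ~= 0" "card (pkeys \<mu>) = k" by (auto simp: R_def)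
   obtain xs where xs: "mset xs = \<rho>" using ex_mset by blast
   have "x \<le> d" if "x \<in># \<rho>" for x
   proof -
    have "x \<in># parts_of \<mu>" using that \<mu>(1) by simp
    then obtain i where i: "i \<in> pkeys \<mu>" "x = lkp \<mu> i - 1" by (auto simp: parts_of_def)
    have "lkp \<mu> i \<le> (\<Sum>i \<in> pkeys \<mu>. lkp \<mu> i)" by (rule member_le_sum) (use i in auto)
    with d[OF \<mu>(2)] i show ?thesis by simp
   qed
   moreover have "length xs = k" using xs \<mu> size_parts_of by (metis size_mset)
   ultimately show "\<rho> \<in> mset ` {xs. set xs \<subseteq> {..d} \<and> length xs = k}" using xs by (force)
  qed
 qed (auto simp: finite_lists_length_eq)
 \<comment> \<open>One monomial per multiset of parts. Cancelling \<open>f\<close> there forces the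
   coefficient \<open>c\<close>, and symmetry carries the cancellation to the whole orbit.\<close>
 define rep where "rep \<rho> = (SOME \<mu>. parts_of \<mu> = \<rho> \<and> pkeys \<mu> \<subseteq> {1..})" for \<rho>
 have rep: "parts_of (rep \<rho>) = \<rho>" "pkeys (rep \<rho>) \<subseteq> {1..}" for \<rho>
  using someI_ex[OF ex_parts_of[of \<rho>]] by (auto simp: rep_def)
 define c where "c \<rho> = f (rep \<rho>) / ppart \<rho> (rep \<rho>)" for \<rho>
 define g where "g = f + series_scale (-1) (\<Sum>\<rho>\<in>R. series_scale (c \<rho>) (ppart \<rho>))"
 have g_at: "g \<mu> = f \<mu> - (\<Sum>\<rho>\<in>R. c \<rho> * ppart \<rho> \<mu>)" for \<mu>
  by (simp add: g_def series_scale_def sum_apply)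
 have gs: "g \<in> sym_functions"
  unfolding g_def by (intro sym_functions_add f sym_functions_scale sym_functions_sum ppart_sym)
 have small: "card (pkeys \<mu>) < k" if nz: "g \<mu> ~= 0" for \<mu>
 proof (rule ccontr)
  assume nl: "\<not> card (pkeys \<mu>) < k"
  have sz: "size \<rho> = k" if "\<rho> \<in> R" for \<rho> using that size_parts_of by (auto simp: R_def)
  have keys: "pkeys \<mu> \<subseteq> {1..}" using sym_functionsD(1)[OF gs nz] .
  have z: "ppart \<rho> \<mu> = 0" if "\<rho> \<in> R" "\<rho> ~= parts_of \<mu>" for \<rho>
   using ppart_triangular[of \<rho> \<mu>] sz[OF that(1)] that(2) nl by fastforce
  show False
  proof (cases "card (pkeys \<mu>) = k")
   case False
   then have f0: "f \<mu> = 0" using Suc.prems(2)[of \<mu>] nl by linarith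
   have "parts_of \<mu> \<notin> R" using sz size_parts_of[of \<mu>] False by auto
   then have "(\<Sum>\<rho>\<in>R. c \<rho> * ppart \<rho> \<mu>) = 0" using z by (intro sum.neutral) (metis mult_zero_right)
   with f0 nz show False by (simp add: g_at)
  next
   case True
   let ?\<rho> = "parts_of \<mu>"
   obtain \<pi> where "\<pi> permutes {1..}" "\<mu> = Poly_Mapping.map_key \<pi> (rep ?\<rho>)"
    by (rule parts_of_eq_permutes[of \<mu> "rep ?\<rho>"]) (use rep keys in auto)
   then have eq: "f \<mu> = f (rep ?\<rho>)" "ppart ?\<rho> \<mu> = ppart ?\<rho> (rep ?\<rho>)"
    using sym_functionsD(3)[OF f] sym_functionsD(3)[OF ppart_sym] by metis+
   have pos: "ppart ?\<rho> \<mu> ~= 0" using ppart_diag[OF keys] by simp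
   show False
   proof (cases "?\<rho> \<in> R")
    case True
    have "(\<Sum>\<rho>\<in>R. c \<rho> * ppart \<rho> \<mu>) = c ?\<rho> * ppart ?\<rho> \<mu>"
     by (rule sum.mono_neutral_right[where S = "{?\<rho>}", simplified, OF \<open>finite R\<close>])
       (use z True in auto)
    also have "\<dots> = f \<mu>" using pos eq by (simp add: c_def)
    finally show False using nz by (simp add: g_at)
   next
    case False
    then have f0: "f \<mu> = 0" using True by (auto simp: R_def)
    have "(\<Sum>\<rho>\<in>R. c \<rho> * ppart \<rho> \<mu>) = 0" using z False by (intro sum.neutral) (metis mult_zero_right)
    with f0 nz show False by (simp add: g_at)
   qed
  qed
 qed
 have "g \<in> sv.span (range ppart)" by (rule Suc.IH[OF gs small])
 moreover have "(\<Sum>\<rho>\<in>R. series_scale (c \<rho>) (ppart \<rho>)) \<in> sv.span (range ppart)"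
  by (intro sv.span_sum sv.span_scale sv.span_base) auto
 ultimately have "g + (\<Sum>\<rho>\<in>R. series_scale (c \<rho>) (ppart \<rho>)) \<in> sv.span (range ppart)" by (rule sv.span_add)
 also have "g + (\<Sum>\<rho>\<in>R. series_scale (c \<rho>) (ppart \<rho>)) = f"
  by (auto simp: g_def fun_eq_iff series_scale_def)
 finally show ?case .
qed

lemma span_ppart: "sv.span (range ppart) = sym_functions"
proof
 show "sym_functions \<subseteq> sv.span (range ppart)"
 proof
  fix f assume f: "f \<in> sym_functions"
  obtain d where d: "\<And>\<mu>. f \<mu> ~= 0 ==> (\<Sum>i \<in> pkeys \<mu>. lkp \<mu> i) \<le> d"
   using sym_functionsD(2)[OF f] by blast
  show "f \<in> sv.span (range ppart)"
   by (rule sym_functions_span_aux[OF f, of "Suc d"]) (meson d card_keys_le_deg le_trans less_Suc_eq_le)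
 qed
 show "sv.span (range ppart) \<subseteq> sym_functions"
  by (rule sv.span_minimal)
   (auto simp: ppart_sym sv.subspace_def sym_functions_zero sym_functions_add sym_functions_scale)
qed

text \<open>Closure under products is derived from the case of a power sum factor, because power sum
  products span the symmetric functions.\<close>

lemma sym_functions_mult:
 assumes "f \<in> sym_functions" "g \<in> sym_functions"
 shows "series_mult f g \<in> sym_functions"
proof -
 have 1: "series_mult f (ppart \<rho>) \<in> sym_functions" if "f \<in> sym_functions" for \<rho> f
  using that
 proof (induction \<rho> arbitrary: f)
  case empty
  then show ?case by (metis ppart_empty series_mult_commute series_mult_one)
 next
  case (add m \<rho>)
  have "series_mult f (ppart (add_mset m \<rho>)) = series_mult (series_mult (power_sum (Suc m)) f) (ppart \<rho>)"
   by (metis ppart_add_mset series_mult_assoc series_mult_commute)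
  then show ?case using add by (simp add: sym_functions_power_sum_mult)
 qed
 have "g \<in> sv.span (range ppart)" using assms span_ppart by simp
 then show ?thesis
 proof (rule sv.span_induct)
  show "sv.subspace {g. series_mult f g \<in> sym_functions}"
   by (auto simp: sv.subspace_def sym_functions_zero series_mult_add_right series_mult_scale_right
     sym_functions_add sym_functions_scale)
 qed (use 1 assms in auto)
qed

section \<open>Existence and uniqueness of the substitution\<close>

abbreviation pweight :: "nat => qfield" where
 "pweight m \<equiv> 1 / (q ^ m - inverse q ^ m)"

definition is_plethysm :: "(series => series) => bool" where
 "is_plethysm \<phi> \<longleftrightarrow> sym_alg_endo \<phi> \<and> (\<forall>m\<ge>1. \<phi> (power_sum m) = series_scale (pweight m) (power_sum m))"

text \<open>On the basis of power sum products the map is diagonal with eigenvalues multiplicative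
  in the parts, which makes it an algebra map. The linear extension lives on all series; restriction
  then supplies the value \<open>undefined\<close> off the symmetric functions.\<close>

lemma is_plethysm_exists: "\<exists>\<phi>. is_plethysm \<phi>"
proof -
 define \<kappa> where "\<kappa> \<rho> = prod_mset (image_mset (%m. pweight (Suc m)) \<rho>)" for \<rho>
 obtain h where h: "Vector_Spaces.linear series_scale series_scale h"
   "\<And>x. x \<in> range ppart ==> h x = series_scale (\<kappa> (inv ppart x)) x"
  using sp.linear_independent_extend[OF independent_ppart,
    where f = "%x. series_scale (\<kappa> (inv ppart x)) x"] by blast
 interpret h: Vector_Spaces.linear series_scale series_scale h by (rule h(1))
 have hp: "h (ppart \<rho>) = series_scale (\<kappa> \<rho>) (ppart \<rho>)" for \<rho>
  using h(2)[of "ppart \<rho>"] inj_ppart by simp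
 have hs: "h f \<in> sym_functions" if "f \<in> sym_functions" for f
 proof -
  from that have "f \<in> sv.span (range ppart)" using span_ppart by simp
  then show ?thesis
  proof (rule sv.span_induct)
   show "sv.subspace {f. h f \<in> sym_functions}"
    by (auto simp: sv.subspace_def sym_functions_zero h.zero h.add h.scale
      sym_functions_add sym_functions_scale)
  qed (auto simp: hp ppart_sym sym_functions_scale)
 qed
 have hm1: "h (series_mult f (ppart \<sigma>)) = series_mult (h f) (h (ppart \<sigma>))" if "f \<in> sym_functions" for f \<sigma>
 proof -
  from that have "f \<in> sv.span (range ppart)" using span_ppart by simp
  then show ?thesis
  proof (rule sv.span_induct)
   show "sv.subspace {f. h (series_mult f (ppart \<sigma>)) = series_mult (h f) (h (ppart \<sigma>))}"
    by (auto simp: sv.subspace_def h.zero h.add h.scale series_mult_add_left series_mult_scale_left)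
   fix x assume "x \<in> range ppart"
   then obtain \<rho> where x: "x = ppart \<rho>" by blast
   show "h (series_mult x (ppart \<sigma>)) = series_mult (h x) (h (ppart \<sigma>))"
    unfolding x ppart_union[symmetric] hp
    by (simp add: series_mult_scale_left series_mult_scale_right ppart_union \<kappa>_def sv.scale_scale)
  qed
 qed
 have hm: "h (series_mult f g) = series_mult (h f) (h g)" if f: "f \<in> sym_functions" and g: "g \<in> sym_functions" for f g
 proof -
  from g have "g \<in> sv.span (range ppart)" using span_ppart by simp
  then show ?thesis
  proof (rule sv.span_induct)
   show "sv.subspace {g. h (series_mult f g) = series_mult (h f) (h g)}"
    by (auto simp: sv.subspace_def h.zero h.add h.scale series_mult_add_right series_mult_scale_right)
  qed (use hm1[OF f] in auto)
 qed
 let ?\<phi> = "restrict h sym_functions"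
 have one: "h series_one = series_one" using hp[of "{#}"] by (simp add: \<kappa>_def)
 have "is_plethysm ?\<phi>" unfolding is_plethysm_def sym_alg_endo_def
 proof (intro conjI ballI allI impI)
  show "?\<phi> \<in> sym_functions \<rightarrow>\<^sub>E sym_functions" using hs by auto
  show "?\<phi> series_one = series_one" by (simp add: one sym_functions_one)
  fix m :: nat assume "m \<ge> 1"
  then obtain k where m: "m = Suc k" by (cases m) auto
  show "?\<phi> (power_sum m) = series_scale (pweight m) (power_sum m)"
   using hp[of "{#k#}"] ppart_sym[of "{#k#}"] unfolding m power_sum_ppart by (simp add: \<kappa>_def)
 qed (simp_all add: series_add_eq sym_functions_add sym_functions_mult sym_functions_scale h.add h.scale hm)
 then show ?thesis by blast
qed

lemma is_plethysmD:
 assumes "is_plethysm \<phi>"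
 shows "f \<in> sym_functions ==> g \<in> sym_functions ==> \<phi> (f + g) = \<phi> f + \<phi> g"
  and "f \<in> sym_functions ==> g \<in> sym_functions ==>
   \<phi> (series_mult f g) = series_mult (\<phi> f) (\<phi> g)"
  and "f \<in> sym_functions ==> \<phi> (series_scale a f) = series_scale a (\<phi> f)"
  and "\<phi> series_one = series_one"
  and "m \<ge> 1 ==> \<phi> (power_sum m) = series_scale (pweight m) (power_sum m)"
  and "\<phi> \<in> sym_functions \<rightarrow>\<^sub>E sym_functions"
  and "\<phi> 0 = 0"
proof -
 show mult: "f \<in> sym_functions ==> g \<in> sym_functions ==> \<phi> (f + g) = \<phi> f + \<phi> g"
  and "f \<in> sym_functions ==> g \<in> sym_functions ==>
   \<phi> (series_mult f g) = series_mult (\<phi> f) (\<phi> g)"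
  and scale: "f \<in> sym_functions ==> \<phi> (series_scale a f) = series_scale a (\<phi> f)"
  and "\<phi> series_one = series_one"
  and "m \<ge> 1 ==> \<phi> (power_sum m) = series_scale (pweight m) (power_sum m)"
  and "\<phi> \<in> sym_functions \<rightarrow>\<^sub>E sym_functions" for f g a
  using assms unfolding is_plethysm_def sym_alg_endo_def series_add_eq by blast+
 have "\<phi> (series_scale 0 0) = series_scale 0 (\<phi> 0)" by (rule scale[OF sym_functions_zero])
 then show "\<phi> 0 = 0" by simp
qed

text \<open>Multiplicativity settles the power sum products, linearity their span, and off the
  symmetric functions both maps are \<open>undefined\<close> by extensionality.\<close>

lemma is_plethysm_unique:
 assumes "is_plethysm \<phi>" "is_plethysm \<psi>"
 shows "\<phi> = \<psi>"
proof
 fix f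
 note a = is_plethysmD[OF assms(1)] and b = is_plethysmD[OF assms(2)]
 have p: "\<phi> (ppart \<rho>) = \<psi> (ppart \<rho>)" for \<rho>
 proof (induction \<rho>)
  case empty
  then show ?case using a(4) b(4) by simp
 next
  case (add m \<rho>)
  have "power_sum (Suc m) \<in> sym_functions" by (simp add: power_sum_sym)
  then show ?case unfolding ppart_add_mset
   using add a(2,5) b(2,5) ppart_sym[of \<rho>] by simp
 qed
 show "\<phi> f = \<psi> f"
 proof (cases "f \<in> sym_functions")
  case True
  then have "f \<in> sv.span (range ppart)" using span_ppart by simp
  then have "f \<in> sym_functions \<and> \<phi> f = \<psi> f"
  proof (rule sv.span_induct)
   show "sv.subspace {f. f \<in> sym_functions \<and> \<phi> f = \<psi> f}"
    unfolding sv.subspace_def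
    using a(1,3,7) b(1,3,7) sym_functions_zero sym_functions_add sym_functions_scale by simp
   show "x \<in> sym_functions \<and> \<phi> x = \<psi> x" if "x \<in> range ppart" for x
    using that p ppart_sym by blast
  qed
  then show ?thesis by simp
 next
  case False
  then show ?thesis using PiE_arb[OF a(6)] PiE_arb[OF b(6)] by simp
 qed
qed

lemma is_plethysm_plethysm: "is_plethysm plethysm"
proof -
 obtain \<phi> where \<phi>: "is_plethysm \<phi>" using is_plethysm_exists by blast
 have "plethysm = (THE \<phi>. is_plethysm \<phi>)" by (simp add: plethysm_def is_plethysm_def)
 also have "\<dots> = \<phi>" using \<phi> is_plethysm_unique by (intro the_equality)
 finally show ?thesis using \<phi> by simp
qed

lemmas plethysm_add = is_plethysmD(1)[OF is_plethysm_plethysm]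
 and plethysm_mult = is_plethysmD(2)[OF is_plethysm_plethysm]
 and plethysm_scale = is_plethysmD(3)[OF is_plethysm_plethysm]
 and plethysm_one = is_plethysmD(4)[OF is_plethysm_plethysm]
 and plethysm_power_sum = is_plethysmD(5)[OF is_plethysm_plethysm]
 and plethysm_zero = is_plethysmD(7)[OF is_plethysm_plethysm]

lemma plethysm_sum: "(\<And>i. i \<in> I ==> f i \<in> sym_functions) ==> plethysm (sum f I) = (\<Sum>i\<in>I. plethysm (f i))"
 by (induction I rule: infinite_finite_induct) (auto simp: plethysm_zero plethysm_add sym_functions_sum)

section \<open>The algebra of functions on flows\<close>

abbreviation qp :: "int => qfield" where "qp k \<equiv> q powi k"

lemma qp_add: "qp (a + b) = qp a * qp b"
 by (simp add: power_int_add)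

lemma sum_list_map_diff:
 fixes f g :: "'a => nat"
 assumes "\<And>x. g x \<le> f x"
 shows "sum_list (map (%x. f x - g x) xs) = sum_list (map f xs) - sum_list (map g xs)"
 and "sum_list (map g xs) \<le> sum_list (map f xs)"
proof -
 have "sum_list (map (%x. f x - g x) xs) = sum_list (map f xs) - sum_list (map g xs)
  \<and> sum_list (map g xs) \<le> sum_list (map f xs)"
  using assms by (induction xs) (auto simp: add_mono)
 then show "sum_list (map (%x. f x - g x) xs) = sum_list (map f xs) - sum_list (map g xs)"
  "sum_list (map g xs) \<le> sum_list (map f xs)" by auto
qed

text \<open>A web cut open: the slices \<open>sl 0\<close>, \<open>sl 1\<close>, ... list the edges at successive levels from left to right,
 and passing the vertex \<open>vs ! k\<close> replaces \<open>ins (vs ! k)\<close> by \<open>outs (vs ! k)\<close>.\<close>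

locale cweb =
 fixes E :: "'e set" and ins outs :: "'v => 'e list" and vs :: "'v list" and sl :: "nat => 'e list"
 assumes fin: "finite E"
  and dist_vs: "distinct vs"
  and vert: "v \<in> set vs ==>
   (\<exists>l r c. ins v = [l, r] \<and> outs v = [c]) \<or> (\<exists>l r c. ins v = [c] \<and> outs v = [l, r])"
  and step: "k < length vs ==>
   \<exists>A B. sl k = A @ ins (vs ! k) @ B \<and> sl (Suc k) = A @ outs (vs ! k) @ B"
  and closed: "sl (length vs) = sl 0"
  and dist_sl: "k \<le> length vs ==> distinct (sl k)"
  and sl_E: "k \<le> length vs ==> set (sl k) \<subseteq> E"
  and uniq_in: "v \<in> set vs ==> v' \<in> set vs ==> e \<in> set (ins v) ==> e \<in> set (ins v') ==> v = v'"
  and uniq_out: "v \<in> set vs ==> v' \<in> set vs ==> e \<in> set (outs v) ==> e \<in> set (outs v') ==> v = v'"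
  and ins_outs: "v \<in> set vs ==> set (ins v) \<inter> set (outs v) = {}"
  and cover: "e \<in> E ==> \<exists>k \<le> length vs. e \<in> set (sl k)"
begin

section \<open>Flows, crossings and the twisted product\<close>

definition flow :: "('e => nat) => bool" where
 "flow f \<longleftrightarrow> (\<forall>e. e \<notin> E --> f e = 0) \<and>
   (\<forall>v\<in>set vs. sum_list (map f (ins v)) = sum_list (map f (outs v)))"

definition mgs :: "'v set" where "mgs = {v \<in> set vs. length (ins v) = 2}"

text \<open>For two strands \<open>f\<close> and \<open>g\<close> a merge counts +1 if
  \<open>f\<close> enters on the left and \<open>g\<close> on the right, and -1 in the opposite
  case. For the flows of two colours i < j this is their contribution to the exponent of a
  colouring.\<close>

definition cross :: "('e => nat) => ('e => nat) => int" where
 "cross f g = (\<Sum>v\<in>mgs. int (f (ins v ! 0)) * int (g (ins v ! 1)) - int (g (ins v ! 0)) * int (f (ins v ! 1)))"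

definition deg :: "('e => nat) => nat" where "deg f = sum_list (map f (sl 0))"

definition thin :: "('e => nat) => bool" where "thin f \<longleftrightarrow> (\<forall>e. f e \<le> 1)"

definition subs :: "('e => nat) => ('e => nat) set" where "subs t = {a. flow a \<and> a \<le> t}"

lemma flow_zero [simp]: "flow 0"
 by (auto simp: flow_def zero_fun_def)

lemma flow_plus: "flow f ==> flow g ==> flow (f + g)"
 by (auto simp: flow_def plus_fun_def sum_list_addf)

lemma flow_minus: "flow f ==> flow g ==> g \<le> f ==> flow (f - g)"
 by (auto simp: flow_def fun_diff_def le_fun_def sum_list_map_diff)

lemma flow_sum: "(\<And>i. i \<in> I ==> flow (f i)) ==> flow (\<Sum>i\<in>I. f i)"
proof (induction I rule: infinite_finite_induct)
 case (insert x F)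
 then show ?case by (simp only: sum.insert not_False_eq_True) (blast intro: flow_plus)
qed (simp_all only: sum.infinite sum.empty flow_zero not_False_eq_True)

lemma deg_zero [simp]: "deg 0 = 0"
 by (simp add: deg_def zero_fun_def)

lemma deg_plus: "deg (f + g) = deg f + deg g"
 by (simp add: deg_def plus_fun_def sum_list_addf)

lemma fun_le_add_diff: "g \<le> f ==> g + (f - g) = f" "g \<le> f ==> (f - g) + g = f"
 for f g :: "'e => nat"
 by (auto simp: fun_eq_iff le_fun_def)

lemma deg_minus: "g \<le> f ==> deg (f - g) = deg f - deg g"
 by (metis deg_plus fun_le_add_diff(1) diff_add_inverse)

lemma deg_mono: "g \<le> f ==> deg g \<le> deg f"
 by (metis deg_plus fun_le_add_diff(1) le_add1)

lemma cross_plus_left: "cross (f + g) h = cross f h + cross g h"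
 and cross_plus_right: "cross h (f + g) = cross h f + cross h g"
 by (auto simp: cross_def sum.distrib[symmetric] algebra_simps intro!: sum.cong)

lemma cross_self [simp]: "cross f f = 0"
 by (simp add: cross_def)

lemma cross_zero [simp]: "cross 0 f = 0" "cross f 0 = 0"
 by (simp_all add: cross_def)

lemma cross_antisym: "cross g f = - cross f g"
 by (simp add: cross_def sum_negf[symmetric] algebra_simps)

lemma cross_sum_left: "cross (\<Sum>i\<in>I. f i) g = (\<Sum>i\<in>I. cross (f i) g)"
 by (induction I rule: infinite_finite_induct)
  (simp_all only: sum.infinite sum.empty sum.insert cross_plus_left cross_zero not_False_eq_True)

lemma finite_below:
 assumes "flow t"
 shows "finite {a. a \<le> t}"
proof -
 let ?N = "\<Sum>e\<in>E. t e"
 let ?F = "{f. \<forall>x. (x \<in> E --> f x \<in> {..?N}) \<and> (x \<notin> E --> f x = (0::nat))}"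
 have "finite ?F" by (rule finite_set_of_finite_funs) (auto simp: fin)
 moreover have "{a. a \<le> t} \<subseteq> ?F"
 proof clarify
  fix f x assume "f \<le> t"
  then have "f x \<le> t x" by (simp add: le_fun_def)
  moreover have "x \<in> E ==> t x \<le> ?N" by (rule member_le_sum) (auto simp: fin)
  ultimately show "(x \<in> E --> f x \<in> {..?N}) \<and> (x \<notin> E --> f x = 0)"
   using assms by (auto simp: flow_def)
 qed
 ultimately show ?thesis by (rule rev_finite_subset)
qed

lemma finite_subs [simp]: "flow t ==> finite (subs t)"
 by (rule finite_subset[OF _ finite_below]) (auto simp: subs_def)

lemma subsD: "a \<in> subs t ==> flow a" "a \<in> subs t ==> a \<le> t"
 by (auto simp: subs_def)

lemma flow_subs_minus: "flow t ==> a \<in> subs t ==> flow (t - a)"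
 by (auto simp: subs_def flow_minus)

text \<open>A convolution twisted by the bicharacter q^cross. It vanishes off the flows, so
  \<open>unit\<close> is neutral for functions supported on flows.\<close>

definition star :: "(('e => nat) => qfield) => (('e => nat) => qfield) => ('e => nat) => qfield" where
 "star F G t = (if flow t then \<Sum>a\<in>subs t. qp (cross a (t - a)) * F a * G (t - a) else 0)"

definition unit :: "('e => nat) => qfield" where
 "unit t = (if t = 0 then 1 else 0)"

lemma star_cong:
 assumes "\<And>a. flow a ==> a \<le> t ==> F a = F' a" "\<And>a. flow a ==> a \<le> t ==> G a = G' a"
 shows "star F G t = star F' G' t"
 unfolding star_def
proof (intro if_cong sum.cong refl)
 fix a assume "flow t" and a: "a \<in> subs t"
 moreover have "t - a \<le> t" by (simp add: le_fun_def)
 ultimately show "qp (cross a (t - a)) * F a * G (t - a) = qp (cross a (t - a)) * F' a * G' (t - a)"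
  using assms subsD[OF a] flow_subs_minus[of t a] by simp
qed

text \<open>Since \<open>cross\<close> is additive in both arguments, both bracketings are sums over
  ordered splittings of \<open>t\<close> into three flows, with the three mutual crossings as
  exponent.\<close>

lemma star_assoc: "star (star F G) K = star F (star G K)"
proof
 fix t
 show "star (star F G) K t = star F (star G K) t"
 proof (cases "flow t")
  case t: True
  have le: "c \<le> t" if "c \<le> a" "a \<le> t" for a c :: "'e => nat" using that by (rule order_trans)
  let ?w = "%a c. qp (cross a (t - a)) * (qp (cross c (a - c)) * F c * G (a - c)) * K (t - a)"
  let ?v = "%c b. qp (cross c (t - c)) * F c * (qp (cross b (t - c - b)) * G b * K (t - c - b))"
  have 1: "c + (a - c) = a \<and> c \<in> subs t \<and> a - c \<in> subs (t - c) \<and> ?v c (a - c) = ?w a c"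
   if "a \<in> subs t" "c \<in> subs a" for a c
  proof (intro conjI)
   have fl: "flow a" "flow c" and ca: "c \<le> a" and at: "a \<le> t" using that by (auto simp: subs_def)
   show "c + (a - c) = a" using ca by (rule fun_le_add_diff)
   show "c \<in> subs t" using fl le[OF ca at] by (simp add: subs_def)
   show "a - c \<in> subs (t - c)"
    using at flow_minus[OF fl(1) fl(2) ca] by (auto simp: subs_def le_fun_def diff_le_mono)
   have e: "t - c - (a - c) = t - a" using ca at by (auto simp: fun_eq_iff le_fun_def)
   have "t - c = (a - c) + (t - a)" using ca at by (auto simp: fun_eq_iff le_fun_def)
   then have "cross c (t - c) = cross c (a - c) + cross c (t - a)" by (simp add: cross_plus_right)
   moreover have "cross a (t - a) = cross c (t - a) + cross (a - c) (t - a)"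
    using fun_le_add_diff(1)[OF ca] cross_plus_left by metis
   ultimately have "qp (cross c (t - c)) * qp (cross (a - c) (t - a)) = qp (cross a (t - a)) * qp (cross c (a - c))"
    by (simp add: qp_add[symmetric] add_ac)
   then show "?v c (a - c) = ?w a c" unfolding e by (simp add: mult_ac)
  qed
  have 2: "c + b - c = b \<and> c + b \<in> subs t \<and> c \<in> subs (c + b)" if "c \<in> subs t" "b \<in> subs (t - c)" for c b
  proof (intro conjI)
   have fl: "flow c" "flow b" and ct: "c \<le> t" and b: "b \<le> t - c" using that by (auto simp: subs_def)
   show "c + b - c = b" by (simp add: fun_eq_iff)
   have "c x + b x \<le> t x" for x using ct[unfolded le_fun_def, rule_format, of x] b[unfolded le_fun_def, rule_format, of x]
    by simp
   then show "c + b \<in> subs t" "c \<in> subs (c + b)"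
    using fl by (auto simp: subs_def flow_plus le_fun_def)
  qed
  have "star (star F G) K t = (\<Sum>(a, c)\<in>Sigma (subs t) subs. ?w a c)"
   using t by (simp add: star_def sum_distrib_left sum_distrib_right subsD sum.Sigma)
  also have "\<dots> = (\<Sum>(c, b)\<in>(SIGMA c:subs t. subs (t - c)). ?v c b)"
   by (rule sum.reindex_bij_witness[where j = "%(a, c). (c, a - c)" and i = "%(c, b). (c + b, c)"])
    (use 1 2 in auto)
  also have "\<dots> = star F (star G K) t"
   using t by (simp add: star_def sum_distrib_left sum_distrib_right subsD sum.Sigma flow_subs_minus cong: sum.cong)
  finally show ?thesis .
 qed (simp add: star_def)
qed

lemma star_unit_left: "(\<And>t. \<not> flow t ==> F t = 0) ==> star unit F = F"
proof
 fix t assume F: "\<And>t. \<not> flow t ==> F t = 0"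
 show "star unit F t = F t"
 proof (cases "flow t")
  case True
  have "t - 0 = t" by (simp add: fun_eq_iff)
  then have "star unit F t = (\<Sum>a\<in>subs t. if a = 0 then F t else 0)"
   unfolding star_def if_P[OF True] by (intro sum.cong refl) (simp only: unit_def cross_zero, simp)
  also have "\<dots> = F t"
   unfolding sum.delta[OF finite_subs[OF True]] by (simp add: subs_def le_fun_def)
  finally show ?thesis .
 qed (simp add: star_def F)
qed

lemma star_unit_right: "(\<And>t. \<not> flow t ==> F t = 0) ==> star F unit = F"
proof
 fix t assume F: "\<And>t. \<not> flow t ==> F t = 0"
 show "star F unit t = F t"
 proof (cases "flow t")
  case True
  have u: "unit (t - a) = (if a = t then 1 else 0)" if "a \<in> subs t" for a
  proof -
   have "t - a = 0 \<longleftrightarrow> a = t"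
    using subsD(2)[OF that] fun_le_add_diff(1)[of a t] by (auto simp: fun_eq_iff)
   then show ?thesis by (simp only: unit_def)
  qed
  have "star F unit t = (\<Sum>a\<in>subs t. if a = t then F t else 0)"
   unfolding star_def if_P[OF True] by (intro sum.cong refl) (simp add: u)
  also have "\<dots> = F t"
   unfolding sum.delta[OF finite_subs[OF True]] using True by (simp add: subs_def)
  finally show ?thesis .
 qed (simp add: star_def F)
qed

lemma star_lin_left: "star (%t. \<Sum>i\<in>I. c i * F i t) G = (%t. \<Sum>i\<in>I. c i * star (F i) G t)"
proof
 fix t
 show "star (%t. \<Sum>i\<in>I. c i * F i t) G t = (\<Sum>i\<in>I. c i * star (F i) G t)"
  by (simp add: star_def sum_distrib_left sum_distrib_right sum.swap[of _ "subs t" I] mult_ac)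
qed

lemma star_lin_right: "star G (%t. \<Sum>i\<in>I. c i * F i t) = (%t. \<Sum>i\<in>I. c i * star G (F i) t)"
proof
 fix t
 show "star G (%t. \<Sum>i\<in>I. c i * F i t) t = (\<Sum>i\<in>I. c i * star G (F i) t)"
  by (simp add: star_def sum_distrib_left sum_distrib_right sum.swap[of _ "subs t" I] mult_ac)
qed

lemma star_scale_left: "star (%t. c * F t) G = (%t. c * star F G t)"
 using star_lin_left[where I = "{0::nat}" and c = "%_. c" and F = "%_. F"] by simp

lemma star_scale_right: "star G (%t. c * F t) = (%t. c * star G F t)"
 using star_lin_right[where I = "{0::nat}" and c = "%_. c" and F = "%_. F"] by simp

lemma star_diff_left: "star (%t. F t - F' t) G = (%t. star F G t - star F' G t)"
 by (auto simp: star_def fun_eq_iff algebra_simps sum_subtractf)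

lemma star_diff_right: "star G (%t. F t - F' t) = (%t. star G F t - star G F' t)"
 by (auto simp: star_def fun_eq_iff algebra_simps sum_subtractf)

lemma star_add_left: "star (%t. F t + F' t) G = (%t. star F G t + star F' G t)"
 by (auto simp: star_def fun_eq_iff algebra_simps sum.distrib)

lemma star_add_right: "star G (%t. F t + F' t) = (%t. star G F t + star G F' t)"
 by (auto simp: star_def fun_eq_iff algebra_simps sum.distrib)

lemma star_flow: "\<not> flow t ==> star F G t = 0"
 by (simp add: star_def)

lemma flow_slice:
 assumes "flow f" "k \<le> length vs"
 shows "sum_list (map f (sl k)) = deg f"
 using assms(2)
proof (induction k)
 case 0
 then show ?case by (simp add: deg_def)
next
 case (Suc k)
 then obtain A B where s: "sl k = A @ ins (vs ! k) @ B" "sl (Suc k) = A @ outs (vs ! k) @ B"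
  using step[of k] by auto
 have "sum_list (map f (ins (vs ! k))) = sum_list (map f (outs (vs ! k)))"
  using assms(1) Suc.prems by (auto simp: flow_def)
 then show ?case using Suc s by simp
qed

lemma flow_le_deg:
 assumes "flow f"
 shows "f e \<le> deg f"
proof (cases "e \<in> E")
 case True
 then obtain k where k: "k \<le> length vs" "e \<in> set (sl k)" using cover by blast
 then have "f e \<le> sum_list (map f (sl k))" by (intro member_le_sum_list) auto
 then show ?thesis using flow_slice[OF assms k(1)] by simp
qed (use assms in \<open>simp add: flow_def\<close>)

lemma deg_eq_0: "flow f ==> deg f = 0 \<longleftrightarrow> f = 0"
proof
 assume "flow f" "deg f = 0"
 then show "f = 0" using flow_le_deg[of f] by (simp add: fun_eq_iff)
qed (simp only: deg_zero)

definition X :: "nat => ('e => nat) => qfield" where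
 "X n a = (if flow a \<and> thin a \<and> deg a = n then 1 else 0)"

lemma X_flow: "\<not> flow t ==> X n t = 0"
 by (simp add: X_def)

lemma X_0: "X 0 = unit"
proof
 show "X 0 t = unit t" for t
  using deg_eq_0[of t] by (cases "t = 0") (simp_all add: X_def unit_def thin_def)
qed

definition lead :: "('e => nat) => 'e" where
 "lead t = hd (filter (%e. t e > 0) (sl 0))"

definition U :: "'e => ('e => nat) => qfield" where
 "U e f = (if flow f \<and> deg f = 1 \<and> f e = 1 then 1 else 0)"

text \<open>With a single colour this is the sum over labelled decompositions divided by the quantum
  factorials of the cut: \<open>f\<close> is the loop of the smallest label. For k =
  \<open>t (lead t)\<close> the factor equals q^(1-k) / [k]; here 1 / [k] is the normalisation, and
  q^(1-k) comes from the k - 1 pairs of that label inside its block.\<close>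

primrec Hd :: "nat => ('e => nat) => qfield" where
 "Hd 0 t = 1"
| "Hd (Suc n) t = (q^2 - 1) / (q ^ (2 * t (lead t)) - 1) *
   (\<Sum>f\<in>{f \<in> subs t. deg f = 1 \<and> f (lead t) = 1}. qp (cross (t - f) f) * Hd n (t - f))"

definition H :: "nat => ('e => nat) => qfield" where
 "H n t = (if flow t \<and> deg t = n then Hd n t else 0)"

lemma H_flow: "\<not> flow t ==> H n t = 0"
 by (simp add: H_def)

lemma H_0: "H 0 = unit"
proof
 show "H 0 t = unit t" for t
  using deg_eq_0[of t] by (cases "t = 0") (simp_all add: H_def unit_def)
qed

lemma lead_split:
 assumes "deg t > 0"
 obtains A B where "sl 0 = A @ lead t # B" "\<forall>x\<in>set A. t x = 0" "t (lead t) > 0"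
proof -
 have "\<exists>x\<in>set (sl 0). t x > 0"
 proof (rule ccontr)
  assume "\<not> ?thesis"
  then have "\<And>x. x \<in> set (map t (sl 0)) ==> x = 0" by auto
  then have "sum_list (map t (sl 0)) = 0" by (metis sum_list_eq_0_iff)
  then show False using assms unfolding deg_def by linarith
 qed
 then obtain A x B where s: "sl 0 = A @ x # B" "t x > 0" "\<forall>y\<in>set A. \<not> t y > 0"
  using split_list_first_prop[of "sl 0" "%x. t x > 0"] by blast
 then have "filter (%e. t e > 0) (sl 0) = x # filter (%e. t e > 0) B" by simp
 then have "lead t = x" by (simp add: lead_def)
 with s that show ?thesis by auto
qed

end

section \<open>Transfer matrices and horizontal positions\<close>

primrec transfer :: "(nat => 'a set) => (nat => 'a => 'a => bool) => (nat => 'a => 'b::comm_semiring_1)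
  => 'a => nat => 'a => 'b" where
 "transfer S R w e 0 p = (if p = e then 1 else 0)"
| "transfer S R w e (Suc k) p' = (\<Sum>p\<in>S k. if R k p p' then w k p * transfer S R w e k p else 0)"

definition tpaths :: "(nat => 'a set) => (nat => 'a => 'a => bool) => 'a => nat => 'a list set" where
 "tpaths S R e k = {\<phi>. length \<phi> = Suc k \<and> \<phi> ! 0 = e \<and> (\<forall>i\<le>k. \<phi> ! i \<in> S i) \<and>
   (\<forall>i<k. R i (\<phi> ! i) (\<phi> ! Suc i))}"

lemma finite_tpaths:
 assumes "\<And>k. finite (S k)"
 shows "finite (tpaths S R e k)"
proof (rule finite_subset)
 show "tpaths S R e k \<subseteq> {\<phi>. set \<phi> \<subseteq> (\<Union>i\<le>k. S i) \<and> length \<phi> = Suc k}"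
  by (force simp: tpaths_def in_set_conv_nth less_Suc_eq_le)
qed (use assms in \<open>auto intro: finite_lists_length_eq\<close>)

lemma transfer_sum:
 assumes fin: "\<And>k. finite (S k)" and "p \<in> S k"
 shows "(\<Sum>\<phi>\<in>{\<phi> \<in> tpaths S R e k. \<phi> ! k = p}. \<Prod>i<k. w i (\<phi> ! i)) = transfer S R w e k p"
 using assms(2)
proof (induction k arbitrary: p)
 case 0
 have "{\<phi> \<in> tpaths S R e 0. \<phi> ! 0 = p} = (if p = e then {[e]} else {})"
  using 0 by (auto simp: tpaths_def length_Suc_conv)
 then show ?case by simp
next
 case (Suc k)
 have "{\<phi> \<in> tpaths S R e (Suc k). \<phi> ! Suc k = p} =
   (%\<phi>. \<phi> @ [p]) ` {\<phi> \<in> tpaths S R e k. R k (\<phi> ! k) p}" (is "?L = ?f ` ?M")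
 proof (intro equalityI subsetI)
  fix \<phi> assume \<phi>: "\<phi> \<in> ?L"
  then have len: "length \<phi> = Suc (Suc k)" by (auto simp: tpaths_def)
  then have eq: "\<phi> = butlast \<phi> @ [p]" using \<phi>
   by (metis (mono_tags, lifting) append_butlast_last_id diff_Suc_1 last_conv_nth length_0_conv mem_Collect_eq nat.distinct(1))
  have nth: "butlast \<phi> ! i = \<phi> ! i" if "i \<le> k" for i using that len by (simp add: nth_butlast)
  have "butlast \<phi> \<in> ?M" using \<phi> len nth by (auto simp: tpaths_def less_imp_le)
  then show "\<phi> \<in> ?f ` ?M" using eq by blast
 next
  fix \<phi> assume "\<phi> \<in> ?f ` ?M"
  then obtain \<psi> where \<psi>: "\<phi> = \<psi> @ [p]" "\<psi> \<in> ?M" by blast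
  then have len: "length \<psi> = Suc k" by (auto simp: tpaths_def)
  have "\<phi> ! i = \<psi> ! i" if "i \<le> k" for i using that len \<psi>(1) by (simp add: nth_append)
  moreover have "\<phi> ! Suc k = p" using len \<psi>(1) by (simp add: nth_append)
  ultimately show "\<phi> \<in> ?L" using \<psi> len Suc.prems
   by (auto simp: tpaths_def le_Suc_eq less_Suc_eq)
 qed
 then have "(\<Sum>\<phi>\<in>?L. \<Prod>i<Suc k. w i (\<phi> ! i)) = (\<Sum>\<phi>\<in>?M. \<Prod>i<Suc k. w i (?f \<phi> ! i))"
  by (simp only:) (subst sum.reindex, auto simp: inj_on_def)
 also have "\<dots> = (\<Sum>\<phi>\<in>?M. w k (\<phi> ! k) * (\<Prod>i<k. w i (\<phi> ! i)))"
  by (intro sum.cong refl) (auto simp: tpaths_def nth_append mult.commute intro!: arg_cong2[of _ _ _ _ "(*)"] prod.cong)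
 also have "\<dots> = (\<Sum>q\<in>S k. \<Sum>\<phi>\<in>{\<phi> \<in> ?M. \<phi> ! k = q}. w k (\<phi> ! k) * (\<Prod>i<k. w i (\<phi> ! i)))"
  by (rule sum.group[symmetric]) (auto simp: tpaths_def fin intro: finite_subset[OF _ finite_tpaths[where S = S and R = R and e = e and k = k, OF fin]])
 also have "\<dots> = (\<Sum>q\<in>S k. if R k q p then w k q * transfer S R w e k q else 0)"
 proof (rule sum.cong[OF refl])
  fix q assume q: "q \<in> S k"
  have "{\<phi> \<in> ?M. \<phi> ! k = q} = (if R k q p then {\<phi> \<in> tpaths S R e k. \<phi> ! k = q} else {})" by auto
  then have "(\<Sum>\<phi>\<in>{\<phi> \<in> ?M. \<phi> ! k = q}. w k (\<phi> ! k) * (\<Prod>i<k. w i (\<phi> ! i))) =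
    (if R k q p then (\<Sum>\<phi>\<in>{\<phi> \<in> tpaths S R e k. \<phi> ! k = q}. w k q * (\<Prod>i<k. w i (\<phi> ! i))) else 0)"
   by (auto intro: sum.cong)
  then show "(\<Sum>\<phi>\<in>{\<phi> \<in> ?M. \<phi> ! k = q}. w k (\<phi> ! k) * (\<Prod>i<k. w i (\<phi> ! i))) =
    (if R k q p then w k q * transfer S R w e k q else 0)"
   using Suc.IH[OF q] by (simp add: sum_distrib_left[symmetric])
 qed
 finally show ?case by simp
qed

text \<open>If every edge of the slice \<open>xs\<close> gets width \<open>a\<close>, this is the
  left end of the interval of horizontal positions occupied by \<open>x\<close>.\<close>

definition before :: "('a => nat) => 'a list => 'a => nat" where
 "before a xs x = sum_list (map a (takeWhile (%y. y ~= x) xs))"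

lemma before_append1: "x \<in> set A ==> before a (A @ B) x = before a A x"
 by (auto simp: before_def takeWhile_append)

lemma before_append2: "x \<notin> set A ==> before a (A @ B) x = sum_list (map a A) + before a B x"
proof -
 assume "x \<notin> set A"
 then have "takeWhile (%y. y ~= x) (A @ B) = A @ takeWhile (%y. y ~= x) B"
  by (intro takeWhile_append2) auto
 then show ?thesis by (simp add: before_def)
qed

lemma before_Cons: "before a (y # A) x = (if x = y then 0 else a y + before a A x)"
 by (auto simp: before_def)

lemma before_separated:
 assumes "x \<in> set xs" "y \<in> set xs" "x ~= y"
 shows "before a xs x + a x \<le> before a xs y \<or> before a xs y + a y \<le> before a xs x"
 using assms by (induction xs) (auto simp: before_Cons)

lemma qp_sum: "qp (\<Sum>i\<in>I. f i) = (\<Prod>i\<in>I. qp (f i))"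
 by (induction I rule: infinite_finite_induct) (auto simp: qp_add)

section \<open>Strands as closed paths through the slices\<close>

context cweb
begin

abbreviation len :: nat where "len \<equiv> length vs"

lemma stepE:
 assumes "k < len"
 obtains A B where "sl k = A @ ins (vs ! k) @ B" "sl (Suc k) = A @ outs (vs ! k) @ B"
  "distinct (A @ ins (vs ! k) @ B)" "distinct (A @ outs (vs ! k) @ B)"
proof -
 obtain A B where "sl k = A @ ins (vs ! k) @ B" "sl (Suc k) = A @ outs (vs ! k) @ B"
  using step[OF assms] by blast
 with that dist_sl[of k] dist_sl[of "Suc k"] assms show ?thesis by auto
qed

text \<open>An edge crossing the cut is seen both in the first and in the last slices, so that data
 transported along the slices descend to the edges only if they agree on the two ends.\<close>

lemma descend:
 fixes val :: "nat => 'e => 'b"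
 assumes st: "\<And>k x. k < len ==> x \<in> set (sl k) ==> x \<in> set (sl (Suc k)) ==> val (Suc k) x = val k x"
  and cl: "\<And>x. x \<in> set (sl 0) ==> val len x = val 0 x"
  and "j \<le> len" "k \<le> len" "x \<in> set (sl j)" "x \<in> set (sl k)"
 shows "val j x = val k x"
proof -
 have run: "val k' x = val j' x"
  if "j' \<le> k'" "k' \<le> len" "\<And>i. j' \<le> i ==> i \<le> k' ==> x \<in> set (sl i)" for j' k'
  using that
 proof (induction k' rule: dec_induct)
  case (step n)
  then show ?case using st[of n x] by simp
 qed simp
 have birth: "x \<in> set (outs (vs ! i))" if "i < len" "x \<notin> set (sl i)" "x \<in> set (sl (Suc i))" for i
  by (rule stepE[OF that(1)]) (use that in auto)
 have wlog: "val j' x = val k' x" if jk: "j' \<le> k'" "k' \<le> len" and x: "x \<in> set (sl j')" "x \<in> set (sl k')" for j' k'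
 proof (cases "\<forall>i. j' \<le> i \<and> i \<le> k' --> x \<in> set (sl i)")
  case True
  then show ?thesis using run jk by simp
 next
  case False
  then obtain i where i: "j' \<le> i" "i \<le> k'" "x \<notin> set (sl i)" by blast
  have ex: "\<exists>b. m \<le> b \<and> b < m' \<and> x \<notin> set (sl b) \<and> x \<in> set (sl (Suc b))"
   if "m \<le> m'" "x \<notin> set (sl m)" "x \<in> set (sl m')" for m m'
   using that
  proof (induction m' rule: dec_induct)
   case (step n)
   then show ?case by (cases "x \<in> set (sl n)") (auto intro: less_SucI)
  qed simp
  obtain b where b: "i \<le> b" "b < k'" "x \<in> set (outs (vs ! b))"
   using ex[OF i(2,3) x(2)] birth jk by (metis less_le_trans)
  \<comment> \<open>A gap is closed only by a vertex that emits \<open>x\<close>, and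
    \<open>uniq_out\<close> with the distinctness of \<open>vs\<close> allows one such event. A gap
    between j' and k' uses it up, so \<open>x\<close> lies in all slices up to j' and in all slices
    from k' on, and the comparison goes through the closing end.\<close>
  have no: False if b': "b' < len" "x \<notin> set (sl b')" "x \<in> set (sl (Suc b'))" "b' < i \<or> k' \<le> b'" for b'
  proof -
   have "x \<in> set (outs (vs ! b'))" using birth b' by blast
   then have "vs ! b' = vs ! b" using uniq_out[of "vs ! b'" "vs ! b" x] b b'(1) jk by auto
   then show False using dist_vs b b' jk by (auto simp: nth_eq_iff_index_eq)
  qed
  have low: "x \<in> set (sl m)" if "m \<le> j'" for m
  proof (rule ccontr)
   assume "x \<notin> set (sl m)"
   from ex[OF that this x(1)] no i(1) jk show False by (meson le_trans less_le_trans)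
  qed
  have high: "x \<in> set (sl m)" if "k' \<le> m" "m \<le> len" for m
  proof (rule ccontr)
   assume nm: "x \<notin> set (sl m)"
   have "x \<in> set (sl len)" using low[of 0] closed by simp
   from ex[OF that(2) nm this] no that(1) show False by (meson le_trans)
  qed
  have "val j' x = val 0 x" using run[of 0 j'] low jk by simp
  moreover have "val len x = val k' x" using run[of k' len] high jk by simp
  moreover have "val len x = val 0 x" using cl low[of 0] by simp
  ultimately show ?thesis by simp
 qed
 show ?thesis using wlog[of j k] wlog[of k j] assms by (metis nat_le_linear)
qed

definition nxt :: "nat => 'e => 'e => bool" where
 "nxt k p p' \<longleftrightarrow> (if p \<in> set (ins (vs ! k)) then p' \<in> set (outs (vs ! k)) else p' = p)"

text \<open>A closed strand that uses an edge in one slice uses it in every slice that contains the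
  edge: \<open>descend\<close> applied to the truth value of \<open>x = \<phi> ! k\<close>.\<close>

lemma path_edges:
 assumes len_phi: "length \<phi> = Suc len" and mem: "\<And>k. k \<le> len ==> \<phi> ! k \<in> set (sl k)"
  and nx: "\<And>k. k < len ==> nxt k (\<phi> ! k) (\<phi> ! Suc k)" and cl: "\<phi> ! len = \<phi> ! 0"
  and k: "k \<le> len" and x: "x \<in> set (sl k)"
 shows "x \<in> set \<phi> \<longleftrightarrow> x = \<phi> ! k"
proof
 assume "x \<in> set \<phi>"
 then obtain j where j: "j \<le> len" "x = \<phi> ! j" using len_phi by (auto simp: in_set_conv_nth less_Suc_eq_le)
 have "(x = \<phi> ! j) = (x = \<phi> ! k)"
 proof (rule descend[where val = "%k x. x = \<phi> ! k"])
  fix k x assume k: "k < len" and x: "x \<in> set (sl k)" "x \<in> set (sl (Suc k))"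
  obtain A B where s: "sl k = A @ ins (vs ! k) @ B" "sl (Suc k) = A @ outs (vs ! k) @ B"
    "distinct (A @ ins (vs ! k) @ B)" "distinct (A @ outs (vs ! k) @ B)" by (rule stepE[OF k])
  have "set (ins (vs ! k)) \<inter> set (outs (vs ! k)) = {}" using ins_outs k by simp
  then have xn: "x \<notin> set (ins (vs ! k))" "x \<notin> set (outs (vs ! k))" using x s by auto
  show "(x = \<phi> ! Suc k) = (x = \<phi> ! k)"
   using nx[OF k] xn by (auto simp: nxt_def split: if_splits)
 qed (use cl j k x mem in auto)
 with j show "x = \<phi> ! k" by simp
qed (use len_phi k in auto)

lemma path_flow:
 assumes phi: "length \<phi> = Suc len" "\<And>k. k \<le> len ==> \<phi> ! k \<in> set (sl k)"
  "\<And>k. k < len ==> nxt k (\<phi> ! k) (\<phi> ! Suc k)" "\<phi> ! len = \<phi> ! 0"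
  and E: "set \<phi> \<subseteq> E"
 shows "flow (%x. if x \<in> set \<phi> then 1 else 0)" (is "flow ?f")
  and "deg (%x. if x \<in> set \<phi> then 1 else 0) = 1"
proof -
 have ind: "sum_list (map ?f xs) = (if \<phi> ! k \<in> set xs then 1 else 0)"
  if "k \<le> len" "distinct xs" "set xs \<subseteq> set (sl k)" for k xs
 proof -
  have "sum_list (map ?f xs) = (\<Sum>x\<in>set xs. if x = \<phi> ! k then 1 else 0)"
   unfolding sum_list_distinct_conv_sum_set[OF that(2)]
   by (rule sum.cong) (use that path_edges[OF phi, of k] in auto)
  then show ?thesis by simp
 qed
 have "sum_list (map ?f (ins v)) = sum_list (map ?f (outs v))" if v: "v \<in> set vs" for v
 proof -
  obtain k where k: "k < len" "v = vs ! k" using v by (auto simp: in_set_conv_nth)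
  obtain A B where s: "sl k = A @ ins v @ B" "sl (Suc k) = A @ outs v @ B"
   "distinct (A @ ins v @ B)" "distinct (A @ outs v @ B)" using stepE[OF k(1)] k(2) by blast
  have "sum_list (map ?f (ins v)) = (if \<phi> ! k \<in> set (ins v) then 1 else 0)"
   using k s by (intro ind) auto
  moreover have "sum_list (map ?f (outs v)) = (if \<phi> ! Suc k \<in> set (outs v) then 1 else 0)"
   using k s by (intro ind) auto
  moreover have "\<phi> ! k \<in> set (ins v) \<longleftrightarrow> \<phi> ! Suc k \<in> set (outs v)"
   using phi(3)[OF k(1)] phi(2)[of k] k s by (auto simp: nxt_def split: if_splits)
  ultimately show ?thesis by simp
 qed
 then show "flow ?f" using E by (auto simp: flow_def)
 show "deg ?f = 1" unfolding deg_def using ind[of 0 "sl 0"] dist_sl[of 0] phi(2)[of 0] by simp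
qed

text \<open>The following predicate says that one copy of \<open>p\<close> can be removed from the slice \<open>k\<close>
 of \<open>a\<close> such that the rest is thin.\<close>

definition ok :: "('e => nat) => nat => 'e => bool" where
 "ok a k p \<longleftrightarrow> a p \<ge> 1 \<and> (\<forall>x\<in>set (sl k). a x \<le> (if x = p then 2 else 1))"

text \<open>The summand of \<open>cross a f\<close> at the vertex \<open>vs ! k\<close>, for a
  strand \<open>f\<close> that uses \<open>p\<close> in slice \<open>k\<close>.\<close>

definition cr :: "('e => nat) => nat => 'e => int" where
 "cr a k p = (let v = vs ! k in if length (ins v) = 2 then
   (if p = ins v ! 1 then int (a (ins v ! 0)) else 0) - (if p = ins v ! 0 then int (a (ins v ! 1)) else 0) else 0)"

text \<open>Total weight of the partial strands from \<open>e\<close> to \<open>p\<close> whose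
  removal has left all slices so far thin. The values 1 and -1 of \<open>s\<close> produce the two
  sums of the exchange relation.\<close>

definition Wt :: "('e => nat) => 'e => int => nat => 'e => qfield" where
 "Wt a e s = transfer (%k. set (sl k)) (%k p p'. nxt k p p' \<and> ok a (Suc k) p') (%k p. qp (s * cr a k p)) e"

definition thinners :: "('e => nat) => 'e => ('e => nat) set" where
 "thinners a e = {f. flow f \<and> f \<le> a \<and> deg f = 1 \<and> f e = 1 \<and> thin (a - f)}"

lemma sum_mgs: "(\<Sum>v\<in>mgs. g v) = (\<Sum>k<len. if length (ins (vs ! k)) = 2 then g (vs ! k) else 0)"
proof -
 have "(\<Sum>v\<in>mgs. g v) = (\<Sum>v\<in>set vs. if length (ins v) = 2 then g v else 0)"
  unfolding mgs_def by (simp add: sum.inter_filter)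
 also have "\<dots> = (\<Sum>v\<in>(!) vs ` {..<len}. if length (ins v) = 2 then g v else 0)"
  by (rule sum.cong) (auto simp: set_conv_nth)
 also have "\<dots> = (\<Sum>k<len. if length (ins (vs ! k)) = 2 then g (vs ! k) else 0)"
  by (subst sum.reindex) (use dist_vs in \<open>auto simp: inj_on_def nth_eq_iff_index_eq\<close>)
 finally show ?thesis .
qed

lemma unit_flow_slice:
 assumes f: "flow f" "deg f = 1" and k: "k \<le> len"
 shows "\<exists>!p. p \<in> set (sl k) \<and> f p = 1" "x \<in> set (sl k) ==> f x \<le> 1"
proof -
 have s: "(\<Sum>x\<in>set (sl k). f x) = 1"
  using flow_slice[OF f(1) k] f(2) dist_sl[OF k] by (simp add: sum_list_distinct_conv_sum_set)
 then show "x \<in> set (sl k) ==> f x \<le> 1" by (metis List.finite_set member_le_sum zero_le)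
 obtain p where p: "p \<in> set (sl k)" "f p = 1" "\<forall>y\<in>set (sl k). p ~= y --> f y = 0"
  using s unfolding One_nat_def sum_eq_Suc0_iff[OF List.finite_set] by blast
 show "\<exists>!p. p \<in> set (sl k) \<and> f p = 1"
 proof (rule ex1I)
  show "p \<in> set (sl k) \<and> f p = 1" using p by simp
  show "y = p" if "y \<in> set (sl k) \<and> f y = 1" for y using p that by (metis zero_neq_one)
 qed
qed

text \<open>Every edge appears in some slice, so thinness of a - f can be tested slice by slice.
  Removable strands thus become closed paths with \<open>ok\<close> in each slice, and
  \<open>cross a f\<close> is a sum of local contributions.\<close>

lemma thinners_sum:
 assumes a: "flow a" and e: "e \<in> set (sl 0)" and ok0: "ok a 0 e"
 shows "(\<Sum>f\<in>thinners a e. qp (s * cross a f)) = Wt a e s len e"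
proof -
 let ?S = "%k. set (sl k)" and ?R = "%k p p'. nxt k p p' \<and> ok a (Suc k) p'"
 define toP where "toP f = map (%k. THE p. p \<in> set (sl k) \<and> f p = 1) [0..<Suc len]" for f :: "'e => nat"
 define toF where "toF \<phi> = (%x. if x \<in> set \<phi> then 1 else 0 :: nat)" for \<phi> :: "'e list"
 let ?P = "{\<phi> \<in> tpaths ?S ?R e len. \<phi> ! len = e}"
 have P: "length \<phi> = Suc len" "\<And>k. k \<le> len ==> \<phi> ! k \<in> set (sl k)"
   "\<And>k. k < len ==> nxt k (\<phi> ! k) (\<phi> ! Suc k)" "\<phi> ! len = \<phi> ! 0" "\<phi> ! 0 = e"
   "\<And>k. k \<le> len ==> ok a k (\<phi> ! k)"
   "\<And>k x. k \<le> len ==> x \<in> set (sl k) ==> x \<in> set \<phi> \<longleftrightarrow> x = \<phi> ! k" if "\<phi> \<in> ?P" for \<phi>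
 proof -
  show 1: "length \<phi> = Suc len" "\<And>k. k \<le> len ==> \<phi> ! k \<in> set (sl k)"
   "\<And>k. k < len ==> nxt k (\<phi> ! k) (\<phi> ! Suc k)" "\<phi> ! len = \<phi> ! 0" "\<phi> ! 0 = e"
   using that by (auto simp: tpaths_def)
  show "ok a k (\<phi> ! k)" if "k \<le> len" for k
   using that \<open>\<phi> \<in> ?P\<close> ok0 by (cases k) (auto simp: tpaths_def)
  show "\<And>k x. k \<le> len ==> x \<in> set (sl k) ==> x \<in> set \<phi> \<longleftrightarrow> x = \<phi> ! k"
   by (rule path_edges[OF 1(1-4)])
 qed
 have toF: "toF \<phi> \<in> thinners a e" if \<phi>: "\<phi> \<in> ?P" for \<phi>
 proof -
  note p = P[OF \<phi>]
  have le: "toF \<phi> \<le> a"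
   using p(1,6) by (auto simp: toF_def le_fun_def in_set_conv_nth ok_def less_Suc_eq_le)
  have "set \<phi> \<subseteq> E" using p(1,2) sl_E by (fastforce simp: in_set_conv_nth less_Suc_eq_le)
  then have fl: "flow (toF \<phi>)" and "deg (toF \<phi>) = 1"
   using path_flow[OF p(1-4)] by (simp_all add: toF_def)
  moreover have "toF \<phi> e = 1" using p(1,5) by (auto simp: toF_def)
  moreover have "thin (a - toF \<phi>)" unfolding thin_def
  proof
   fix x
   show "(a - toF \<phi>) x \<le> 1"
   proof (cases "x \<in> E")
    case True
    then obtain k where k: "k \<le> len" "x \<in> set (sl k)" using cover by blast
    then show ?thesis using p(6)[OF k(1)] p(7)[OF k] by (auto simp: toF_def ok_def split: if_splits)
   qed (use a in \<open>simp add: flow_def\<close>)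
  qed
  ultimately show ?thesis using fl le by (simp add: thinners_def)
 qed
 have toP_nth: "toP f ! k \<in> set (sl k)" "f (toP f ! k) = 1"
   "\<And>p. p \<in> set (sl k) ==> f p = 1 ==> p = toP f ! k"
  if "f \<in> thinners a e" "k \<le> len" for f k
 proof -
  have ex1: "\<exists>!p. p \<in> set (sl k) \<and> f p = 1" using unit_flow_slice that by (auto simp: thinners_def)
  have "[0..<Suc len] ! k = k" using nth_upt[of 0 k "Suc len"] that(2) by linarith
  moreover have "k < length [0..<Suc len]" using that(2) by (simp only: length_upt)
  ultimately have eq: "toP f ! k = (THE p. p \<in> set (sl k) \<and> f p = 1)"
   unfolding toP_def by (simp only: nth_map)
  show "toP f ! k \<in> set (sl k)" "f (toP f ! k) = 1"
   "\<And>p. p \<in> set (sl k) ==> f p = 1 ==> p = toP f ! k"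
   unfolding eq using theI'[OF ex1] the1_equality[OF ex1, symmetric] by blast+
 qed
 have f01: "f x \<le> 1" if "f \<in> thinners a e" for f x
 proof (cases "x \<in> E")
  case True
  then obtain k where "k \<le> len" "x \<in> set (sl k)" using cover by blast
  then show ?thesis using unit_flow_slice(2) that by (auto simp: thinners_def)
 qed (use that in \<open>simp add: thinners_def flow_def\<close>)
 have toP: "toP f \<in> ?P" if f: "f \<in> thinners a e" for f
 proof -
  have len_toP: "length (toP f) = Suc len" by (simp add: toP_def)
  have fe: "f e = 1" "flow f" "f \<le> a" "thin (a - f)" "deg f = 1" using f by (auto simp: thinners_def)
  have "toP f ! 0 = e" using toP_nth(3)[OF f, of 0 e] e fe by simp
  moreover have "toP f ! len = e" using toP_nth(3)[OF f, of len e] e fe closed by simp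
  moreover have "nxt k (toP f ! k) (toP f ! Suc k)" if k: "k < len" for k
  proof -
   obtain A B where s: "sl k = A @ ins (vs ! k) @ B" "sl (Suc k) = A @ outs (vs ! k) @ B"
    "distinct (A @ ins (vs ! k) @ B)" "distinct (A @ outs (vs ! k) @ B)" by (rule stepE[OF k])
   show ?thesis
   proof (cases "toP f ! k \<in> set (ins (vs ! k))")
    case True
    have "1 \<le> sum_list (map f (ins (vs ! k)))"
     using member_le_sum_list[of "f (toP f ! k)" "map f (ins (vs ! k))"] imageI[OF True, of f]
      toP_nth(2)[OF f, of k] k by simp
    then have "sum_list (map f (outs (vs ! k))) \<ge> 1" using fe(2) k by (auto simp: flow_def)
    then obtain x where x: "x \<in> set (outs (vs ! k))" "f x ~= 0"
     by (metis (no_types, lifting) imageE list.set_map not_one_le_zero sum_list_eq_0_iff)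
    then have "f x = 1" using f01[OF f, of x] by simp
    then have "x = toP f ! Suc k" using toP_nth(3)[OF f, of "Suc k" x] x s k by auto
    then show ?thesis using x True by (simp add: nxt_def)
   next
    case False
    then have "toP f ! k \<in> set (sl (Suc k))" using toP_nth(1)[OF f, of k] k s by auto
    then have "toP f ! k = toP f ! Suc k" using toP_nth[OF f, of "Suc k"] toP_nth(2)[OF f, of k] k by auto
    then show ?thesis using False by (simp add: nxt_def)
   qed
  qed
  moreover have "ok a k (toP f ! k)" if k: "k \<le> len" for k
  proof -
   have "a (toP f ! k) \<ge> 1" using toP_nth(2)[OF f k] fe(3) by (metis le_funD)
   moreover have "a x \<le> (if x = toP f ! k then 2 else 1)" if x: "x \<in> set (sl k)" for x
   proof -
    have d: "a x - f x \<le> 1" using fe(4) by (auto simp: thin_def)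
    have "f x = 0" if "x ~= toP f ! k" using toP_nth(3)[OF f k x] f01[OF f, of x] that by linarith
    then show ?thesis using d f01[OF f, of x] by auto
   qed
   ultimately show ?thesis by (simp add: ok_def)
  qed
  ultimately show ?thesis using len_toP toP_nth(1)[OF f] by (simp add: tpaths_def)
 qed
 have "(\<Sum>f\<in>thinners a e. qp (s * cross a f)) = (\<Sum>\<phi>\<in>?P. \<Prod>k<len. qp (s * cr a k (\<phi> ! k)))"
 proof (rule sum.reindex_bij_witness[where i = toF and j = toP])
  fix f assume f: "f \<in> thinners a e"
  show "toP f \<in> ?P" by (rule toP[OF f])
  show "toF (toP f) = f"
  proof
   fix x
   have l: "length (toP f) = Suc len" by (simp add: toP_def)
   show "toF (toP f) x = f x"
   proof (cases "x \<in> E")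
    case True
    then obtain k where k: "k \<le> len" "x \<in> set (sl k)" using cover by blast
    then have "x \<in> set (toP f) \<longleftrightarrow> x = toP f ! k" using P(7)[OF toP[OF f]] by blast
    moreover have "f x = (if x = toP f ! k then 1 else 0)"
    proof (cases "x = toP f ! k")
     case False
     then have "f x ~= 1" using toP_nth(3)[OF f k] by blast
     then show ?thesis using False f01[OF f, of x] by simp
    qed (use toP_nth(2)[OF f k(1)] in simp)
    ultimately show ?thesis by (simp add: toF_def)
   next
    case False
    then have "x \<notin> set (toP f)" using toP_nth(1)[OF f] sl_E l by (fastforce simp: in_set_conv_nth less_Suc_eq_le)
    then show ?thesis using False f by (simp add: toF_def thinners_def flow_def)
   qed
  qed
  have "cross a f = (\<Sum>k<len. cr a k (toP f ! k))"
   unfolding cross_def sum_mgs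
  proof (rule sum.cong[OF refl])
   fix k assume "k \<in> {..<len}"
   then have k: "k < len" by simp
   obtain A B where s: "sl k = A @ ins (vs ! k) @ B" by (rule stepE[OF k])
   have v: "f x = (if x = toP f ! k then 1 else 0)" if "x \<in> set (sl k)" for x
   proof (cases "x = toP f ! k")
    case False
    then have "f x ~= 1" using toP_nth(3)[OF f _ that] k by auto
    then show ?thesis using False f01[OF f, of x] by simp
   qed (use toP_nth(2)[OF f, of k] k in simp)
   show "(if length (ins (vs ! k)) = 2
     then int (a (ins (vs ! k) ! 0)) * int (f (ins (vs ! k) ! 1)) - int (f (ins (vs ! k) ! 0)) * int (a (ins (vs ! k) ! 1))
     else 0) = cr a k (toP f ! k)"
    using s v[of "ins (vs ! k) ! 0"] v[of "ins (vs ! k) ! 1"]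
    by (auto simp: cr_def Let_def)
  qed
  then show "(\<Prod>k<len. qp (s * cr a k (toP f ! k))) = qp (s * cross a f)"
   by (simp add: sum_distrib_left qp_sum)
 next
  fix \<phi> assume \<phi>: "\<phi> \<in> ?P"
  show "toF \<phi> \<in> thinners a e" by (rule toF[OF \<phi>])
  show "toP (toF \<phi>) = \<phi>"
  proof (rule nth_equalityI)
   show l: "length (toP (toF \<phi>)) = length \<phi>" using P(1)[OF \<phi>] by (simp add: toP_def)
   fix k assume "k < length (toP (toF \<phi>))"
   then have k: "k \<le> len" using l P(1)[OF \<phi>] by simp
   have "toF \<phi> (\<phi> ! k) = 1" using k P(1)[OF \<phi>] by (simp add: toF_def)
   then show "toP (toF \<phi>) ! k = \<phi> ! k" using toP_nth(3)[OF toF[OF \<phi>] k P(2)[OF \<phi> k]] by simp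
  qed
 qed
 also have "\<dots> = Wt a e s len e"
  unfolding Wt_def by (rule transfer_sum) (use e closed in auto)
 finally show ?thesis .
qed

section \<open>Transport of the weights from slice to slice\<close>

lemma Wt_ok: "Wt a e s (Suc k) p ~= 0 ==> ok a (Suc k) p"
 unfolding Wt_def by (auto elim!: sum.not_neutral_contains_not_neutral split: if_splits)

lemma Wt_Suc: "Wt a e s (Suc k) p' = (if ok a (Suc k) p' then
  \<Sum>p\<in>set (sl k). if nxt k p p' then qp (s * cr a k p) * Wt a e s k p else 0 else 0)"
 unfolding Wt_def transfer.simps by (auto intro!: sum.cong)

lemma Wt_keep:
 assumes k: "k < len" and p: "p \<in> set (sl k)" "p \<in> set (sl (Suc k))" "p \<notin> set (ins (vs ! k))"
 shows "Wt a e s (Suc k) p = (if ok a (Suc k) p then Wt a e s k p else 0)"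
proof -
 obtain A B where s: "sl k = A @ ins (vs ! k) @ B" "sl (Suc k) = A @ outs (vs ! k) @ B"
    "distinct (A @ ins (vs ! k) @ B)" "distinct (A @ outs (vs ! k) @ B)" by (rule stepE[OF k])
 have po: "p \<notin> set (outs (vs ! k))" using p s by auto
 have c: "cr a k p = 0" using p(3) by (auto simp: cr_def Let_def)
 have "(\<Sum>x\<in>set (sl k). if nxt k x p then qp (s * cr a k x) * Wt a e s k x else 0)
   = (\<Sum>x\<in>set (sl k). if x = p then Wt a e s k p else 0)"
  by (rule sum.cong) (use p po c in \<open>auto simp: nxt_def\<close>)
 then show ?thesis using p by (simp add: Wt_Suc)
qed

lemma Wt_out:
 assumes k: "k < len" and p: "p \<in> set (outs (vs ! k))"
 shows "Wt a e s (Suc k) p = (if ok a (Suc k) p then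
   sum_list (map (%x. qp (s * cr a k x) * Wt a e s k x) (ins (vs ! k))) else 0)"
proof -
 obtain A B where s: "sl k = A @ ins (vs ! k) @ B" "sl (Suc k) = A @ outs (vs ! k) @ B"
    "distinct (A @ ins (vs ! k) @ B)" "distinct (A @ outs (vs ! k) @ B)" by (rule stepE[OF k])
 have nx: "nxt k x p \<longleftrightarrow> x \<in> set (ins (vs ! k))" if "x \<in> set (sl k)" for x
  using that p s by (auto simp: nxt_def)
 have "(\<Sum>x\<in>set (sl k). if nxt k x p then qp (s * cr a k x) * Wt a e s k x else 0)
   = (\<Sum>x\<in>set (sl k). if x \<in> set (ins (vs ! k)) then qp (s * cr a k x) * Wt a e s k x else 0)"
  by (rule sum.cong) (use nx in auto)
 also have "\<dots> = (\<Sum>x\<in>set (ins (vs ! k)). qp (s * cr a k x) * Wt a e s k x)"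
  by (rule sum.mono_neutral_cong_right) (use s in auto)
 also have "\<dots> = sum_list (map (%x. qp (s * cr a k x) * Wt a e s k x) (ins (vs ! k)))"
  using s by (simp add: sum_list_distinct_conv_sum_set)
 finally show ?thesis by (simp add: Wt_Suc)
qed

definition win :: "('e => nat) => nat => nat => nat => 'e => bool" where
 "win a d l k p \<longleftrightarrow> a p \<ge> 1 \<and> l \<le> before a (sl k) p \<and> before a (sl k) p + a p \<le> l + d"

text \<open>As long as the slices are thin, the removed strand is the leftmost one.  Afterwards it lies in
 a window of thickness 2, namely in the last thick edge or in one of the two strands this edge was
 split into.  The exponent \<open>2 * l\<close> in the ratio of the weights for \<open>q\<close> and \<open>q\<^sup>-\<^sup>1\<close> records the
 horizontal position \<open>l\<close> of the window.\<close>

definition thin_state :: "('e => nat) => 'e => nat => bool" where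
 "thin_state a e k \<longleftrightarrow> (\<forall>j\<le>k. \<forall>x\<in>set (sl j). a x \<le> 1) \<and>
   (\<forall>s\<in>{1, -1}. \<forall>p\<in>set (sl k). Wt a e s k p = (if win a 1 0 k p then 1 else 0))"

definition window_state :: "('e => nat) => 'e => nat => nat => bool" where
 "window_state a e \<iota> k \<longleftrightarrow> (\<exists>j\<le>k. \<exists>x\<in>set (sl j). a x \<ge> 2) \<and>
   (\<exists>l w. \<forall>p\<in>set (sl k). Wt a e 1 k p = (if win a 2 l k p then w else 0) \<and>
    Wt a e (-1) k p = (if win a 2 l k p then q ^ (2 * l + 2 * \<iota>) * w else 0))"

lemma win_unique:
 assumes "distinct (sl k)" "D \<in> set (sl k)" "p \<in> set (sl k)" "p ~= D" "a D = 2"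
  "before a (sl k) D = l"
 shows "\<not> win a 2 l k p"
 using before_separated[OF assms(2,3) assms(4)[symmetric], of a] assms(5,6) by (auto simp: win_def)

text \<open>If the next slice has an edge \<open>D\<close> of thickness at least 2, then all the weight sits on \<open>D\<close>.\<close>

lemma window_stateI:
 assumes k: "k \<le> len" and D: "D \<in> set (sl k)" "a D \<ge> 2"
  and okW: "\<And>s p. Wt a e s k p ~= 0 ==> ok a k p"
  and ratio: "ok a k D ==> a D = 2 ==>
   Wt a e (-1) k D = q ^ (2 * before a (sl k) D + 2 * \<iota>) * Wt a e 1 k D"
 shows "window_state a e \<iota> k"
proof (cases "ok a k D")
 case True
 then have D2: "a D = 2" using D by (auto simp: ok_def split: if_splits)
 have other: "Wt a e s k p = 0" if "p \<in> set (sl k)" "p ~= D" for s p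
 proof (rule ccontr)
  assume "Wt a e s k p ~= 0"
  then have "a D \<le> 1" using okW[of s p] D that by (auto simp: ok_def)
  with D2 show False by simp
 qed
 have "win a 2 (before a (sl k) D) k D" using D2 by (simp add: win_def)
 moreover have "\<not> win a 2 (before a (sl k) D) k p" if "p \<in> set (sl k)" "p ~= D" for p
  using win_unique[where D = D and p = p and a = a] dist_sl[OF k] D(1) that D2 by blast
 ultimately have "\<forall>p\<in>set (sl k). Wt a e 1 k p = (if win a 2 (before a (sl k) D) k p then Wt a e 1 k D else 0) \<and>
    Wt a e (-1) k p = (if win a 2 (before a (sl k) D) k p then q ^ (2 * before a (sl k) D + 2 * \<iota>) * Wt a e 1 k D else 0)"
  using other ratio[OF True D2] by (metis (full_types))
 then show ?thesis unfolding window_state_def using D by blast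
next
 case False
 have "Wt a e s k p = 0" if "p \<in> set (sl k)" for s p
 proof (rule ccontr)
  assume "Wt a e s k p ~= 0"
  then have "ok a k p" by (rule okW)
  moreover then have "p ~= D" using False by blast
  ultimately have "a D \<le> 1" using D by (auto simp: ok_def split: if_splits)
  with D show False by simp
 qed
 then have 1: "\<forall>p\<in>set (sl k). Wt a e 1 k p = (if win a 2 0 k p then 0 else 0) \<and>
    Wt a e (-1) k p = (if win a 2 0 k p then q ^ (2 * 0 + 2 * \<iota>) * 0 else 0)" by simp
 show ?thesis unfolding window_state_def using D by (intro conjI) (blast, rule exI, rule exI, rule 1)
qed

lemma before_step:
 assumes s: "sl k = A @ ins (vs ! k) @ B" "sl (Suc k) = A @ outs (vs ! k) @ B"
  "distinct (A @ ins (vs ! k) @ B)" "distinct (A @ outs (vs ! k) @ B)"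
  and a: "sum_list (map a (ins (vs ! k))) = sum_list (map a (outs (vs ! k)))"
  and p: "p \<in> set A \<union> set B"
 shows "before a (sl (Suc k)) p = before a (sl k) p"
 using p
proof
 assume "p \<in> set A"
 then show ?thesis by (simp add: s before_append1)
next
 assume "p \<in> set B"
 then have "p \<notin> set A" "p \<notin> set (ins (vs ! k))" "p \<notin> set (outs (vs ! k))" using s by auto
 then show ?thesis by (simp add: s before_append2 a)
qed

text \<open>At a merge of two single strands the weight gets q^-s for arriving on the left and q^s
  for arriving on the right. If both lie in the window, the ratio of the weights for s = -1 and s =
  1 does not change. If only the left one does, the ratio gains q^2 and the window moves one step to
  the right; if only the right one does, the opposite happens. So the exponent of the ratio always
  follows the position of the window.\<close>

lemma state_step:
 assumes a: "flow a" and k: "k < len" and okW: "\<And>s p. Wt a e s k p ~= 0 ==> ok a k p"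
  and st: "(\<iota> = 1 \<and> thin_state a e k) \<or> window_state a e \<iota> k"
 shows "(\<iota> = 1 \<and> thin_state a e (Suc k)) \<or> window_state a e \<iota> (Suc k)"
proof -
 let ?v = "vs ! k"
 obtain A B where s: "sl k = A @ ins ?v @ B" "sl (Suc k) = A @ outs ?v @ B"
    "distinct (A @ ins ?v @ B)" "distinct (A @ outs ?v @ B)" by (rule stepE[OF k])
 have v: "?v \<in> set vs" using k by simp
 have cons: "sum_list (map a (ins ?v)) = sum_list (map a (outs ?v))" using a v by (simp add: flow_def)
 have bef: "before a (sl (Suc k)) p = before a (sl k) p" if "p \<in> set A \<union> set B" for p
  by (rule before_step[OF s cons that])
 have keep: "Wt a e t (Suc k) p = (if ok a (Suc k) p then Wt a e t k p else 0)" if "p \<in> set A \<union> set B" for t p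
  by (rule Wt_keep[OF k]) (use that s in auto)
 have okS: "Wt a e t (Suc k) p ~= 0 ==> ok a (Suc k) p" for t p by (rule Wt_ok)
 let ?\<alpha> = "sum_list (map a A)"
 have bi: "before a (sl k) x = ?\<alpha> + before a (ins ?v) x" if "x \<in> set (ins ?v)" for x
 proof -
  have "x \<notin> set A" using that s by auto
  then show ?thesis using that by (simp add: s before_append2 before_append1)
 qed
 have bo: "before a (sl (Suc k)) x = ?\<alpha> + before a (outs ?v) x" if "x \<in> set (outs ?v)" for x
 proof -
  have "x \<notin> set A" using that s by auto
  then show ?thesis using that by (simp add: s before_append2 before_append1)
 qed
 have W0: "Wt a e t k p = 0" if "p \<in> set (sl k)" "a p = 0" for t p
  using okW[of t p] that by (auto simp: ok_def)
 have Wdead: "Wt a e t k p = 0" if "x \<in> set (sl k)" "a x \<ge> 2" "x ~= p" for t p x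
  using okW[of t p] that by (fastforce simp: ok_def)
 have Wdead3: "Wt a e t k p = 0" if "x \<in> set (sl k)" "a x \<ge> 3" for t p x
  using okW[of t p] that by (fastforce simp: ok_def split: if_splits)
 from vert[OF v] consider (merge) l r c where "ins ?v = [l, r]" "outs ?v = [c]"
  | (split) l r c where "ins ?v = [c]" "outs ?v = [l, r]" by blast
 then show ?thesis
 proof cases
  case merge
  note m = merge
  have lr: "l ~= r" using s m by auto
  have ac: "a c = a l + a r" using cons m by simp
  have b: "before a (sl k) l = ?\<alpha>" "before a (sl k) r = ?\<alpha> + a l" "before a (sl (Suc k)) c = ?\<alpha>"
   using bi[of l] bi[of r] bo[of c] m lr by (auto simp: before_Cons)
  have crs: "cr a k l = - int (a r)" "cr a k r = int (a l)" using m lr by (auto simp: cr_def Let_def)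
  have Wc: "Wt a e t (Suc k) c = (if ok a (Suc k) c then
    qp (- t * int (a r)) * Wt a e t k l + qp (t * int (a l)) * Wt a e t k r else 0)" for t
   using Wt_out[OF k, of c a e t] m crs by simp
  have mem: "l \<in> set (sl k)" "r \<in> set (sl k)" "c \<in> set (sl (Suc k))" using s m by auto
  show ?thesis
  proof (cases "\<exists>D\<in>set (sl (Suc k)). a D \<ge> 2")
   case True
   then obtain D where D: "D \<in> set (sl (Suc k))" "a D \<ge> 2" by blast
   have "window_state a e \<iota> (Suc k)"
   proof (rule window_stateI[OF _ D okS])
    show "Suc k \<le> len" using k by simp
    assume okD: "ok a (Suc k) D" and D2: "a D = 2"
    show "Wt a e (-1) (Suc k) D = q ^ (2 * before a (sl (Suc k)) D + 2 * \<iota>) * Wt a e 1 (Suc k) D"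
    proof (cases "D = c")
     case False
     then have DAB: "D \<in> set A \<union> set B" using D s m by auto
     then have Dk: "D \<in> set (sl k)" using s by auto
     then have "window_state a e \<iota> k" using st D2 by (fastforce simp: thin_state_def)
     then obtain l0 w where lw: "\<forall>p\<in>set (sl k). Wt a e 1 k p = (if win a 2 l0 k p then w else 0) \<and>
       Wt a e (-1) k p = (if win a 2 l0 k p then q ^ (2 * l0 + 2 * \<iota>) * w else 0)"
      unfolding window_state_def by blast
     have "win a 2 l0 k D ==> before a (sl k) D = l0" using D2 by (auto simp: win_def)
     then show ?thesis unfolding keep[OF DAB] bef[OF DAB] using lw Dk by auto
    next
     case True
     have cases3: "(a l = 1 \<and> a r = 1) \<or> (a l = 2 \<and> a r = 0) \<or> (a l = 0 \<and> a r = 2)"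
      using ac D2 True by auto
     have okc: "ok a (Suc k) c" using okD True by simp
     show ?thesis unfolding True b(3)
      using st
     proof
      \<comment> \<open>The first thick edge. All weight sits on the leftmost strand, which can
        enter only as \<open>l\<close> and only if nothing lies to the left. It receives q^-1 for s
        = 1 and q for s = -1, hence the ratio q^2 recorded by \<iota> = 1.\<close>
      assume st: "\<iota> = 1 \<and> thin_state a e k"
      then have le1: "a l \<le> 1" "a r \<le> 1" using mem by (auto simp: thin_state_def)
      then have one: "a l = 1" "a r = 1" using cases3 by auto
      have "win a 1 0 k l \<longleftrightarrow> ?\<alpha> = 0" "\<not> win a 1 0 k r" using b one by (auto simp: win_def)
      then have Wv: "Wt a e t k l = (if ?\<alpha> = 0 then 1 else 0)" "Wt a e t k r = 0" if "t \<in> {1, -1}" for t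
       using st mem that unfolding thin_state_def by auto
      have "Wt a e 1 (Suc k) c = (if ?\<alpha> = 0 then qp (- 1) else 0)"
       using Wv[of 1] okc one by (simp add: Wc)
      moreover have "Wt a e (-1) (Suc k) c = (if ?\<alpha> = 0 then qp 1 else 0)"
       using Wv[of "-1"] okc one by (simp add: Wc)
      moreover have "qp 1 = q ^ 2 * qp (-1)" by (simp add: power2_eq_square power_int_minus)
      ultimately show "Wt a e (-1) (Suc k) c = q ^ (2 * ?\<alpha> + 2 * \<iota>) * Wt a e 1 (Suc k) c"
       using st by (cases "?\<alpha> = 0") (simp_all del: sum_list_eq_0_iff)
     next
      assume "window_state a e \<iota> k"
      then obtain l0 w where lw: "\<forall>p\<in>set (sl k). Wt a e 1 k p = (if win a 2 l0 k p then w else 0) \<and>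
        Wt a e (-1) k p = (if win a 2 l0 k p then q ^ (2 * l0 + 2 * \<iota>) * w else 0)"
       unfolding window_state_def by blast
      have wl: "win a 2 l0 k l \<longleftrightarrow> a l \<ge> 1 \<and> l0 \<le> ?\<alpha> \<and> ?\<alpha> + a l \<le> l0 + 2"
       and wr: "win a 2 l0 k r \<longleftrightarrow> a r \<ge> 1 \<and> l0 \<le> ?\<alpha> + a l \<and> ?\<alpha> + a l + a r \<le> l0 + 2"
       unfolding win_def b by auto
      have W1: "Wt a e 1 (Suc k) c = qp (- int (a r)) * (if win a 2 l0 k l then w else 0) +
        qp (int (a l)) * (if win a 2 l0 k r then w else 0)"
       and W2: "Wt a e (-1) (Suc k) c = qp (int (a r)) * (if win a 2 l0 k l then q ^ (2 * l0 + 2 * \<iota>) * w else 0) +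
        qp (- int (a l)) * (if win a 2 l0 k r then q ^ (2 * l0 + 2 * \<iota>) * w else 0)"
       using lw mem okc by (auto simp: Wc)
      have qq: "qp (-1) = inverse q" "qp 1 = q" by (simp_all add: power_int_minus)
      have rel: "x = inverse q * (q * x)" "q ^ (2 * Suc n + m) = q * q * q ^ (2 * n + m)" for x :: qfield and n m
       by (auto simp: mult.assoc[symmetric])
      from cases3 show "Wt a e (-1) (Suc k) c = q ^ (2 * ?\<alpha> + 2 * \<iota>) * Wt a e 1 (Suc k) c"
      proof (elim disjE conjE)
       assume one: "a l = 1" "a r = 1"
       \<comment> \<open>In turn: \<open>l\<close> and \<open>r\<close> fill the window;
         \<open>l\<close> is its right half; \<open>r\<close> is its left half; neither lies in
         it.\<close>
       consider "?\<alpha> = l0" | "?\<alpha> = Suc l0" | "Suc ?\<alpha> = l0"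
        | "\<not> win a 2 l0 k l" "\<not> win a 2 l0 k r" using wl wr one by force
       then show ?thesis
       proof cases
        case 1
        then have "win a 2 l0 k l" "win a 2 l0 k r" using wl wr one by auto
        then show ?thesis using 1 one by (simp add: W1 W2 qq algebra_simps)
       next
        case 2
        then have "win a 2 l0 k l" "\<not> win a 2 l0 k r" using wl wr one by auto
        then show ?thesis using 2 one by (simp add: W1 W2 qq rel(2) mult_ac)
       next
        case 3
        then have "\<not> win a 2 l0 k l" "win a 2 l0 k r" using wl wr one by auto
        then show ?thesis using 3[symmetric] one by (simp add: W1 W2 qq rel(2) mult_ac)
       next
        case 4
        then show ?thesis by (simp add: W1 W2)
       qed
      next
       assume tw: "a l = 2" "a r = 0"
       then have "\<not> win a 2 l0 k r" "win a 2 l0 k l ==> ?\<alpha> = l0" using wl wr by auto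
       then show ?thesis using tw by (auto simp: W1 W2)
      next
       assume tw: "a l = 0" "a r = 2"
       then have "\<not> win a 2 l0 k l" "win a 2 l0 k r ==> ?\<alpha> = l0" using wl wr by auto
       then show ?thesis using tw by (auto simp: W1 W2)
      qed
     qed
    qed
   qed
   then show ?thesis ..
  next
   case False
   then have le1: "a x \<le> 1" if "x \<in> set (sl (Suc k))" for x using that by force
   have okk: "ok a (Suc k) p \<longleftrightarrow> a p \<ge> 1" if "p \<in> set (sl (Suc k))" for p
   proof -
    have "\<forall>x\<in>set (sl (Suc k)). a x \<le> (if x = p then 2 else 1)"
     by (intro ballI, rule order_trans, erule le1) simp
    then show ?thesis by (simp add: ok_def)
   qed
   have c01: "(a l = 0 \<and> a r = 0) \<or> (a l = 1 \<and> a r = 0) \<or> (a l = 0 \<and> a r = 1)"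
    using le1[OF mem(3)] ac by auto
   \<comment> \<open>With no thick edge in the next slice one of \<open>l\<close> and
     \<open>r\<close> is empty, so there is no crossing and weights and window pass on
     unchanged.\<close>
   have trans: "Wt a e t (Suc k) p = (if win a d l0 (Suc k) p then w else 0)"
    if W: "\<forall>p\<in>set (sl k). Wt a e t k p = (if win a d l0 k p then w else 0)"
     and p: "p \<in> set (sl (Suc k))" for t d l0 w p
   proof (cases "p = c")
    case False
    then have pAB: "p \<in> set A \<union> set B" and pk: "p \<in> set (sl k)" using p s m by auto
    show ?thesis unfolding keep[OF pAB] win_def bef[OF pAB] okk[OF p]
     using W pk by (auto simp: win_def)
   next
    case True
    show ?thesis unfolding True Wc okk[OF mem(3)] win_def b(3)
     using c01 by (elim disjE conjE) (use W mem ac b(1,2) in \<open>simp_all add: win_def\<close>)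
   qed
   show ?thesis using st
   proof
    assume "\<iota> = 1 \<and> thin_state a e k"
    then show ?thesis using trans le1 unfolding thin_state_def by (auto simp: le_Suc_eq)
   next
    assume ws: "window_state a e \<iota> k"
    then obtain l0 w where lw: "\<forall>p\<in>set (sl k). Wt a e 1 k p = (if win a 2 l0 k p then w else 0) \<and>
      Wt a e (-1) k p = (if win a 2 l0 k p then q ^ (2 * l0 + 2 * \<iota>) * w else 0)"
     unfolding window_state_def by blast
    have ex: "\<exists>j\<le>Suc k. \<exists>x\<in>set (sl j). a x \<ge> 2"
     using ws unfolding window_state_def by (meson le_SucI)
    have "\<forall>p\<in>set (sl (Suc k)). Wt a e 1 (Suc k) p = (if win a 2 l0 (Suc k) p then w else 0) \<and>
      Wt a e (-1) (Suc k) p = (if win a 2 l0 (Suc k) p then q ^ (2 * l0 + 2 * \<iota>) * w else 0)"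
     using trans lw by blast
    then show ?thesis using ex unfolding window_state_def by blast
   qed
  qed
 next
  case split
  note m = split
  have lr: "l ~= r" using s m by auto
  have ac: "a c = a l + a r" using cons m by simp
  have b: "before a (sl (Suc k)) l = ?\<alpha>" "before a (sl (Suc k)) r = ?\<alpha> + a l" "before a (sl k) c = ?\<alpha>"
   using bo[of l] bo[of r] bi[of c] m lr by (auto simp: before_Cons)
  have crs: "cr a k c = 0" using m by (auto simp: cr_def Let_def)
  have Wo: "Wt a e t (Suc k) x = (if ok a (Suc k) x then Wt a e t k c else 0)" if "x \<in> {l, r}" for t x
   using Wt_out[OF k, of x a e t] m crs that by auto
  have mem: "l \<in> set (sl (Suc k))" "r \<in> set (sl (Suc k))" "c \<in> set (sl k)" using s m by auto
  show ?thesis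
  proof (cases "\<exists>D\<in>set (sl (Suc k)). a D \<ge> 2")
   case True
   then obtain D where D: "D \<in> set (sl (Suc k))" "a D \<ge> 2" by blast
   have Dk: "\<exists>D'\<in>set (sl k). a D' \<ge> 2"
   proof (cases "D \<in> {l, r}")
    case True
    then show ?thesis using D ac mem by (intro bexI[of _ c]) auto
   next
    case False
    then show ?thesis using D s m by auto
   qed
   then have "window_state a e \<iota> k" using st by (fastforce simp: thin_state_def)
   then obtain l0 w where lw: "\<forall>p\<in>set (sl k). Wt a e 1 k p = (if win a 2 l0 k p then w else 0) \<and>
     Wt a e (-1) k p = (if win a 2 l0 k p then q ^ (2 * l0 + 2 * \<iota>) * w else 0)"
    unfolding window_state_def by blast
   have "window_state a e \<iota> (Suc k)"
   proof (rule window_stateI[OF _ D okS])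
    show "Suc k \<le> len" using k by simp
    assume okD: "ok a (Suc k) D" and D2: "a D = 2"
    show "Wt a e (-1) (Suc k) D = q ^ (2 * before a (sl (Suc k)) D + 2 * \<iota>) * Wt a e 1 (Suc k) D"
    proof (cases "D \<in> {l, r}")
     case False
     then have DAB: "D \<in> set A \<union> set B" using D s m by auto
     then have Dk: "D \<in> set (sl k)" using s by auto
     have "win a 2 l0 k D ==> before a (sl k) D = l0" using D2 by (auto simp: win_def)
     then show ?thesis unfolding keep[OF DAB] bef[OF DAB] using lw Dk by auto
    next
     case True
     show ?thesis
     proof (cases "a c = 2")
      case True
      then have "before a (sl (Suc k)) D = ?\<alpha>" using \<open>D \<in> {l, r}\<close> b D2 ac by auto
      moreover have "win a 2 l0 k c ==> ?\<alpha> = l0" using b True by (auto simp: win_def)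
      ultimately show ?thesis unfolding Wo[OF \<open>D \<in> {l, r}\<close>] using lw mem by auto
     next
      case False
      then have "a c \<ge> 3" using \<open>D \<in> {l, r}\<close> ac D2 by auto
      then have "Wt a e t k c = 0" for t using Wdead3[OF mem(3)] by blast
      then show ?thesis unfolding Wo[OF \<open>D \<in> {l, r}\<close>] by simp
     qed
    qed
   qed
   then show ?thesis ..
  next
   case False
   then have le1: "a x \<le> 1" if "x \<in> set (sl (Suc k))" for x using that by force
   have okk: "ok a (Suc k) p \<longleftrightarrow> a p \<ge> 1" if "p \<in> set (sl (Suc k))" for p
   proof -
    have "\<forall>x\<in>set (sl (Suc k)). a x \<le> (if x = p then 2 else 1)"
     by (intro ballI, rule order_trans, erule le1) simp
    then show ?thesis by (simp add: ok_def)
   qed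
   have l01: "a l \<le> 1" "a r \<le> 1" using le1 mem by auto
   have trans: "Wt a e t (Suc k) p = (if win a d l0 (Suc k) p then w else 0)"
    if W: "\<forall>p\<in>set (sl k). Wt a e t k p = (if win a d l0 k p then w else 0)"
     and p: "p \<in> set (sl (Suc k))" and c1: "a c \<le> 1" for t d l0 w p
   proof (cases "p \<in> {l, r}")
    case False
    then have pAB: "p \<in> set A \<union> set B" and pk: "p \<in> set (sl k)" using p s m by auto
    show ?thesis unfolding keep[OF pAB] win_def bef[OF pAB] okk[OF p]
     using W pk by (auto simp: win_def)
   next
    case True
    have "(a l = 0 \<and> a r = 0) \<or> (a l = 1 \<and> a r = 0) \<or> (a l = 0 \<and> a r = 1)" using c1 ac by auto
    then show ?thesis unfolding Wo[OF True] okk[OF p] win_def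
     using True W mem ac b by (auto simp: win_def)
   qed
   show ?thesis using st
   proof
    assume t: "\<iota> = 1 \<and> thin_state a e k"
    then have "a c \<le> 1" using mem by (auto simp: thin_state_def)
    then show ?thesis using t trans le1 unfolding thin_state_def by (auto simp: le_Suc_eq)
   next
    assume ws: "window_state a e \<iota> k"
    then obtain l0 w where lw: "\<forall>p\<in>set (sl k). Wt a e 1 k p = (if win a 2 l0 k p then w else 0) \<and>
      Wt a e (-1) k p = (if win a 2 l0 k p then q ^ (2 * l0 + 2 * \<iota>) * w else 0)"
     unfolding window_state_def by blast
    have ex: "\<exists>j\<le>Suc k. \<exists>x\<in>set (sl j). a x \<ge> 2" using ws unfolding window_state_def by (meson le_SucI)
    show ?thesis
    proof (cases "a c \<le> 1")
     case True
     have "\<forall>p\<in>set (sl (Suc k)). Wt a e 1 (Suc k) p = (if win a 2 l0 (Suc k) p then w else 0) \<and>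
       Wt a e (-1) (Suc k) p = (if win a 2 l0 (Suc k) p then q ^ (2 * l0 + 2 * \<iota>) * w else 0)"
      using trans True lw by blast
     then show ?thesis using ex unfolding window_state_def by blast
    next
     case False
     \<comment> \<open>A removable strand has to pass the thick edge \<open>c\<close>, so every
       other edge is dead. If \<open>c\<close> fills the window, the two strands after the split
       inherit it; otherwise no weight is left, and w = 0 serves.\<close>
     then have c2: "a c = 2" "a l = 1" "a r = 1" using ac l01 by auto
     have AB0: "Wt a e t (Suc k) p = 0" if "p \<in> set (sl (Suc k))" "p \<notin> {l, r}" for t p
     proof -
      have "p \<in> set A \<union> set B" "p ~= c" using that s m by auto
      then show ?thesis using keep Wdead[OF mem(3), of p] c2 by simp
     qed
     show ?thesis
     proof (cases "?\<alpha> = l0")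
      case True
      have wc: "win a 2 l0 k c" using True b c2 by (simp add: win_def)
      have wlr: "win a 2 l0 (Suc k) x" if "x \<in> {l, r}" for x
       using True b c2 that by (auto simp: win_def)
      have nw: "\<not> win a 2 l0 (Suc k) p" if "p \<in> set (sl (Suc k))" "p \<notin> {l, r}" for p
      proof -
       have "p \<in> set A \<union> set B" "p ~= c" "p \<in> set (sl k)" using that s m by auto
       then show ?thesis
        using win_unique[of k c p a l0] dist_sl[of k] k mem(3) c2 b(3) True bef[of p] by (auto simp: win_def)
      qed
      have "Wt a e 1 (Suc k) p = (if win a 2 l0 (Suc k) p then w else 0) \<and>
        Wt a e (-1) (Suc k) p = (if win a 2 l0 (Suc k) p then q ^ (2 * l0 + 2 * \<iota>) * w else 0)"
       if p: "p \<in> set (sl (Suc k))" for p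
      proof (cases "p \<in> {l, r}")
       case True
       then have "ok a (Suc k) p" using okk[OF p] c2 by auto
       then show ?thesis unfolding Wo[OF True] using lw mem wc wlr[OF True] by simp
      next
       case False
       then show ?thesis using AB0[OF p] nw[OF p] by simp
      qed
      then show ?thesis using ex unfolding window_state_def by blast
     next
      case False
      then have "\<not> win a 2 l0 k c" using b c2 by (auto simp: win_def)
      then have c0: "Wt a e 1 k c = 0" "Wt a e (-1) k c = 0" using lw mem by auto
      have "Wt a e 1 (Suc k) p = 0 \<and> Wt a e (-1) (Suc k) p = 0" if p: "p \<in> set (sl (Suc k))" for p
       using AB0[OF p] Wo[of p] c0 by (cases "p \<in> {l, r}") auto
      then have "\<forall>p\<in>set (sl (Suc k)). Wt a e 1 (Suc k) p = (if win a 2 l0 (Suc k) p then 0 else 0) \<and>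
        Wt a e (-1) (Suc k) p = (if win a 2 l0 (Suc k) p then q ^ (2 * l0 + 2 * \<iota>) * 0 else 0)"
       by simp
      then show ?thesis using ex unfolding window_state_def by blast
     qed
    qed
   qed
  qed
 qed
qed

lemma thinners_ok:
 assumes f: "f \<in> thinners a e" and e: "e \<in> set (sl 0)"
 shows "ok a 0 e"
proof -
 have f': "flow f" "deg f = 1" "f e = 1" "f \<le> a" "thin (a - f)" using f by (auto simp: thinners_def)
 have "a x \<le> (if x = e then 2 else 1)" if x: "x \<in> set (sl 0)" for x
 proof -
  have d: "a x - f x \<le> 1" using f'(5) by (auto simp: thin_def)
  have "f x \<le> 1" using unit_flow_slice(2)[OF f'(1,2), of 0 x] x by simp
  moreover have "f x ~= 1" if "x ~= e" using unit_flow_slice(1)[OF f'(1,2), of 0] x e f'(3) that by auto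
  ultimately show ?thesis using d by force
 qed
 moreover have "a e \<ge> 1" using f'(3,4) by (metis le_funD)
 ultimately show ?thesis by (simp add: ok_def)
qed

text \<open>If \<open>a\<close> is thin, the strand starting in \<open>e\<close> is forced and has
  no crossings, so both sums are 1. Otherwise the window has returned to position 0, the second sum
  is q^(2 (2 - a e)) times the first, and the right side cancels.\<close>

lemma thinners_identity:
 assumes a: "flow a" and s0: "sl 0 = A @ e # B" "\<forall>x\<in>set A. a x = 0"
 shows "(q ^ (2 * a e) - 1) * (if thin a then 1 else 0) =
  q ^ 2 * (\<Sum>f\<in>thinners a e. qp (cross a f)) - q ^ (2 * (a e - 1)) * (\<Sum>f\<in>thinners a e. qp (- cross a f))"
proof (cases "ok a 0 e")
 case False
 have e: "e \<in> set (sl 0)" using s0 by simp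
 have empty: "thinners a e = {}" using thinners_ok e False by blast
 show ?thesis
 proof (cases "a e = 0")
  case False
  have "\<not> thin a"
  proof
   assume "thin a"
   then have "a x \<le> 1" for x by (simp add: thin_def)
   then have "a x \<le> (if x = e then 2 else 1)" for x by (rule order_trans) simp
   then have "ok a 0 e" using False by (simp add: ok_def Suc_le_eq)
   with \<open>\<not> ok a 0 e\<close> show False ..
  qed
  then show ?thesis by (simp add: empty)
 qed (simp add: empty)
next
 case ok0: True
 have e: "e \<in> set (sl 0)" using s0 by simp
 have be: "before a (sl 0) e = 0"
 proof -
  have "e \<notin> set A" using dist_sl[of 0] s0 by auto
  then show ?thesis using s0 by (simp add: before_append2 before_Cons)
 qed
 \<comment> \<open>This is 1 if the strand starts on a single strand and 0 if it starts on a thick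
   edge, where the first merge into a thick edge has not been counted.\<close>
 define \<iota> where "\<iota> = 2 - a e"
 have ae: "a e = 1 \<or> a e = 2" using ok0 e by (auto simp: ok_def split: if_splits)
 have W0: "Wt a e s 0 p = (if p = e then 1 else 0)" for s p by (simp add: Wt_def)
 have start: "(\<iota> = 1 \<and> thin_state a e 0) \<or> window_state a e \<iota> 0"
  using ae
 proof
  assume ae: "a e = 1"
  then have le1: "a x \<le> 1" if "x \<in> set (sl 0)" for x using ok0 that by (auto simp: ok_def split: if_splits)
  have "win a 1 0 0 p \<longleftrightarrow> p = e" if p: "p \<in> set (sl 0)" for p
   using before_separated[OF e p, of a] be ae by (cases "p = e") (auto simp: win_def)
  then show ?thesis using le1 ae by (simp add: thin_state_def W0 \<iota>_def)
 next
  assume ae: "a e = 2"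
  have "win a 2 0 0 p \<longleftrightarrow> p = e" if p: "p \<in> set (sl 0)" for p
   using win_unique[of 0 e p a 0] dist_sl[of 0] e p be ae by (auto simp: win_def)
  then have "\<forall>p\<in>set (sl 0). Wt a e 1 0 p = (if win a 2 0 0 p then 1 else 0) \<and>
    Wt a e (-1) 0 p = (if win a 2 0 0 p then q ^ (2 * 0 + 2 * \<iota>) * 1 else 0)"
   by (simp add: W0 \<iota>_def ae)
  moreover have "\<exists>j\<le>0. \<exists>x\<in>set (sl j). a x \<ge> 2" using e ae by (intro exI[of _ 0] conjI bexI[of _ e]) auto
  ultimately show ?thesis unfolding window_state_def by blast
 qed
 have okW: "Wt a e s k p ~= 0 ==> ok a k p" for s k p
 proof (cases k)
  case 0
  then show "Wt a e s k p ~= 0 ==> ok a k p" using ok0 by (auto simp: W0 split: if_splits)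
 qed (use Wt_ok in blast)
 have "(\<iota> = 1 \<and> thin_state a e k) \<or> window_state a e \<iota> k" if "k \<le> len" for k
  using that
 proof (induction k)
  case (Suc k)
  then show ?case using state_step[OF a, of k e \<iota>] okW by auto
 qed (rule start)
 then have final: "(\<iota> = 1 \<and> thin_state a e len) \<or> window_state a e \<iota> len" by simp
 have S: "(\<Sum>f\<in>thinners a e. qp (cross a f)) = Wt a e 1 len e"
  "(\<Sum>f\<in>thinners a e. qp (- cross a f)) = Wt a e (-1) len e"
  using thinners_sum[OF a e ok0, of 1] thinners_sum[OF a e ok0, of "-1"] by simp_all
 show ?thesis using final
 proof
  assume t: "\<iota> = 1 \<and> thin_state a e len"
  then have ae: "a e = 1" using ae by (auto simp: \<iota>_def)
  have "a x \<le> 1" for x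
  proof (cases "x \<in> E")
   case True
   then show ?thesis using t cover[OF True] by (auto simp: thin_state_def)
  qed (use a in \<open>simp add: flow_def\<close>)
  then have "thin a" by (simp add: thin_def)
  moreover have "win a 1 0 len e" using be ae closed by (simp add: win_def)
  ultimately show ?thesis using t e closed ae unfolding thin_state_def by (simp add: S)
 next
  assume ws: "window_state a e \<iota> len"
  then obtain x where "a x \<ge> 2" unfolding window_state_def by blast
  then have "\<not> a x \<le> 1" by simp
  then have "\<not> thin a" unfolding thin_def by blast
  obtain l w where lw: "Wt a e 1 len e = (if win a 2 l len e then w else 0)"
    "Wt a e (-1) len e = (if win a 2 l len e then q ^ (2 * l + 2 * \<iota>) * w else 0)"
   using ws e closed unfolding window_state_def by metis
  have "win a 2 l len e ==> l = 0" using be closed by (simp add: win_def)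
  then have "Wt a e (-1) len e = q ^ (2 * \<iota>) * Wt a e 1 len e" using lw by auto
  with ae \<open>\<not> thin a\<close> show ?thesis by (auto simp: \<iota>_def S)
 qed
qed

section \<open>The exchange relation between thin flows and strands\<close>

lemma star_X_U:
 assumes a: "flow a" and n: "n \<ge> 1"
 shows "star (X (n - 1)) (U e) a = (if deg a = n then \<Sum>f\<in>thinners a e. qp (cross a f) else 0)"
proof -
 have "star (X (n - 1)) (U e) a = (\<Sum>f\<in>subs a. qp (cross (a - f) f) * X (n - 1) (a - f) * U e f)"
  unfolding star_def if_P[OF a]
 proof (rule sum.reindex_bij_witness[where i = "%f. a - f" and j = "%f. a - f"])
  fix f assume f: "f \<in> subs a"
  then show "a - (a - f) = f" by (auto simp: subs_def fun_eq_iff le_fun_def)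
  then show "qp (cross (a - (a - f)) (a - f)) * X (n - 1) (a - (a - f)) * U e (a - f)
    = qp (cross f (a - f)) * X (n - 1) f * U e (a - f)" by simp
  show "a - f \<in> subs a" using f a by (auto simp: subs_def flow_minus le_fun_def)
 qed (use a in \<open>auto simp: subs_def fun_eq_iff le_fun_def flow_minus\<close>)
 also have "\<dots> = (\<Sum>f\<in>subs a. if f \<in> thinners a e \<and> deg a = n then qp (cross a f) else 0)"
 proof (rule sum.cong[OF refl])
  fix f assume f: "f \<in> subs a"
  then have f': "flow f" "f \<le> a" "flow (a - f)" using a by (auto simp: subs_def flow_minus)
  have "cross a f = cross (a - f) f"
   using cross_plus_left[of "a - f" f f] fun_le_add_diff(2)[OF f'(2)] by simp
  moreover have "deg (a - f) = deg a - deg f" "deg f \<le> deg a"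
   using f' by (auto simp: deg_minus deg_mono)
  ultimately show "qp (cross (a - f) f) * X (n - 1) (a - f) * U e f =
    (if f \<in> thinners a e \<and> deg a = n then qp (cross a f) else 0)"
   using n f' by (auto simp: X_def U_def thinners_def)
 qed
 also have "\<dots> = (if deg a = n then \<Sum>f\<in>thinners a e. qp (cross a f) else 0)"
 proof -
  have "thinners a e = {f \<in> subs a. f \<in> thinners a e}" by (auto simp: thinners_def subs_def)
  then show ?thesis using sum.inter_filter[OF finite_subs[OF a], of "%f. qp (cross a f)" "%f. f \<in> thinners a e"]
   by simp
 qed
 finally show ?thesis .
qed

lemma star_U_X:
 assumes a: "flow a" and n: "n \<ge> 1"
 shows "star (U e) (%g. q ^ (2 * g e) * X (n - 1) g) a =
  (if deg a = n then q ^ (2 * (a e - 1)) * (\<Sum>f\<in>thinners a e. qp (- cross a f)) else 0)"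
proof -
 have "star (U e) (%g. q ^ (2 * g e) * X (n - 1) g) a =
   (\<Sum>f\<in>subs a. if f \<in> thinners a e \<and> deg a = n then q ^ (2 * (a e - 1)) * qp (- cross a f) else 0)"
  unfolding star_def if_P[OF a]
 proof (rule sum.cong[OF refl])
  fix f assume f: "f \<in> subs a"
  then have f': "flow f" "f \<le> a" "flow (a - f)" using a by (auto simp: subs_def flow_minus)
  have "cross f a = cross f (a - f)"
   using cross_plus_right[of f "a - f" f] fun_le_add_diff(2)[OF f'(2)] by simp
  then have "cross f (a - f) = - cross a f" by (simp add: cross_antisym[of f a])
  moreover have "deg (a - f) = deg a - deg f" "deg f \<le> deg a"
   using f' by (auto simp: deg_minus deg_mono)
  ultimately show "qp (cross f (a - f)) * U e f * (q ^ (2 * (a - f) e) * X (n - 1) (a - f)) =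
    (if f \<in> thinners a e \<and> deg a = n then q ^ (2 * (a e - 1)) * qp (- cross a f) else 0)"
   using n f' by (auto simp: X_def U_def thinners_def)
 qed
 also have "\<dots> = (if deg a = n then \<Sum>f\<in>thinners a e. q ^ (2 * (a e - 1)) * qp (- cross a f) else 0)"
 proof -
  have "thinners a e = {f \<in> subs a. f \<in> thinners a e}" by (auto simp: thinners_def subs_def)
  then show ?thesis using sum.inter_filter[OF finite_subs[OF a],
    of "%f. q ^ (2 * (a e - 1)) * qp (- cross a f)" "%f. f \<in> thinners a e"]
   by simp
 qed
 finally show ?thesis by (simp add: sum_distrib_left)
qed

text \<open>In the last product the strand takes 1 from the value on \<open>e\<close>, so the weight
  q^(2 g e) reproduces the constant q^(2 (a e - 1)) of \<open>thinners_identity\<close>. As a weight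
  on flows it can be moved through products.\<close>

lemma X_U_exchange:
 assumes a: "flow a" and s0: "sl 0 = A @ e # B" "\<forall>x\<in>set A. a x = 0" and n: "n \<ge> 1"
 shows "(q ^ (2 * a e) - 1) * X n a =
  q ^ 2 * star (X (n - 1)) (U e) a - star (U e) (%g. q ^ (2 * g e) * X (n - 1) g) a"
proof (cases "deg a = n")
 case True
 then have "X n a = (if thin a then 1 else 0)" using a by (simp add: X_def)
 then show ?thesis using thinners_identity[OF a s0] True
  by (simp only: star_X_U[OF a n] star_U_X[OF a n] if_True refl)
next
 case False
 then have "X n a = 0" by (simp add: X_def)
 then show ?thesis using False
  by (simp only: star_X_U[OF a n] star_U_X[OF a n] if_False mult_zero_right diff_0_right)
qed

end

section \<open>Commutation of the \<open>X n\<close>\<close>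

lemma sum_list_pos: "sum_list xs > 0 ==> \<exists>x\<in>set xs. x > (0::nat)"
 by (induction xs) auto

lemma split_unique:
 assumes "A1 @ x # B1 = A2 @ x # B2" "x \<notin> set A1" "x \<notin> set A2"
 shows "A1 = A2"
proof -
 have "takeWhile (%y. y ~= x) (A @ x # B) = A" if "x \<notin> set A" for A B
  using that by (induction A) auto
 then show ?thesis using assms by metis
qed

context cweb
begin

lemma star_cong2:
 assumes "\<And>a. a \<in> subs t ==> F a * G (t - a) = F' a * G' (t - a)"
 shows "star F G t = star F' G' t"
 unfolding star_def using assms by (auto simp: mult.assoc intro!: sum.cong)

lemma star_eq_0:
 assumes "\<And>a. a \<in> subs t ==> F a = 0 \<or> G (t - a) = 0"
 shows "star F G t = 0"
 unfolding star_def by (auto intro!: sum.neutral dest: assms)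

lemma sub_minus_le: "t - a \<le> t" for t a :: "'e => nat"
 by (simp add: le_fun_def)

text \<open>The slices are cyclic, so any of them may serve as the cut. This makes the exchange
  relation available for the leftmost used edge of every slice.\<close>

lemma rotate_cweb:
 assumes "k < len"
 shows "cweb E ins outs (rotate k vs) (%j. sl ((j + k) mod len))"
proof
 have slmod: "sl (i mod len) = sl i" if "i \<le> len" for i
  using that closed by (cases "i = len") auto
 show "finite E" by (rule fin)
 show "distinct (rotate k vs)" by (simp add: dist_vs)
 show "\<And>v. v \<in> set (rotate k vs) ==>
   (\<exists>l r c. ins v = [l, r] \<and> outs v = [c]) \<or> (\<exists>l r c. ins v = [c] \<and> outs v = [l, r])"
  using vert by simp
 show "\<exists>A B. sl ((j + k) mod len) = A @ ins (rotate k vs ! j) @ B \<and>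
   sl ((Suc j + k) mod len) = A @ outs (rotate k vs ! j) @ B" if "j < length (rotate k vs)" for j
 proof -
  let ?i = "(j + k) mod len"
  have i: "?i < len" by (rule mod_less_divisor) (use assms in linarith)
  have "sl ((Suc j + k) mod len) = sl (Suc ?i mod len)" by (simp add: mod_Suc_eq)
  also have "\<dots> = sl (Suc ?i)" using slmod[of "Suc ?i"] i by simp
  finally have "sl ((Suc j + k) mod len) = sl (Suc ?i)" .
  moreover have "rotate k vs ! j = vs ! ?i" using that by (simp add: nth_rotate add.commute)
  ultimately show ?thesis using step[OF i] by simp
 qed
 show "sl ((length (rotate k vs) + k) mod len) = sl ((0 + k) mod len)" by simp
 show "distinct (sl ((j + k) mod len))" "set (sl ((j + k) mod len)) \<subseteq> E" for j
 proof -
  have "(j + k) mod len \<le> len" by (rule less_imp_le, rule mod_less_divisor) (use assms in linarith)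
  then show "distinct (sl ((j + k) mod len))" "set (sl ((j + k) mod len)) \<subseteq> E"
   by (rule dist_sl, rule sl_E)
 qed
 show "\<And>v v' e. v \<in> set (rotate k vs) ==> v' \<in> set (rotate k vs) ==> e \<in> set (ins v) ==> e \<in> set (ins v') ==> v = v'"
  "\<And>v v' e. v \<in> set (rotate k vs) ==> v' \<in> set (rotate k vs) ==> e \<in> set (outs v) ==> e \<in> set (outs v') ==> v = v'"
  "\<And>v. v \<in> set (rotate k vs) ==> set (ins v) \<inter> set (outs v) = {}"
  using uniq_in uniq_out ins_outs by simp_all
 fix e assume "e \<in> E"
 then obtain i where i: "i \<le> len" "e \<in> set (sl i)" using cover by blast
 \<comment> \<open>The rotated position of slice \<open>i\<close>. Adding \<open>len\<close> avoids
   truncated subtraction, and \<open>i mod len\<close> identifies the closing slice with slice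
   0.\<close>
 let ?j = "(i mod len + len - k) mod len"
 have "(?j + k) mod len = (i mod len + len - k + k) mod len" by (simp add: mod_add_left_eq)
 also have "i mod len + len - k + k = i mod len + len" using assms by simp
 also have "\<dots> mod len = i mod len" by simp
 finally have "sl ((?j + k) mod len) = sl i" using slmod[OF i(1)] by simp
 moreover have "?j \<le> len" by (rule less_imp_le, rule mod_less_divisor) (use assms in linarith)
 ultimately show "\<exists>j \<le> length (rotate k vs). e \<in> set (sl ((j + k) mod len))" using i by auto
qed

lemma X_U_exchange_at:
 assumes a: "flow a" and k: "k \<le> len" and s: "sl k = A @ e # B" "\<forall>x\<in>set A. a x = 0" and n: "n \<ge> 1"
 shows "(q ^ (2 * a e) - 1) * X n a =
  q ^ 2 * star (X (n - 1)) (U e) a - star (U e) (%g. q ^ (2 * g e) * X (n - 1) g) a"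
proof (cases "k = len")
 case True
 then show ?thesis using X_U_exchange[OF a _ s(2) n] s(1) closed by simp
next
 case False
 then have k': "k < len" using k by simp
 interpret R: cweb E ins outs "rotate k vs" "%j. sl ((j + k) mod len)" by (rule rotate_cweb[OF k'])
 have fl: "R.flow = flow" unfolding R.flow_def flow_def by simp
 have cr: "R.cross = cross" unfolding R.cross_def cross_def R.mgs_def mgs_def by simp
 have su: "R.subs = subs" unfolding R.subs_def subs_def fl ..
 have st: "R.star = star" unfolding R.star_def star_def fl cr su ..
 have dg: "R.deg f = deg f" if "flow f" for f unfolding R.deg_def using flow_slice[OF that, of k] k' by simp
 have X: "R.X = X"
 proof (intro ext)
  show "R.X n f = X n f" for n f using dg[of f] by (simp only: R.X_def X_def fl) auto
 qed
 have U: "R.U = U"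
 proof (intro ext)
  show "R.U e f = U e f" for e f using dg[of f] by (simp only: R.U_def U_def fl) auto
 qed
 show ?thesis using R.X_U_exchange[of a A e B n] a s n k' unfolding fl st X U by simp
qed

text \<open>If \<open>t e\<close> is 2, both factors take the value 1 on \<open>e\<close>, so only
  the parts \<open>X1\<close> enter. Exchange with a strand expresses \<open>X1\<close> through
  \<open>X0\<close> and \<open>U e\<close>. In \<open>Y (Suc a) b + Y a (Suc b)\<close> the strand
  then multiplies a product of smaller degree, which is symmetric in \<open>a\<close> and
  \<open>b\<close> by induction.\<close>

lemma X_comm_thick:
 assumes t: "flow t" and k: "k \<le> len" and s: "sl k = A @ e # B" "\<forall>x\<in>set A. t x = 0" and te: "t e \<ge> 2"
  and IH: "\<And>c a b. flow c ==> deg c < deg t ==> star (X a) (X b) c = star (X b) (X a) c"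
 shows "star (X a) (X b) t = star (X b) (X a) t"
proof (cases "t e \<ge> 3")
 case True
 \<comment> \<open>Two thin flows together reach at most 2 on \<open>e\<close>.\<close>
 have "star (X a) (X b) t = 0" for a b
 proof (rule star_eq_0)
  fix f assume f: "f \<in> subs t"
  show "X a f = 0 \<or> X b (t - f) = 0"
  proof (rule ccontr)
   assume "\<not> ?thesis"
   then have "f e \<le> 1" "(t - f) e \<le> 1" unfolding X_def thin_def by presburger+
   then show False using True by simp
  qed
 qed
 then show ?thesis by simp
next
 case False
 then have te: "t e = 2" using te by simp
 define X0 where "X0 n c = (if c e = 0 then X n c else 0)" for n c
 define X1 where "X1 n c = (if c e = 1 then X n c else 0)" for n c
 have lead0: "\<forall>x\<in>set A. c x = 0" if "c \<le> t" for c using s(2) that by (metis le_fun_def le_zero_eq)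
 have U1: "U e c ~= 0 ==> c e = 1" "U e c ~= 0 ==> deg c = 1" for c
  by (simp_all add: U_def split: if_splits)
 have X01: "X0 n c ~= 0 ==> c e = 0" "X1 n c ~= 0 ==> c e = 1" for n c
  by (simp_all add: X0_def X1_def split: if_splits)
 have X2: "c e \<ge> 2 ==> X n c = 0" for n c
 proof -
  assume "c e \<ge> 2"
  then have "\<not> c e \<le> 1" by simp
  then have "\<not> thin c" unfolding thin_def by blast
  then show ?thesis by (simp add: X_def)
 qed
 have add_e: "c e = f e + (c - f) e" if "f \<in> subs c" for f c
  using subsD(2)[OF that] by (simp add: le_fun_def)
 have UR: "f e = c e - 1" if "f \<in> subs c" "U e (c - f) ~= 0" for f c
  using add_e[OF that(1)] U1(1)[OF that(2)] by linarith
 have UL: "(c - f) e = c e - 1" if "f \<in> subs c" "U e f ~= 0" for f c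
  using add_e[OF that(1)] U1(1)[OF that(2)] by linarith
 have UR1: "c e \<ge> 1" if "f \<in> subs c" "U e (c - f) ~= 0" for f c
  using add_e[OF that(1)] U1(1)[OF that(2)] by linarith
 have UL1: "c e \<ge> 1" if "f \<in> subs c" "U e f ~= 0" for f c
  using add_e[OF that(1)] U1(1)[OF that(2)] by linarith
 have congR: "star F (U e) c = star G (U e) c" if "\<And>f. f e = c e - 1 ==> F f = G f" for F G c
 proof (rule star_cong2)
  fix f assume f: "f \<in> subs c"
  show "F f * U e (c - f) = G f * U e (c - f)"
   using that UR[OF f] by (cases "U e (c - f) = 0") auto
 qed
 have congL: "star (U e) F c = star (U e) G c" if "\<And>f. f e = c e - 1 ==> F f = G f" for F G c
 proof (rule star_cong2)
  fix f assume f: "f \<in> subs c"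
  show "U e f * F (c - f) = U e f * G (c - f)"
   using that UL[OF f] by (cases "U e f = 0") auto
 qed
 have zeroR: "star F (U e) c = 0" if "\<And>f. f e = c e - 1 ==> c e \<ge> 1 ==> F f = 0" for F c
  by (rule star_eq_0) (use that UR UR1 in blast)
 have zeroL: "star (U e) F c = 0" if "\<And>f. f e = c e - 1 ==> c e \<ge> 1 ==> F f = 0" for F c
  by (rule star_eq_0) (use that UL UL1 in blast)
 \<comment> \<open>The exchange relation where the value on \<open>e\<close> is 1: the strand takes
   all of it, and the remaining factor avoids \<open>e\<close>.\<close>
 have i: "(q^2 - 1) * X1 (Suc n) c = q^2 * star (X0 n) (U e) c - star (U e) (X0 n) c"
  if c: "flow c" "c \<le> t" for n c
 proof (cases "c e = 1")
  case True
  have "star (X n) (U e) c = star (X0 n) (U e) c"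
   by (rule congR) (simp add: X0_def True)
  moreover have "star (U e) (%g. q ^ (2 * g e) * X n g) c = star (U e) (X0 n) c"
   by (rule congL) (simp add: X0_def True)
  ultimately show ?thesis
   using X_U_exchange_at[OF c(1) k s(1) lead0[OF c(2)], of "Suc n"] True by (simp add: X1_def)
 next
  case False
  then have "star (X0 n) (U e) c = 0" "star (U e) (X0 n) c = 0"
   by (intro zeroR zeroL; auto simp: X0_def)+
  then show ?thesis using False by (simp add: X1_def)
 qed
 \<comment> \<open>Where the value on \<open>e\<close> is 2 there is no thin flow. The left side of
   the exchange relation is 0, and the weight q^2 cancels.\<close>
 have ii: "star (X1 n) (U e) c = star (U e) (X1 n) c" if c: "flow c" "c \<le> t" for n c
 proof (cases "c e = 2")
  case True
  have "star (X n) (U e) c = star (X1 n) (U e) c"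
   by (rule congR) (simp add: X1_def True)
  moreover have "star (U e) (%g. q ^ (2 * g e) * X n g) c = star (U e) (%g. q ^ 2 * X1 n g) c"
   by (rule congL) (simp add: X1_def True)
  moreover have "X (Suc n) c = 0" using True X2 by simp
  ultimately show ?thesis
   using X_U_exchange_at[OF c(1) k s(1) lead0[OF c(2)], of "Suc n"] by (simp add: star_scale_right)
 next
  case False
  then have "star (X1 n) (U e) c = 0" "star (U e) (X1 n) c = 0"
   by (intro zeroR zeroL; auto simp: X1_def)+
  then show ?thesis by simp
 qed
 define Y where "Y a b = star (X1 a) (X1 b) t" for a b
 define Z where "Z a b = (%c. star (X0 a) (X1 b) c + star (X1 a) (X0 b) c)" for a b
 \<comment> \<open>The first factor is expanded by \<open>i\<close>, and \<open>ii\<close> moves the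
   strand past \<open>X1 b\<close>. \<open>Y2\<close> does the same with the second factor.\<close>
 have Y1: "(q^2 - 1) * Y (Suc a) b = q^2 * star (star (X0 a) (X1 b)) (U e) t - star (U e) (star (X0 a) (X1 b)) t" for a b
 proof -
  have "(q^2 - 1) * Y (Suc a) b = star (%c. (q^2 - 1) * X1 (Suc a) c) (X1 b) t"
   by (simp only: Y_def star_scale_left)
  also have "\<dots> = star (%c. q^2 * star (X0 a) (U e) c - star (U e) (X0 a) c) (X1 b) t"
   by (rule star_cong) (simp_all only: i)
  also have "\<dots> = q^2 * star (X0 a) (star (U e) (X1 b)) t - star (U e) (star (X0 a) (X1 b)) t"
   by (simp only: star_diff_left star_scale_left star_assoc)
  also have "star (X0 a) (star (U e) (X1 b)) t = star (X0 a) (star (X1 b) (U e)) t"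
   by (rule star_cong) (simp_all only: ii)
  finally show ?thesis by (simp only: star_assoc)
 qed
 have Y2: "(q^2 - 1) * Y a (Suc b) = q^2 * star (star (X1 a) (X0 b)) (U e) t - star (U e) (star (X1 a) (X0 b)) t" for a b
 proof -
  have "(q^2 - 1) * Y a (Suc b) = star (X1 a) (%c. (q^2 - 1) * X1 (Suc b) c) t"
   by (simp only: Y_def star_scale_right)
  also have "\<dots> = star (X1 a) (%c. q^2 * star (X0 b) (U e) c - star (U e) (X0 b) c) t"
   by (rule star_cong) (simp_all only: i)
  also have "\<dots> = q^2 * star (star (X1 a) (X0 b)) (U e) t - star (star (X1 a) (U e)) (X0 b) t"
   by (simp only: star_diff_right star_scale_right star_assoc)
  also have "star (star (X1 a) (U e)) (X0 b) t = star (star (U e) (X1 a)) (X0 b) t"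
   by (rule star_cong) (simp_all only: ii)
  finally show ?thesis by (simp only: star_assoc)
 qed
 \<comment> \<open>Where the value on \<open>e\<close> is 1, exactly one factor carries it, so
   \<open>Z a b\<close> is the full product of \<open>X a\<close> and \<open>X b\<close>; elsewhere
   both terms of \<open>Z\<close> vanish.\<close>
 have Zsym: "Z a b c = Z b a c" if c: "flow c" "c \<le> t" "deg c < deg t" for a b c
 proof (cases "c e = 1")
  case True
  have "Z a b c = star (X a) (X b) c" for a b
  proof -
   have 01: "(f e = 0 \<and> (c - f) e = 1) \<or> (f e = 1 \<and> (c - f) e = 0)" if "f \<in> subs c" for f
    using add_e[OF that] True by linarith
   have "Z a b c = star (X0 a) (X b) c + star (X1 a) (X b) c"
    unfolding Z_def
    by (intro arg_cong2[of _ _ _ _ "(+)"] star_cong2; drule 01; auto simp: X0_def X1_def)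
   also have "\<dots> = star (%f. X0 a f + X1 a f) (X b) c" by (simp only: star_add_left)
   also have "\<dots> = star (X a) (X b) c"
    by (rule star_cong2; drule 01; auto simp: X0_def X1_def)
   finally show ?thesis .
  qed
  then show ?thesis using IH c by simp
 next
  case False
  have "star (X0 a) (X1 b) c = 0" "star (X1 a) (X0 b) c = 0" for a b
  proof -
   have "X0 n f = 0 \<or> X1 m (c - f) = 0" "X1 n f = 0 \<or> X0 m (c - f) = 0" if "f \<in> subs c" for f n m
    using add_e[OF that] False X01[of n f] X01[of m "c - f"] by linarith+
   then show "star (X0 a) (X1 b) c = 0" "star (X1 a) (X0 b) c = 0"
    by (blast intro: star_eq_0)+
  qed
  then have "Z a b c = 0" for a b by (simp add: Z_def)
  then show ?thesis by simp
 qed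
 have Zst: "star (Z a b) (U e) t = star (Z b a) (U e) t" "star (U e) (Z a b) t = star (U e) (Z b a) t" for a b
 proof -
  have *: "Z a b f = Z b a f" if "f \<in> subs t" "deg (t - f) = 1 \<or> deg f < deg t" for f
  proof -
   have "deg t = deg f + deg (t - f)"
    using deg_plus[of f "t - f"] fun_le_add_diff(1)[OF subsD(2)[OF that(1)]] by simp
   then have "deg f < deg t" using that by auto
   then show ?thesis using Zsym subsD[OF that(1)] by blast
  qed
  show "star (Z a b) (U e) t = star (Z b a) (U e) t"
  proof (rule star_cong2)
   fix f assume f: "f \<in> subs t"
   show "Z a b f * U e (t - f) = Z b a f * U e (t - f)"
    using *[OF f] U1(2)[of "t - f"] by (cases "U e (t - f) = 0") simp_all
  qed
  show "star (U e) (Z a b) t = star (U e) (Z b a) t"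
  proof (rule star_cong2)
   fix f assume f: "f \<in> subs t"
   have "t - f \<in> subs t" using f t by (simp add: subs_def flow_minus sub_minus_le)
   moreover have "deg t = deg f + deg (t - f)"
    using deg_plus[of f "t - f"] fun_le_add_diff(1)[OF subsD(2)[OF f]] by simp
   ultimately have "U e f ~= 0 ==> Z a b (t - f) = Z b a (t - f)" using *[of "t - f"] U1(2)[of f] by auto
   then show "U e f * Z a b (t - f) = U e f * Z b a (t - f)" by (metis mult_zero_left)
  qed
 qed
 have nz: "q^2 - 1 ~= 0" by (rule q_pow_minus_1_nz) simp
 have "(q^2 - 1) * (Y (Suc a) b + Y a (Suc b)) = q^2 * star (Z a b) (U e) t - star (U e) (Z a b) t" for a b
  unfolding distrib_left Y1 Y2 Z_def star_add_left star_add_right by (simp add: algebra_simps)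
 then have "(q^2 - 1) * (Y (Suc a) b + Y a (Suc b)) = (q^2 - 1) * (Y (Suc b) a + Y b (Suc a))" for a b
  using Zst[of a b] by simp
 then have rel: "Y (Suc a) b + Y a (Suc b) = Y (Suc b) a + Y b (Suc a)" for a b
  using nz by simp
 have Y0: "Y 0 b = 0" "Y b 0 = 0" for b
 proof -
  have "X1 0 c = 0" for c by (simp add: X1_def X_0 unit_def)
  then show "Y 0 b = 0" "Y b 0 = 0" unfolding Y_def by (auto intro: star_eq_0)
 qed
 \<comment> \<open>Induction on \<open>a\<close> separates the two terms of \<open>rel\<close>,
   starting from \<open>Y 0 b = Y b 0 = 0\<close>.\<close>
 have "Y a b = Y b a" for a b
 proof (induction a arbitrary: b)
  case (Suc a)
  then show ?case using rel[of a b] by (metis add_right_cancel add.commute)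
 qed (simp add: Y0)
 moreover have "star (X a) (X b) t = Y a b" for a b
  unfolding Y_def
 proof (rule star_cong2)
  fix f assume f: "f \<in> subs t"
  show "X a f * X b (t - f) = X1 a f * X1 b (t - f)"
  proof (cases "f e = 1")
   case False
   then have "f e \<ge> 2 \<or> (t - f) e \<ge> 2" using add_e[OF f] te by linarith
   then show ?thesis using X2 False by (auto simp: X1_def)
  qed (use te in \<open>simp add: X1_def\<close>)
 qed
 ultimately show ?thesis by simp
qed

text \<open>If no slice starts with an edge of thickness at least 2, the leftmost edges form a circle
 which does not interact with the rest.\<close>

lemma leftmost_circle:
 assumes t: "flow t" "deg t > 0"
  and one: "\<And>k A e B. k \<le> len ==> sl k = A @ e # B ==> \<forall>x\<in>set A. t x = 0 ==> t e \<le> 1"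
 obtains C e where "flow C" "C \<le> t" "deg C = 1" "C e = 1" "t e = 1" "\<And>x. C x \<le> 1" "\<And>x. C x = 1 ==> t x = 1"
  "\<And>f x. flow f ==> f \<le> t ==> C x = 1 ==> f x = f e"
  "\<And>g. flow g ==> g \<le> t - C ==> cross C g = 0"
proof -
 define ld where "ld k = hd (filter (%e. t e > 0) (sl k))" for k
 have ld: "\<exists>A B. sl k = A @ ld k # B \<and> (\<forall>x\<in>set A. t x = 0) \<and> t (ld k) = 1" if k: "k \<le> len" for k
 proof -
  have "\<exists>x\<in>set (sl k). t x > 0"
  proof (rule ccontr)
   assume "\<not> ?thesis"
   then have "\<And>x. x \<in> set (map t (sl k)) ==> x = 0" by auto
   then have "sum_list (map t (sl k)) = 0" by (metis sum_list_eq_0_iff)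
   then show False using flow_slice[OF t(1) k] t(2) by simp
  qed
  then obtain A x B where s: "sl k = A @ x # B" "t x > 0" "\<forall>y\<in>set A. \<not> t y > 0"
   using split_list_first_prop[of "sl k" "%x. t x > 0"] by blast
  then have "filter (%e. t e > 0) (sl k) = x # filter (%e. t e > 0) B" by simp
  then have "ld k = x" by (simp add: ld_def)
  moreover have "t x \<le> 1" using one[OF k s(1)] s(3) by simp
  ultimately show ?thesis using s by auto
 qed
 have ld_eq: "ld k = e" if "sl k = A @ e # B" "\<forall>x\<in>set A. t x = 0" "t e > 0" for k A e B
  using that by (simp add: ld_def)
 have mem: "ld k \<in> set (sl k)" "t (ld k) = 1" if "k \<le> len" for k using ld[OF that] by auto
 \<comment> \<open>The vertex may lie to the right of the leftmost strand, on it, or to its left. If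
   the strand enters a merge, the outgoing edge is the next leftmost edge and so has value 1; hence
   the total through the vertex is 1.\<close>
 have stp: "nxt k (ld k) (ld (Suc k)) \<and>
   (ld k \<in> set (ins (vs ! k)) --> sum_list (map t (ins (vs ! k))) = 1)" if k: "k < len" for k
 proof -
  let ?v = "vs ! k"
  obtain A B where s: "sl k = A @ ins ?v @ B" "sl (Suc k) = A @ outs ?v @ B"
   "distinct (A @ ins ?v @ B)" "distinct (A @ outs ?v @ B)" by (rule stepE[OF k])
  have v: "?v \<in> set vs" using k by simp
  have cons: "sum_list (map t (ins ?v)) = sum_list (map t (outs ?v))" using t v by (simp add: flow_def)
  obtain P Q where P: "sl k = P @ ld k # Q" "\<forall>x\<in>set P. t x = 0" "t (ld k) = 1" using ld[of k] k by auto
  have dP: "ld k \<notin> set P" using dist_sl[of k] k unfolding P(1) by simp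
  consider (A) "ld k \<in> set A" | (I) "ld k \<in> set (ins ?v)" | (B) "ld k \<in> set B"
   using mem[of k] k s by auto
  then show ?thesis
  proof cases
   case A
   then obtain A1 A2 where A12: "A = A1 @ ld k # A2" by (auto dest: split_list)
   have "A1 = P"
   proof -
    have "P @ ld k # Q = A1 @ ld k # (A2 @ ins ?v @ B)" using P(1) s(1) A12 by simp
    then have "A1 @ ld k # (A2 @ ins ?v @ B) = P @ ld k # Q" by simp
    moreover have "ld k \<notin> set A1" "ld k \<notin> set P" using dP s(3) A12 by simp_all
    ultimately show ?thesis by (rule split_unique)
   qed
   then have "ld (Suc k) = ld k" using ld_eq[of "Suc k" P "ld k"] s(2) A12 P by simp
   moreover have "ld k \<notin> set (ins ?v)" using A s by auto
   ultimately show ?thesis by (simp add: nxt_def)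
  next
   case I
   then obtain I1 I2 where I12: "ins ?v = I1 @ ld k # I2" by (auto dest: split_list)
   have PA: "P = A @ I1"
   proof -
    have "P @ ld k # Q = (A @ I1) @ ld k # (I2 @ B)" using P(1) s(1) I12 by simp
    moreover have "ld k \<notin> set P" "ld k \<notin> set (A @ I1)" using dP s(3) I12 by simp_all
    ultimately show ?thesis by (rule split_unique)
   qed
   have "sum_list (map t (outs ?v)) > 0" using cons I12 P(3) by simp
   then have "\<exists>x\<in>set (outs ?v). t x > 0"
    using sum_list_pos[of "map t (outs ?v)"] by auto
   then obtain O1 x O2 where O: "outs ?v = O1 @ x # O2" "t x > 0" "\<forall>y\<in>set O1. \<not> t y > 0"
    using split_list_first_prop[of "outs ?v" "%x. t x > 0"] by blast
   have ldS: "ld (Suc k) = x"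
    using ld_eq[of "Suc k" "A @ O1" x "O2 @ B"] s(2) O P(2) PA by auto
   then have tx: "t x = 1" using mem(2)[of "Suc k"] k by simp
   have "sum_list (map t (ins ?v)) = 1"
   proof (cases "length (ins ?v) = 1")
    case True
    then have "ins ?v = [ld k]" using I12 by (cases I1) auto
    then show ?thesis using P(3) by simp
   next
    case False
    then have "\<exists>c. outs ?v = [c]" using vert[OF v] by auto
    then have "outs ?v = [x]" using O(1) by (cases O1) auto
    then show ?thesis using cons tx by simp
   qed
   then show ?thesis using I O ldS by (simp add: nxt_def)
  next
   case B
   then obtain B1 B2 where B12: "B = B1 @ ld k # B2" by (auto dest: split_list)
   have PA: "P = A @ ins ?v @ B1"
   proof -
    have "P @ ld k # Q = (A @ ins ?v @ B1) @ ld k # B2" using P(1) s(1) B12 by simp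
    moreover have "ld k \<notin> set P" "ld k \<notin> set (A @ ins ?v @ B1)" using dP s(3) B12 by simp_all
    ultimately show ?thesis by (rule split_unique)
   qed
   then have "sum_list (map t (ins ?v)) = 0" using P(2) by (simp add: sum_list_eq_0_iff)
   then have "\<forall>x\<in>set (outs ?v). t x = 0" using cons by simp
   then have "ld (Suc k) = ld k"
    using ld_eq[of "Suc k" "A @ outs ?v @ B1" "ld k"] s(2) B12 P PA by auto
   moreover have "ld k \<notin> set (ins ?v)" using B s by auto
   ultimately show ?thesis by (simp add: nxt_def)
  qed
 qed
 define \<phi> where "\<phi> = map ld [0..<Suc len]"
 have nth: "\<phi> ! k = ld k" if "k \<le> len" for k
 proof -
  have "[0..<Suc len] ! k = k" using nth_upt[of 0 k "Suc len"] that by linarith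
  moreover have "k < length [0..<Suc len]" using that by (simp only: length_upt)
  ultimately show ?thesis unfolding \<phi>_def by (simp only: nth_map)
 qed
 have phi: "length \<phi> = Suc len" "\<And>k. k \<le> len ==> \<phi> ! k \<in> set (sl k)"
  "\<And>k. k < len ==> nxt k (\<phi> ! k) (\<phi> ! Suc k)" "\<phi> ! len = \<phi> ! 0"
  using mem stp by (simp_all add: nth) (simp_all add: \<phi>_def ld_def closed)
 have setphi: "set \<phi> = ld ` {0..len}" by (simp add: \<phi>_def atLeastLessThanSuc_atLeastAtMost del: upt_Suc)
 define C where "C x = (if x \<in> set \<phi> then 1 else 0 :: nat)" for x
 have E: "set \<phi> \<subseteq> E" using mem(1) sl_E unfolding setphi by fastforce
 have C: "flow C" "deg C = 1" using path_flow[OF phi E] by (simp_all add: C_def[abs_def])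
 have tC: "t x = 1" if "C x = 1" for x
 proof -
  have "x \<in> set \<phi>" using that by (simp add: C_def split: if_splits)
  then obtain k where "k \<le> len" "x = ld k" unfolding setphi by auto
  then show ?thesis using mem(2) by simp
 qed
 \<comment> \<open>At a vertex on the circle the whole flow \<open>t\<close> has total 1, so a
   smaller flow can only hand its value from one edge of the circle to the next.\<close>
 have const: "f (ld k) = f (ld 0)" if f: "flow f" "f \<le> t" and "k \<le> len" for f k
  using that(3)
 proof (induction k)
  case (Suc k)
  let ?v = "vs ! k"
  have k: "k < len" using Suc by simp
  have v: "?v \<in> set vs" using k by simp
  have pick: "sum_list (map f xs) = f x" if "x \<in> set xs" "sum_list (map t xs) = 1" "t x = 1" for x xs
  proof -
   from split_list[OF that(1)] obtain xs1 xs2 where xs: "xs = xs1 @ x # xs2" by blast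
   have "sum_list (map t (xs1 @ xs2)) = 0" using that xs by simp
   then have "\<forall>y\<in>set (xs1 @ xs2). t y = 0" by auto
   then have "\<forall>y\<in>set (xs1 @ xs2). f y = 0" using f(2) by (metis le_fun_def le_zero_eq)
   then show ?thesis using xs by (simp add: sum_list_eq_0_iff)
  qed
  show ?case
  proof (cases "ld k \<in> set (ins ?v)")
   case True
   then have S: "sum_list (map t (ins ?v)) = 1" "ld (Suc k) \<in> set (outs ?v)"
    using stp[OF k] by (auto simp: nxt_def)
   have "sum_list (map f (ins ?v)) = f (ld k)" using pick[OF True S(1)] mem(2)[of k] k by simp
   moreover have "sum_list (map t (outs ?v)) = 1" using S t v by (simp add: flow_def)
   then have "sum_list (map f (outs ?v)) = f (ld (Suc k))" using pick[OF S(2)] mem(2)[of "Suc k"] k by simp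
   ultimately show ?thesis using f v Suc by (simp add: flow_def)
  next
   case False
   then show ?thesis using stp[OF k] Suc by (simp add: nxt_def)
  qed
 qed simp
 show ?thesis
 proof (rule that[OF C(1) _ C(2)])
  show "C \<le> t" unfolding le_fun_def using tC by (auto simp: C_def)
  show "C (ld 0) = 1" by (auto simp: C_def setphi)
  show "t (ld 0) = 1" using mem by simp
  show "C x \<le> 1" for x by (simp add: C_def)
  show "C x = 1 ==> t x = 1" for x by (rule tC)
  show "f x = f (ld 0)" if "flow f" "f \<le> t" "C x = 1" for f x
   using that const setphi by (auto simp: C_def split: if_splits)
  show "cross C g = 0" if g: "flow g" "g \<le> t - C" for g
   unfolding cross_def
  proof (rule sum.neutral, rule ballI)
   fix v assume "v \<in> mgs"
   then have v: "v \<in> set vs" "length (ins v) = 2" by (auto simp: mgs_def)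
   then obtain l r c where m: "ins v = [l, r]" "outs v = [c]" using vert[of v] by auto
   obtain k where k: "k < len" "v = vs ! k" using v by (auto simp: in_set_conv_nth)
   obtain A B where s: "sl k = A @ ins v @ B" "distinct (A @ ins v @ B)"
    using stepE[OF k(1)] k(2) by metis
   have Cx: "C x = (if x = ld k then 1 else 0)" if "x \<in> set (sl k)" for x
    using path_edges[OF phi, of k x] k that nth[of k] by (simp add: C_def)
   have gt: "g x \<le> t x" for x using le_funD[OF g(2), of x] by simp
   \<comment> \<open>At a merge on the circle the other incoming edge is therefore empty in
     \<open>t\<close>, which makes the crossing vanish.\<close>
   have sum1: "ld k \<in> {l, r} ==> t l + t r = 1" using stp[OF k(1)] unfolding k(2)[symmetric] m by simp
   have lr: "l ~= r" using s m by auto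
   have mem_lr: "l \<in> set (sl k)" "r \<in> set (sl k)" using s(1) m by simp_all
   have "g r = 0" if "C l = 1"
   proof -
    have "l = ld k" using Cx[OF mem_lr(1)] that by presburger
    then have "ld k \<in> {l, r}" by blast
    then show ?thesis using sum1 tC[OF that] gt[of r] by linarith
   qed
   moreover have "g l = 0" if "C r = 1"
   proof -
    have "r = ld k" using Cx[OF mem_lr(2)] that by presburger
    then have "ld k \<in> {l, r}" by blast
    then show ?thesis using sum1 tC[OF that] gt[of l] by linarith
   qed
   ultimately have "C l * g r = 0" "g l * C r = 0" by (auto simp: C_def)
   then show "int (C (ins v ! 0)) * int (g (ins v ! 1)) - int (g (ins v ! 0)) * int (C (ins v ! 1)) = 0"
    using m by auto
  qed
 qed
qed

text \<open>A flow below \<open>t\<close> contains the isolated circle entirely or not at all, and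
  the circle crosses nothing else. Removing it from the factor that contains it lowers the degree of
  that factor by 1 and leaves the exponent unchanged.\<close>

lemma X_comm_circle:
 assumes t: "flow t" and C: "flow C" "C \<le> t" "deg C = 1" "C e = 1" "t e = 1" "\<And>x. C x \<le> 1" "\<And>x. C x = 1 ==> t x = 1"
  "\<And>f x. flow f ==> f \<le> t ==> C x = 1 ==> f x = f e"
  "\<And>g. flow g ==> g \<le> t - C ==> cross C g = 0"
 shows "star (X a) (X b) t = (if a = 0 then 0 else star (X (a - 1)) (X b) (t - C)) +
   (if b = 0 then 0 else star (X a) (X (b - 1)) (t - C))"
proof -
 have tC: "flow (t - C)" using t C by (simp add: flow_minus)
 have C01: "C x = 0 \<or> C x = 1" for x using C(6)[of x] by linarith
 have sub1: "C \<le> f" if "f \<in> subs t" "f e = 1" for f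
  unfolding le_fun_def using C(8)[OF subsD[OF that(1)]] that(2) C01 by (metis le0 order_refl)
 have sub0: "f \<le> t - C" if "f \<in> subs t" "f e = 0" for f
  unfolding le_fun_def
 proof
  fix x
  have "f x \<le> t x" using subsD(2)[OF that(1)] by (simp add: le_fun_def)
  moreover have "C x = 1 ==> f x = 0" using C(8)[OF subsD[OF that(1)]] that(2) by simp
  ultimately show "f x \<le> (t - C) x" using C01[of x] by auto
 qed
 have sub_e: "f e = 0" if "f \<le> t - C" for f using that C(4,5) by (auto simp: le_fun_def dest: spec[of _ e])
 have leD: "f x + C x \<le> t x" if "f \<le> t - C" for f x
  using that C(2) by (auto simp: le_fun_def le_diff_conv2)
 have Xplus: "X n (f + C) = (if n = 0 then 0 else X (n - 1) f)" if f: "flow f" "f \<le> t - C" for f n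
 proof -
  have fC: "C x = 1 ==> f x = 0" for x using leD[OF f(2), of x] C(7)[of x] by simp
  have "thin (f + C) \<longleftrightarrow> thin f"
  proof
   show "thin (f + C) ==> thin f" by (auto simp: thin_def dest: add_leD1)
   show "thin f ==> thin (f + C)" unfolding thin_def
    using fC C01 by (metis add.right_neutral add_0 order_refl plus_fun_apply)
  qed
  then show ?thesis using f C by (auto simp: X_def flow_plus deg_plus)
 qed
 have S: "star (X a) (X b) t = (\<Sum>f\<in>{f \<in> subs t. f e = 1}. qp (cross f (t - f)) * X a f * X b (t - f)) +
   (\<Sum>f\<in>{f \<in> subs t. f e = 0}. qp (cross f (t - f)) * X a f * X b (t - f))"
 proof -
  have "f e = 1 \<or> f e = 0" if "f \<in> subs t" for f
   using le_funD[OF subsD(2)[OF that], of e] C(5) by linarith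
  then have "subs t = {f \<in> subs t. f e = 1} \<union> {f \<in> subs t. f e = 0}" by blast
  then have "(\<Sum>f\<in>subs t. qp (cross f (t - f)) * X a f * X b (t - f)) =
    (\<Sum>f\<in>{f \<in> subs t. f e = 1} \<union> {f \<in> subs t. f e = 0}. qp (cross f (t - f)) * X a f * X b (t - f))" by simp
  then show ?thesis unfolding star_def if_P[OF t]
   by (subst (asm) sum.union_disjoint) (use t in auto)
 qed
 have d: "deg (t - C) = deg t - 1" using C by (simp add: deg_minus)
 have 1: "(\<Sum>f\<in>{f \<in> subs t. f e = 1}. qp (cross f (t - f)) * X a f * X b (t - f)) =
   (if a = 0 then 0 else star (X (a - 1)) (X b) (t - C))"
 proof -
  have "(\<Sum>f\<in>{f \<in> subs t. f e = 1}. qp (cross f (t - f)) * X a f * X b (t - f)) =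
   (\<Sum>h\<in>subs (t - C). qp (cross h (t - C - h)) * (if a = 0 then 0 else X (a - 1) h) * X b (t - C - h))"
  proof (rule sum.reindex_bij_witness[where j = "%f. f - C" and i = "%h. h + C"])
   fix f assume "f \<in> {f \<in> subs t. f e = 1}"
   then have f: "f \<in> subs t" "f e = 1" by auto
   have fl: "flow f" "f \<le> t" "C \<le> f" using subsD[OF f(1)] sub1[OF f] by auto
   show "f - C + C = f" using fl by (simp add: fun_le_add_diff)
   have h: "f - C \<le> t - C" using fl by (auto simp: le_fun_def diff_le_mono)
   have hf: "flow (f - C)" using fl C by (simp add: flow_minus)
   show "f - C \<in> subs (t - C)" using h hf by (simp add: subs_def)
   have e1: "t - C - (f - C) = t - f" using fl by (auto simp: fun_eq_iff le_fun_def)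
   have "cross f (t - f) = cross (f - C) (t - f) + cross C (t - f)"
    using cross_plus_left[of "f - C" C "t - f"] fl by (simp add: fun_le_add_diff)
   moreover have "cross C (t - f) = 0"
    by (rule C(9)) (use fl t in \<open>auto simp: flow_minus le_fun_def diff_le_mono2\<close>)
   moreover have "X a f = (if a = 0 then 0 else X (a - 1) (f - C))"
    using Xplus[OF hf h, of a] fl by (simp add: fun_le_add_diff)
   ultimately show "qp (cross (f - C) (t - C - (f - C))) * (if a = 0 then 0 else X (a - 1) (f - C)) * X b (t - C - (f - C))
     = qp (cross f (t - f)) * X a f * X b (t - f)" unfolding e1 by simp
  next
   fix h assume "h \<in> subs (t - C)"
   then have h: "flow h" "h \<le> t - C" by (auto simp: subs_def)
   show "h + C - C = h" by (simp add: fun_eq_iff)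
   show "h + C \<in> {f \<in> subs t. f e = 1}"
    using h C sub_e[OF h(2)] leD[OF h(2)] by (simp add: subs_def flow_plus le_fun_def)
  qed
  then show ?thesis using tC by (auto simp: star_def intro: sum.cong)
 qed
 have 2: "(\<Sum>f\<in>{f \<in> subs t. f e = 0}. qp (cross f (t - f)) * X a f * X b (t - f)) =
   (if b = 0 then 0 else star (X a) (X (b - 1)) (t - C))"
 proof -
  have "{f \<in> subs t. f e = 0} = subs (t - C)"
   using sub0 sub_e by (auto simp: subs_def intro: order_trans[OF _ sub_minus_le])
  moreover have "qp (cross f (t - f)) * X a f * X b (t - f) =
    qp (cross f (t - C - f)) * X a f * (if b = 0 then 0 else X (b - 1) (t - C - f))" if f: "f \<in> subs (t - C)" for f
  proof -
   have fl: "flow f" "f \<le> t - C" using subsD[OF f] by auto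
   have e1: "t - f = (t - C - f) + C"
   proof (rule ext)
    show "(t - f) x = (t - C - f + C) x" for x using leD[OF fl(2), of x] by simp
   qed
   have "cross f (t - f) = cross f (t - C - f) + cross f C" by (subst e1) (rule cross_plus_right)
   moreover have "cross f C = 0" using C(9)[OF fl] cross_antisym[of f C] by simp
   moreover have "X b (t - f) = (if b = 0 then 0 else X (b - 1) (t - C - f))"
    unfolding e1 by (rule Xplus) (use fl tC in \<open>auto simp: flow_minus sub_minus_le\<close>)
   ultimately show ?thesis by simp
  qed
  ultimately have "(\<Sum>f\<in>{f \<in> subs t. f e = 0}. qp (cross f (t - f)) * X a f * X b (t - f)) =
    (\<Sum>f\<in>subs (t - C). qp (cross f (t - C - f)) * X a f * (if b = 0 then 0 else X (b - 1) (t - C - f)))"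
   by (simp only: cong: sum.cong)
  then show ?thesis using tC by (simp add: star_def)
 qed
 show ?thesis unfolding S 1 2 ..
qed

text \<open>Induction on the degree: either the first used edge of some slice has value at least 2
  and the strand exchange applies, or the leftmost circle splits off and the two resulting products
  have smaller degree.\<close>

lemma X_comm_at: "flow t ==> star (X a) (X b) t = star (X b) (X a) t"
proof (induction "deg t" arbitrary: t a b rule: less_induct)
 case less
 show ?case
 proof (cases "deg t = 0")
  case True
  then have "t = 0" using less.prems by (simp add: deg_eq_0)
  moreover have "subs 0 = {0}" by (auto simp: subs_def le_fun_def fun_eq_iff)
  ultimately show ?thesis by (simp add: star_def)
 next
  case False
  show ?thesis
  proof (cases "\<exists>k A e B. k \<le> len \<and> sl k = A @ e # B \<and> (\<forall>x\<in>set A. t x = 0) \<and> t e \<ge> 2")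
   case True
   then obtain k A e B where k: "k \<le> len" "sl k = A @ e # B" "\<forall>x\<in>set A. t x = 0" "t e \<ge> 2" by blast
   show ?thesis by (rule X_comm_thick[OF less.prems k]) (rule less.hyps)
  next
   case no: False
   have one: "t e \<le> 1" if "k \<le> len" "sl k = A @ e # B" "\<forall>x\<in>set A. t x = 0" for k A e B
   proof (rule ccontr)
    assume "\<not> t e \<le> 1"
    then have "t e \<ge> 2" by simp
    with no that show False by blast
   qed
   have pos: "deg t > 0" using False by simp
   obtain C e where C: "flow C" "C \<le> t" "deg C = 1" "C e = 1" "t e = 1" "\<And>x. C x \<le> 1" "\<And>x. C x = 1 ==> t x = 1"
     "\<And>f x. flow f ==> f \<le> t ==> C x = 1 ==> f x = f e"
     "\<And>g. flow g ==> g \<le> t - C ==> cross C g = 0"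
   proof (rule leftmost_circle[OF less.prems pos])
    show "k \<le> len ==> sl k = A @ e # B ==> \<forall>x\<in>set A. t x = 0 ==> t e \<le> 1" for k A e B
     by (rule one)
   qed (rule that)
   have "deg (t - C) < deg t" "flow (t - C)" using C False less.prems by (simp_all add: deg_minus flow_minus)
   then have "star (X a) (X b) (t - C) = star (X b) (X a) (t - C)" for a b by (rule less.hyps)
   then show ?thesis
    by (simp add: X_comm_circle[OF less.prems C, of a b] X_comm_circle[OF less.prems C, of b a])
  qed
 qed
qed

section \<open>Comparison of \<open>H\<close> with \<open>X\<close>\<close>

lemma Hd_exchange:
 assumes a: "flow a" and s: "sl 0 = A @ e # B" "\<forall>x\<in>set A. a x = 0"
 shows "(q ^ (2 * a e) - 1) * Hd (deg a) a = (q^2 - 1) * star (%f. Hd (deg f) f) (U e) a"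
proof (cases "a e = 0")
 case True
 have "star (%f. Hd (deg f) f) (U e) a = 0"
 proof (rule star_eq_0)
  fix f
  have "(a - f) e ~= 1" using True by simp
  then show "Hd (deg f) f = 0 \<or> U e (a - f) = 0" by (simp add: U_def)
 qed
 then show ?thesis using True by simp
next
 case False
 then have ld: "lead a = e" using s by (simp add: lead_def)
 obtain m where m: "deg a = Suc m" using False flow_le_deg[OF a, of e] by (cases "deg a") auto
 have nz: "q ^ (2 * a e) - 1 ~= 0" using False by (intro q_pow_minus_1_nz) simp
 have "star (%f. Hd (deg f) f) (U e) a = (\<Sum>f\<in>subs a. qp (cross (a - f) f) * Hd (deg (a - f)) (a - f) * U e f)"
  unfolding star_def if_P[OF a]
 proof (rule sum.reindex_bij_witness[where i = "%f. a - f" and j = "%f. a - f"])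
  fix f assume f: "f \<in> subs a"
  then show "a - (a - f) = f" by (auto simp: subs_def fun_eq_iff le_fun_def)
  then show "qp (cross (a - (a - f)) (a - f)) * Hd (deg (a - (a - f))) (a - (a - f)) * U e (a - f)
    = qp (cross f (a - f)) * Hd (deg f) f * U e (a - f)" by simp
  show "a - f \<in> subs a" using f a by (auto simp: subs_def flow_minus le_fun_def)
 qed (use a in \<open>auto simp: subs_def fun_eq_iff le_fun_def flow_minus\<close>)
 also have "\<dots> = (\<Sum>f\<in>subs a. if deg f = 1 \<and> f e = 1 then qp (cross (a - f) f) * Hd m (a - f) else 0)"
  by (rule sum.cong) (auto simp: U_def subs_def deg_minus m)
 also have "\<dots> = (\<Sum>f\<in>{f \<in> subs a. deg f = 1 \<and> f e = 1}. qp (cross (a - f) f) * Hd m (a - f))"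
  by (simp add: sum.inter_filter[OF finite_subs[OF a]])
 finally show ?thesis using nz unfolding m by (simp add: ld)
qed

definition Hf :: "('e => nat) => qfield" where "Hf f = Hd (deg f) f"
text \<open>The coefficients of X((q^2 - 1) u). The scaling gives \<open>X\<close> the same factor
  q^2 - 1 in its exchange relation as \<open>Hf\<close> has.\<close>

definition Yf :: "('e => nat) => qfield" where "Yf f = (q^2 - 1) ^ deg f * X (deg f) f"

lemma Yf_exchange:
 assumes a: "flow a" and s: "sl 0 = A @ e # B" "\<forall>x\<in>set A. a x = 0"
 shows "(q ^ (2 * a e) - 1) * Yf a =
  (q^2 - 1) * (q^2 * star Yf (U e) a - star (U e) (%g. q ^ (2 * g e) * Yf g) a)"
proof (cases "deg a")
 case 0
 then have "a = 0" using a by (simp add: deg_eq_0)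
 then have "star Yf (U e) a = 0" "star (U e) (%g. q ^ (2 * g e) * Yf g) a = 0"
  by (auto intro!: star_eq_0 simp: U_def subs_def le_fun_def)
 then show ?thesis using \<open>a = 0\<close> by simp
next
 case (Suc m)
 have dg: "deg f = m" if "f \<in> subs a" "U e (a - f) ~= 0" for f
 proof -
  have "deg (a - f) = 1" using that(2) by (simp add: U_def split: if_splits)
  then show ?thesis using Suc deg_plus[of f "a - f"] fun_le_add_diff(1)[OF subsD(2)[OF that(1)]] by simp
 qed
 have dg': "deg (a - f) = m" if "f \<in> subs a" "U e f ~= 0" for f
 proof -
  have "deg f = 1" using that(2) by (simp add: U_def split: if_splits)
  then show ?thesis using Suc deg_plus[of f "a - f"] fun_le_add_diff(1)[OF subsD(2)[OF that(1)]] by simp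
 qed
 have "star Yf (U e) a = star (%f. (q^2 - 1) ^ m * X m f) (U e) a"
  by (rule star_cong2) (use dg in \<open>force simp: Yf_def\<close>)
 then have "star Yf (U e) a = (q^2 - 1) ^ m * star (X m) (U e) a" by (simp only: star_scale_left)
 moreover have "star (U e) (%g. q ^ (2 * g e) * Yf g) a =
   star (U e) (%g. (q^2 - 1) ^ m * (q ^ (2 * g e) * X m g)) a"
  by (rule star_cong2) (use dg' in \<open>force simp: Yf_def\<close>)
 then have "star (U e) (%g. q ^ (2 * g e) * Yf g) a =
   (q^2 - 1) ^ m * star (U e) (%g. q ^ (2 * g e) * X m g) a" by (simp only: star_scale_right)
 moreover have "(q ^ (2 * a e) - 1) * X (Suc m) a =
   q ^ 2 * star (X m) (U e) a - star (U e) (%g. q ^ (2 * g e) * X m g) a"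
  using X_U_exchange[OF a s, of "Suc m"] by simp
 moreover have "(q ^ (2 * a e) - 1) * Yf a = (q^2 - 1) * ((q^2 - 1) ^ m * ((q ^ (2 * a e) - 1) * X (Suc m) a))"
  by (simp add: Yf_def Suc)
 ultimately show ?thesis
  by (simp only: right_diff_distrib mult.left_commute)
qed

text \<open>This is H(u) X((q^2 - 1) u) = H(q^2 u). Let T be multiplication by q^(2 f e), which
  respects \<open>star\<close>, and put c = q^2 - 1. Then T H = H + c H U and T Y + c U T Y = Y + c
  q^2 Y U. Hence T(H Y) - H Y = c q^2 (H Y) U, where induction applies to H Y in degree
  \<open>deg t - 1\<close>, and the exchange relation of H finishes.\<close>

lemma Hf_Yf:
 assumes "flow t"
 shows "star Hf Yf t = q ^ (2 * deg t) * Hf t"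
 using assms
proof (induction "deg t" arbitrary: t rule: less_induct)
 case less
 note t = less.prems
 show ?case
 proof (cases "deg t = 0")
  case True
  then have "t = 0" using t by (simp add: deg_eq_0)
  moreover have "subs 0 = {0}" by (auto simp: subs_def le_fun_def fun_eq_iff)
  ultimately show ?thesis by (simp add: star_def Yf_def X_0 unit_def)
 next
  case False
  then obtain A B where s: "sl 0 = A @ lead t # B" "\<forall>x\<in>set A. t x = 0" and pos: "t (lead t) > 0"
   using lead_split[of t] by auto
  let ?e = "lead t"
  have lead0: "\<forall>x\<in>set A. c x = 0" if "c \<le> t" for c using s(2) that by (metis le_fun_def le_zero_eq)
  have R1: "q ^ (2 * a ?e) * Hf a = Hf a + (q^2 - 1) * star Hf (U ?e) a" if "flow a" "a \<le> t" for a
   using Hd_exchange[OF that(1) s(1) lead0[OF that(2)]] unfolding Hf_def[abs_def] by (simp add: algebra_simps)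
  have R2: "q ^ (2 * a ?e) * Yf a + (q^2 - 1) * star (U ?e) (%g. q ^ (2 * g ?e) * Yf g) a =
    Yf a + (q^2 - 1) * (q^2 * star Yf (U ?e) a)" if "flow a" "a \<le> t" for a
   using Yf_exchange[OF that(1) s(1) lead0[OF that(2)]] by (simp add: algebra_simps)
  let ?T = "%g. q ^ (2 * g ?e) * Yf g"
  have "q ^ (2 * t ?e) * star Hf Yf t = star (%f. q ^ (2 * f ?e) * Hf f) ?T t"
   unfolding star_def if_P[OF t] sum_distrib_left
  proof (rule sum.cong[OF refl])
   fix a assume "a \<in> subs t"
   then have "t ?e = a ?e + (t - a) ?e" using subsD(2) by (fastforce simp: le_fun_def)
   then have "2 * t ?e = 2 * a ?e + 2 * (t - a) ?e" by simp
   then have "q ^ (2 * t ?e) = q ^ (2 * a ?e) * q ^ (2 * (t - a) ?e)" by (metis power_add)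
   then show "q ^ (2 * t ?e) * (qp (cross a (t - a)) * Hf a * Yf (t - a)) =
     qp (cross a (t - a)) * (q ^ (2 * a ?e) * Hf a) * (q ^ (2 * (t - a) ?e) * Yf (t - a))"
    by (simp only: mult_ac)
  qed
  also have "\<dots> = star (%f. Hf f + (q^2 - 1) * star Hf (U ?e) f) ?T t"
   by (rule star_cong) (simp_all only: R1)
  also have "\<dots> = star Hf (%a. ?T a + (q^2 - 1) * star (U ?e) ?T a) t"
   by (simp only: star_add_left star_add_right star_scale_left star_scale_right star_assoc)
  also have "\<dots> = star Hf (%a. Yf a + (q^2 - 1) * (q^2 * star Yf (U ?e) a)) t"
   by (rule star_cong) (simp_all only: R2)
  also have "\<dots> = star Hf Yf t + (q^2 - 1) * (q^2 * star (star Hf Yf) (U ?e) t)"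
   by (simp only: star_add_right star_scale_right star_assoc)
  also have "star (star Hf Yf) (U ?e) t = star (%a. q ^ (2 * (deg t - 1)) * Hf a) (U ?e) t"
  proof (rule star_cong2)
   fix f assume f: "f \<in> subs t"
   show "star Hf Yf f * U ?e (t - f) = q ^ (2 * (deg t - 1)) * Hf f * U ?e (t - f)"
   proof (cases "U ?e (t - f) = 0")
    case False
    then have "deg (t - f) = 1" by (simp add: U_def split: if_splits)
    then have "deg f < deg t" "deg f = deg t - 1"
     using deg_plus[of f "t - f"] fun_le_add_diff(1)[OF subsD(2)[OF f]] by simp_all
    then show ?thesis using less.hyps[of f] subsD(1)[OF f] by simp
   qed simp
  qed
  also have "\<dots> = q ^ (2 * (deg t - 1)) * star Hf (U ?e) t" by (simp only: star_scale_left)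
  also have "(q^2 - 1) * (q^2 * (q ^ (2 * (deg t - 1)) * star Hf (U ?e) t)) =
    q ^ (2 * deg t) * ((q^2 - 1) * star Hf (U ?e) t)"
  proof -
   have "2 * deg t = 2 + 2 * (deg t - 1)" using False by simp
   then have "q ^ (2 * deg t) = q^2 * q ^ (2 * (deg t - 1))" by (metis power_add)
   then show ?thesis by (simp only: mult_ac)
  qed
  also have "(q^2 - 1) * star Hf (U ?e) t = (q ^ (2 * t ?e) - 1) * Hf t"
   using R1[OF t] by (simp add: algebra_simps)
  finally have "(q ^ (2 * t ?e) - 1) * star Hf Yf t = (q ^ (2 * t ?e) - 1) * (q ^ (2 * deg t) * Hf t)"
   by (simp add: algebra_simps)
  moreover have "q ^ (2 * t ?e) - 1 ~= 0" using pos by (intro q_pow_minus_1_nz) simp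
  ultimately show ?thesis by simp
 qed
qed

text \<open>The degree \<open>n\<close> part of \<open>Hf_Yf\<close>, with the right factor sorted
  by its degree.\<close>

lemma H_rec: "q ^ (2 * n) * H n t = (\<Sum>k\<le>n. (q^2 - 1) ^ k * star (H (n - k)) (X k) t)"
proof (cases "flow t")
 case True
 have dg: "deg t = deg f + deg (t - f)" if "f \<in> subs t" for f
  using deg_plus[of f "t - f"] fun_le_add_diff(1)[OF subsD(2)[OF that]] by simp
 have "(\<Sum>k\<le>n. (q^2 - 1) ^ k * star (H (n - k)) (X k) t) =
   (\<Sum>f\<in>subs t. \<Sum>k\<le>n. (q^2 - 1) ^ k * (qp (cross f (t - f)) * H (n - k) f * X k (t - f)))"
  unfolding star_def if_P[OF True] sum_distrib_left by (rule sum.swap)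
 also have "\<dots> = (\<Sum>f\<in>subs t. if deg t = n then qp (cross f (t - f)) * Hf f * Yf (t - f) else 0)"
 proof (rule sum.cong[OF refl])
  fix f assume f: "f \<in> subs t"
  let ?d = "deg (t - f)"
  have "(\<Sum>k\<le>n. (q^2 - 1) ^ k * (qp (cross f (t - f)) * H (n - k) f * X k (t - f))) =
    (\<Sum>k\<le>n. if k = ?d then (q^2 - 1) ^ ?d * (qp (cross f (t - f)) * H (n - ?d) f * X ?d (t - f)) else 0)"
   by (rule sum.cong) (auto simp: X_def)
  also have "\<dots> = (if ?d \<le> n then (q^2 - 1) ^ ?d * (qp (cross f (t - f)) * H (n - ?d) f * X ?d (t - f)) else 0)"
   by simp
  also have "\<dots> = (if deg t = n then qp (cross f (t - f)) * Hf f * Yf (t - f) else 0)"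
   using dg[OF f] subsD(1)[OF f] by (auto simp: H_def Hf_def Yf_def)
  finally show "(\<Sum>k\<le>n. (q^2 - 1) ^ k * (qp (cross f (t - f)) * H (n - k) f * X k (t - f))) =
    (if deg t = n then qp (cross f (t - f)) * Hf f * Yf (t - f) else 0)" .
 qed
 also have "\<dots> = (if deg t = n then star Hf Yf t else 0)" by (simp add: star_def True)
 also have "\<dots> = q ^ (2 * n) * H n t" using Hf_Yf[OF True] True by (simp add: H_def Hf_def)
 finally show ?thesis ..
qed (simp add: H_flow star_flow)

lemma X_comm: "star (X a) (X b) = star (X b) (X a)"
proof
 show "star (X a) (X b) t = star (X b) (X a) t" for t
  using X_comm_at by (cases "flow t") (auto simp: star_flow)
qed

end

section \<open>Newton identities\<close>

lemma sum_triangle_swap: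
 fixes f :: "nat => nat => 'a::comm_monoid_add"
 shows "(\<Sum>k=1..n. \<Sum>m=1..n-k. f m k) = (\<Sum>m=1..n. \<Sum>k=1..n-m. f m k)"
proof -
 have "(\<Sum>k=1..n. \<Sum>m=1..n-k. f m k) = (\<Sum>(k, m)\<in>(SIGMA k:{1..n}. {1..n-k}). f m k)"
  by (simp add: sum.Sigma)
 also have "\<dots> = (\<Sum>(m, k)\<in>(SIGMA m:{1..n}. {1..n-m}). f m k)"
  by (rule sum.reindex_bij_witness[where i = prod.swap and j = prod.swap]) auto
 also have "\<dots> = (\<Sum>m=1..n. \<Sum>k=1..n-m. f m k)" by (simp add: sum.Sigma)
 finally show ?thesis .
qed

lemma sum_triangle_shift:
 fixes f :: "nat => nat => 'a::comm_monoid_add"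
 shows "(\<Sum>k=1..n. \<Sum>m=1..k. f m (k - m)) = (\<Sum>m=1..n. \<Sum>k=0..n-m. f m k)"
proof -
 have "(\<Sum>k=1..n. \<Sum>m=1..k. f m (k - m)) = (\<Sum>(k, m)\<in>(SIGMA k:{1..n}. {1..k}). f m (k - m))"
  by (simp add: sum.Sigma)
 also have "\<dots> = (\<Sum>(m, k)\<in>(SIGMA m:{1..n}. {0..n-m}). f m k)"
  by (rule sum.reindex_bij_witness[where i = "%(m, k). (k + m, m)" and j = "%(k, m). (m, k - m)"]) auto
 also have "\<dots> = (\<Sum>m=1..n. \<Sum>k=0..n-m. f m k)" by (simp add: sum.Sigma)
 finally show ?thesis .
qed

context cweb
begin

text \<open>Newton's identities solved for the power sums, with the signs of complete functions: the
  series of the \<open>N m\<close> is u X'(u) / X(u). With this choice \<open>N m\<close> pairs with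
  p_m, without a sign, in the logarithm of the product of all X(x_i).\<close>

fun N :: "nat => ('e => nat) => qfield" where
 "N n = (%t. of_nat n * X n t - (\<Sum>m\<in>{1..<n}. star (N m) (X (n - m)) t))"

declare N.simps [simp del]

lemma N_flow: "\<not> flow t ==> N n t = 0"
 by (simp add: N.simps[of n] X_flow star_flow)

lemma X_newton: "of_nat n * X n t = (\<Sum>m=1..n. star (N m) (X (n - m)) t)"
proof (cases n)
 case (Suc k)
 have "{1..n} = insert n {1..<n}" using Suc by auto
 moreover have "star (N n) (X 0) = N n" by (simp add: X_0 star_unit_right N_flow)
 ultimately have "(\<Sum>m=1..n. star (N m) (X (n - m)) t) =
   N n t + (\<Sum>m\<in>{1..<n}. star (N m) (X (n - m)) t)" by simp
 then show ?thesis by (simp add: N.simps[of n])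
qed simp

lemma N_deg: "N n t ~= 0 ==> deg t = n"
proof (induction n arbitrary: t rule: less_induct)
 case (less n)
 show ?case
 proof (rule ccontr)
  assume "deg t ~= n"
  then have "X n t = 0" by (simp add: X_def)
  moreover have "star (N m) (X (n - m)) t = 0" if "m \<in> {1..<n}" for m
  proof (cases "flow t")
   case True
   have "qp (cross a (t - a)) * N m a * X (n - m) (t - a) = 0" if a: "a \<in> subs t" for a
   proof (rule ccontr)
    assume "\<not> ?thesis"
    then have "N m a ~= 0" "X (n - m) (t - a) ~= 0" by auto
    then have "deg a = m" "deg (t - a) = n - m"
     using less.IH \<open>m \<in> {1..<n}\<close> by (auto simp: X_def split: if_splits)
    then have "deg t = n" using deg_plus[of a "t - a"] fun_le_add_diff(1)[OF subsD(2)[OF a]] \<open>m \<in> {1..<n}\<close> by simp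
    with \<open>deg t ~= n\<close> show False by simp
   qed
   then have "(\<Sum>a\<in>subs t. qp (cross a (t - a)) * N m a * X (n - m) (t - a)) = 0"
    by (rule sum.neutral[OF ballI])
   then show ?thesis unfolding star_def by presburger
  qed (simp add: star_flow)
  ultimately have "N n t = 0" by (simp add: N.simps[of n])
  with less.prems show False by simp
 qed
qed

lemma N_comm: "star (N n) (X k) = star (X k) (N n)"
proof (induction n rule: less_induct)
 case (less n)
 have "star (N m) (star (X (n - m)) (X k)) = star (X k) (star (N m) (X (n - m)))" if "m \<in> {1..<n}" for m
  using less.IH[of m] that by (metis X_comm atLeastLessThan_iff star_assoc)
 then have "(%t. of_nat n * star (X n) (X k) t - (\<Sum>m\<in>{1..<n}. 1 * star (star (N m) (X (n - m))) (X k) t))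
   = (%t. of_nat n * star (X k) (X n) t - (\<Sum>m\<in>{1..<n}. 1 * star (X k) (star (N m) (X (n - m))) t))"
  by (simp add: X_comm[of n k] star_assoc)
 moreover have "N n = (%t. of_nat n * X n t - (\<Sum>m\<in>{1..<n}. 1 * star (N m) (X (n - m)) t))"
  by (simp add: N.simps[of n])
 ultimately show ?case
  by (simp only: star_diff_left star_diff_right star_scale_left star_scale_right star_lin_left star_lin_right)
qed

text \<open>By \<open>H_rec\<close> each \<open>H n\<close> is built from the \<open>X k\<close>
  alone, so whatever commutes with these commutes with \<open>H n\<close>.\<close>

lemma H_comm_aux:
 assumes "\<And>k. star F (X k) = star (X k) F" "\<And>t. \<not> flow t ==> F t = 0"
 shows "star F (H n) = star (H n) F"
proof (induction n rule: less_induct)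
 case (less n)
 show ?case
 proof (cases "n = 0")
  case True
  then show ?thesis by (simp add: H_0 star_unit_left star_unit_right assms(2))
 next
  case False
  \<comment> \<open>The term k = 0 of \<open>H_rec\<close> is \<open>H n\<close> itself; bringing it
    to the left leaves the factor q^(2n) - 1.\<close>
  define c where "c = 1 / (q ^ (2 * n) - 1)"
  have nz: "q ^ (2 * n) - 1 ~= 0" using False by (intro q_pow_minus_1_nz) auto
  have Hn: "H n = (%t. \<Sum>k\<in>{1..n}. (c * (q^2 - 1) ^ k) * star (H (n - k)) (X k) t)"
  proof
   fix t
   have "{..n} = insert 0 {1..n}" by auto
   then have "q ^ (2 * n) * H n t = star (H n) (X 0) t + (\<Sum>k\<in>{1..n}. (q^2 - 1) ^ k * star (H (n - k)) (X k) t)"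
    using H_rec[of n t] by simp
   also have "star (H n) (X 0) = H n" by (simp add: X_0 star_unit_right H_flow)
   finally have "(q ^ (2 * n) - 1) * H n t = (\<Sum>k\<in>{1..n}. (q^2 - 1) ^ k * star (H (n - k)) (X k) t)"
    by (simp add: algebra_simps)
   then have "H n t = c * (\<Sum>k\<in>{1..n}. (q^2 - 1) ^ k * star (H (n - k)) (X k) t)"
    using nz by (simp add: c_def field_simps)
   then show "H n t = (\<Sum>k\<in>{1..n}. (c * (q^2 - 1) ^ k) * star (H (n - k)) (X k) t)"
    by (simp add: sum_distrib_left mult.assoc)
  qed
  have "star F (star (H (n - k)) (X k)) = star (star (H (n - k)) (X k)) F" if "k \<in> {1..n}" for k
   using less.IH[of "n - k"] that assms(1) by (simp add: star_assoc[symmetric]) (simp add: star_assoc)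
  then show ?thesis
   by (subst (1 2) Hn) (simp add: star_lin_left star_lin_right)
 qed
qed

lemma N_H_comm: "star (N m) (H n) = star (H n) (N m)"
 by (rule H_comm_aux) (auto simp: N_comm N_flow)

text \<open>The solution of (q^(2m) - 1) \<open>hc m\<close> = (q^2 - 1)^m, which compares the
  coefficients of \<open>N m\<close> in the logarithmic derivatives of H(q^2 u) / H(u) and X((q^2 -
  1) u).\<close>

definition hc :: "nat => qfield" where
 "hc m = (q^2 - 1) ^ m / (q ^ (2 * m) - 1)"

text \<open>The logarithmic derivative of H(q^2 u) = H(u) X((q^2 - 1) u), carried out on
  coefficients. In each term of \<open>H_rec\<close> the factor n is split as (n - k) + k: the
  induction hypothesis treats the first part, \<open>X_newton\<close> the second. Both double sums
  are rearranged by the index of \<open>N m\<close> and folded back with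
  \<open>H_rec\<close>.\<close>

lemma H_newton: "of_nat n * H n t = (\<Sum>m=1..n. hc m * star (N m) (H (n - m)) t)"
proof (induction n arbitrary: t rule: less_induct)
 case (less n)
 let ?y = "q^2 - 1"
 define B where "B m i k = star (N m) (star (H i) (X k)) t" for m i k
 define D where "D m = star (N m) (H (n - m)) t" for m
 show ?case
 proof (cases "n = 0")
  case False
  have nz: "q ^ (2 * n) - 1 ~= 0" using False by (intro q_pow_minus_1_nz) auto
  have HX0: "star (H i) (X 0) = H i" for i by (simp add: X_0 star_unit_right H_flow)
  have rec: "q ^ (2 * i) * star F (H i) t = (\<Sum>k=0..i. ?y ^ k * star F (star (H (i - k)) (X k)) t)" for F i
  proof -
   have "(%t. q ^ (2 * i) * H i t) = (%t. \<Sum>k=0..i. ?y ^ k * star (H (i - k)) (X k) t)"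
    using H_rec[of i] by (simp add: atMost_atLeast0)
   then have "star F (%t. q ^ (2 * i) * H i t) t = star F (%t. \<Sum>k=0..i. ?y ^ k * star (H (i - k)) (X k) t) t"
    by simp
   then show ?thesis by (simp only: star_scale_right star_lin_right)
  qed
  have "q ^ (2 * n) * H n t = (\<Sum>k=0..n. ?y ^ k * star (H (n - k)) (X k) t)"
   using H_rec[of n t] by (simp add: atMost_atLeast0)
  also have "\<dots> = H n t + (\<Sum>k=1..n. ?y ^ k * star (H (n - k)) (X k) t)"
   by (subst sum.atLeast_Suc_atMost) (auto simp: HX0)
  finally have base: "(q ^ (2 * n) - 1) * H n t = (\<Sum>k=1..n. ?y ^ k * star (H (n - k)) (X k) t)"
   by (simp add: algebra_simps)
  have one: "of_nat (n - k) * star (H (n - k)) (X k) t = (\<Sum>m=1..n-k. hc m * B m (n - k - m) k)"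
   if "k \<in> {1..n}" for k
  proof -
   have "(%t. of_nat (n - k) * H (n - k) t) = (%t. \<Sum>m=1..n-k. hc m * star (N m) (H (n - k - m)) t)"
    using less.IH[of "n - k"] that by (auto simp: fun_eq_iff)
   then have "star (%t. of_nat (n - k) * H (n - k) t) (X k) t =
     star (%t. \<Sum>m=1..n-k. hc m * star (N m) (H (n - k - m)) t) (X k) t" by simp
   then show ?thesis by (simp only: star_scale_left star_lin_left star_assoc B_def)
  qed
  have sw: "star (H i) (star (N m) G) = star (N m) (star (H i) G)" for i m G
   by (metis N_H_comm star_assoc)
  have two: "of_nat k * star (H (n - k)) (X k) t = (\<Sum>m=1..k. B m (n - k) (k - m))" for k
  proof -
   have "(%t. of_nat k * X k t) = (%t. \<Sum>m=1..k. 1 * star (N m) (X (k - m)) t)"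
    using X_newton[of k] by simp
   then have "star (H (n - k)) (%t. of_nat k * X k t) t =
     star (H (n - k)) (%t. \<Sum>m=1..k. 1 * star (N m) (X (k - m)) t) t" by simp
   then show ?thesis
    unfolding star_scale_right star_lin_right sw B_def by simp
  qed
  have "(q ^ (2 * n) - 1) * (of_nat n * H n t) = (\<Sum>k=1..n. of_nat n * (?y ^ k * star (H (n - k)) (X k) t))"
   by (subst mult.left_commute) (simp only: base sum_distrib_left)
  also have "\<dots> = (\<Sum>k=1..n. ?y ^ k * (of_nat (n - k) * star (H (n - k)) (X k) t)
    + ?y ^ k * (of_nat k * star (H (n - k)) (X k) t))"
   (is "_ = (\<Sum>k=1..n. ?r k)")
  proof (rule sum.cong[OF refl])
   fix k assume "k \<in> {1..n}"
   then have "of_nat n = (of_nat (n - k) + of_nat k :: qfield)" by (simp add: of_nat_diff)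
   then show "of_nat n * (?y ^ k * star (H (n - k)) (X k) t) = ?r k"
    by (simp only: distrib_right distrib_left mult.left_commute)
  qed
  also have "\<dots> = (\<Sum>k=1..n. \<Sum>m=1..n-k. ?y ^ k * hc m * B m (n - k - m) k)
    + (\<Sum>k=1..n. \<Sum>m=1..k. ?y ^ m * (?y ^ (k - m) * B m (n - m - (k - m)) (k - m)))"
   unfolding sum.distrib
  proof (intro arg_cong2[of _ _ _ _ "(+)"] sum.cong refl)
   fix k assume k: "k \<in> {1..n}"
   show "?y ^ k * (of_nat (n - k) * star (H (n - k)) (X k) t) = (\<Sum>m=1..n-k. ?y ^ k * hc m * B m (n - k - m) k)"
    by (simp only: one[OF k] sum_distrib_left mult.assoc)
   show "?y ^ k * (of_nat k * star (H (n - k)) (X k) t) =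
     (\<Sum>m=1..k. ?y ^ m * (?y ^ (k - m) * B m (n - m - (k - m)) (k - m)))"
    unfolding two sum_distrib_left
   proof (rule sum.cong[OF refl])
    fix m assume m: "m \<in> {1..k}"
    then have "?y ^ k = ?y ^ m * ?y ^ (k - m)" by (simp add: power_add[symmetric])
    moreover have "n - k = n - m - (k - m)" using m by auto
    ultimately show "?y ^ k * B m (n - k) (k - m) = ?y ^ m * (?y ^ (k - m) * B m (n - m - (k - m)) (k - m))"
     by (simp only: mult.assoc)
   qed
  qed
  also have "(\<Sum>k=1..n. \<Sum>m=1..n-k. ?y ^ k * hc m * B m (n - k - m) k) =
    (\<Sum>m=1..n. hc m * (\<Sum>k=1..n-m. ?y ^ k * B m (n - m - k) k))"
  proof (subst sum_triangle_swap, unfold sum_distrib_left, intro sum.cong refl)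
   fix m k
   have "n - k - m = n - m - k" by simp
   then show "?y ^ k * hc m * B m (n - k - m) k = hc m * (?y ^ k * B m (n - m - k) k)"
    by (simp only: mult_ac)
  qed
  also have "(\<Sum>k=1..n. \<Sum>m=1..k. ?y ^ m * (?y ^ (k - m) * B m (n - m - (k - m)) (k - m))) =
    (\<Sum>m=1..n. ?y ^ m * (\<Sum>k=0..n-m. ?y ^ k * B m (n - m - k) k))"
   by (subst sum_triangle_shift[where f = "%m k. ?y ^ m * (?y ^ k * B m (n - m - k) k)"])
    (simp only: sum_distrib_left)
  also have "(\<Sum>m=1..n. hc m * (\<Sum>k=1..n-m. ?y ^ k * B m (n - m - k) k)) +
    (\<Sum>m=1..n. ?y ^ m * (\<Sum>k=0..n-m. ?y ^ k * B m (n - m - k) k)) =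
    (\<Sum>m=1..n. (q ^ (2 * n) - 1) * (hc m * D m))"
   unfolding sum.distrib[symmetric]
  proof (rule sum.cong[OF refl])
   fix m assume m: "m \<in> {1..n}"
   have s0: "(\<Sum>k=0..n-m. ?y ^ k * B m (n - m - k) k) = q ^ (2 * (n - m)) * D m"
    unfolding B_def D_def by (rule rec[symmetric])
   have "(\<Sum>k=0..n-m. ?y ^ k * B m (n - m - k) k) = D m + (\<Sum>k=1..n-m. ?y ^ k * B m (n - m - k) k)"
    by (subst sum.atLeast_Suc_atMost) (auto simp: B_def D_def HX0)
   then have s1: "(\<Sum>k=1..n-m. ?y ^ k * B m (n - m - k) k) = (q ^ (2 * (n - m)) - 1) * D m"
    using s0 by (simp add: algebra_simps)
   have "q ^ (2 * m) - 1 ~= 0" using m by (intro q_pow_minus_1_nz) auto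
   \<comment> \<open>After this the coefficient of \<open>hc m * D m\<close> is (q^(2 (n-m)) - 1) +
     (q^(2m) - 1) q^(2 (n-m)), which collapses to q^(2n) - 1.\<close>
   then have y: "?y ^ m = hc m * (q ^ (2 * m) - 1)" by (simp add: hc_def)
   have p: "q ^ (2 * m) * q ^ (2 * (n - m)) = q ^ (2 * n)"
    using m by (simp add: power_add[symmetric] mult_2)
   show "hc m * (\<Sum>k=1..n-m. ?y ^ k * B m (n - m - k) k) + ?y ^ m * (\<Sum>k=0..n-m. ?y ^ k * B m (n - m - k) k)
     = (q ^ (2 * n) - 1) * (hc m * D m)"
    unfolding s0 s1 y p[symmetric] by (simp add: algebra_simps)
  qed
  also have "\<dots> = (q ^ (2 * n) - 1) * (\<Sum>m=1..n. hc m * D m)" by (simp only: sum_distrib_left)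
  finally show ?thesis using nz unfolding D_def by (simp only: mult_cancel_left) blast
 qed simp
qed

section \<open>Products with one factor for each variable\<close>

primrec sp :: "(nat => ('e => nat) => qfield) => nat => ('e => nat) => qfield" where
 "sp f 0 = unit"
| "sp f (Suc K) = star (sp f K) (f (Suc K))"

lemma unit_flow: "\<not> flow t ==> unit t = 0"
 by (cases "t = 0") (simp_all add: unit_def)

lemma sp_flow: "\<not> flow t ==> sp f K t = 0"
 by (cases K) (simp_all add: unit_flow star_flow)

lemma sp_cong: "(\<And>i. i \<in> {1..K} ==> f i = g i) ==> sp f K = sp g K"
 by (induction K) auto

lemma sp_extend:
 assumes "K \<le> K'" "\<And>i. K < i ==> i \<le> K' ==> f i = unit"
 shows "sp f K' = sp f K"
 using assms
proof (induction K' rule: dec_induct)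
 case (step n)
 then have "sp f (Suc n) = star (sp f K) unit" by simp
 then show ?case by (simp add: star_unit_right sp_flow)
qed simp

lemma sp_deg:
 assumes "\<And>i t. f i t ~= 0 ==> deg t = d i"
 shows "sp f K t ~= 0 ==> deg t = (\<Sum>i=1..K. d i)"
proof (induction K arbitrary: t)
 case 0
 then have "t = 0" by (simp add: unit_def split: if_splits)
 then have "deg t = 0" by (simp only: deg_zero)
 then show ?case by simp
next
 case (Suc K)
 obtain a where a: "a \<in> subs t" "sp f K a ~= 0" "f (Suc K) (t - a) ~= 0"
  using Suc.prems star_eq_0[of t "sp f K" "f (Suc K)"] by auto
 have "deg t = deg a + deg (t - a)"
  using deg_plus[of a "t - a"] fun_le_add_diff(1)[OF subsD(2)[OF a(1)]] by simp
 then show ?case using Suc.IH[OF a(2)] assms[OF a(3)] by simp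
qed

end

text \<open>The families \<open>F\<close> below are the functions \<open>X\<close> and \<open>H\<close>.\<close>

locale newton_family = cweb E ins outs vs sl
 for E :: "'e set" and ins outs :: "'v => 'e list" and vs sl +
 fixes F :: "nat => ('e => nat) => qfield" and c :: "nat => qfield"
 assumes F_0: "F 0 = unit"
  and F_deg: "F n t ~= 0 ==> deg t = n"
  and F_flow: "\<not> flow t ==> F n t = 0"
  and N_F: "star (N m) (F n) = star (F n) (N m)"
  and newton: "of_nat n * F n t = (\<Sum>m=1..n. c m * star (N m) (F (n - m)) t)"
begin

lemma N_sp: "star (N m) (sp (%i. F (e i)) K) = star (sp (%i. F (e i)) K) (N m)"
proof (induction K)
 case 0
 then show ?case by (simp add: star_unit_left star_unit_right N_flow)
next
 case (Suc K)
 then show ?case by (metis N_F sp.simps(2) star_assoc)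
qed

text \<open>The product rule: Newton's identity is applied in one factor at a time, and
  \<open>N m\<close>, which commutes with all factors, is moved to the front.\<close>

lemma sp_newton:
 "of_nat (\<Sum>i=1..K. e i) * sp (%i. F (e i)) K t =
   (\<Sum>i=1..K. \<Sum>m=1..e i. c m * star (N m) (sp (%j. F ((e(i := e i - m)) j)) K) t)"
proof (induction K arbitrary: t)
 case 0
 then show ?case by simp
next
 case (Suc K)
 let ?S = "sp (%i. F (e i)) K" and ?G = "F (e (Suc K))"
 have "of_nat (\<Sum>i=1..K. e i) * star ?S ?G t = star (%t. of_nat (\<Sum>i=1..K. e i) * ?S t) ?G t"
  by (simp only: star_scale_left)
 also have "\<dots> = star (%t. \<Sum>i=1..K. 1 * (\<Sum>m=1..e i. c m * star (N m) (sp (%j. F ((e(i := e i - m)) j)) K) t)) ?G t"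
  by (simp only: Suc.IH mult_1)
 also have "\<dots> = (\<Sum>i=1..K. 1 * (\<Sum>m=1..e i. c m * star (N m) (star (sp (%j. F ((e(i := e i - m)) j)) K) ?G) t))"
  by (simp only: star_lin_left star_assoc)
 also have "\<dots> = (\<Sum>i=1..K. \<Sum>m=1..e i. c m * star (N m) (sp (%j. F ((e(i := e i - m)) j)) (Suc K)) t)"
 proof (simp only: mult_1, intro sum.cong refl)
  fix i m assume "i \<in> {1..K}"
  then have "(e(i := e i - m)) (Suc K) = e (Suc K)" by simp
  then show "c m * star (N m) (star (sp (%j. F ((e(i := e i - m)) j)) K) ?G) t =
    c m * star (N m) (sp (%j. F ((e(i := e i - m)) j)) (Suc K)) t" by simp
 qed
 finally have 1: "of_nat (\<Sum>i=1..K. e i) * star ?S ?G t =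
   (\<Sum>i=1..K. \<Sum>m=1..e i. c m * star (N m) (sp (%j. F ((e(i := e i - m)) j)) (Suc K)) t)" .
 have "of_nat (e (Suc K)) * star ?S ?G t = star ?S (%t. of_nat (e (Suc K)) * ?G t) t"
  by (simp only: star_scale_right)
 also have "\<dots> = (\<Sum>m=1..e (Suc K). c m * star ?S (star (N m) (F (e (Suc K) - m))) t)"
  by (simp only: newton star_lin_right)
 also have "\<dots> = (\<Sum>m=1..e (Suc K). c m * star (N m) (sp (%j. F ((e(Suc K := e (Suc K) - m)) j)) (Suc K)) t)"
 proof (intro sum.cong refl)
  fix m
  have "sp (%j. F ((e(Suc K := e (Suc K) - m)) j)) K = ?S" by (rule sp_cong) auto
  then have "star (N m) (sp (%j. F ((e(Suc K := e (Suc K) - m)) j)) (Suc K)) = star (star (N m) ?S) (F (e (Suc K) - m))"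
   by (simp add: star_assoc)
  also have "\<dots> = star ?S (star (N m) (F (e (Suc K) - m)))" by (simp add: N_sp star_assoc)
  finally show "c m * star ?S (star (N m) (F (e (Suc K) - m))) t =
    c m * star (N m) (sp (%j. F ((e(Suc K := e (Suc K) - m)) j)) (Suc K)) t" by simp
 qed
 finally show ?case using 1 by (simp add: distrib_right)
qed

definition kmax :: "(nat \<Rightarrow>\<^sub>0 nat) => nat" where "kmax \<mu> = Max (insert 0 (pkeys \<mu>))"

text \<open>With F(u) the series of the \<open>F n\<close>, this is the coefficient of x^\<mu> in
  the ordered product of the F(x_i), evaluated at the flow \<open>t\<close>. Because
  \<open>F 0\<close> is the unit, factors beyond the last occurring variable do not matter
  (\<open>ser_eq\<close>).\<close>

definition ser :: "('e => nat) => series" where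
 "ser t \<mu> = (if pkeys \<mu> \<subseteq> {1..} then sp (%i. F (lkp \<mu> i)) (kmax \<mu>) t else 0)"

lemma ser_eq:
 assumes "pkeys \<mu> \<subseteq> {1..K}"
 shows "ser t \<mu> = sp (%i. F (lkp \<mu> i)) K t"
proof -
 have "kmax \<mu> \<le> K" using assms unfolding kmax_def by (intro Max.boundedI) auto
 moreover have "F (lkp \<mu> i) = unit" if "kmax \<mu> < i" for i
 proof -
  have "i \<notin> pkeys \<mu>" using that Max_ge[of "insert 0 (pkeys \<mu>)" i] by (auto simp: kmax_def)
  then show ?thesis by (simp add: in_keys_iff F_0)
 qed
 ultimately have "sp (%i. F (lkp \<mu> i)) K = sp (%i. F (lkp \<mu> i)) (kmax \<mu>)" by (intro sp_extend) auto
 then show ?thesis using assms by (auto simp: ser_def)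
qed

lemma keys_kmax: "pkeys \<mu> \<subseteq> {1..} ==> pkeys \<mu> \<subseteq> {1..kmax \<mu>}"
 using Max_ge[of "insert 0 (pkeys \<mu>)"] by (auto simp: kmax_def)

text \<open>Euler's identity for the product of the F(x_i): its logarithmic derivative is the sum of
  the c m \<open>N m\<close> p_m. The result is a recursion on the degree in which the variables
  enter only through power sums; symmetry and the effect of the substitution both follow from
  it.\<close>

lemma ser_newton:
 assumes t: "flow t"
 shows "of_nat (deg t) * ser t \<mu> = (\<Sum>m=1..deg t. \<Sum>a\<in>{a \<in> subs t. deg a = m}.
  c m * qp (cross a (t - a)) * N m a * series_mult (power_sum m) (ser (t - a)) \<mu>)"
proof (cases "pkeys \<mu> \<subseteq> {1..}")
 case False
 from False obtain j where "j \<in> pkeys \<mu>" "\<not> j \<ge> 1" by auto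
 then have k0: "0 \<in> pkeys \<mu>" by (cases j) auto
 have "series_mult (power_sum m) (ser s) \<mu> = 0" if "m \<ge> 1" for m s
  unfolding power_sum_mult[OF that]
 proof (intro sum.neutral ballI)
  fix i assume "i \<in> {i \<in> pkeys \<mu>. 1 \<le> i \<and> m \<le> lkp \<mu> i}"
  with k0 have "0 \<in> pkeys (\<mu> - sgl i m)" by (auto simp: in_keys_iff lookup_minus lookup_single)
  then show "ser s (\<mu> - sgl i m) = 0" by (auto simp: ser_def)
 qed
 moreover have "ser t \<mu> = 0" using False by (simp add: ser_def)
 ultimately show ?thesis by simp
next
 case True
 define K where "K = kmax \<mu>"
 have keys: "pkeys \<mu> \<subseteq> {1..K}" unfolding K_def by (rule keys_kmax[OF True])
 let ?e = "lkp \<mu>"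
 define S where "S i m = sp (%j. F ((?e(i := ?e i - m)) j)) K" for i m
 have S: "S i m s = ser s (\<mu> - sgl i m)" for i m s
 proof -
  have "pkeys (\<mu> - sgl i m) \<subseteq> {1..K}" using keys keys_minus_single(2)[of \<mu> i m] by blast
  moreover have "lkp (\<mu> - sgl i m) = ?e(i := ?e i - m)"
   by (auto simp: fun_eq_iff lookup_minus lookup_single when_def)
  ultimately show ?thesis by (simp add: ser_eq S_def)
 qed
 have degs: "sp (%i. F (e i)) K s ~= 0 ==> deg s = (\<Sum>i=1..K. e i)" for e s
  by (rule sp_deg) (rule F_deg)
 have star0: "star (N m) (S i m) t = (\<Sum>a\<in>{a \<in> subs t. deg a = m}. qp (cross a (t - a)) * N m a * S i m (t - a))" for i m
  unfolding star_def if_P[OF t]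
  by (rule sum.mono_neutral_right) (use t N_deg in \<open>auto\<close>)
 have "of_nat (deg t) * ser t \<mu> = of_nat (\<Sum>i=1..K. ?e i) * ser t \<mu>"
  using degs[of ?e t] unfolding ser_eq[OF keys] by (cases "sp (%i. F (?e i)) K t = 0") auto
 also have "\<dots> = (\<Sum>i=1..K. \<Sum>m=1..?e i. c m * star (N m) (S i m) t)"
  unfolding ser_eq[OF keys] S_def by (rule sp_newton)
 also have "\<dots> = (\<Sum>i=1..K. \<Sum>m=1..deg t. if m \<le> ?e i then c m * star (N m) (S i m) t else 0)"
 proof (rule sum.cong[OF refl])
  fix i assume i: "i \<in> {1..K}"
  show "(\<Sum>m=1..?e i. c m * star (N m) (S i m) t) = (\<Sum>m=1..deg t. if m \<le> ?e i then c m * star (N m) (S i m) t else 0)"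
  proof (cases "deg t = (\<Sum>i=1..K. ?e i)")
   case True
   then have "?e i \<le> deg t" using member_le_sum[of i "{1..K}" ?e] i by simp
   then have "{1..?e i} = {m \<in> {1..deg t}. m \<le> ?e i}" by auto
   then show ?thesis by (simp only: sum.inter_filter[OF finite_atLeastAtMost])
  next
   \<comment> \<open>If the exponents do not add up to the degree of \<open>t\<close>, all terms
     vanish for degree reasons, so the range up to \<open>deg t\<close> is correct in this case
     too.\<close>
   case False
   have "star (N m) (S i m) t = 0" if "m \<le> ?e i" for m
   proof (rule star_eq_0, rule ccontr)
    fix a assume a: "a \<in> subs t" and nz: "\<not> (N m a = 0 \<or> S i m (t - a) = 0)"
    then have "deg a = m" "deg (t - a) = (\<Sum>j=1..K. (?e(i := ?e i - m)) j)"
     using N_deg degs by (auto simp: S_def)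
    moreover have "(\<Sum>j=1..K. (?e(i := ?e i - m)) j) + m = (\<Sum>j=1..K. ?e j)"
    proof -
     have "(\<Sum>j\<in>{1..K} - {i}. (?e(i := ?e i - m)) j) = (\<Sum>j\<in>{1..K} - {i}. ?e j)"
      by (rule sum.cong) auto
     then have "(\<Sum>j=1..K. (?e(i := ?e i - m)) j) = (?e i - m) + (\<Sum>j\<in>{1..K} - {i}. ?e j)"
      using sum.remove[OF finite_atLeastAtMost i, of "?e(i := ?e i - m)"] by simp
     then show ?thesis using sum.remove[OF finite_atLeastAtMost i, of ?e] that by simp
    qed
    moreover have "deg t = deg a + deg (t - a)"
     using deg_plus[of a "t - a"] fun_le_add_diff(1)[OF subsD(2)[OF a]] by simp
    ultimately show False using False by simp
   qed
   then show ?thesis by (simp add: sum.neutral)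
  qed
 qed
 also have "\<dots> = (\<Sum>m=1..deg t. \<Sum>i=1..K. if m \<le> ?e i then c m * star (N m) (S i m) t else 0)"
  by (rule sum.swap)
 also have "\<dots> = (\<Sum>m=1..deg t. \<Sum>a\<in>{a \<in> subs t. deg a = m}.
  c m * qp (cross a (t - a)) * N m a * series_mult (power_sum m) (ser (t - a)) \<mu>)"
 proof (rule sum.cong[OF refl])
  fix m assume "m \<in> {1..deg t}"
  then have m: "m \<ge> 1" by simp
  have I: "{i \<in> pkeys \<mu>. 1 \<le> i \<and> m \<le> ?e i} = {i \<in> {1..K}. m \<le> ?e i}"
  proof -
   have "i \<in> pkeys \<mu>" if "m \<le> ?e i" for i using that m by (simp add: in_keys_iff)
   then show ?thesis using keys by auto
  qed
  have "(\<Sum>i=1..K. if m \<le> ?e i then c m * star (N m) (S i m) t else 0) =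
    (\<Sum>i\<in>{i \<in> {1..K}. m \<le> ?e i}. c m * star (N m) (S i m) t)"
   by (simp only: sum.inter_filter[OF finite_atLeastAtMost])
  also have "\<dots> = (\<Sum>i\<in>{i \<in> {1..K}. m \<le> ?e i}. \<Sum>a\<in>{a \<in> subs t. deg a = m}.
    c m * qp (cross a (t - a)) * N m a * ser (t - a) (\<mu> - sgl i m))"
   by (simp only: star0 S sum_distrib_left mult.assoc)
  also have "\<dots> = (\<Sum>a\<in>{a \<in> subs t. deg a = m}. \<Sum>i\<in>{i \<in> {1..K}. m \<le> ?e i}.
    c m * qp (cross a (t - a)) * N m a * ser (t - a) (\<mu> - sgl i m))" by (rule sum.swap)
  also have "\<dots> = (\<Sum>a\<in>{a \<in> subs t. deg a = m}.
    c m * qp (cross a (t - a)) * N m a * series_mult (power_sum m) (ser (t - a)) \<mu>)"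
   by (simp only: power_sum_mult[OF m] I sum_distrib_left)
  finally show "(\<Sum>i=1..K. if m \<le> ?e i then c m * star (N m) (S i m) t else 0) =
    (\<Sum>a\<in>{a \<in> subs t. deg a = m}.
    c m * qp (cross a (t - a)) * N m a * series_mult (power_sum m) (ser (t - a)) \<mu>)" .
 qed
 finally show ?thesis .
qed

lemma ser_newton':
 assumes t: "flow t"
 shows "series_scale (of_nat (deg t)) (ser t) = (\<Sum>m=1..deg t. \<Sum>a\<in>{a \<in> subs t. deg a = m}.
  series_scale (c m * qp (cross a (t - a)) * N m a) (series_mult (power_sum m) (ser (t - a))))"
proof
 show "series_scale (of_nat (deg t)) (ser t) \<mu> = (\<Sum>m=1..deg t. \<Sum>a\<in>{a \<in> subs t. deg a = m}.
  series_scale (c m * qp (cross a (t - a)) * N m a) (series_mult (power_sum m) (ser (t - a)))) \<mu>" for \<mu>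
  unfolding sum_apply series_scale_def by (rule ser_newton[OF t])
qed

lemma ser_zero: "ser 0 = series_one"
proof
 fix \<mu> :: "nat \<Rightarrow>\<^sub>0 nat"
 show "ser 0 \<mu> = series_one \<mu>"
 proof (cases "\<mu> = 0")
  case True
  then have "ser 0 \<mu> = sp (%i. F (lkp \<mu> i)) 0 0" by (intro ser_eq) simp
  then show ?thesis using True by (simp add: series_one_def unit_def)
 next
  case False
  then obtain i where i: "i \<in> pkeys \<mu>" by (metis all_not_in_conv keys_eq_empty)
  have "ser 0 \<mu> = 0"
  proof (rule ccontr)
   assume nz: "ser 0 \<mu> ~= 0"
   then have k: "pkeys \<mu> \<subseteq> {1..}" by (auto simp: ser_def split: if_splits)
   have "deg 0 = (\<Sum>i=1..kmax \<mu>. lkp \<mu> i)"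
    using nz unfolding ser_eq[OF keys_kmax[OF k]] by (intro sp_deg) (auto intro: F_deg)
   moreover have "i \<in> {1..kmax \<mu>}" using i keys_kmax[OF k] by blast
   ultimately have "lkp \<mu> i = 0" by (metis deg_zero finite_atLeastAtMost sum_eq_0_iff)
   with i show False by (simp add: in_keys_iff)
  qed
  then show ?thesis using False by (simp add: series_one_def)
 qed
qed

lemma ser_sym: "flow t ==> ser t \<in> sym_functions"
proof (induction "deg t" arbitrary: t rule: less_induct)
 case less
 show ?case
 proof (cases "deg t = 0")
  case True
  then have "t = 0" using less.prems by (simp add: deg_eq_0)
  then show ?thesis by (simp add: ser_zero sym_functions_one)
 next
  case False
  have "ser t = series_scale (1 / of_nat (deg t)) (series_scale (of_nat (deg t)) (ser t))"
   using False by (simp add: series_scale_def)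
  moreover have "series_scale (of_nat (deg t)) (ser t) \<in> sym_functions"
   unfolding ser_newton'[OF less.prems]
  proof (intro sym_functions_sum sym_functions_scale)
   fix m a assume m: "m \<in> {1..deg t}" and "a \<in> {a \<in> subs t. deg a = m}"
   then have a: "a \<in> subs t" "deg a = m" by auto
   have "deg (t - a) < deg t" using m a by (simp add: deg_minus subsD)
   then have "ser (t - a) \<in> sym_functions" using less.hyps flow_subs_minus[OF less.prems a(1)] by blast
   then show "series_mult (power_sum m) (ser (t - a)) \<in> sym_functions"
    using m by (intro sym_functions_power_sum_mult) auto
  qed
  ultimately show ?thesis using sym_functions_scale by metis
 qed
qed

end

section \<open>The substitution on the generating series\<close>

context cweb
begin

lemma newton_family_X: "newton_family E ins outs vs sl X (%_. 1)"
proof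
 show "X n t ~= 0 ==> deg t = n" for n t by (simp add: X_def split: if_splits)
 show "of_nat n * X n t = (\<Sum>m=1..n. 1 * star (N m) (X (n - m)) t)" for n t by (simp add: X_newton)
qed (rule X_0, erule X_flow, rule N_comm)

lemma newton_family_H: "newton_family E ins outs vs sl H hc"
proof
 show "H n t ~= 0 ==> deg t = n" for n t by (simp add: H_def split: if_splits)
qed (rule H_0, erule H_flow, rule N_H_comm, rule H_newton)

interpretation sX: newton_family E ins outs vs sl X "%_. 1" by (rule newton_family_X)
interpretation sH: newton_family E ins outs vs sl H hc by (rule newton_family_H)

lemma hc_eq: "m \<ge> 1 ==> (q - inverse q) ^ m * pweight m = hc m"
proof -
 assume m: "m \<ge> 1"
 have "q * (q - inverse q) = q^2 - 1" by (simp add: right_diff_distrib power2_eq_square)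
 then have 1: "q ^ m * (q - inverse q) ^ m = (q^2 - 1) ^ m" by (metis power_mult_distrib)
 have 2: "q ^ m * (q ^ m - inverse q ^ m) = q ^ (2 * m) - 1"
 proof -
  have "q ^ m * q ^ m = q ^ (2 * m)" by (simp add: power_add[symmetric] mult_2)
  moreover have "q ^ m * inverse q ^ m = 1" by (simp add: power_inverse)
  ultimately show ?thesis by (simp only: right_diff_distrib)
 qed
 have "(q - inverse q) ^ m * pweight m = (q ^ m * (q - inverse q) ^ m) / (q ^ m * (q ^ m - inverse q ^ m))"
  by simp
 then show ?thesis unfolding 1 2 by (simp add: hc_def)
qed

text \<open>Both sides obey the recursion \<open>ser_newton'\<close>. The substitution multiplies
  the term of p_m by \<open>pweight m\<close>, and the share (q - q^-1)^m of the prefactor turns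
  this weight into \<open>hc m\<close>.\<close>

lemma plethysm_ser_X: "flow t ==> series_scale ((q - inverse q) ^ deg t) (plethysm (sX.ser t)) = sH.ser t"
proof (induction "deg t" arbitrary: t rule: less_induct)
 case less
 note t = less.prems
 let ?c = "q - inverse q"
 show ?case
 proof (cases "deg t = 0")
  case True
  then have "t = 0" using t by (simp add: deg_eq_0)
  then show ?thesis by (simp add: sX.ser_zero sH.ser_zero plethysm_one)
 next
  case False
  let ?A = "%m. {a \<in> subs t. deg a = m}"
  have sy: "sX.ser (t - a) \<in> sym_functions" if "a \<in> subs t" for a
   by (rule sX.ser_sym) (rule flow_subs_minus[OF t that])
  have ps: "series_mult (power_sum m) (sX.ser (t - a)) \<in> sym_functions" if "m \<ge> 1" "a \<in> subs t" for m a
   using that sy by (intro sym_functions_power_sum_mult) auto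
  have "series_scale (of_nat (deg t)) (plethysm (sX.ser t)) = plethysm (series_scale (of_nat (deg t)) (sX.ser t))"
   using plethysm_scale[OF sX.ser_sym[OF t]] by simp
  also have "\<dots> = (\<Sum>m=1..deg t. \<Sum>a\<in>?A m. plethysm (series_scale (qp (cross a (t - a)) * N m a)
    (series_mult (power_sum m) (sX.ser (t - a)))))"
   unfolding sX.ser_newton'[OF t]
   by (subst plethysm_sum, intro sym_functions_sum sym_functions_scale ps, simp, simp,
     intro sum.cong refl, subst plethysm_sum) (auto intro!: sym_functions_scale ps)
  also have "\<dots> = (\<Sum>m=1..deg t. \<Sum>a\<in>?A m. series_scale (qp (cross a (t - a)) * N m a * pweight m)
    (series_mult (power_sum m) (plethysm (sX.ser (t - a)))))"
  proof (intro sum.cong refl)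
   fix m a assume "m \<in> {1..deg t}" "a \<in> ?A m"
   then have m: "m \<ge> 1" and a: "a \<in> subs t" by auto
   show "plethysm (series_scale (qp (cross a (t - a)) * N m a) (series_mult (power_sum m) (sX.ser (t - a)))) =
     series_scale (qp (cross a (t - a)) * N m a * pweight m) (series_mult (power_sum m) (plethysm (sX.ser (t - a))))"
    by (simp only: plethysm_scale[OF ps[OF m a]] plethysm_mult[OF power_sum_sym[OF m] sy[OF a]]
      plethysm_power_sum[OF m] series_mult_scale_left sv.scale_scale)
  qed
  finally have "series_scale (?c ^ deg t) (series_scale (of_nat (deg t)) (plethysm (sX.ser t))) =
    (\<Sum>m=1..deg t. \<Sum>a\<in>?A m. series_scale (?c ^ deg t * (qp (cross a (t - a)) * N m a * pweight m))
    (series_mult (power_sum m) (plethysm (sX.ser (t - a)))))"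
   by (simp only: sv.scale_sum_right sv.scale_scale)
  also have "\<dots> = (\<Sum>m=1..deg t. \<Sum>a\<in>?A m. series_scale (hc m * qp (cross a (t - a)) * N m a)
    (series_mult (power_sum m) (sH.ser (t - a))))"
  proof (intro sum.cong refl)
   fix m a assume m: "m \<in> {1..deg t}" and "a \<in> ?A m"
   then have a: "a \<in> subs t" "deg a = m" by auto
   have d: "deg (t - a) = deg t - m" using a by (simp add: deg_minus subsD)
   then have lt: "deg (t - a) < deg t" using m by auto
   have IH: "sH.ser (t - a) = series_scale (?c ^ (deg t - m)) (plethysm (sX.ser (t - a)))"
    using less.hyps[OF lt flow_subs_minus[OF t a(1)]] d by simp
   have p1: "?c ^ deg t = ?c ^ m * ?c ^ (deg t - m)" using m by (simp add: power_add[symmetric])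
   have p2: "?c ^ m * pweight m = hc m" using m by (intro hc_eq) auto
   have e: "?c ^ deg t * (qp (cross a (t - a)) * N m a * pweight m) =
     hc m * qp (cross a (t - a)) * N m a * ?c ^ (deg t - m)"
    unfolding p1 p2[symmetric] by (simp only: mult_ac)
   show "series_scale (?c ^ deg t * (qp (cross a (t - a)) * N m a * pweight m))
     (series_mult (power_sum m) (plethysm (sX.ser (t - a)))) =
     series_scale (hc m * qp (cross a (t - a)) * N m a) (series_mult (power_sum m) (sH.ser (t - a)))"
    unfolding IH e series_mult_scale_right sv.scale_scale ..
  qed
  also have "\<dots> = series_scale (of_nat (deg t)) (sH.ser t)" by (rule sH.ser_newton'[OF t, symmetric])
  finally have "series_scale (of_nat (deg t)) (series_scale (?c ^ deg t) (plethysm (sX.ser t))) =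
    series_scale (of_nat (deg t)) (sH.ser t)" by (simp only: sv.scale_scale mult.commute)
  then show ?thesis using False by (simp add: series_scale_def fun_eq_iff)
 qed
qed

end

lemma qp_nat: "qp (int n) = q ^ n"
 by simp

section \<open>Peeling off the smallest label\<close>

lemma qint_mult: "(q^2 - 1) * qint n = q * (q ^ n - inverse q ^ n)"
proof -
 have "q - inverse q ~= 0" using q_diff_nz[of 1] by simp
 moreover have 1: "q^2 - 1 = q * (q - inverse q)" by (simp add: right_diff_distrib power2_eq_square)
 ultimately have 2: "(q - inverse q) * qint n = q ^ n - inverse q ^ n" by (simp add: qint_def)
 show ?thesis by (simp only: 1 mult.assoc 2)
qed

text \<open>Let S be the total and s_i the partial sums. The i-th summand is q^(S+1) (q^(-2 s_{i-1})
  - q^(-2 s_i)), so the sum telescopes to q (q^S - q^-S).\<close>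

lemma qint_telescope:
 fixes x :: "nat => nat"
 shows "(\<Sum>i=1..K. qp (int (\<Sum>j\<in>{i<..K}. x j) - int (\<Sum>j=1..i. x j) + 1) * (q ^ (2 * x i) - 1)) =
   (q^2 - 1) * qint (\<Sum>i=1..K. x i)"
proof (induction K)
 case 0
 then show ?case by (simp add: qint_def)
next
 case (Suc K)
 let ?S = "\<Sum>i=1..K. x i" and ?y = "x (Suc K)"
 have "(\<Sum>i=1..K. qp (int (\<Sum>j\<in>{i<..Suc K}. x j) - int (\<Sum>j=1..i. x j) + 1) * (q ^ (2 * x i) - 1)) =
   (\<Sum>i=1..K. q ^ ?y * (qp (int (\<Sum>j\<in>{i<..K}. x j) - int (\<Sum>j=1..i. x j) + 1) * (q ^ (2 * x i) - 1)))"
 proof (rule sum.cong[OF refl])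
  fix i assume "i \<in> {1..K}"
  then have "{i<..Suc K} = insert (Suc K) {i<..K}" by auto
  then have "int (\<Sum>j\<in>{i<..Suc K}. x j) - int (\<Sum>j=1..i. x j) + 1 =
    int ?y + (int (\<Sum>j\<in>{i<..K}. x j) - int (\<Sum>j=1..i. x j) + 1)" by simp
  then show "qp (int (\<Sum>j\<in>{i<..Suc K}. x j) - int (\<Sum>j=1..i. x j) + 1) * (q ^ (2 * x i) - 1) =
    q ^ ?y * (qp (int (\<Sum>j\<in>{i<..K}. x j) - int (\<Sum>j=1..i. x j) + 1) * (q ^ (2 * x i) - 1))"
   by (simp only: qp_add qp_nat mult.assoc)
 qed
 also have "\<dots> = q ^ ?y * ((q^2 - 1) * qint ?S)" by (simp only: sum_distrib_left[symmetric] Suc.IH)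
 finally have *: "(\<Sum>i=1..K. qp (int (\<Sum>j\<in>{i<..Suc K}. x j) - int (\<Sum>j=1..i. x j) + 1) * (q ^ (2 * x i) - 1)) =
   q ^ ?y * ((q^2 - 1) * qint ?S)" .
 have split: "(\<Sum>i=1..Suc K. G i) = G (Suc K) + (\<Sum>i=1..K. G i)" for G :: "nat => qfield"
  by simp
 have last: "int (\<Sum>j\<in>{Suc K<..Suc K}. x j) - int (\<Sum>j=1..Suc K. x j) + 1 = 1 - int (?S + ?y)" by simp
 have "(\<Sum>i=1..Suc K. qp (int (\<Sum>j\<in>{i<..Suc K}. x j) - int (\<Sum>j=1..i. x j) + 1) * (q ^ (2 * x i) - 1)) =
   q ^ ?y * (q * (q ^ ?S - inverse q ^ ?S)) + qp (1 - int (?S + ?y)) * (q ^ (2 * ?y) - 1)"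
  unfolding split last * qint_mult by (simp only: add.commute)
 also have "qp (1 - int (?S + ?y)) = q * inverse q ^ ?S * inverse q ^ ?y"
 proof -
  have "qp (1 - int n) = q * inverse q ^ n" for n
   by (simp add: power_int_diff power_inverse divide_inverse)
  then show ?thesis by (simp only: power_add mult.assoc)
 qed
 also have "q ^ (2 * ?y) = q ^ ?y * q ^ ?y" by (simp add: power_add[symmetric] mult_2)
 also have "q ^ ?y * (q * (q ^ ?S - inverse q ^ ?S)) + q * inverse q ^ ?S * inverse q ^ ?y * (q ^ ?y * q ^ ?y - 1) =
   q * (q ^ ?S * q ^ ?y - inverse q ^ ?S * inverse q ^ ?y)"
 proof -
  have 1: "inverse q ^ ?y * q ^ ?y = 1" by (simp add: power_inverse)
  have "inverse q ^ ?y * (q ^ ?y * q ^ ?y - 1) = (inverse q ^ ?y * q ^ ?y) * q ^ ?y - inverse q ^ ?y"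
   by (simp add: algebra_simps)
  also have "\<dots> = q ^ ?y - inverse q ^ ?y" using 1 by simp
  finally have "q * inverse q ^ ?S * inverse q ^ ?y * (q ^ ?y * q ^ ?y - 1) =
    q * inverse q ^ ?S * (q ^ ?y - inverse q ^ ?y)" by (simp only: mult.assoc)
  then show ?thesis by (simp add: algebra_simps)
 qed
 also have "\<dots> = (q^2 - 1) * qint (\<Sum>i=1..Suc K. x i)" by (simp add: qint_mult power_add)
 finally show ?case .
qed

lemma sum_list_indicator:
 assumes "distinct xs" "disjoint_family_on S (set xs)"
 shows "sum_list (map (%x. if m \<in> S x then 1 else 0) xs) = (if m \<in> (\<Union>x\<in>set xs. S x) then 1 else 0 :: nat)"
 using assms
proof (induction xs)
 case (Cons x xs)
 have "S x \<inter> (\<Union>y\<in>set xs. S y) = {}" "disjoint_family_on S (set xs)"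
  using Cons.prems by (auto simp: disjoint_family_on_def)
 then show ?case using Cons by auto
qed simp

lemma sum_by_colour:
 fixes g :: "nat => int"
 assumes "finite S" "\<And>v. v \<in> S ==> \<sigma> v \<in> {1..K}"
 shows "(\<Sum>v\<in>S. g (\<sigma> v)) = (\<Sum>j=1..K. int (card {v \<in> S. \<sigma> v = j}) * g j)"
proof -
 have "(\<Sum>v\<in>S. g (\<sigma> v)) = (\<Sum>j=1..K. \<Sum>v\<in>{v \<in> S. \<sigma> v = j}. g (\<sigma> v))"
  by (rule sum.group[symmetric]) (use assms in auto)
 also have "\<dots> = (\<Sum>j=1..K. int (card {v \<in> S. \<sigma> v = j}) * g j)"
  by (intro sum.cong refl) simp
 finally show ?thesis .
qed

section \<open>Families of flows and labelled decompositions\<close>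

context cweb
begin

primrec pc :: "nat => (nat => 'e => nat) => int" where
 "pc 0 T = 0"
| "pc (Suc K) T = pc K T + (\<Sum>i=1..K. cross (T i) (T (Suc K)))"

lemma pc_cong: "(\<And>i. i \<in> {1..K} ==> T i = T' i) ==> pc K T = pc K T'"
 by (induction K) auto

text \<open>Bilinearity of \<open>cross\<close>. Crossings of \<open>f\<close> with the rest of
  \<open>T i\<close> do not occur, because both belong to the same colour.\<close>

lemma pc_remove:
 assumes "i \<in> {1..K}" "f \<le> T i"
 shows "pc K T = pc K (T(i := T i - f)) + (\<Sum>j\<in>{1..<i}. cross (T j) f) + (\<Sum>j\<in>{i<..K}. cross f (T j))"
 using assms
proof (induction K)
 case (Suc K)
 let ?T = "T(i := T i - f)"
 show ?case
 proof (cases "i = Suc K")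
  case True
  have "pc K ?T = pc K T" by (rule pc_cong) (use True in auto)
  moreover have "(\<Sum>j=1..K. cross (T j) (T (Suc K))) = (\<Sum>j=1..K. cross (?T j) (?T (Suc K))) + (\<Sum>j=1..K. cross (T j) f)"
   unfolding sum.distrib[symmetric]
  proof (rule sum.cong[OF refl])
   fix j assume "j \<in> {1..K}"
   then have j: "?T j = T j" using True by auto
   have i: "?T i = T i - f" by simp
   have c: "cross (T j) (T i) = cross (T j) (T i - f) + cross (T j) f"
    using cross_plus_right[of "T j" "T i - f" f] unfolding fun_le_add_diff(2)[OF Suc.prems(2)] .
   show "cross (T j) (T (Suc K)) = cross (?T j) (?T (Suc K)) + cross (T j) f"
    unfolding True[symmetric] j i c by (rule refl)
  qed
  moreover have "{1..<i} = {1..K}" "{i<..Suc K} = {}" using True by auto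
  ultimately show ?thesis by (simp only: pc.simps sum.empty add_0_right add.assoc)
 next
  case False
  then have i: "i \<in> {1..K}" using Suc.prems by auto
  have "(\<Sum>j=1..K. cross (T j) (T (Suc K))) = (\<Sum>j=1..K. cross (?T j) (?T (Suc K)) + (if j = i then cross f (T (Suc K)) else 0))"
  proof (rule sum.cong[OF refl])
   fix j assume "j \<in> {1..K}"
   show "cross (T j) (T (Suc K)) = cross (?T j) (?T (Suc K)) + (if j = i then cross f (T (Suc K)) else 0)"
    using False cross_plus_left[of "T i - f" f "T (Suc K)"] fun_le_add_diff(2)[OF Suc.prems(2)]
    by (cases "j = i") simp_all
  qed
  also have "\<dots> = (\<Sum>j=1..K. cross (?T j) (?T (Suc K))) + cross f (T (Suc K))"
   using i by (simp add: sum.distrib)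
  finally have *: "(\<Sum>j=1..K. cross (T j) (T (Suc K))) = (\<Sum>j=1..K. cross (?T j) (?T (Suc K))) + cross f (T (Suc K))" .
  have "{i<..Suc K} = insert (Suc K) {i<..K}" using i by auto
  then have sp: "(\<Sum>j\<in>{i<..Suc K}. cross f (T j)) = cross f (T (Suc K)) + (\<Sum>j\<in>{i<..K}. cross f (T j))" by simp
  show ?thesis unfolding pc.simps * sp using Suc.IH[OF i Suc.prems(2)] by linarith
 qed
qed simp

definition fam :: "nat => ('e => nat) => (nat => 'e => nat) set" where
 "fam K t = {T \<in> {1..K} \<rightarrow>\<^sub>E {f. flow f}. (\<Sum>i=1..K. T i) = t}"

lemma fam_flow: "T \<in> fam K t ==> i \<in> {1..K} ==> flow (T i)"
 by (auto simp: fam_def)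

lemma fam_le: "T \<in> fam K t ==> i \<in> {1..K} ==> T i \<le> t"
proof -
 assume T: "T \<in> fam K t" and i: "i \<in> {1..K}"
 have "T i e \<le> t e" for e
 proof -
  have "t e = (\<Sum>i=1..K. T i e)" using T by (auto simp: fam_def sum_apply)
  also have "\<dots> \<ge> T i e" using i by (intro member_le_sum) auto
  finally show ?thesis .
 qed
 then show ?thesis by (simp add: le_fun_def)
qed

lemma finite_fam:
 assumes "flow t"
 shows "finite (fam K t)"
proof (rule finite_subset)
 show "fam K t \<subseteq> {1..K} \<rightarrow>\<^sub>E subs t"
  using fam_le fam_flow by (fastforce simp: subs_def fam_def)
qed (use assms in \<open>auto intro: finite_PiE\<close>)

lemma sp_fam:
 assumes "flow t"
 shows "sp f K t = (\<Sum>T\<in>fam K t. qp (pc K T) * (\<Prod>i=1..K. f i (T i)))"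
 using assms
proof (induction K arbitrary: t)
 case 0
 have "fam 0 t = (if t = 0 then {%_. undefined} else {})"
  by (auto simp: fam_def)
 then show ?case by (cases "t = 0") (simp_all only: unit_def if_True if_False sp.simps, simp_all)
next
 case (Suc K)
 note t = Suc.prems
 have "sp f (Suc K) t = (\<Sum>a\<in>subs t. \<Sum>T\<in>fam K a. qp (cross a (t - a)) * (qp (pc K T) * (\<Prod>i=1..K. f i (T i))) * f (Suc K) (t - a))"
  by (simp add: star_def t Suc.IH subsD sum_distrib_left sum_distrib_right)
 also have "\<dots> = (\<Sum>(a, T)\<in>(SIGMA a:subs t. fam K a). qp (cross a (t - a)) * (qp (pc K T) * (\<Prod>i=1..K. f i (T i))) * f (Suc K) (t - a))"
  using t by (simp add: sum.Sigma finite_fam subsD)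
 also have "\<dots> = (\<Sum>T\<in>fam (Suc K) t. qp (pc (Suc K) T) * (\<Prod>i=1..Suc K. f i (T i)))"
 proof (rule sum.reindex_bij_witness[where
   i = "%T. (\<Sum>i=1..K. T i, restrict T {1..K})" and j = "%(a, T). T(Suc K := t - a)"])
  fix p assume "p \<in> (SIGMA a:subs t. fam K a)"
  then obtain a T where p: "p = (a, T)" "a \<in> subs t" "T \<in> fam K a" by auto
  have Ta: "(\<Sum>i=1..K. T i) = a" and Tx: "T \<in> extensional {1..K}" using p(3) by (auto simp: fam_def PiE_def)
  let ?T = "T(Suc K := t - a)"
  have s: "(\<Sum>i=1..K. ?T i) = a" using Ta by (metis (mono_tags, lifting) atLeastAtMost_iff fun_upd_other not_less_eq_eq sum.cong order_refl)
  have r: "restrict ?T {1..K} = T" using Tx by (auto simp: fun_eq_iff extensional_def)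
  show "((\<Sum>i=1..K. (case p of (a, T) => T(Suc K := t - a)) i), restrict (case p of (a, T) => T(Suc K := t - a)) {1..K}) = p"
   unfolding p by (simp only: prod.case s r)
  have "(\<Sum>i=1..Suc K. ?T i) = t"
   using s fun_le_add_diff(1)[OF subsD(2)[OF p(2)]] by (simp del: fun_upd_apply add: fun_upd_same)
  moreover have "?T \<in> {1..Suc K} \<rightarrow>\<^sub>E {f. flow f}"
   using p(3) flow_subs_minus[OF t p(2)] by (auto simp: fam_def PiE_def Pi_def extensional_def)
  ultimately show "(case p of (a, T) => T(Suc K := t - a)) \<in> fam (Suc K) t" by (simp add: p fam_def)
  have "pc K ?T = pc K T" by (rule pc_cong) auto
  moreover have "(\<Sum>i=1..K. cross (?T i) (t - a)) = cross a (t - a)" using s by (simp add: cross_sum_left[symmetric])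
  moreover have "(\<Prod>i=1..K. f i (?T i)) = (\<Prod>i=1..K. f i (T i))" by (rule prod.cong) auto
  ultimately show "qp (pc (Suc K) (case p of (a, T) => T(Suc K := t - a))) * (\<Prod>i=1..Suc K. f i ((case p of (a, T) => T(Suc K := t - a)) i))
    = (case p of (a, T) => qp (cross a (t - a)) * (qp (pc K T) * (\<Prod>i=1..K. f i (T i))) * f (Suc K) (t - a))"
   by (simp add: p qp_add mult_ac)
 next
  fix T assume T: "T \<in> fam (Suc K) t"
  let ?a = "\<Sum>i=1..K. T i"
  have st: "?a + T (Suc K) = t" using T by (simp add: fam_def)
  have d: "t - ?a = T (Suc K)" unfolding st[symmetric] by (simp add: fun_eq_iff)
  have fl: "flow (T i)" if "i \<in> {1..Suc K}" for i using fam_flow[OF T that] .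
  have fa: "flow ?a" by (rule flow_sum) (use fl in auto)
  have "?a \<le> t" unfolding st[symmetric] by (simp add: le_fun_def)
  moreover have "restrict T {1..K} \<in> fam K ?a" using fl by (auto simp: fam_def intro: sum.cong)
  ultimately show "(\<Sum>i=1..K. T i, restrict T {1..K}) \<in> (SIGMA a:subs t. fam K a)"
   using fa by (simp add: subs_def)
  have ex: "T \<in> extensional {1..Suc K}" using T by (auto simp: fam_def PiE_def)
  show "(case (\<Sum>i=1..K. T i, restrict T {1..K}) of (a, T) => T(Suc K := t - a)) = T"
   unfolding prod.case d using ex by (auto simp: fun_eq_iff extensional_def le_Suc_eq)
 qed
 finally show ?case .
qed

lemma star_U_right:
 assumes a: "flow a"
 shows "star F (U e) a = (\<Sum>f\<in>{f. flow f \<and> f \<le> a \<and> deg f = 1 \<and> f e = 1}. qp (cross (a - f) f) * F (a - f))"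
proof -
 have "star F (U e) a = (\<Sum>f\<in>subs a. qp (cross (a - f) f) * F (a - f) * U e f)"
  unfolding star_def if_P[OF a]
 proof (rule sum.reindex_bij_witness[where i = "%f. a - f" and j = "%f. a - f"])
  fix f assume f: "f \<in> subs a"
  then show "a - (a - f) = f" by (auto simp: subs_def fun_eq_iff le_fun_def)
  then show "qp (cross (a - (a - f)) (a - f)) * F (a - (a - f)) * U e (a - f)
    = qp (cross f (a - f)) * F f * U e (a - f)" by simp
  show "a - f \<in> subs a" using f a by (auto simp: subs_def flow_minus le_fun_def)
 qed (use a in \<open>auto simp: subs_def fun_eq_iff le_fun_def flow_minus\<close>)
 also have "\<dots> = (\<Sum>f\<in>subs a. if deg f = 1 \<and> f e = 1 then qp (cross (a - f) f) * F (a - f) else 0)"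
  by (rule sum.cong) (auto simp: U_def subs_def)
 also have "\<dots> = (\<Sum>f\<in>{f \<in> subs a. deg f = 1 \<and> f e = 1}. qp (cross (a - f) f) * F (a - f))"
  by (simp only: sum.inter_filter[OF finite_subs[OF a]])
 also have "{f \<in> subs a. deg f = 1 \<and> f e = 1} = {f. flow f \<and> f \<le> a \<and> deg f = 1 \<and> f e = 1}"
  by (auto simp: subs_def)
 finally show ?thesis .
qed

definition linv :: "('e => nat set) => (nat => nat) => int" where
 "linv L \<sigma> = (\<Sum>e\<in>set (sl 0). \<Sum>p\<in>{(u, v). u \<in> L e \<and> v \<in> L e \<and> u < v}. attack_sign \<sigma> p) +
   (\<Sum>v\<in>mgs. \<Sum>p\<in>L (ins v ! 0) \<times> L (ins v ! 1). attack_sign \<sigma> p)"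

text \<open>The analogue of \<open>SLD\<close> for arbitrary finite label sets and blocks. The value
  {} off \<open>E\<close> keeps the functions canonical when labels are deleted or inserted edge by
  edge.\<close>

definition SL :: "('e => nat) => nat set => ('e => nat set) => ('e => nat set) set" where
 "SL t S bl = {L. (\<forall>e. e \<notin> E --> L e = {}) \<and> (\<forall>e\<in>E. L e \<subseteq> S \<and> card (L e) = t e) \<and>
   (\<forall>e\<in>set (sl 0). L e = bl e) \<and>
   (\<forall>v\<in>set vs. (\<Union>e\<in>set (ins v). L e) = (\<Union>e\<in>set (outs v). L e) \<and>
    disjoint_family_on L (set (ins v)) \<and> disjoint_family_on L (set (outs v)))}"

text \<open>The block labels \<open>bl\<close> of the cut are kept general, since deleting the smallest label does not
 preserve the blocks of consecutive integers.\<close>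

definition gb :: "('e => nat) => nat set => ('e => nat set) => bool" where
 "gb t S bl \<longleftrightarrow> finite S \<and> S = (\<Union>e\<in>set (sl 0). bl e) \<and> (\<forall>e\<in>set (sl 0). card (bl e) = t e) \<and>
   (\<forall>A e B. sl 0 = A @ e # B --> (\<forall>x\<in>set A. \<forall>u\<in>bl x. \<forall>v\<in>bl e. u < v))"

text \<open>For each colour, the flow formed by the loops whose labels have that colour.\<close>

definition cf :: "nat => ('e => nat set) => (nat => nat) => nat => 'e => nat" where
 "cf K L \<sigma> = (\<lambda>i\<in>{1..K}. %e. card {u \<in> L e. \<sigma> u = i})"

definition PP :: "nat => (nat => 'e => nat) => ('e => nat) => nat set => ('e => nat set) => (('e => nat set) \<times> (nat => nat)) set" where
 "PP K T t S bl = {(L, \<sigma>). L \<in> SL t S bl \<and> \<sigma> \<in> S \<rightarrow>\<^sub>E {1..K} \<and> cf K L \<sigma> = T}"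

lemma gb_disjoint:
 assumes "gb t S bl"
 shows "disjoint_family_on bl (set (sl 0))"
 unfolding disjoint_family_on_def
proof (intro ballI impI)
 have wlog: "bl x \<inter> bl y = {}" if xy: "sl 0 = A @ y # B" "x \<in> set A" for x y A B
  using assms that unfolding gb_def by (metis disjoint_iff less_irrefl)
 fix x y assume x: "x \<in> set (sl 0)" and y: "y \<in> set (sl 0)" and ne: "x ~= y"
 obtain A B where s: "sl 0 = A @ y # B" using split_list[OF y] by blast
 then have "x \<in> set A \<or> x \<in> set B" using x ne by auto
 then show "bl x \<inter> bl y = {}"
 proof
  assume "x \<in> set A"
  then show ?thesis using wlog s by blast
 next
  assume "x \<in> set B"
  then obtain B1 B2 where "B = B1 @ x # B2" using split_list by metis
  then have "sl 0 = (A @ y # B1) @ x # B2" using s by simp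
  then show ?thesis using wlog[of "A @ y # B1" x B2 y] by auto
 qed
qed

lemma finite_SL:
 assumes "finite S"
 shows "finite (SL t S bl)"
proof -
 have "inj_on (%L. restrict L E) (SL t S bl)"
 proof (rule inj_onI, rule ext)
  fix L L' e assume L: "L \<in> SL t S bl" "L' \<in> SL t S bl" "restrict L E = restrict L' E"
  show "L e = L' e"
  proof (cases "e \<in> E")
   case True
   then show ?thesis using fun_cong[OF L(3), of e] by simp
  qed (use L(1,2) in \<open>simp add: SL_def\<close>)
 qed
 moreover have "(%L. restrict L E) ` SL t S bl \<subseteq> E \<rightarrow>\<^sub>E Pow S"
 proof
  fix r assume "r \<in> (%L. restrict L E) ` SL t S bl"
  then obtain L where L: "r = restrict L E" "\<forall>e\<in>E. L e \<subseteq> S" by (auto simp: SL_def)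
  then show "r \<in> E \<rightarrow>\<^sub>E Pow S" by simp
 qed
 moreover have "finite (E \<rightarrow>\<^sub>E Pow S)" using fin assms by (intro finite_PiE) auto
 ultimately show ?thesis using inj_on_finite by blast
qed

lemma finite_PP:
 assumes "finite S"
 shows "finite (PP K T t S bl)"
proof (rule finite_subset)
 show "PP K T t S bl \<subseteq> SL t S bl \<times> (S \<rightarrow>\<^sub>E {1..K})" by (auto simp: PP_def)
qed (use assms finite_SL in \<open>auto intro!: finite_cartesian_product finite_PiE\<close>)

text \<open>Labels increase from block to block, so the smallest one lies in the leftmost non-empty
  block, which is the block at \<open>lead t\<close>.\<close>

lemma gb_min:
 assumes gb: "gb t S bl" and pos: "deg t > 0"
 obtains A e B m where "sl 0 = A @ e # B" "lead t = e" "\<forall>x\<in>set A. t x = 0" "t e > 0" "m \<in> bl e" "m \<in> S"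
  "\<And>u. u \<in> S ==> m \<le> u" "\<And>x. x \<in> set (sl 0) ==> x ~= e ==> m \<notin> bl x"
proof -
 obtain A B where s: "sl 0 = A @ lead t # B" "\<forall>x\<in>set A. t x = 0" "t (lead t) > 0"
  using lead_split[OF pos] by blast
 let ?e = "lead t"
 have e: "?e \<in> set (sl 0)" using s by simp
 have finS: "finite S" and S: "S = (\<Union>e\<in>set (sl 0). bl e)" and cd: "\<And>e. e \<in> set (sl 0) ==> card (bl e) = t e"
  using gb unfolding gb_def by blast+
 have ne: "bl ?e ~= {}" using cd[OF e] s(3) by auto
 then have "S ~= {}" using S e by blast
 then have m: "Min S \<in> S" using finS by simp
 have min: "Min S \<le> u" if "u \<in> S" for u using finS that by simp
 obtain x where x: "x \<in> set (sl 0)" "Min S \<in> bl x" using m S by blast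
 have "x = ?e"
 proof (rule ccontr)
  assume "x ~= ?e"
  then have "x \<in> set A \<or> x \<in> set B" using x s by auto
  then show False
  proof
   assume "x \<in> set A"
   then have "card (bl x) = 0" using cd[OF x(1)] s(2) by simp
   moreover have "bl x \<subseteq> S" unfolding S using x(1) by blast
   then have "finite (bl x)" using finS finite_subset by blast
   ultimately have "bl x = {}" by simp
   then show False using x(2) by blast
  next
   assume "x \<in> set B"
   then obtain B1 B2 where "B = B1 @ x # B2" using split_list by metis
   then have "sl 0 = (A @ ?e # B1) @ x # B2" using s by simp
   moreover obtain v where v: "v \<in> bl ?e" using ne by blast
   ultimately have "v < Min S" using gb x(2) unfolding gb_def by (metis in_set_conv_decomp)
   moreover have "v \<in> S" using v S e by blast
   ultimately show False using min by (metis leD)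
  qed
 qed
 then have me: "Min S \<in> bl ?e" using x by simp
 have "Min S \<notin> bl y" if "y \<in> set (sl 0)" "y ~= ?e" for y
  using gb_disjoint[OF gb] me that e unfolding disjoint_family_on_def by blast
 then show ?thesis using that[OF s(1) refl s(2,3) me m min] by blast
qed

definition Fs :: "('e => nat) => 'e => ('e => nat) set" where
 "Fs a e = {f. flow f \<and> f \<le> a \<and> deg f = 1 \<and> f e = 1}"

lemma unit_flow_cut:
 assumes f: "f \<in> Fs a e" and e: "e \<in> set (sl 0)" and x: "x \<in> set (sl 0)" "x ~= e"
 shows "f x = 0"
proof -
 have "f x ~= 1" using unit_flow_slice(1)[of f 0] f e x by (auto simp: Fs_def)
 then show ?thesis using unit_flow_slice(2)[of f 0 x] f x by (auto simp: Fs_def)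
qed

lemma unit_flow_le1:
 assumes f: "flow f" "deg f = 1"
 shows "f x \<le> 1"
 using flow_le_deg[OF f(1), of x] f(2) by simp

lemma gb_remove:
 assumes gb: "gb t S bl" and e: "e \<in> set (sl 0)" and m: "m \<in> bl e" "\<And>x. x \<in> set (sl 0) ==> x ~= e ==> m \<notin> bl x"
  and f: "f e = 1" "\<And>x. x \<in> set (sl 0) ==> x ~= e ==> f x = 0"
 shows "gb (t - f) (S - {m}) (%x. bl x - {m})"
 unfolding gb_def
proof (intro conjI ballI allI impI)
 have g: "finite S" "S = (\<Union>x\<in>set (sl 0). bl x)" "\<And>x. x \<in> set (sl 0) ==> card (bl x) = t x"
  using gb unfolding gb_def by blast+
 show "finite (S - {m})" using g(1) by simp
 show "S - {m} = (\<Union>x\<in>set (sl 0). bl x - {m})" unfolding g(2) by blast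
 fix x assume x: "x \<in> set (sl 0)"
 then have c: "card (bl x) = t x" by (rule g(3))
 show "card (bl x - {m}) = (t - f) x"
 proof (cases "x = e")
  case True
  then show ?thesis using c m(1) f(1) by simp
 next
  case False
  then show ?thesis using c m(2)[OF x] f(2)[OF x] by simp
 qed
next
 fix A y B x u v assume "sl 0 = A @ y # B" "x \<in> set A" "u \<in> bl x - {m}" "v \<in> bl y - {m}"
 then show "u < v" using gb unfolding gb_def by blast
qed

lemma SL_D:
 assumes "L \<in> SL t S bl"
 shows "e \<notin> E ==> L e = {}" "L e \<subseteq> S" "e \<in> E ==> card (L e) = t e" "e \<in> set (sl 0) ==> L e = bl e"
  "v \<in> set vs ==> (\<Union>e\<in>set (ins v). L e) = (\<Union>e\<in>set (outs v). L e)"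
  "v \<in> set vs ==> disjoint_family_on L (set (ins v))" "v \<in> set vs ==> disjoint_family_on L (set (outs v))"
proof -
 show "e \<notin> E ==> L e = {}" "e \<in> E ==> card (L e) = t e" "e \<in> set (sl 0) ==> L e = bl e"
  "v \<in> set vs ==> (\<Union>e\<in>set (ins v). L e) = (\<Union>e\<in>set (outs v). L e)"
  "v \<in> set vs ==> disjoint_family_on L (set (ins v))" "v \<in> set vs ==> disjoint_family_on L (set (outs v))"
  using assms by (simp_all add: SL_def)
 show "L e \<subseteq> S" using assms by (cases "e \<in> E") (simp_all add: SL_def)
qed

lemma distinct_ins_outs:
 assumes "v \<in> set vs"
 shows "distinct (ins v)" "distinct (outs v)"
proof -
 obtain k where k: "k < len" "v = vs ! k" using assms by (auto simp: in_set_conv_nth)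
 show "distinct (ins v)" "distinct (outs v)" using stepE[OF k(1)] k(2) by (metis distinct_append)+
qed

lemma label_flow:
 assumes L: "L \<in> SL t S bl" and gb: "gb t S bl" and m: "m \<in> S"
 shows "flow (%e. if m \<in> L e then 1 else 0)" "deg (%e. if m \<in> L e then 1 else 0) = 1"
proof -
 let ?f = "%e. if m \<in> L e then 1 else 0 :: nat"
 have "sum_list (map ?f (ins v)) = sum_list (map ?f (outs v))" if v: "v \<in> set vs" for v
  using sum_list_indicator[OF distinct_ins_outs(1)[OF v] SL_D(6)[OF L v]]
   sum_list_indicator[OF distinct_ins_outs(2)[OF v] SL_D(7)[OF L v]] SL_D(5)[OF L v] by simp
 then show "flow ?f" using SL_D(1)[OF L] by (auto simp: flow_def)
 have "disjoint_family_on L (set (sl 0))"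
  using gb_disjoint[OF gb] SL_D(4)[OF L] by (simp add: disjoint_family_on_def)
 moreover have "m \<in> (\<Union>x\<in>set (sl 0). L x)" using gb m SL_D(4)[OF L] by (auto simp: gb_def)
 ultimately show "deg ?f = 1" unfolding deg_def using sum_list_indicator[OF dist_sl[of 0], of L m] by simp
qed

lemma SL_remove:
 assumes L: "L \<in> SL t S bl" and finS: "finite S"
 shows "(%e. L e - {m}) \<in> SL (t - (%e. if m \<in> L e then 1 else 0)) (S - {m}) (%e. bl e - {m})"
proof -
 have "card (L e - {m}) = t e - (if m \<in> L e then 1 else 0)" if "e \<in> E" for e
  using SL_D(2,3)[OF L] that finS by (simp add: card_Diff_singleton_if)
 moreover have "(\<Union>e\<in>set (ins v). L e - {m}) = (\<Union>e\<in>set (outs v). L e - {m})" if "v \<in> set vs" for v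
  using SL_D(5)[OF L that] by blast
 moreover have "disjoint_family_on (%e. L e - {m}) (set (ins v))" "disjoint_family_on (%e. L e - {m}) (set (outs v))" if "v \<in> set vs" for v
  using SL_D(6)[OF L that] SL_D(7)[OF L that] unfolding disjoint_family_on_def by blast+
 moreover have "L e - {m} \<subseteq> S - {m}" for e using SL_D(2)[OF L, of e] by blast
 moreover have "e \<notin> E ==> L e - {m} = {}" "e \<in> set (sl 0) ==> L e - {m} = bl e - {m}" for e
  using SL_D(1,4)[OF L] by simp_all
 ultimately show ?thesis unfolding SL_def by simp
qed

text \<open>A flow of degree 1 uses at most one incoming and one outgoing edge of a vertex, and uses
  both or neither. So adding its label along it preserves the disjoint unions.\<close>

lemma SL_insert:
 assumes L: "L \<in> SL (t - f) (S - {m}) (%e. bl e - {m})" and finS: "finite S" and m: "m \<in> S"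
  and f: "flow f" "deg f = 1" "f \<le> t" and bl: "\<And>e. e \<in> set (sl 0) ==> m \<in> bl e \<longleftrightarrow> f e = 1"
 shows "(%e. if f e = 1 then insert m (L e) else L e) \<in> SL t S bl" (is "?L \<in> _")
proof -
 have f01: "f e = 0 \<or> f e = 1" for e using unit_flow_le1[OF f(1,2), of e] by linarith
 have mL: "m \<notin> L e" for e using SL_D(2)[OF L, of e] by blast
 have c1: "card (?L e) = t e" if "e \<in> E" for e
 proof -
  have "finite (L e)" using SL_D(2)[OF L, of e] finS by (meson finite_Diff finite_subset)
  moreover have "f e \<le> t e" using f(3) by (simp add: le_fun_def)
  ultimately show ?thesis using SL_D(3)[OF L that] mL[of e] f01[of e] by auto
 qed
 have c2: "?L e \<subseteq> S" for e using SL_D(2)[OF L, of e] m by auto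
 have c3: "?L e = {}" if "e \<notin> E" for e using SL_D(1)[OF L that] f(1) that by (simp add: flow_def)
 have c4: "?L e = bl e" if "e \<in> set (sl 0)" for e
  using SL_D(4)[OF L that] bl[OF that] by auto
 have c5: "(\<Union>e\<in>set (ins v). ?L e) = (\<Union>e\<in>set (outs v). ?L e) \<and>
   disjoint_family_on ?L (set (ins v)) \<and> disjoint_family_on ?L (set (outs v))" if v: "v \<in> set vs" for v
 proof -
  have s: "sum_list (map f (ins v)) = sum_list (map f (outs v))" using f(1) v by (simp add: flow_def)
  obtain k where k: "k < len" "v = vs ! k" using v by (auto simp: in_set_conv_nth)
  obtain A B where sk: "sl k = A @ ins v @ B" "sl (Suc k) = A @ outs v @ B"
   using stepE[OF k(1)] k(2) by metis
  have unq: "\<not> (f x = 1 \<and> f y = 1)" if "x \<in> set (ins v) \<and> y \<in> set (ins v) \<or> x \<in> set (outs v) \<and> y \<in> set (outs v)" "x ~= y" for x y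
   using unit_flow_slice(1)[OF f(1,2), of k] unit_flow_slice(1)[OF f(1,2), of "Suc k"] k(1) sk that by auto
  have ex: "(\<exists>x\<in>set xs. f x = 1) \<longleftrightarrow> sum_list (map f xs) > 0" for xs
  proof
   assume "\<exists>x\<in>set xs. f x = 1"
   then obtain x where x: "x \<in> set xs" "f x = 1" by blast
   then have "f x \<in> set (map f xs)" unfolding set_map by blast
   then have "f x \<le> sum_list (map f xs)" by (rule member_le_sum_list) simp
   then show "sum_list (map f xs) > 0" using x by simp
  next
   assume "sum_list (map f xs) > 0"
   then obtain x where x: "x \<in> set xs" "f x > 0" using sum_list_pos[of "map f xs"] by auto
   then have "f x = 1" using f01[of x] by linarith
   then show "\<exists>x\<in>set xs. f x = 1" using x(1) by blast
  qed
  have mm: "m \<in> (\<Union>e\<in>set xs. ?L e) \<longleftrightarrow> sum_list (map f xs) > 0" for xs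
   using ex[of xs] mL by auto
  have nm: "y \<in> (\<Union>e\<in>set xs. ?L e) \<longleftrightarrow> y \<in> (\<Union>e\<in>set xs. L e)" if "y ~= m" for xs y using that by auto
  have un: "(\<Union>e\<in>set (ins v). ?L e) = (\<Union>e\<in>set (outs v). ?L e)"
  proof (rule set_eqI)
   fix y show "y \<in> (\<Union>e\<in>set (ins v). ?L e) \<longleftrightarrow> y \<in> (\<Union>e\<in>set (outs v). ?L e)"
   proof (cases "y = m")
    case True
    show ?thesis unfolding True mm s by (rule refl)
   next
    case False
    show ?thesis unfolding nm[OF False] SL_D(5)[OF L v] by (rule refl)
   qed
  qed
  have dj: "disjoint_family_on ?L Z" if "disjoint_family_on L Z" "Z = set (ins v) \<or> Z = set (outs v)" for Z
   unfolding disjoint_family_on_def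
  proof (intro ballI impI)
   fix x y assume xy: "x \<in> Z" "y \<in> Z" "x ~= y"
   then have "L x \<inter> L y = {}" using that(1) by (auto simp: disjoint_family_on_def)
   moreover have "\<not> (f x = 1 \<and> f y = 1)" using unq[of x y] xy that(2) by blast
   ultimately show "?L x \<inter> ?L y = {}" using mL by auto
  qed
  show ?thesis
   by (intro conjI un dj[OF SL_D(6)[OF L v] disjI1[OF refl]] dj[OF SL_D(7)[OF L v] disjI2[OF refl]])
 qed
 show ?thesis
  unfolding SL_def mem_Collect_eq by (intro conjI allI impI ballI) (rule c3 c2 c1 c4 c5[THEN conjunct1] c5[THEN conjunct2, THEN conjunct1] c5[THEN conjunct2, THEN conjunct2], assumption?)+
qed

end

section \<open>Effect of the smallest label on the exponent\<close>

lemma sum_pairs_remove: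
 fixes g :: "nat \<times> nat => int"
 assumes "finite A" "m \<in> A" "\<And>u. u \<in> A ==> m \<le> u"
 shows "(\<Sum>p\<in>{(u, v). u \<in> A \<and> v \<in> A \<and> u < v}. g p) =
   (\<Sum>p\<in>{(u, v). u \<in> A - {m} \<and> v \<in> A - {m} \<and> u < v}. g p) + (\<Sum>v\<in>A - {m}. g (m, v))"
proof -
 have e: "{(u, v). u \<in> A \<and> v \<in> A \<and> u < v} =
   {(u, v). u \<in> A - {m} \<and> v \<in> A - {m} \<and> u < v} \<union> Pair m ` (A - {m})"
  using assms(2,3) by (force simp: image_iff)
 have f: "finite {(u, v). u \<in> A - {m} \<and> v \<in> A - {m} \<and> u < v}"
  by (rule finite_subset[of _ "A \<times> A"]) (use assms(1) in auto)
 have "(\<Sum>p\<in>Pair m ` (A - {m}). g p) = (\<Sum>v\<in>A - {m}. g (m, v))"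
  by (subst sum.reindex) (auto simp: inj_on_def)
 then show ?thesis unfolding e by (subst sum.union_disjoint) (use f assms(1) in auto)
qed

lemma sum_times_remove:
 fixes g :: "nat \<times> nat => int"
 assumes "finite A" "finite B" "A \<inter> B = {}"
 shows "(\<Sum>p\<in>A \<times> B. g p) = (\<Sum>p\<in>(A - {m}) \<times> (B - {m}). g p) +
   (if m \<in> A then \<Sum>v\<in>B - {m}. g (m, v) else 0) + (if m \<in> B then \<Sum>u\<in>A - {m}. g (u, m) else 0)"
proof -
 have A: "(\<Sum>u\<in>A. h u) = (\<Sum>u\<in>A - {m}. h u) + (if m \<in> A then h m else 0)" for h :: "nat => int"
  using assms(1) by (simp add: sum.remove)
 have B: "(\<Sum>u\<in>B. h u) = (\<Sum>u\<in>B - {m}. h u) + (if m \<in> B then h m else 0)" for h :: "nat => int"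
  using assms(2) by (simp add: sum.remove)
 have C: "(\<Sum>p\<in>A \<times> B. g p) = (\<Sum>u\<in>A. \<Sum>v\<in>B. g (u, v))" for A B by (simp add: sum.cartesian_product)
 have D: "m \<notin> A \<or> m \<notin> B" using assms(3) by auto
 show ?thesis
 proof (cases "m \<in> A")
  case True
  then have B': "B - {m} = B" using D by auto
  show ?thesis using True D unfolding C B' A[of "%u. \<Sum>v\<in>B. g (u, v)"] by simp
 next
  case False
  then have A': "A - {m} = A" by auto
  show ?thesis using False unfolding C A' B sum.distrib by simp
 qed
qed

lemma mult_swap_eq: "a * s = r ==> a * (c * s) = c * r" for a :: "'a :: comm_semiring_1"
 by (auto simp: mult.left_commute)

text \<open>A tie counts -1 in the order (m, v) and +1 in the order (v, m). For the smallest label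
  the sign is therefore antisymmetric, and a label of the same colour acts like one of a smaller
  colour; \<open>sg\<close> encodes this.\<close>

lemma attack_sign_min:
 "m < v ==> attack_sign \<sigma> (m, v) = (if \<sigma> v > \<sigma> m then 1 else - 1)"
 "m < v ==> attack_sign \<sigma> (v, m) = (if \<sigma> v > \<sigma> m then - 1 else 1)"
 by (auto simp: attack_sign_def)

context cweb
begin

definition sg :: "nat => nat => int" where
 "sg i j = (if j > i then 1 else - 1)"

text \<open>The pairs with \<open>m\<close> come from its block, which gives the values
  \<open>T' j e\<close>, and from the merges on its loop. By the antisymmetry of the sign, the merge
  pairs add up to crossings of the loop with the remaining flow of each colour.\<close>

lemma linv_remove:
 assumes gb: "gb t S bl" and L: "L \<in> SL t S bl" and \<sigma>: "\<sigma> \<in> S \<rightarrow>\<^sub>E {1..K}"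
  and e: "e \<in> set (sl 0)" and m: "m \<in> bl e" "\<And>u. u \<in> S ==> m \<le> u"
   "\<And>x. x \<in> set (sl 0) ==> x ~= e ==> m \<notin> bl x"
  and f: "f = (%e. if m \<in> L e then 1 else 0)"
  and T': "\<And>j x. j \<in> {1..K} ==> T' j x = card {u \<in> L x - {m}. \<sigma> u = j}"
 shows "linv L \<sigma> = linv (%e. L e - {m}) (restrict \<sigma> (S - {m})) +
   (\<Sum>j=1..K. sg (\<sigma> m) j * int (T' j e)) + (\<Sum>j=1..K. sg (\<sigma> m) j * cross f (T' j))"
proof -
 let ?L = "%e. L e - {m}" and ?\<sigma> = "restrict \<sigma> (S - {m})"
 have finS: "finite S" using gb unfolding gb_def by blast
 have LS: "L x \<subseteq> S" for x using SL_D(2)[OF L] .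
 have fL: "finite (L x)" for x using finS LS finite_subset by blast
 have mS: "m \<in> S" using gb e m(1) unfolding gb_def by blast
 have lt: "m < u" if "u \<in> L x - {m}" for x u using that LS[of x] m(2)[of u] by fastforce
 have ext: "attack_sign ?\<sigma> (u, v) = attack_sign \<sigma> (u, v)" if "u \<in> S - {m}" "v \<in> S - {m}" for u v
  using that by (simp add: attack_sign_def)
 have col: "(\<Sum>v\<in>L x - {m}. attack_sign \<sigma> (m, v)) = (\<Sum>j=1..K. sg (\<sigma> m) j * int (T' j x))"
  "(\<Sum>v\<in>L x - {m}. attack_sign \<sigma> (v, m)) = - (\<Sum>j=1..K. sg (\<sigma> m) j * int (T' j x))" for x
 proof -
  have s: "(\<Sum>v\<in>L x - {m}. sg (\<sigma> m) (\<sigma> v)) = (\<Sum>j=1..K. sg (\<sigma> m) j * int (T' j x))"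
   using sum_by_colour[of "L x - {m}" \<sigma> K "sg (\<sigma> m)"] fL[of x] \<sigma> LS[of x]
   by (simp add: T' PiE_def Pi_def subset_iff mult.commute)
  have "(\<Sum>v\<in>L x - {m}. attack_sign \<sigma> (m, v)) = (\<Sum>v\<in>L x - {m}. sg (\<sigma> m) (\<sigma> v))"
  proof (rule sum.cong[OF refl])
   fix v assume "v \<in> L x - {m}"
   then have "m < v" by (rule lt)
   then show "attack_sign \<sigma> (m, v) = sg (\<sigma> m) (\<sigma> v)" unfolding attack_sign_min(1)[OF \<open>m < v\<close>] sg_def by simp
  qed
  then show "(\<Sum>v\<in>L x - {m}. attack_sign \<sigma> (m, v)) = (\<Sum>j=1..K. sg (\<sigma> m) j * int (T' j x))" using s by simp
  have "(\<Sum>v\<in>L x - {m}. attack_sign \<sigma> (v, m)) = (\<Sum>v\<in>L x - {m}. - sg (\<sigma> m) (\<sigma> v))"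
  proof (rule sum.cong[OF refl])
   fix v assume "v \<in> L x - {m}"
   then have "m < v" by (rule lt)
   then show "attack_sign \<sigma> (v, m) = - sg (\<sigma> m) (\<sigma> v)" unfolding attack_sign_min(2)[OF \<open>m < v\<close>] sg_def by simp
  qed
  then show "(\<Sum>v\<in>L x - {m}. attack_sign \<sigma> (v, m)) = - (\<Sum>j=1..K. sg (\<sigma> m) j * int (T' j x))" using s by (simp add: sum_negf)
 qed
 have cut: "(\<Sum>x\<in>set (sl 0). \<Sum>p\<in>{(u, v). u \<in> L x \<and> v \<in> L x \<and> u < v}. attack_sign \<sigma> p) =
   (\<Sum>x\<in>set (sl 0). \<Sum>p\<in>{(u, v). u \<in> ?L x \<and> v \<in> ?L x \<and> u < v}. attack_sign ?\<sigma> p) + (\<Sum>j=1..K. sg (\<sigma> m) j * int (T' j e))"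
 proof -
  have "(\<Sum>p\<in>{(u, v). u \<in> L x \<and> v \<in> L x \<and> u < v}. attack_sign \<sigma> p) =
   (\<Sum>p\<in>{(u, v). u \<in> ?L x \<and> v \<in> ?L x \<and> u < v}. attack_sign ?\<sigma> p) + (if x = e then \<Sum>j=1..K. sg (\<sigma> m) j * int (T' j e) else 0)"
   if x: "x \<in> set (sl 0)" for x
  proof -
   have r: "(\<Sum>p\<in>{(u, v). u \<in> ?L x \<and> v \<in> ?L x \<and> u < v}. attack_sign ?\<sigma> p) =
     (\<Sum>p\<in>{(u, v). u \<in> ?L x \<and> v \<in> ?L x \<and> u < v}. attack_sign \<sigma> p)"
   proof (rule sum.cong[OF refl])
    fix p assume "p \<in> {(u, v). u \<in> ?L x \<and> v \<in> ?L x \<and> u < v}"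
    then show "attack_sign ?\<sigma> p = attack_sign \<sigma> p" using ext LS by blast
   qed
   show ?thesis
   proof (cases "x = e")
    case True
    then have "m \<in> L x" using m(1) SL_D(4)[OF L x] by simp
    then show ?thesis using sum_pairs_remove[OF fL, of m x "attack_sign \<sigma>"] lt r col(1)[of e] LS[of x] m(2) True
     by (simp add: subset_iff)
   next
    case False
    then have "m \<notin> L x" using m(3) SL_D(4)[OF L x] x by simp
    then show ?thesis using False r by simp
   qed
  qed
  then have "(\<Sum>x\<in>set (sl 0). \<Sum>p\<in>{(u, v). u \<in> L x \<and> v \<in> L x \<and> u < v}. attack_sign \<sigma> p) =
   (\<Sum>x\<in>set (sl 0). (\<Sum>p\<in>{(u, v). u \<in> ?L x \<and> v \<in> ?L x \<and> u < v}. attack_sign ?\<sigma> p) + (if x = e then \<Sum>j=1..K. sg (\<sigma> m) j * int (T' j e) else 0))"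
   by (rule sum.cong[OF refl])
  then show ?thesis using e by (simp add: sum.distrib)
 qed
 have mg: "(\<Sum>v\<in>mgs. \<Sum>p\<in>L (ins v ! 0) \<times> L (ins v ! 1). attack_sign \<sigma> p) =
   (\<Sum>v\<in>mgs. \<Sum>p\<in>?L (ins v ! 0) \<times> ?L (ins v ! 1). attack_sign ?\<sigma> p) + (\<Sum>j=1..K. sg (\<sigma> m) j * cross f (T' j))"
 proof -
  have "(\<Sum>p\<in>L (ins v ! 0) \<times> L (ins v ! 1). attack_sign \<sigma> p) =
   (\<Sum>p\<in>?L (ins v ! 0) \<times> ?L (ins v ! 1). attack_sign ?\<sigma> p) +
   (\<Sum>j=1..K. sg (\<sigma> m) j * (int (f (ins v ! 0)) * int (T' j (ins v ! 1)) - int (T' j (ins v ! 0)) * int (f (ins v ! 1))))"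
   if v: "v \<in> mgs" for v
  proof -
   obtain l r where lr: "ins v = [l, r]" "l ~= r" "v \<in> set vs"
    using v vert[of v] distinct_ins_outs(1)[of v] by (auto simp: mgs_def)
   have dj: "L l \<inter> L r = {}" using SL_D(6)[OF L lr(3)] lr(1,2) by (simp add: disjoint_family_on_def)
   have r: "(\<Sum>p\<in>?L l \<times> ?L r. attack_sign ?\<sigma> p) = (\<Sum>p\<in>?L l \<times> ?L r. attack_sign \<sigma> p)"
   proof (rule sum.cong[OF refl])
    fix p assume "p \<in> ?L l \<times> ?L r"
    then show "attack_sign ?\<sigma> p = attack_sign \<sigma> p" using ext LS by blast
   qed
   have "(\<Sum>p\<in>L l \<times> L r. attack_sign \<sigma> p) = (\<Sum>p\<in>?L l \<times> ?L r. attack_sign \<sigma> p) +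
     (if m \<in> L l then \<Sum>j=1..K. sg (\<sigma> m) j * int (T' j r) else 0) + (if m \<in> L r then - (\<Sum>j=1..K. sg (\<sigma> m) j * int (T' j l)) else 0)"
    unfolding sum_times_remove[OF fL fL dj, of "attack_sign \<sigma>" m] col by (rule refl)
   also have "\<dots> = (\<Sum>p\<in>?L l \<times> ?L r. attack_sign \<sigma> p) +
     (int (f l) * (\<Sum>j=1..K. sg (\<sigma> m) j * int (T' j r)) - (\<Sum>j=1..K. sg (\<sigma> m) j * int (T' j l)) * int (f r))"
    by (simp add: f)
   also have "(int (f l) * (\<Sum>j=1..K. sg (\<sigma> m) j * int (T' j r)) - (\<Sum>j=1..K. sg (\<sigma> m) j * int (T' j l)) * int (f r)) =
     (\<Sum>j=1..K. sg (\<sigma> m) j * (int (f l) * int (T' j r) - int (T' j l) * int (f r)))"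
    unfolding sum_distrib_left sum_distrib_right sum_subtractf[symmetric]
    by (intro sum.cong refl) (simp only: right_diff_distrib mult_ac)
   finally show ?thesis using r lr(1) by simp
  qed
  then have "(\<Sum>v\<in>mgs. \<Sum>p\<in>L (ins v ! 0) \<times> L (ins v ! 1). attack_sign \<sigma> p) =
   (\<Sum>v\<in>mgs. (\<Sum>p\<in>?L (ins v ! 0) \<times> ?L (ins v ! 1). attack_sign ?\<sigma> p) +
   (\<Sum>j=1..K. sg (\<sigma> m) j * (int (f (ins v ! 0)) * int (T' j (ins v ! 1)) - int (T' j (ins v ! 0)) * int (f (ins v ! 1)))))"
   by (rule sum.cong[OF refl])
  also have "\<dots> = (\<Sum>v\<in>mgs. \<Sum>p\<in>?L (ins v ! 0) \<times> ?L (ins v ! 1). attack_sign ?\<sigma> p) + (\<Sum>j=1..K. sg (\<sigma> m) j * cross f (T' j))"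
   unfolding sum.distrib cross_def sum_distrib_left by (simp only: sum.swap[of _ mgs])
  finally show ?thesis .
 qed
 show ?thesis unfolding linv_def cut mg by simp
qed

text \<open>For a fixed colour \<open>i\<close> of the smallest label, its crossings with the other
  colours restore \<open>pc K T\<close>. The sum over its loop is then the product of
  \<open>Hf\<close> with \<open>U e\<close> at \<open>T i\<close>, which \<open>Hd_exchange\<close>
  evaluates; the sum over \<open>i\<close> is \<open>qint_telescope\<close>.\<close>

lemma peel_weights:
 assumes T: "T \<in> fam K t" and s: "sl 0 = A @ e # B" "\<forall>x\<in>set A. t x = 0" and pos: "t e > 0"
 shows "(\<Sum>i=1..K. \<Sum>f\<in>Fs (T i) e.
   qp ((\<Sum>j=1..K. sg i j * int ((T(i := T i - f)) j e)) + (\<Sum>j=1..K. sg i j * cross f ((T(i := T i - f)) j))) *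
   (qp (pc K (T(i := T i - f))) * (\<Prod>j=1..K. Hf ((T(i := T i - f)) j)))) =
  qint (t e) * qp (pc K T) * (\<Prod>j=1..K. Hf (T j))"
proof -
 let ?x = "%i. T i e"
 have te: "t e = (\<Sum>i=1..K. ?x i)" using T by (auto simp: fam_def sum_apply)
 have q1: "q^2 - 1 ~= 0" by (rule q_pow_minus_1_nz) simp
 have inner: "(q^2 - 1) * (\<Sum>f\<in>Fs (T i) e.
   qp ((\<Sum>j=1..K. sg i j * int ((T(i := T i - f)) j e)) + (\<Sum>j=1..K. sg i j * cross f ((T(i := T i - f)) j))) *
   (qp (pc K (T(i := T i - f))) * (\<Prod>j=1..K. Hf ((T(i := T i - f)) j)))) =
   qp (int (\<Sum>j\<in>{i<..K}. ?x j) - int (\<Sum>j=1..i. ?x j) + 1) * (q ^ (2 * ?x i) - 1) * (qp (pc K T) * (\<Prod>j=1..K. Hf (T j)))"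
  (is "_ * ?I = _") if i: "i \<in> {1..K}" for i
 proof -
  have fl: "flow (T i)" using fam_flow[OF T i] .
  let ?P = "\<Prod>j\<in>{1..K} - {i}. Hf (T j)"
  let ?ex = "int (\<Sum>j\<in>{i<..K}. ?x j) - int (\<Sum>j=1..i. ?x j) + 1"
  have split: "(\<Sum>j=1..K. g j) = (\<Sum>j\<in>{1..<i}. g j) + g i + (\<Sum>j\<in>{i<..K}. g j)" for g :: "nat => int"
  proof -
   have "{1..K} = {1..<i} \<union> ({i} \<union> {i<..K})" using i by auto
   then show ?thesis by (simp only:) (subst sum.union_disjoint; auto)
  qed
  have trm: "qp ((\<Sum>j=1..K. sg i j * int ((T(i := T i - f)) j e)) + (\<Sum>j=1..K. sg i j * cross f ((T(i := T i - f)) j))) *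
    (qp (pc K (T(i := T i - f))) * (\<Prod>j=1..K. Hf ((T(i := T i - f)) j))) =
    (qp ?ex * qp (pc K T) * ?P) * (qp (cross (T i - f) f) * Hf (T i - f))" if f: "f \<in> Fs (T i) e" for f
  proof -
   let ?T = "T(i := T i - f)"
   have f': "f \<le> T i" "f e = 1" using f by (auto simp: Fs_def)
   from f'(1) have "f e \<le> T i e" by (rule le_funD)
   \<comment> \<open>The own colour counts with sign -1 and has lost the strand \<open>f\<close>;
     this is the +1 in \<open>?ex\<close>.\<close>
   then have x1: "int (?T i e) = int (?x i) - 1" using f'(2) by simp
   have low: "(\<Sum>j\<in>{1..<i}. sg i j * int (?T j e)) = - (\<Sum>j\<in>{1..<i}. int (?x j))"
    unfolding sum_negf[symmetric] by (rule sum.cong) (auto simp: sg_def)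
   have high: "(\<Sum>j\<in>{i<..K}. sg i j * int (?T j e)) = (\<Sum>j\<in>{i<..K}. int (?x j))"
    by (rule sum.cong) (auto simp: sg_def)
   have "{1..i} = insert i {1..<i}" using i by auto
   then have ii: "int (\<Sum>j=1..i. ?x j) = int (?x i) + (\<Sum>j\<in>{1..<i}. int (?x j))" by simp
   have e1: "(\<Sum>j=1..K. sg i j * int (?T j e)) = ?ex"
    unfolding split low high ii x1 by (simp add: sg_def)
   have low: "(\<Sum>j\<in>{1..<i}. sg i j * cross f (?T j)) = (\<Sum>j\<in>{1..<i}. cross (T j) f)"
    by (rule sum.cong) (auto simp: sg_def cross_antisym[of _ f])
   have high: "(\<Sum>j\<in>{i<..K}. sg i j * cross f (?T j)) = (\<Sum>j\<in>{i<..K}. cross f (T j))"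
    by (rule sum.cong) (auto simp: sg_def)
   \<comment> \<open>Because \<open>sg i i\<close> is -1, the crossing with the own colour is
     reversed and becomes the twist of the product of \<open>Hf\<close> with
     \<open>U e\<close>.\<close>
   have mid: "sg i i * cross f (?T i) = cross (T i - f) f" by (simp add: sg_def cross_antisym[of "T i - f" f])
   have e2: "(\<Sum>j=1..K. sg i j * cross f (?T j)) + pc K ?T = pc K T + cross (T i - f) f"
    unfolding split low high mid pc_remove[where T = T, OF i f'(1)] by simp
   have p: "(\<Prod>j=1..K. Hf (?T j)) = ?P * Hf (T i - f)"
   proof -
    have "(\<Prod>j=1..K. Hf (?T j)) = Hf (?T i) * (\<Prod>j\<in>{1..K} - {i}. Hf (?T j))"
     using i by (simp only: prod.remove finite_atLeastAtMost)
    moreover have "(\<Prod>j\<in>{1..K} - {i}. Hf (?T j)) = ?P" by (rule prod.cong) auto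
    ultimately show ?thesis by simp
   qed
   have "qp ((\<Sum>j=1..K. sg i j * int (?T j e)) + (\<Sum>j=1..K. sg i j * cross f (?T j))) * qp (pc K ?T) =
     qp ?ex * qp ((\<Sum>j=1..K. sg i j * cross f (?T j)) + pc K ?T)"
    unfolding e1 by (simp only: qp_add mult.assoc)
   also have "\<dots> = qp ?ex * (qp (pc K T) * qp (cross (T i - f) f))" unfolding e2 by (simp only: qp_add)
   finally show ?thesis unfolding p mult.assoc[symmetric] by (simp only: mult_ac)
  qed
  have "?I = (qp ?ex * qp (pc K T) * ?P) * (\<Sum>f\<in>Fs (T i) e. qp (cross (T i - f) f) * Hf (T i - f))"
   unfolding sum_distrib_left by (rule sum.cong[OF refl]) (rule trm)
  also have "(\<Sum>f\<in>Fs (T i) e. qp (cross (T i - f) f) * Hf (T i - f)) = star Hf (U e) (T i)"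
   unfolding star_U_right[OF fl] Fs_def by (rule refl)
  finally have I: "?I = (qp ?ex * qp (pc K T) * ?P) * star Hf (U e) (T i)" .
  have z: "\<forall>x\<in>set A. T i x = 0"
  proof
   fix x assume "x \<in> set A"
   then have "t x = 0" using s(2) by blast
   moreover have "T i x \<le> t x" using fam_le[OF T i] by (simp add: le_fun_def)
   ultimately show "T i x = 0" by simp
  qed
  have HfE: "Hf = (%f. Hd (deg f) f)" by (rule ext) (simp add: Hf_def)
  have "(q^2 - 1) * star Hf (U e) (T i) = (q ^ (2 * ?x i) - 1) * Hf (T i)"
   using Hd_exchange[OF fl s(1) z] unfolding HfE by simp
  then have "(q^2 - 1) * ?I = (qp ?ex * qp (pc K T) * ?P) * ((q ^ (2 * ?x i) - 1) * Hf (T i))"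
   unfolding I by (rule mult_swap_eq)
  moreover have "(\<Prod>j=1..K. Hf (T j)) = Hf (T i) * ?P" using i by (simp add: prod.remove)
  ultimately show ?thesis by (simp only: mult_ac)
 qed
 have "(q^2 - 1) * (\<Sum>i=1..K. \<Sum>f\<in>Fs (T i) e.
   qp ((\<Sum>j=1..K. sg i j * int ((T(i := T i - f)) j e)) + (\<Sum>j=1..K. sg i j * cross f ((T(i := T i - f)) j))) *
   (qp (pc K (T(i := T i - f))) * (\<Prod>j=1..K. Hf ((T(i := T i - f)) j)))) =
   (\<Sum>i=1..K. qp (int (\<Sum>j\<in>{i<..K}. ?x j) - int (\<Sum>j=1..i. ?x j) + 1) * (q ^ (2 * ?x i) - 1)) * (qp (pc K T) * (\<Prod>j=1..K. Hf (T j)))"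
  unfolding sum_distrib_right sum_distrib_left[of "q^2 - 1" _ "{1..K}"] by (rule sum.cong[OF refl]) (rule inner)
 also have "\<dots> = (q^2 - 1) * (qint (t e) * qp (pc K T) * (\<Prod>j=1..K. Hf (T j)))"
  unfolding qint_telescope te by (simp only: mult.assoc)
 finally show ?thesis by (rule mult_left_cancel[OF q1, THEN iffD1])
qed

lemma pc_zero: "(\<And>i. i \<in> {1..K} ==> T i = 0) ==> pc K T = 0"
proof (induction K)
 case (Suc K)
 have z: "T i = 0" if "i \<in> {1..Suc K}" for i using Suc.prems[OF that] .
 have "pc K T = 0" by (rule Suc.IH) (rule z, simp)
 moreover have "(\<Sum>i=1..K. cross (T i) (T (Suc K))) = 0"
 proof (rule sum.neutral, rule ballI)
  fix i assume "i \<in> {1..K}"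
  then have "T i = 0" by (intro z) simp
  then show "cross (T i) (T (Suc K)) = 0" by (simp only: cross_zero)
 qed
 ultimately show ?case by (simp only: pc.simps)
qed simp

lemma fam_remove:
 assumes T: "T \<in> fam K t" and i: "i \<in> {1..K}" and f: "flow f" "f \<le> T i"
 shows "T(i := T i - f) \<in> fam K (t - f)"
proof -
 let ?T = "T(i := T i - f)"
 have Tx: "T \<in> {1..K} \<rightarrow>\<^sub>E {f. flow f}" and Ts: "(\<Sum>i=1..K. T i) = t" using T unfolding fam_def by blast+
 have fl: "flow (T i - f)" using flow_minus[OF fam_flow[OF T i] f] .
 have "?T \<in> {1..K} \<rightarrow>\<^sub>E {f. flow f}" using Tx fl i unfolding PiE_def Pi_def extensional_def by auto
 moreover have "(\<Sum>j=1..K. ?T j) = t - f"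
 proof -
  have "(\<Sum>j=1..K. ?T j) = ?T i + (\<Sum>j\<in>{1..K} - {i}. ?T j)" using i by (simp only: sum.remove finite_atLeastAtMost)
  also have "(\<Sum>j\<in>{1..K} - {i}. ?T j) = (\<Sum>j\<in>{1..K} - {i}. T j)" by (rule sum.cong) auto
  finally have "(\<Sum>j=1..K. ?T j) + f = (T i - f + f) + (\<Sum>j\<in>{1..K} - {i}. T j)" by (simp only: fun_upd_same add_ac)
  also have "\<dots> = T i + (\<Sum>j\<in>{1..K} - {i}. T j)" unfolding fun_le_add_diff(2)[OF f(2)] by (rule refl)
  also have "\<dots> = t" using i Ts by (simp only: sum.remove finite_atLeastAtMost)
  finally have a: "(\<Sum>j=1..K. ?T j) + f = t" .
  show ?thesis unfolding a[symmetric] by (rule ext) (simp add: plus_fun_def fun_diff_def)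
 qed
 ultimately show ?thesis unfolding fam_def by blast
qed

lemma cf_out: "j \<notin> {1..K} ==> cf K L \<sigma> j = undefined"
 unfolding cf_def restrict_def by (simp only: if_False)

text \<open>Deleting a label while recording its colour and its loop is one direction of the
  bijection behind \<open>labelings_sum\<close>; \<open>PP_insert\<close> is the other.\<close>

lemma PP_remove:
 assumes gb: "gb t S bl" and P: "(L, \<sigma>) \<in> PP K T t S bl" and m: "m \<in> S"
  and f: "f = (%e. if m \<in> L e then 1 else 0)" and T': "T' = T(\<sigma> m := T (\<sigma> m) - f)"
 shows "\<sigma> m \<in> {1..K}" "flow f" "deg f = 1" "f \<le> T (\<sigma> m)"
  "\<And>j x. j \<in> {1..K} ==> T' j x = card {u \<in> L x - {m}. \<sigma> u = j}"
  "((%e. L e - {m}), restrict \<sigma> (S - {m})) \<in> PP K T' (t - f) (S - {m}) (%e. bl e - {m})"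
proof -
 have L: "L \<in> SL t S bl" and \<sigma>: "\<sigma> \<in> S \<rightarrow>\<^sub>E {1..K}" and c: "cf K L \<sigma> = T" using P unfolding PP_def by blast+
 have finS: "finite S" using gb unfolding gb_def by blast
 have fL: "finite (L x)" for x using finS SL_D(2)[OF L] finite_subset by blast
 show i: "\<sigma> m \<in> {1..K}" using \<sigma> m by auto
 show "flow f" "deg f = 1" using label_flow[OF L gb m] unfolding f by blast+
 have Tv: "T j x = card {u \<in> L x. \<sigma> u = j}" if "j \<in> {1..K}" for j x using that unfolding c[symmetric] cf_def by simp
 show "f \<le> T (\<sigma> m)"
 proof (rule le_funI)
  fix x
  show "f x \<le> T (\<sigma> m) x"
  proof (cases "m \<in> L x")
   case True
   then have "{m} \<subseteq> {u \<in> L x. \<sigma> u = \<sigma> m}" by simp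
   then have "card {m} \<le> card {u \<in> L x. \<sigma> u = \<sigma> m}" using fL[of x] by (intro card_mono) auto
   then show ?thesis using True unfolding Tv[OF i] f by simp
  qed (simp add: f)
 qed
 show cT: "T' j x = card {u \<in> L x - {m}. \<sigma> u = j}" if j: "j \<in> {1..K}" for j x
 proof (cases "j = \<sigma> m")
  case True
  have e: "{u \<in> L x - {m}. \<sigma> u = j} = {u \<in> L x. \<sigma> u = \<sigma> m} - {m}" using True by blast
  have "T' j x = T (\<sigma> m) x - f x" unfolding T' True by simp
  also have "\<dots> = card {u \<in> L x - {m}. \<sigma> u = j}"
   unfolding e Tv[OF i] f using fL[of x] by (simp add: card_Diff_singleton_if)
  finally show ?thesis .
 next
  case False
  then have "{u \<in> L x - {m}. \<sigma> u = j} = {u \<in> L x. \<sigma> u = j}" by blast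
  then show ?thesis using False Tv[OF j] unfolding T' by simp
 qed
 have "cf K (%e. L e - {m}) (restrict \<sigma> (S - {m})) = T'"
 proof (rule ext, rule ext)
  fix j x
  show "cf K (%e. L e - {m}) (restrict \<sigma> (S - {m})) j x = T' j x"
  proof (cases "j \<in> {1..K}")
   case True
   have "{u \<in> L x - {m}. restrict \<sigma> (S - {m}) u = j} = {u \<in> L x - {m}. \<sigma> u = j}"
    using SL_D(2)[OF L, of x] by auto
   then show ?thesis using True cT[OF True] unfolding cf_def by simp
  next
   case False
   have "T j = undefined" unfolding c[symmetric] by (rule cf_out[OF False])
   moreover have "j ~= \<sigma> m" using False i by blast
   ultimately show ?thesis unfolding T' cf_out[OF False] by simp
  qed
 qed
 moreover have "restrict \<sigma> (S - {m}) \<in> S - {m} \<rightarrow>\<^sub>E {1..K}" using \<sigma> by auto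
 ultimately show "((%e. L e - {m}), restrict \<sigma> (S - {m})) \<in> PP K T' (t - f) (S - {m}) (%e. bl e - {m})"
  using SL_remove[OF L finS, of m] unfolding PP_def f by blast
qed

lemma PP_insert:
 assumes gb: "gb t S bl" and i: "i \<in> {1..K}" and f: "flow f" "deg f = 1" "f \<le> T i" "f \<le> t" and m: "m \<in> S"
  and bl: "\<And>e. e \<in> set (sl 0) ==> m \<in> bl e \<longleftrightarrow> f e = 1" and T: "T \<in> extensional {1..K}"
  and P: "(L, \<sigma>) \<in> PP K (T(i := T i - f)) (t - f) (S - {m}) (%e. bl e - {m})"
 shows "(%e. if f e = 1 then insert m (L e) else L e, \<sigma>(m := i)) \<in> PP K T t S bl"
proof -
 let ?L = "%e. if f e = 1 then insert m (L e) else L e" and ?\<sigma> = "\<sigma>(m := i)"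
 have L: "L \<in> SL (t - f) (S - {m}) (%e. bl e - {m})" and \<sigma>: "\<sigma> \<in> S - {m} \<rightarrow>\<^sub>E {1..K}"
  and c: "cf K L \<sigma> = T(i := T i - f)" using P unfolding PP_def by blast+
 have finS: "finite S" using gb unfolding gb_def by blast
 have fL: "finite (L x)" for x using finS SL_D(2)[OF L] finite_subset by blast
 have mL: "m \<notin> L x" for x using SL_D(2)[OF L, of x] by blast
 have f01: "f x = 0 \<or> f x = 1" for x using unit_flow_le1[OF f(1,2), of x] by linarith
 have Tv: "(T(i := T i - f)) j x = card {u \<in> L x. \<sigma> u = j}" if "j \<in> {1..K}" for j x using that unfolding c[symmetric] cf_def by simp
 have "?\<sigma> \<in> S \<rightarrow>\<^sub>E {1..K}" using \<sigma> i m by (auto simp: PiE_def Pi_def extensional_def)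
 moreover have "cf K ?L ?\<sigma> = T"
 proof (rule ext, rule ext)
  fix j x
  show "cf K ?L ?\<sigma> j x = T j x"
  proof (cases "j \<in> {1..K}")
   case True
   have "card {u \<in> ?L x. ?\<sigma> u = j} = T j x"
   proof (cases "j = i")
    case j: True
    have le: "f x \<le> T i x" using f(3) by (simp add: le_fun_def)
    have v: "T i x - f x = card {u \<in> L x. \<sigma> u = i}" using Tv[OF i, of x] by simp
    have "{u \<in> ?L x. ?\<sigma> u = j} = (if f x = 1 then insert m {u \<in> L x. \<sigma> u = i} else {u \<in> L x. \<sigma> u = i})"
     using j mL[of x] by auto
    moreover have "m \<notin> {u \<in> L x. \<sigma> u = i}" using mL by blast
    ultimately have "card {u \<in> ?L x. ?\<sigma> u = j} = f x + card {u \<in> L x. \<sigma> u = i}"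
     using fL[of x] f01[of x] by auto
    then show ?thesis using v le j by simp
   next
    case False
    have "{u \<in> ?L x. ?\<sigma> u = j} = {u \<in> L x. \<sigma> u = j}" using False mL[of x] by auto
    then show ?thesis using Tv[OF True, of x] False by simp
   qed
   then show ?thesis using True unfolding cf_def by simp
  next
   case False
   then have "T j = undefined" using T by (auto simp: extensional_def)
   then show ?thesis unfolding cf_out[OF False] by simp
  qed
 qed
 ultimately show ?thesis using SL_insert[OF L finS m f(1,2,4) bl] unfolding PP_def by blast
qed

lemma PP_empty:
 assumes T: "T \<in> fam K t" and t: "t = 0" and gb: "gb t S bl"
 shows "PP K T t S bl = {(%_. {}, %_. undefined)}" "S = {}" "\<And>i. i \<in> {1..K} ==> T i = 0"
proof -
 have g: "finite S" "S = (\<Union>x\<in>set (sl 0). bl x)" "\<And>x. x \<in> set (sl 0) ==> card (bl x) = t x"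
  using gb unfolding gb_def by blast+
 have b: "bl x = {}" if x: "x \<in> set (sl 0)" for x
 proof -
  have "bl x \<subseteq> S" using g(2) x by blast
  then have "finite (bl x)" using g(1) finite_subset by blast
  then show ?thesis using g(3)[OF x] unfolding t by simp
 qed
 then show S: "S = {}" using g(2) by simp
 show T0: "T i = 0" if "i \<in> {1..K}" for i
  using fam_le[OF T that] unfolding t by (auto simp: le_fun_def fun_eq_iff)
 have Tx: "T \<in> extensional {1..K}" using T unfolding fam_def PiE_def by blast
 have "(%_. {}) \<in> SL t S bl" using b unfolding SL_def t by (simp add: disjoint_family_on_def)
 moreover have "cf K (%_. {}) \<sigma> = T" for \<sigma>
 proof (rule ext, rule ext)
  fix j x show "cf K (%_. {}) \<sigma> j x = T j x"
  proof (cases "j \<in> {1..K}")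
   case True
   then show ?thesis using T0[OF True] unfolding cf_def by simp
  next
   case False
   then have "T j = undefined" using Tx by (auto simp: extensional_def)
   then show ?thesis unfolding cf_out[OF False] by simp
  qed
 qed
 moreover have "L = (%_. {})" if "L \<in> SL t S bl" for L using SL_D(2)[OF that] unfolding S by auto
 ultimately show "PP K T t S bl = {(%_. {}, %_. undefined)}" unfolding PP_def S PiE_empty_domain by blast
qed

end

section \<open>Summation over labelled decompositions\<close>

context cweb
begin

text \<open>Induction on the degree by deleting the smallest label, whose colour \<open>i\<close>
  and loop in \<open>Fs (T i) e\<close> can be chosen freely. The factorial of its block loses the
  factor \<open>qint (t e)\<close>, and \<open>peel_weights\<close> gives it back.\<close>

lemma labelings_sum:
 assumes "flow t" "T \<in> fam K t" "gb t S bl"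
 shows "(\<Sum>(L, \<sigma>)\<in>PP K T t S bl. qp (linv L \<sigma>)) =
  (\<Prod>e\<in>set (sl 0). qfact (t e)) * qp (pc K T) * (\<Prod>i=1..K. Hf (T i))"
 using assms
proof (induction "deg t" arbitrary: t T S bl rule: less_induct)
 case less
 note t = less.prems(1) and T = less.prems(2) and gb = less.prems(3)
 show ?case
 proof (cases "deg t = 0")
  case True
  then have t0: "t = 0" using deg_eq_0[OF t] by simp
  have Hf0: "Hf 0 = 1" unfolding Hf_def deg_zero by simp
  have pc0: "pc K T = 0" by (rule pc_zero) (rule PP_empty(3)[OF T t0 gb])
  have "linv (%_. {}) \<sigma> = 0" for \<sigma> by (simp add: linv_def)
  moreover have "(\<Prod>i=1..K. Hf (T i)) = 1" 
  proof (rule prod.neutral, rule ballI)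
   fix i assume "i \<in> {1..K}"
   then show "Hf (T i) = 1" unfolding PP_empty(3)[OF T t0 gb \<open>i \<in> {1..K}\<close>] by (intro Hf0)
  qed
  moreover have "(\<Prod>e\<in>set (sl 0). qfact (t e)) = 1" unfolding t0 by (simp add: qfact_def)
  ultimately show ?thesis unfolding PP_empty(1)[OF T t0 gb] pc0 by simp
 next
  case False
  then have "deg t > 0" by simp
  then obtain A e B m where s1: "sl 0 = A @ e # B" and "lead t = e" and s2: "\<forall>x\<in>set A. t x = 0" "t e > 0"
   and m: "m \<in> bl e" "m \<in> S" "\<And>u. u \<in> S ==> m \<le> u" "\<And>x. x \<in> set (sl 0) ==> x ~= e ==> m \<notin> bl x"
   by (rule gb_min[OF gb]) (rule that)
  note s = s1 s2
  have e: "e \<in> set (sl 0)" using s(1) by simp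
  have finS: "finite S" using gb unfolding gb_def by blast
  have Tx: "T \<in> extensional {1..K}" using T unfolding fam_def PiE_def by blast
  let ?S = "S - {m}" and ?bl = "%x. bl x - {m}"
  let ?T = "%i f. T(i := T i - f)"
  let ?f = "%L x. if m \<in> L x then 1 else 0 :: nat"
  let ?I = "SIGMA i:{1..K}. Fs (T i) e"
  let ?W = "%i f. qp ((\<Sum>j=1..K. sg i j * int (?T i f j e)) + (\<Sum>j=1..K. sg i j * cross f (?T i f j)))"
  let ?R = "qfact (t e - 1) * (\<Prod>x\<in>set (sl 0) - {e}. qfact (t x))"
  have I: "flow f" "f \<le> T i" "deg f = 1" "f e = 1" "f \<le> t" "\<And>x. x \<in> set (sl 0) ==> m \<in> bl x \<longleftrightarrow> f x = 1"
   "\<And>x. x \<in> set (sl 0) ==> x ~= e ==> f x = 0" if i: "i \<in> {1..K}" and f: "f \<in> Fs (T i) e" for i f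
  proof -
   show a: "flow f" "f \<le> T i" "deg f = 1" "f e = 1" using f unfolding Fs_def by blast+
   show "f \<le> t" using a(2) fam_le[OF T i] by (rule order_trans)
   show z: "f x = 0" if "x \<in> set (sl 0)" "x ~= e" for x using unit_flow_cut[OF f e that] .
   show "m \<in> bl x \<longleftrightarrow> f x = 1" if x: "x \<in> set (sl 0)" for x
    using m(1) m(4)[OF x] a(4) z[OF x] by (cases "x = e") auto
  qed
  have fe: "?f L e = 1" if "L \<in> SL t S bl" for L using SL_D(4)[OF that e] m(1) by simp
  \<comment> \<open>\<open>?J\<close> splits off colour and loop of the smallest label and restricts
    the rest; \<open>?V\<close> puts the label back along the loop.\<close>
  let ?J = "%(L, \<sigma>). ((\<sigma> m, ?f L), (%x. L x - {m}, restrict \<sigma> ?S))"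
  let ?V = "%((i, f), (L, \<sigma>)). (%x. if f x = 1 then insert m (L x) else L x, \<sigma>(m := i))"
  let ?g = "%(L, \<sigma>). qp (linv L \<sigma>)"
  let ?h = "%((i, f), (L, \<sigma>)). qp (linv L \<sigma>) * ?W i f"
  have "(\<Sum>(L, \<sigma>)\<in>PP K T t S bl. qp (linv L \<sigma>)) =
    (\<Sum>((i, f), (L, \<sigma>))\<in>(SIGMA p:?I. PP K (?T (fst p) (snd p)) (t - snd p) ?S ?bl). qp (linv L \<sigma>) * ?W i f)"
  proof (rule sum.reindex_bij_witness[where
    j = ?J and i = ?V])
   fix p assume "p \<in> PP K T t S bl"
   then obtain L \<sigma> where p: "p = (L, \<sigma>)" and P: "(L, \<sigma>) \<in> PP K T t S bl" by (metis prod.exhaust)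
   have L: "L \<in> SL t S bl" and \<sigma>: "\<sigma> \<in> S \<rightarrow>\<^sub>E {1..K}" using P unfolding PP_def by blast+
   note R = PP_remove[OF gb P m(2) refl refl]
   have "(%x. if ?f L x = 1 then insert m (L x - {m}) else L x - {m}) = L" by (rule ext) auto
   moreover have "(restrict \<sigma> ?S)(m := \<sigma> m) = \<sigma>"
   proof
    fix u show "((restrict \<sigma> ?S)(m := \<sigma> m)) u = \<sigma> u" using \<sigma> m(2) by (auto simp: PiE_def extensional_def)
   qed
   ultimately show "?V (?J p) = p"
    unfolding p prod.case by (simp only:)
   have "?f L \<in> Fs (T (\<sigma> m)) e" using R(2-4) fe[OF L] unfolding Fs_def by blast
   then show "?J p \<in> (SIGMA p:?I. PP K (?T (fst p) (snd p)) (t - snd p) ?S ?bl)"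
    using R(1,6) unfolding p prod.case by (intro SigmaI) (simp_all only: fst_conv snd_conv)
   have lr: "linv L \<sigma> = linv (%x. L x - {m}) (restrict \<sigma> ?S) + (\<Sum>j=1..K. sg (\<sigma> m) j * int (?T (\<sigma> m) (?f L) j e)) +
     (\<Sum>j=1..K. sg (\<sigma> m) j * cross (?f L) (?T (\<sigma> m) (?f L) j))"
    by (rule linv_remove[OF gb L \<sigma> e m(1,3,4) refl R(5)])
   show "?h (?J p) = ?g p"
    unfolding p prod.case lr by (simp only: qp_add mult.assoc)
  next
   fix p assume "p \<in> (SIGMA p:?I. PP K (?T (fst p) (snd p)) (t - snd p) ?S ?bl)"
   then obtain i f L \<sigma> where p: "p = ((i, f), (L, \<sigma>))" and i: "i \<in> {1..K}" and f: "f \<in> Fs (T i) e"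
    and P: "(L, \<sigma>) \<in> PP K (?T i f) (t - f) ?S ?bl" by (auto simp del: fun_upd_apply)
   have L: "L \<in> SL (t - f) ?S ?bl" and \<sigma>: "\<sigma> \<in> ?S \<rightarrow>\<^sub>E {1..K}" using P unfolding PP_def by blast+
   have mL: "m \<notin> L x" for x using SL_D(2)[OF L, of x] by blast
   have "?f (%x. if f x = 1 then insert m (L x) else L x) = f"
   proof
    fix x show "?f (%x. if f x = 1 then insert m (L x) else L x) x = f x"
     using unit_flow_le1[OF I(1,3)[OF i f], of x] mL[of x] by auto
   qed
   moreover have "(%x. (if f x = 1 then insert m (L x) else L x) - {m}) = L"
   proof
    fix x show "(if f x = 1 then insert m (L x) else L x) - {m} = L x" using mL[of x] by auto
   qed
   moreover have "restrict (\<sigma>(m := i)) ?S = \<sigma>"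
   proof
    fix u show "restrict (\<sigma>(m := i)) ?S u = \<sigma> u" using \<sigma> by (auto simp: PiE_def extensional_def)
   qed
   ultimately show "?J (?V p) = p"
    unfolding p prod.case by (simp only: fun_upd_same)
   show "?V p \<in> PP K T t S bl"
    unfolding p prod.case
    by (rule PP_insert[OF gb i I(1)[OF i f] I(3)[OF i f] I(2)[OF i f] I(5)[OF i f] m(2) I(6)[OF i f] Tx P])
  qed
  also have "\<dots> = (\<Sum>p\<in>?I. \<Sum>r\<in>PP K (?T (fst p) (snd p)) (t - snd p) ?S ?bl. case (p, r) of ((i, f), (L, \<sigma>)) => qp (linv L \<sigma>) * ?W i f)"
  proof (subst sum.Sigma)
   show "finite ?I" unfolding Fs_def
    by (intro finite_SigmaI finite_atLeastAtMost)
     (rule finite_subset[OF _ finite_below[OF fam_flow[OF T]]], auto)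
   show "\<forall>p\<in>?I. finite (PP K (?T (fst p) (snd p)) (t - snd p) ?S ?bl)" using finS finite_PP by blast
  qed (simp only: case_prod_eta, intro sum.cong refl, simp split: prod.splits)
  also have "\<dots> = (\<Sum>p\<in>?I. case p of (i, f) => ?R * (?W i f * (qp (pc K (?T i f)) * (\<Prod>j=1..K. Hf (?T i f j)))))"
  proof (rule sum.cong[OF refl])
   fix p assume "p \<in> ?I"
   then obtain i f where p: "p = (i, f)" and i: "i \<in> {1..K}" and f: "f \<in> Fs (T i) e" by blast
   have "deg (t - f) < deg t" unfolding deg_minus[OF I(5)[OF i f]] I(3)[OF i f] using False by simp
   moreover have "flow (t - f)" using flow_minus[OF t I(1)[OF i f] I(5)[OF i f]] .
   moreover have "?T i f \<in> fam K (t - f)" using fam_remove[OF T i I(1)[OF i f] I(2)[OF i f]] .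
   moreover have "gb (t - f) ?S ?bl" using gb_remove[where f = f, OF gb e m(1,4) I(4)[OF i f] I(7)[OF i f]] .
   ultimately have ih: "(\<Sum>(L, \<sigma>)\<in>PP K (?T i f) (t - f) ?S ?bl. qp (linv L \<sigma>)) =
     (\<Prod>x\<in>set (sl 0). qfact ((t - f) x)) * qp (pc K (?T i f)) * (\<Prod>j=1..K. Hf (?T i f j))"
    by (rule less.hyps)
   have "(\<Prod>x\<in>set (sl 0). qfact ((t - f) x)) = qfact ((t - f) e) * (\<Prod>x\<in>set (sl 0) - {e}. qfact ((t - f) x))"
    using e by (simp only: prod.remove List.finite_set)
   also have "(\<Prod>x\<in>set (sl 0) - {e}. qfact ((t - f) x)) = (\<Prod>x\<in>set (sl 0) - {e}. qfact (t x))"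
    by (rule prod.cong) (use I(7)[OF i f] in auto)
   also have "(t - f) e = t e - 1" using I(4)[OF i f] by simp
   finally have R: "(\<Prod>x\<in>set (sl 0). qfact ((t - f) x)) = ?R" .
   have "(\<Sum>r\<in>PP K (?T i f) (t - f) ?S ?bl. case (p, r) of ((i, f), (L, \<sigma>)) => qp (linv L \<sigma>) * ?W i f) =
     (\<Sum>(L, \<sigma>)\<in>PP K (?T i f) (t - f) ?S ?bl. qp (linv L \<sigma>)) * ?W i f"
    unfolding sum_distrib_right p prod.case by (intro sum.cong refl) (simp split: prod.splits)
   then show "(\<Sum>r\<in>PP K (?T (fst p) (snd p)) (t - snd p) ?S ?bl. case (p, r) of ((i, f), (L, \<sigma>)) => qp (linv L \<sigma>) * ?W i f) =
     (case p of (i, f) => ?R * (?W i f * (qp (pc K (?T i f)) * (\<Prod>j=1..K. Hf (?T i f j)))))"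
    unfolding ih R p prod.case fst_conv snd_conv by (simp only: mult_ac)
  qed
  also have "\<dots> = ?R * (\<Sum>i=1..K. \<Sum>f\<in>Fs (T i) e. ?W i f * (qp (pc K (?T i f)) * (\<Prod>j=1..K. Hf (?T i f j))))"
  proof -
   have fF: "finite (Fs (T i) e)" if "i \<in> {1..K}" for i
    by (rule finite_subset[OF _ finite_below[OF fam_flow[OF T that]]]) (auto simp: Fs_def)
   show ?thesis unfolding sum_distrib_left by (rule sum.Sigma[symmetric]) (use fF in auto)
  qed
  also have "\<dots> = ?R * (qint (t e) * qp (pc K T) * (\<Prod>j=1..K. Hf (T j)))"
   unfolding peel_weights[OF T s] by (rule refl)
  also have "\<dots> = (\<Prod>x\<in>set (sl 0). qfact (t x)) * qp (pc K T) * (\<Prod>j=1..K. Hf (T j))"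
  proof -
   obtain k where k: "t e = Suc k" using s(3) by (cases "t e") auto
   have "qfact (t e) = qfact (t e - 1) * qint (t e)" unfolding k qfact_def by simp
   then have "(\<Prod>x\<in>set (sl 0). qfact (t x)) = ?R * qint (t e)"
    using e by (simp only: prod.remove List.finite_set mult_ac)
   then show ?thesis by (simp only: mult_ac)
  qed
  finally show ?thesis .
 qed
qed

end

section \<open>Slices of an annular web\<close>

lemma sorted_wrt_unique:
 assumes "sorted_wrt R xs" "sorted_wrt R ys" "set xs = set ys" and asym: "\<And>a b. R a b ==> R b a ==> False"
 shows "xs = ys"
 using assms(1-3)
proof (induction xs arbitrary: ys)
 case (Cons a xs)
 obtain b ys' where ys: "ys = b # ys'" using Cons.prems(3) by (cases ys) auto
 have ab: "a = b"
 proof (rule ccontr)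
  assume "a ~= b"
  then have "b \<in> set xs" "a \<in> set ys'" using Cons.prems(3) ys by auto
  then show False using Cons.prems(1,2) ys asym by auto
 qed
 have "a \<notin> set xs" "b \<notin> set ys'" using Cons.prems(1,2) ys asym by auto
 then have "set xs = set ys'" using Cons.prems(3) ys ab by auto
 then show ?case using Cons.IH[of ys'] Cons.prems(1,2) ys ab by simp
qed simp

lemma filter_min_sorted:
 assumes "sorted (map g L)" "\<And>i. i \<in> set L ==> x \<le> g i"
 shows "L = filter (%i. g i = x) L @ filter (%i. g i ~= x) L"
 using assms
proof (induction L)
 case (Cons i L)
 show ?case
 proof (cases "g i = x")
  case True
  then show ?thesis using Cons by simp
 next
  case False
  then have "x < g i" using Cons.prems(2)[of i] by simp
  then have "g j ~= x" if "j \<in> set (i # L)" for j using Cons.prems(1) that by auto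
  then show ?thesis by (simp add: filter_id_conv filter_empty_conv)
 qed
qed simp

text \<open>Used with \<open>g\<close> the horizontal position at a fixed height: the list of edges
  is cut into groups through one point, each belonging to a vertex or to a single passing
  edge.\<close>

lemma concat_filter_sorted:
 fixes g :: "'a => 'b :: linorder"
 assumes "sorted (map g L)" "sorted_wrt (<) xs" "g ` set L \<subseteq> set xs"
 shows "concat (map (%x. filter (%i. g i = x) L) xs) = L"
 using assms
proof (induction xs arbitrary: L)
 case (Cons x xs)
 let ?M = "filter (%i. g i ~= x) L"
 have "x \<le> g i" if "i \<in> set L" for i
 proof -
  have "g i \<in> set (x # xs)" using Cons.prems(3) that by blast
  then show ?thesis using Cons.prems(2) by auto
 qed
 then have L: "L = filter (%i. g i = x) L @ ?M" using filter_min_sorted[OF Cons.prems(1)] by blast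
 have "concat (map (%x. filter (%i. g i = x) ?M) xs) = ?M"
  by (rule Cons.IH) (use Cons.prems in \<open>auto intro: sorted_filter\<close>)
 moreover have m: "map (%x. filter (%i. g i = x) ?M) xs = map (%x. filter (%i. g i = x) L) xs"
  using Cons.prems(2) by (auto simp: filter_eq_Cons_iff intro!: map_cong filter_cong)
 ultimately have "concat (map (%x. filter (%i. g i = x) L) (x # xs)) = filter (%i. g i = x) L @ ?M"
  unfolding m by simp
 also have "\<dots> = L" using L by (rule sym)
 finally show ?case .
qed simp

lemma ann_eq_iff: "ann x y = ann x' y' \<longleftrightarrow> x = x' \<and> y - y' \<in> \<int>"
proof -
 have "cis (2 * pi * y) = cis (2 * pi * y') \<longleftrightarrow> y - y' \<in> \<int>"
 proof
  assume "cis (2 * pi * y) = cis (2 * pi * y')"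
  then have "sin (2 * pi * y) = sin (2 * pi * y') \<and> cos (2 * pi * y) = cos (2 * pi * y')"
   by (simp add: complex_eq_iff)
  then obtain n :: int where "2 * pi * y = 2 * pi * y' + 2 * pi * n" unfolding sin_cos_eq_iff by blast
  then have "2 * pi * (y - y') = 2 * pi * n" by (simp add: algebra_simps)
  then have "y - y' = n" by simp
  then show "y - y' \<in> \<int>" by simp
 next
  assume "y - y' \<in> \<int>"
  then obtain n :: int where "y - y' = n" by (auto elim: Ints_cases)
  then have "2 * pi * y = 2 * pi * (y' + n)" by simp
  then have "2 * pi * y = 2 * pi * y' + 2 * pi * n" by (simp only: distrib_left)
  then have "sin (2 * pi * y) = sin (2 * pi * y') \<and> cos (2 * pi * y) = cos (2 * pi * y')"
   unfolding sin_cos_eq_iff by blast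
  then show "cis (2 * pi * y) = cis (2 * pi * y')" by (simp add: complex_eq_iff)
 qed
 then show ?thesis by (simp add: ann_def)
qed

lemma ann_shift: "ann x (y - of_int k) = ann x y"
 by (simp add: ann_eq_iff)

text \<open>The integer translates of finitely many numbers form a discrete set. Applied to the ends
  of the edges, it gives each height a punctured neighbourhood in which no edge begins or
  ends.\<close>

lemma discrete_translates:
 fixes R :: "real set"
 assumes "finite R"
 obtains d where "d > 0" "\<And>y r k. y ~= y0 ==> \<bar>y - y0\<bar> < d ==> r \<in> R ==> y ~= r + of_int k"
proof -
 have "\<exists>d>0. \<forall>y. y ~= y0 --> \<bar>y - y0\<bar> < d --> (\<forall>r\<in>R. \<forall>k. y ~= r + of_int k)"
  using assms
 proof (induction R rule: finite_induct)
  case empty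
  then show ?case by (intro exI[of _ 1]) simp
 next
  case (insert r R)
  then obtain d where d: "d > 0" "\<And>y. y ~= y0 ==> \<bar>y - y0\<bar> < d ==> \<forall>r\<in>R. \<forall>k. y ~= r + of_int k" by blast
  let ?f = "frac (y0 - r)"
  \<comment> \<open>The distance from \<open>y0\<close> to the nearest translate of \<open>r\<close>
    other than \<open>y0\<close> itself.\<close>
  let ?c = "if ?f = 0 then 1 else min ?f (1 - ?f)"
  have c: "?c > 0"
  proof (cases "?f = 0")
   case False
   then have "?f > 0" "1 - ?f > 0" using frac_lt_1[of "y0 - r"] frac_ge_0[of "y0 - r"] by linarith+
   then show ?thesis by (simp only: False if_False min_less_iff_conj)
  qed simp
  have "y ~= r + of_int k" if "y ~= y0" "\<bar>y - y0\<bar> < ?c" for y k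
  proof
   assume y: "y = r + of_int k"
   define m where "m = k - \<lfloor>y0 - r\<rfloor>"
   have e: "y - y0 = of_int m - ?f" unfolding y m_def frac_def by simp
   have f: "0 \<le> ?f" "?f < 1" by (rule frac_ge_0, rule frac_lt_1)
   have b: "\<bar>of_int m - ?f\<bar> < ?c" using that(2) unfolding e .
   have c1: "?c \<le> 1" "?f ~= 0 ==> ?c \<le> ?f" "?f ~= 0 ==> ?c \<le> 1 - ?f" using f by auto
   have n0: "of_int m - ?f ~= 0" using that(1) unfolding e[symmetric] by simp
   consider "m \<le> -1" | "m = 0" | "m \<ge> 1" by linarith
   then show False
   proof cases
    case 1
    then have "real_of_int m \<le> -1" by linarith
    then show False using f b c1(1) by linarith
   next
    case 2
    then have "?f ~= 0" using n0 by auto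
    then show False using f b c1(2) 2 by simp
   next
    case 3
    then have m: "real_of_int m \<ge> 1" by linarith
    then show False using f b c1(1,3) by (cases "?f = 0") linarith+
   qed
  qed
  then show ?case using d c by (intro exI[of _ "min d ?c"]) (auto simp del: if_split)
 qed
 then show ?thesis using that by blast
qed

text \<open>Continuous functions that never meet on a connected set keep their order, by the
  intermediate value theorem; at a limit point the strict inequalities survive as weak ones. This is
  the form in which embeddedness enters.\<close>

lemma constant_order:
 fixes P :: "'i => real => real"
 assumes fin: "finite J" and S: "connected S" "S ~= {}" "y0 islimpt S"
  and cont: "\<And>i. i \<in> J ==> continuous_on (insert y0 S) (P i)"
  and dis: "\<And>i j y. i \<in> J ==> j \<in> J ==> i ~= j ==> y \<in> S ==> P i y ~= P j y"
 obtains L where "set L = J" "distinct L" "sorted_wrt (%i j. \<forall>y\<in>S. P i y < P j y) L"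
  "sorted (map (%i. P i y0) L)"
proof -
 obtain y1 where y1: "y1 \<in> S" using S(2) by blast
 have inj: "inj_on (%i. P i y1) J" using dis[OF _ _ _ y1] by (auto simp: inj_on_def)
 define X where "X = (%i. P i y1) ` J"
 define L where "L = map (inv_into J (%i. P i y1)) (sorted_list_of_set X)"
 have finX: "finite X" using fin by (simp add: X_def)
 have setL: "set L = J" using finX inv_into_image_cancel[OF inj order_refl] by (simp add: L_def X_def)
 have mL: "map (%i. P i y1) L = sorted_list_of_set X"
  unfolding L_def map_map
 proof (rule map_idI)
  fix x assume "x \<in> set (sorted_list_of_set X)"
  then have "x \<in> (%i. P i y1) ` J" using finX by (simp add: X_def)
  then show "((%i. P i y1) \<circ> inv_into J (%i. P i y1)) x = x"
   using f_inv_into_f[of x "%i. P i y1" J] by simp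
 qed
 have s1: "sorted_wrt (%i j. P i y1 < P j y1) L"
  using strict_sorted_list_of_set[of X] unfolding mL[symmetric] sorted_wrt_map .
 have key: "P i y < P j y" if ij: "i \<in> J" "j \<in> J" "P i y1 < P j y1" and y: "y \<in> S" for i j y
 proof (rule ccontr)
  assume "\<not> P i y < P j y"
  moreover have "i ~= j" using ij(3) by auto
  ultimately have lt: "P j y - P i y < 0" using dis[OF ij(1,2) _ y] by simp
  let ?g = "%y. P j y - P i y"
  have "continuous_on S ?g"
   using cont[OF ij(1)] cont[OF ij(2)] by (intro continuous_on_diff) (auto intro: continuous_on_subset)
  then have "connected (?g ` S)" using S(1) by (rule connected_continuous_image)
  then have "0 \<in> ?g ` S" using connectedD_interval[of "?g ` S" "?g y" "?g y1" 0] lt ij(3) y y1 by auto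
  then obtain z where "z \<in> S" "P j z = P i z" by auto
  then show False using dis[OF ij(1,2) \<open>i ~= j\<close>, of z] by simp
 qed
 have sy: "sorted_wrt (%i j. \<forall>y\<in>S. P i y < P j y) L"
  by (rule sorted_wrt_mono_rel[OF _ s1]) (use key setL in auto)
 have "distinct L" using finX mL by (metis distinct_map distinct_sorted_list_of_set)
 moreover have "sorted (map (%i. P i y0) L)"
  unfolding sorted_wrt_map
 proof (rule sorted_wrt_mono_rel[OF _ s1])
  fix i j assume ij: "i \<in> set L" "j \<in> set L" "P i y1 < P j y1"
  have lim: "(P i \<longlongrightarrow> P i y0) (at y0 within S)" if "i \<in> J" for i
   using cont[OF that] by (meson continuous_on_def insertI1 subset_insertI tendsto_within_subset)
  show "P i y0 \<le> P j y0"
  proof (rule tendsto_le[OF _ lim lim])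
   show "at y0 within S ~= bot" using S(3) by (simp add: trivial_limit_within)
   show "\<forall>\<^sub>F y in at y0 within S. P i y \<le> P j y"
    unfolding eventually_at_filter using key ij setL by (intro always_eventually) (auto intro: less_imp_le)
  qed (use ij setL in auto)
 qed
 ultimately show ?thesis using that[OF setL] sy by blast
qed

section \<open>Lifted edges around a height\<close>

locale ann_web =
 fixes w :: "'e web"
 assumes web: "annular_web w"
begin

lemma fin_E: "finite (edges w)" and fin_V: "finite (verts w)"
 using web by (auto simp: annular_web_def)

lemma edgeD:
 assumes "e \<in> edges w"
 shows "lo w e < hi w e" "continuous_on {lo w e..hi w e} (pos w e)" "pos w e ` {lo w e..hi w e} \<subseteq> {0..1}"
  "thick w e > 0" "edge_start w e \<in> verts w \<longleftrightarrow> edge_end w e \<in> verts w"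
  "edge_start w e \<notin> verts w ==> edge_end w e = edge_start w e"
  "y \<in> edge_dom w e ==> edge_pt w e y \<notin> verts w"
 using web assms by (auto simp: annular_web_def)

lemma edge_inj:
 assumes "e \<in> edges w" "e' \<in> edges w" "y \<in> edge_dom w e" "y' \<in> edge_dom w e'" "edge_pt w e y = edge_pt w e' y'"
 shows "e = e' \<and> y = y'"
proof -
 have "inj_on (%(e, y). edge_pt w e y) (SIGMA e:edges w. edge_dom w e)" using web by (simp add: annular_web_def)
 then have "(e, y) = (e', y')" by (rule inj_onD) (use assms in auto)
 then show ?thesis by simp
qed

lemma vertD:
 assumes "v \<in> verts w"
 shows "card (in_edges w v) = 2 \<and> card (out_edges w v) = 1 \<or> card (in_edges w v) = 1 \<and> card (out_edges w v) = 2"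
  "(\<Sum>e\<in>in_edges w v. thick w e) = (\<Sum>e\<in>out_edges w v. thick w e)"
proof -
 have "verts w = merges w \<union> splits w" using web by (simp add: annular_web_def)
 then show "card (in_edges w v) = 2 \<and> card (out_edges w v) = 1 \<or> card (in_edges w v) = 1 \<and> card (out_edges w v) = 2"
  using assms by (auto simp: merges_def splits_def)
 show "(\<Sum>e\<in>in_edges w v. thick w e) = (\<Sum>e\<in>out_edges w v. thick w e)"
  using web assms by (simp add: annular_web_def)
qed

text \<open>An instance \<open>(e, k)\<close> is the lift of the edge \<open>e\<close> to the strip with heights from \<open>lo w e + k\<close>
 to \<open>hi w e + k\<close>; \<open>dn y\<close> and \<open>up y\<close> collect the instances just below and just above height \<open>y\<close>.\<close>

definition dn :: "real => ('e \<times> int) set" where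
 "dn y = {(e, k). e \<in> edges w \<and> lo w e + k < y \<and> y \<le> hi w e + k}"

definition up :: "real => ('e \<times> int) set" where
 "up y = {(e, k). e \<in> edges w \<and> lo w e + k \<le> y \<and> y < hi w e + k}"

definition ps :: "'e \<times> int => real => real" where
 "ps i y = pos w (fst i) (y - of_int (snd i))"

lemma finite_dn: "finite (dn y)" and finite_up: "finite (up y)"
proof -
 have f: "finite (SIGMA e:edges w. {\<lfloor>y - hi w e\<rfloor>..\<lceil>y - lo w e\<rceil>})" using fin_E by (intro finite_SigmaI) auto
 show "finite (dn y)"
  by (rule finite_subset[OF _ f]) (auto simp: dn_def; linarith)
 show "finite (up y)"
  by (rule finite_subset[OF _ f]) (auto simp: up_def; linarith)
qed

lemma edge_pt_ps: "edge_pt w e (y - of_int k) = ann (ps (e, k) y) y"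
 by (simp add: edge_pt_def ps_def ann_shift)

lemma ann_edge_pt: "edge_pt w e z = ann x y ==> \<exists>k. z = y - of_int k \<and> ps (e, k) y = x"
proof -
 assume a: "edge_pt w e z = ann x y"
 then have 1: "pos w e z = x" "z - y \<in> \<int>" unfolding edge_pt_def ann_eq_iff by auto
 then obtain n :: int where "z - y = n" by (auto elim: Ints_cases)
 then have "z = y - of_int (- n)" by simp
 then show ?thesis using 1(1) by (intro exI[of _ "- n"]) (simp add: ps_def)
qed

lemma interior_dom: "lo w e < y ==> y < hi w e ==> y \<in> edge_dom w e"
 by (simp add: edge_dom_def)

lemma interior_inj:
 assumes "i \<in> dn y" "j \<in> dn y" "y < hi w (fst i) + snd i" "y < hi w (fst j) + snd j" "ps i y = ps j y"
 shows "i = j"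
proof -
 obtain e k e' k' where ij: "i = (e, k)" "j = (e', k')" by (metis prod.exhaust)
 have "y - of_int k \<in> edge_dom w e" "y - of_int k' \<in> edge_dom w e'"
  using assms(1-4) ij by (auto simp: dn_def intro: interior_dom)
 moreover have "edge_pt w e (y - of_int k) = edge_pt w e' (y - of_int k')"
  using assms(5) ij by (simp add: edge_pt_ps)
 ultimately have "e = e' \<and> y - of_int k = y - of_int k'"
  using assms(1,2) ij by (intro edge_inj) (auto simp: dn_def)
 then show ?thesis using ij by simp
qed

text \<open>On a vertex-free circle the upper end is outside \<open>edge_dom\<close>; its point is
  represented by the lower end of the same edge.\<close>

lemma dom_of_dn:
 assumes i: "(e, k) \<in> dn y" and nv: "ann (ps (e, k) y) y \<notin> verts w"
 obtains z where "z \<in> edge_dom w e" "edge_pt w e z = ann (ps (e, k) y) y" "y < hi w e + k ==> z = y - of_int k"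
  "y = hi w e + k ==> z = lo w e"
proof (cases "y < hi w e + k")
 case True
 show ?thesis
 proof (rule that[of "y - of_int k"])
  show "y - of_int k \<in> edge_dom w e" by (rule interior_dom) (use i True in \<open>auto simp: dn_def\<close>)
 qed (use True in \<open>simp_all add: edge_pt_ps\<close>)
next
 case False
 then have y: "y - of_int k = hi w e" and e: "e \<in> edges w" using i by (auto simp: dn_def)
 have "edge_end w e = ann (ps (e, k) y) y" using edge_pt_ps[of e y k] y by (simp add: edge_end_def)
 then have "edge_start w e \<notin> verts w" "edge_start w e = ann (ps (e, k) y) y" using edgeD(5,6)[OF e] nv by auto
 then show ?thesis using that[of "lo w e"] edgeD(1)[OF e] False by (auto simp: edge_dom_def edge_start_def)
qed

lemma dom_of_up:
 assumes i: "(e, k) \<in> up y" and nv: "ann (ps (e, k) y) y \<notin> verts w"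
 shows "y - of_int k \<in> edge_dom w e"
proof (cases "y = lo w e + k")
 case True
 then have "edge_start w e = ann (ps (e, k) y) y" using edge_pt_ps[of e y k] by (simp add: edge_start_def)
 then show ?thesis using True i nv by (auto simp: edge_dom_def up_def)
qed (use i in \<open>auto simp: up_def intro: interior_dom\<close>)

lemma up_inj:
 assumes "i \<in> up y" "j \<in> up y" "ps i y = ps j y" "ann (ps i y) y \<notin> verts w"
 shows "i = j"
proof -
 obtain e k e' k' where ij: "i = (e, k)" "j = (e', k')" by (metis prod.exhaust)
 have "y - of_int k \<in> edge_dom w e" "y - of_int k' \<in> edge_dom w e'"
  using assms ij dom_of_up by auto
 moreover have "edge_pt w e (y - of_int k) = edge_pt w e' (y - of_int k')"
  using assms(3) ij by (simp add: edge_pt_ps)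
 ultimately have "e = e' \<and> y - of_int k = y - of_int k'"
  using assms(1,2) ij by (intro edge_inj) (auto simp: up_def)
 then show ?thesis using ij by simp
qed

lemma dn_inj:
 assumes "i \<in> dn y" "j \<in> dn y" "ps i y = ps j y" "ann (ps i y) y \<notin> verts w"
 shows "i = j"
proof -
 obtain e k e' k' where ij: "i = (e, k)" "j = (e', k')" by (metis prod.exhaust)
 obtain z where z: "z \<in> edge_dom w e" "edge_pt w e z = ann (ps (e, k) y) y" "y < hi w e + k ==> z = y - of_int k"
  "y = hi w e + k ==> z = lo w e" using dom_of_dn[of e k y] assms ij by metis
 obtain z' where z': "z' \<in> edge_dom w e'" "edge_pt w e' z' = ann (ps (e', k') y) y" "y < hi w e' + k' ==> z' = y - of_int k'"
  "y = hi w e' + k' ==> z' = lo w e'" using dom_of_dn[of e' k' y] assms ij by metis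
 have "e = e' \<and> z = z'" using z(1,2) z'(1,2) assms ij by (intro edge_inj) (auto simp: dn_def)
 then have e: "e = e'" "z = z'" by auto
 have "k = k'" using assms(1,2) z(3,4) z'(3,4) e ij by (auto simp: dn_def; smt (verit) of_int_eq_iff)
 then show ?thesis using e ij by simp
qed

text \<open>A vertex-free circle that reaches its upper end continues in another lift of the same
  edge. So the names agree below and above a point, while the instances need not.\<close>

lemma dn_up_names:
 assumes x: "ann x y \<notin> verts w"
 shows "fst ` {i \<in> dn y. ps i y = x} = fst ` {i \<in> up y. ps i y = x}"
proof (intro equalityI subsetI)
 fix e assume "e \<in> fst ` {i \<in> dn y. ps i y = x}"
 then obtain k where k: "(e, k) \<in> dn y" "ps (e, k) y = x" by force
 then have e: "e \<in> edges w" by (simp add: dn_def)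
 show "e \<in> fst ` {i \<in> up y. ps i y = x}"
 proof (cases "y < hi w e + k")
  case True
  then have "(e, k) \<in> up y" using k by (auto simp: dn_def up_def)
  then show ?thesis using k(2) by force
 next
  case False
  then have y: "y - of_int k = hi w e" using k by (auto simp: dn_def)
  then have "edge_end w e = ann x y" using edge_pt_ps[of e y k] k(2) by (simp add: edge_end_def)
  then have "edge_pt w e (lo w e) = ann x y" using edgeD(5,6)[OF e] x by (simp add: edge_start_def)
  then obtain k' where k': "lo w e = y - of_int k'" "ps (e, k') y = x" using ann_edge_pt by blast
  then have "(e, k') \<in> up y" using e edgeD(1)[OF e] by (auto simp: up_def)
  then show ?thesis using k'(2) by force
 qed
next
 fix e assume "e \<in> fst ` {i \<in> up y. ps i y = x}"
 then obtain k where k: "(e, k) \<in> up y" "ps (e, k) y = x" by force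
 then have e: "e \<in> edges w" by (simp add: up_def)
 show "e \<in> fst ` {i \<in> dn y. ps i y = x}"
 proof (cases "lo w e + k < y")
  case True
  then have "(e, k) \<in> dn y" using k by (auto simp: dn_def up_def)
  then show ?thesis using k(2) by force
 next
  case False
  then have y: "y - of_int k = lo w e" using k by (auto simp: up_def)
  then have s: "edge_start w e = ann x y" using edge_pt_ps[of e y k] k(2) by (simp add: edge_start_def)
  then have "edge_pt w e (hi w e) = ann x y" using edgeD(6)[OF e] x by (simp add: edge_end_def)
  then obtain k' where k': "hi w e = y - of_int k'" "ps (e, k') y = x" using ann_edge_pt by blast
  then have "(e, k') \<in> dn y" using e edgeD(1)[OF e] by (auto simp: dn_def)
  then show ?thesis using k'(2) by force
 qed
qed

lemma dn_vertex:
 assumes v: "ann x y \<in> verts w" and i: "i \<in> dn y" "ps i y = x"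
 shows "y = hi w (fst i) + snd i" "fst i \<in> in_edges w (ann x y)"
proof -
 obtain e k where ek: "i = (e, k)" by (metis prod.exhaust)
 have e: "e \<in> edges w" using i ek by (simp add: dn_def)
 show y: "y = hi w (fst i) + snd i"
 proof (rule ccontr)
  assume "\<not> ?thesis"
  then have "y - of_int k \<in> edge_dom w e" using i ek by (intro interior_dom) (auto simp: dn_def)
  then have "ann (ps (e, k) y) y \<notin> verts w" using edgeD(7)[OF e] unfolding edge_pt_ps[symmetric] by blast
  then show False using v i ek by simp
 qed
 then show "fst i \<in> in_edges w (ann x y)"
  using edge_pt_ps[of e y k] i e ek by (simp add: in_edges_def edge_end_def)
qed

lemma up_vertex:
 assumes v: "ann x y \<in> verts w" and i: "i \<in> up y" "ps i y = x"
 shows "y = lo w (fst i) + snd i" "fst i \<in> out_edges w (ann x y)"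
proof -
 obtain e k where ek: "i = (e, k)" by (metis prod.exhaust)
 have e: "e \<in> edges w" using i ek by (simp add: up_def)
 show y: "y = lo w (fst i) + snd i"
 proof (rule ccontr)
  assume "\<not> ?thesis"
  then have "y - of_int k \<in> edge_dom w e" using i ek by (intro interior_dom) (auto simp: up_def)
  then have "ann (ps (e, k) y) y \<notin> verts w" using edgeD(7)[OF e] unfolding edge_pt_ps[symmetric] by blast
  then show False using v i ek by simp
 qed
 then show "fst i \<in> out_edges w (ann x y)"
  using edge_pt_ps[of e y k] i e ek by (simp add: out_edges_def edge_start_def)
qed

lemma dn_vertex_names: "ann x y \<in> verts w ==> fst ` {i \<in> dn y. ps i y = x} = in_edges w (ann x y)"
proof (intro equalityI subsetI)
 fix e assume v: "ann x y \<in> verts w" and "e \<in> in_edges w (ann x y)"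
 then have e: "e \<in> edges w" "edge_pt w e (hi w e) = ann x y" by (auto simp: in_edges_def edge_end_def)
 then obtain k where k: "hi w e = y - of_int k" "ps (e, k) y = x" using ann_edge_pt by blast
 then have "(e, k) \<in> dn y" using e edgeD(1)[OF e(1)] by (auto simp: dn_def)
 then show "e \<in> fst ` {i \<in> dn y. ps i y = x}" using k(2) by force
qed (use dn_vertex in blast)

lemma up_vertex_names: "ann x y \<in> verts w ==> fst ` {i \<in> up y. ps i y = x} = out_edges w (ann x y)"
proof (intro equalityI subsetI)
 fix e assume v: "ann x y \<in> verts w" and "e \<in> out_edges w (ann x y)"
 then have e: "e \<in> edges w" "edge_pt w e (lo w e) = ann x y" by (auto simp: out_edges_def edge_start_def)
 then obtain k where k: "lo w e = y - of_int k" "ps (e, k) y = x" using ann_edge_pt by blast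
 then have "(e, k) \<in> up y" using e edgeD(1)[OF e(1)] by (auto simp: up_def)
 then show "e \<in> fst ` {i \<in> up y. ps i y = x}" using k(2) by force
qed (use up_vertex in blast)

lemma vertex_height:
 assumes "ann x y \<in> verts w"
 obtains e k where "e \<in> edges w" "y = hi w e + of_int k"
proof -
 have "in_edges w (ann x y) ~= {}" using vertD(1)[OF assms] by auto
 then obtain e where "e \<in> edges w" "edge_pt w e (hi w e) = ann x y" by (auto simp: in_edges_def edge_end_def)
 then show ?thesis using ann_edge_pt[of e "hi w e" x y] that by force
qed

lemma ps_range: "i \<in> dn y \<or> i \<in> up y ==> ps i y \<in> {0..1}"
 using edgeD(3)[of "fst i"] by (auto simp: dn_def up_def ps_def image_subset_iff)

lemma cut_edges_list:
 assumes rad: "radial_cut w y" and L: "set L = up y" "sorted_wrt (%i j. ps i y < ps j y) L"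
 shows "cut_edges w y = map fst L"
proof -
 have nv: "ann (ps i y) y \<notin> verts w" if "i \<in> up y" for i
  using rad ps_range[of i y] that by (auto simp: radial_cut_def)
 have curve: "ann x y \<in> edge_curve w e \<longleftrightarrow> (\<exists>k. (e, k) \<in> up y \<and> ps (e, k) y = x)"
  if e: "e \<in> edges w" and x: "x \<in> {0..1}" for x e
 proof
  assume "ann x y \<in> edge_curve w e"
  then obtain z where z: "lo w e \<le> z" "z \<le> hi w e" "edge_pt w e z = ann x y" by (auto simp: edge_curve_def)
  then obtain k where k: "z = y - of_int k" "ps (e, k) y = x" using ann_edge_pt by blast
  have v: "ann x y \<notin> verts w" using rad x by (auto simp: radial_cut_def)
  show "\<exists>k. (e, k) \<in> up y \<and> ps (e, k) y = x"
  proof (cases "z = hi w e")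
   case False
   then have "(e, k) \<in> up y" using z k e by (auto simp: up_def)
   then show ?thesis using k by blast
  next
   case True
   then have "(e, k) \<in> dn y" using k e edgeD(1)[OF e] by (auto simp: dn_def)
   then have "e \<in> fst ` {i \<in> dn y. ps i y = x}" using k(2) by force
   then show ?thesis unfolding dn_up_names[OF v] by auto
  qed
 next
  assume "\<exists>k. (e, k) \<in> up y \<and> ps (e, k) y = x"
  then obtain k where "(e, k) \<in> up y" "ps (e, k) y = x" by blast
  then show "ann x y \<in> edge_curve w e" unfolding edge_curve_def
   by (intro image_eqI[of _ _ "y - of_int k"]) (auto simp: up_def edge_pt_ps)
 qed
 let ?X = "{x \<in> {0..1}. \<exists>e\<in>edges w. ann x y \<in> edge_curve w e}"
 have "?X = set (map (%i. ps i y) L)"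
 proof (intro equalityI subsetI)
  fix x assume "x \<in> ?X"
  then obtain e k where "(e, k) \<in> up y" "ps (e, k) y = x" using curve by blast
  then show "x \<in> set (map (%i. ps i y) L)" using L(1) by force
 next
  fix x assume "x \<in> set (map (%i. ps i y) L)"
  then obtain e k where ek: "(e, k) \<in> up y" "ps (e, k) y = x" using L(1) by force
  then have "e \<in> edges w" "x \<in> {0..1}" using ps_range[of "(e, k)" y] by (auto simp: up_def)
  then show "x \<in> ?X" using curve ek by blast
 qed
 moreover have "sorted_wrt (<) (map (%i. ps i y) L)" using L(2) by (simp add: sorted_wrt_map)
 ultimately have "sorted_list_of_set ?X = map (%i. ps i y) L"
  by (metis sorted_list_of_set.idem_if_sorted_distinct strict_sorted_iff)
 moreover have "(THE e. e \<in> edges w \<and> ann (ps i y) y \<in> edge_curve w e) = fst i" if i: "i \<in> set L" for i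
 proof (rule the_equality)
  have iu: "i \<in> up y" using i L by simp
  then have e: "fst i \<in> edges w" by (auto simp: up_def)
  then show "fst i \<in> edges w \<and> ann (ps i y) y \<in> edge_curve w (fst i)"
   using curve[OF e, of "ps i y"] ps_range[of i y] iu by (cases i) auto
  fix e assume e: "e \<in> edges w \<and> ann (ps i y) y \<in> edge_curve w e"
  then obtain k where "(e, k) \<in> up y" "ps (e, k) y = ps i y" using curve[of e "ps i y"] ps_range[of i y] iu by blast
  then have "(e, k) = i" using up_inj[of "(e, k)" y i] iu nv[OF iu] by simp
  then show "e = fst i" by auto
 qed
 ultimately show ?thesis unfolding cut_edges_def by (simp add: comp_def)
qed

end

lemma distinct_of_sorted_wrt:
 assumes "sorted_wrt R xs" "\<And>a. \<not> R a a"
 shows "distinct xs"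
 using assms(1) by (induction xs) (use assms(2) in auto)

lemma right_open: "(a :: real) < b ==> eventually (%z. z \<in> {a<..<b}) (at_right a)"
 by (rule eventually_at_right_real)

section \<open>Left-to-right order near a height\<close>

context ann_web
begin

definition left_of_above :: "'e => 'e => bool" where
 "left_of_above e e' \<longleftrightarrow> (\<forall>\<^sub>F s in at_right 0. pos w e (lo w e + s) < pos w e' (lo w e' + s))"

text \<open>The choice is harmless: the relation is asymmetric, so a sorted list is determined by
  its elements, and \<open>group_names\<close> provides one at every vertex.\<close>

definition ins :: "real \<times> complex => 'e list" where
 "ins v = (SOME L. set L = in_edges w v \<and> sorted_wrt (left_of_below w) L)"

definition outs :: "real \<times> complex => 'e list" where
 "outs v = (SOME L. set L = out_edges w v \<and> sorted_wrt left_of_above L)"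

lemma eventually_asym:
 assumes "\<forall>\<^sub>F s in at_right (a :: real). f s < (g s :: real)" "\<forall>\<^sub>F s in at_right a. g s < f s"
 shows False
proof -
 have "\<forall>\<^sub>F s in at_right a. False" using eventually_conj[OF assms] by (rule eventually_mono) auto
 then show False by simp
qed

lemma below_asym: "left_of_below w e e' ==> left_of_below w e' e ==> False"
 unfolding left_of_below_def by (rule eventually_asym)

lemma above_asym: "left_of_above e e' ==> left_of_above e' e ==> False"
 unfolding left_of_above_def by (rule eventually_asym)

lemma ins_eq:
 assumes "set L = in_edges w v" "sorted_wrt (left_of_below w) L"
 shows "ins v = L"
proof -
 have "set (ins v) = in_edges w v \<and> sorted_wrt (left_of_below w) (ins v)"
  unfolding ins_def by (rule someI[of _ L]) (use assms in simp)
 then show ?thesis using assms sorted_wrt_unique[of "left_of_below w" "ins v" L] below_asym by metis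
qed

lemma outs_eq:
 assumes "set L = out_edges w v" "sorted_wrt left_of_above L"
 shows "outs v = L"
proof -
 have "set (outs v) = out_edges w v \<and> sorted_wrt left_of_above (outs v)"
  unfolding outs_def by (rule someI[of _ L]) (use assms in simp)
 then show ?thesis using assms sorted_wrt_unique[of left_of_above "outs v" L] above_asym by metis
qed

lemma neighbourhood:
 obtains d where "d > 0"
  "\<And>y. y0 - d < y ==> y < y0 ==> up y = dn y0 \<and> dn y = dn y0 \<and> radial_cut w y"
  "\<And>y. y0 < y ==> y < y0 + d ==> up y = up y0 \<and> dn y = up y0 \<and> radial_cut w y"
  "\<And>e k. (e, k) \<in> dn y0 ==> lo w e + k \<le> y0 - d" "\<And>e k. (e, k) \<in> up y0 ==> y0 + d \<le> hi w e + k"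
  "\<And>x y. y ~= y0 ==> \<bar>y - y0\<bar> < d ==> ann x y \<notin> verts w"
proof -
 let ?R = "lo w ` edges w \<union> hi w ` edges w"
 obtain d where d: "d > 0" "\<And>y r k. y ~= y0 ==> \<bar>y - y0\<bar> < d ==> r \<in> ?R ==> y ~= r + of_int k"
  using discrete_translates[of ?R y0] fin_E by auto
 have ne: "y ~= lo w e + of_int k" "y ~= hi w e + of_int k" if "e \<in> edges w" "y ~= y0" "\<bar>y - y0\<bar> < d" for e y k
  using d(2)[OF that(2,3)] that(1) by blast+
 have far: "lo w e + of_int k ~= y0 ==> \<bar>lo w e + of_int k - y0\<bar> \<ge> d" "hi w e + of_int k ~= y0 ==> \<bar>hi w e + of_int k - y0\<bar> \<ge> d"
  if "e \<in> edges w" for e k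
  using ne[OF that, of "lo w e + of_int k" k] ne[OF that, of "hi w e + of_int k" k] by force+
 have nv: "ann x y \<notin> verts w" if "y ~= y0" "\<bar>y - y0\<bar> < d" for x y
 proof
  assume "ann x y \<in> verts w"
  then obtain e k where "e \<in> edges w" "y = hi w e + of_int k" by (rule vertex_height)
  then show False using ne(2) that by blast
 qed
 show ?thesis
 proof (rule that[OF d(1)])
  fix y assume y: "y0 - d < y" "y < y0"
  have "lo w e + of_int k < y0 \<and> y0 \<le> hi w e + of_int k \<longleftrightarrow> lo w e + of_int k \<le> y \<and> y < hi w e + of_int k"
   "lo w e + of_int k < y0 \<and> y0 \<le> hi w e + of_int k \<longleftrightarrow> lo w e + of_int k < y \<and> y \<le> hi w e + of_int k" if "e \<in> edges w" for e k
   using far[OF that, of k] y by linarith+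
  then show "up y = dn y0 \<and> dn y = dn y0 \<and> radial_cut w y"
   using nv[of y] y unfolding up_def dn_def radial_cut_def by auto
 next
  fix y assume y: "y0 < y" "y < y0 + d"
  have "lo w e + of_int k \<le> y0 \<and> y0 < hi w e + of_int k \<longleftrightarrow> lo w e + of_int k \<le> y \<and> y < hi w e + of_int k"
   "lo w e + of_int k \<le> y0 \<and> y0 < hi w e + of_int k \<longleftrightarrow> lo w e + of_int k < y \<and> y \<le> hi w e + of_int k" if "e \<in> edges w" for e k
   using far[OF that, of k] y by linarith+
  then show "up y = up y0 \<and> dn y = up y0 \<and> radial_cut w y"
   using nv[of y] y unfolding up_def dn_def radial_cut_def by auto
 next
  show "lo w e + of_int k \<le> y0 - d" if "(e, k) \<in> dn y0" for e k
   using that far(1)[of e k] by (auto simp: dn_def)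
  show "y0 + d \<le> hi w e + of_int k" if "(e, k) \<in> up y0" for e k
   using that far(2)[of e k] by (auto simp: up_def)
 qed (rule nv)
qed

text \<open>\<open>LB\<close> and \<open>LA\<close> list the instances just below and just above
  \<open>y0\<close> from left to right. The order is strict and constant on either side but only
  weak at \<open>y0\<close>, where several instances may meet in a vertex.\<close>

definition local_data :: "real => real => ('e \<times> int) list => ('e \<times> int) list => bool" where
 "local_data y0 d LB LA \<longleftrightarrow> d > 0 \<and>
   set LB = dn y0 \<and> distinct LB \<and> sorted (map (%i. ps i y0) LB) \<and>
   sorted_wrt (%i j. \<forall>y\<in>{y0 - d<..<y0}. ps i y < ps j y) LB \<and>
   (\<forall>y\<in>{y0 - d<..<y0}. up y = dn y0 \<and> radial_cut w y \<and> cut_edges w y = map fst LB) \<and>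
   set LA = up y0 \<and> distinct LA \<and> sorted (map (%i. ps i y0) LA) \<and>
   sorted_wrt (%i j. \<forall>y\<in>{y0<..<y0 + d}. ps i y < ps j y) LA \<and>
   (\<forall>y\<in>{y0<..<y0 + d}. up y = up y0 \<and> radial_cut w y \<and> cut_edges w y = map fst LA) \<and>
   (radial_cut w y0 --> cut_edges w y0 = map fst LA) \<and>
   (\<forall>x y. y ~= y0 --> \<bar>y - y0\<bar> < d --> ann x y \<notin> verts w)"

lemma local_data_ex: "\<exists>d LB LA. local_data y0 d LB LA"
proof -
 obtain d where d: "d > 0"
  "\<And>y. y0 - d < y ==> y < y0 ==> up y = dn y0 \<and> dn y = dn y0 \<and> radial_cut w y"
  "\<And>y. y0 < y ==> y < y0 + d ==> up y = up y0 \<and> dn y = up y0 \<and> radial_cut w y"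
  "\<And>e k. (e, k) \<in> dn y0 ==> lo w e + k \<le> y0 - d" "\<And>e k. (e, k) \<in> up y0 ==> y0 + d \<le> hi w e + k"
  "\<And>x y. y ~= y0 ==> \<bar>y - y0\<bar> < d ==> ann x y \<notin> verts w"
  using neighbourhood[of y0] by blast
 have cont: "continuous_on T (ps i)" if "fst i \<in> edges w" "\<And>y. y \<in> T ==> lo w (fst i) + of_int (snd i) \<le> y \<and> y \<le> hi w (fst i) + of_int (snd i)" for i T
  unfolding ps_def
 proof (rule continuous_on_compose2[OF edgeD(2)[OF that(1)]])
  show "(%y. y - of_int (snd i)) ` T \<subseteq> {lo w (fst i)..hi w (fst i)}" using that(2) by force
 qed (intro continuous_intros)
 have dis: "ps i y ~= ps j y" if "up y = dn y" "i \<in> dn y" "j \<in> dn y" "i ~= j" for i j y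
 proof
  assume "ps i y = ps j y"
  moreover have "y < hi w (fst i) + snd i" "y < hi w (fst j) + snd j"
   using that(2,3) unfolding that(1)[symmetric] by (auto simp: up_def)
  ultimately show False using interior_inj[OF that(2,3)] that(4) by blast
 qed
 obtain LB where LB: "set LB = dn y0" "distinct LB" "sorted_wrt (%i j. \<forall>y\<in>{y0 - d<..<y0}. ps i y < ps j y) LB"
  "sorted (map (%i. ps i y0) LB)"
 proof (rule constant_order[of "dn y0" "{y0 - d<..<y0}" y0 ps])
  show "{y0 - d<..<y0} ~= {}" "y0 islimpt {y0 - d<..<y0}"
   using d(1) by (auto intro: islimpt_greaterThanLessThan2)
  show "continuous_on (insert y0 {y0 - d<..<y0}) (ps i)" if "i \<in> dn y0" for i
   by (rule cont) (use that d(4)[of "fst i" "snd i"] d(1) in \<open>auto simp: dn_def\<close>)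
  show "ps i y ~= ps j y" if "i \<in> dn y0" "j \<in> dn y0" "i ~= j" "y \<in> {y0 - d<..<y0}" for i j y
   by (rule dis) (use d(2)[of y] that in auto)
 qed (auto intro: finite_dn)
 obtain LA where LA: "set LA = up y0" "distinct LA" "sorted_wrt (%i j. \<forall>y\<in>{y0<..<y0 + d}. ps i y < ps j y) LA"
  "sorted (map (%i. ps i y0) LA)"
 proof (rule constant_order[of "up y0" "{y0<..<y0 + d}" y0 ps])
  show "{y0<..<y0 + d} ~= {}" "y0 islimpt {y0<..<y0 + d}"
   using d(1) by (auto intro: islimpt_greaterThanLessThan1)
  show "continuous_on (insert y0 {y0<..<y0 + d}) (ps i)" if "i \<in> up y0" for i
   by (rule cont) (use that d(5)[of "fst i" "snd i"] d(1) in \<open>auto simp: up_def\<close>)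
  show "ps i y ~= ps j y" if "i \<in> up y0" "j \<in> up y0" "i ~= j" "y \<in> {y0<..<y0 + d}" for i j y
   by (rule dis) (use d(3)[of y] that in auto)
 qed (auto intro: finite_up)
 have cB: "cut_edges w y = map fst LB" if y: "y \<in> {y0 - d<..<y0}" for y
 proof (rule cut_edges_list)
  show "sorted_wrt (%i j. ps i y < ps j y) LB" by (rule sorted_wrt_mono_rel[OF _ LB(3)]) (use y in blast)
 qed (use d(2)[of y] y LB(1) in auto)
 have cA: "cut_edges w y = map fst LA" if y: "y \<in> {y0<..<y0 + d}" for y
 proof (rule cut_edges_list)
  show "sorted_wrt (%i j. ps i y < ps j y) LA" by (rule sorted_wrt_mono_rel[OF _ LA(3)]) (use y in blast)
 qed (use d(3)[of y] y LA(1) in auto)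
 have c0: "cut_edges w y0 = map fst LA" if r: "radial_cut w y0"
 proof (rule cut_edges_list[OF r LA(1)])
  have "inj_on (%i. ps i y0) (set LA)"
  proof (rule inj_onI)
   fix i j assume ij: "i \<in> set LA" "j \<in> set LA" "ps i y0 = ps j y0"
   have "ann (ps i y0) y0 \<notin> verts w" using r ps_range[of i y0] ij(1) LA(1) unfolding radial_cut_def by blast
   then show "i = j" using up_inj[of i y0 j] ij LA(1) by simp
  qed
  then have "distinct (map (%i. ps i y0) LA)" using LA(2) by (simp add: distinct_map)
  then have "sorted_wrt (<) (map (%i. ps i y0) LA)" using LA(4) strict_sorted_iff by blast
  then show "sorted_wrt (%i j. ps i y0 < ps j y0) LA" by (simp add: sorted_wrt_map)
 qed
 have "local_data y0 d LB LA"
  unfolding local_data_def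
 proof (intro conjI ballI allI impI)
  show "up y = dn y0" "radial_cut w y" "cut_edges w y = map fst LB" if "y \<in> {y0 - d<..<y0}" for y
   using d(2)[of y] cB[OF that] that by auto
  show "up y = up y0" "radial_cut w y" "cut_edges w y = map fst LA" if "y \<in> {y0<..<y0 + d}" for y
   using d(3)[of y] cA[OF that] that by auto
 qed (fact d(1) LB LA c0 d(6))+
 then show ?thesis by blast
qed

section \<open>Conserved weights across a height\<close>

lemma group_inj:
 shows "inj_on fst {i \<in> dn y. ps i y = x}" "inj_on fst {i \<in> up y. ps i y = x}"
proof -
 show "inj_on fst {i \<in> dn y. ps i y = x}"
 proof (rule inj_onI)
  fix i j assume i: "i \<in> {i \<in> dn y. ps i y = x}" and j: "j \<in> {i \<in> dn y. ps i y = x}" and e: "fst i = fst j"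
  show "i = j"
  proof (cases "ann x y \<in> verts w")
   case True
   have "y = hi w (fst i) + snd i" "y = hi w (fst j) + snd j" using dn_vertex(1)[OF True] i j by blast+
   then have "snd i = snd j" using e by simp
   then show ?thesis using e by (simp add: prod_eq_iff)
  qed (use dn_inj[of i y j] i j in auto)
 qed
 show "inj_on fst {i \<in> up y. ps i y = x}"
 proof (rule inj_onI)
  fix i j assume i: "i \<in> {i \<in> up y. ps i y = x}" and j: "j \<in> {i \<in> up y. ps i y = x}" and e: "fst i = fst j"
  show "i = j"
  proof (cases "ann x y \<in> verts w")
   case True
   have "y = lo w (fst i) + snd i" "y = lo w (fst j) + snd j" using up_vertex(1)[OF True] i j by blast+
   then have "snd i = snd j" using e by simp
   then show ?thesis using e by (simp add: prod_eq_iff)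
  qed (use up_inj[of i y j] i j in auto)
 qed
qed

definition cons :: "('e => nat) => bool" where
 "cons \<theta> \<longleftrightarrow> (\<forall>v\<in>verts w. (\<Sum>e\<in>in_edges w v. \<theta> e) = (\<Sum>e\<in>out_edges w v. \<theta> e))"

lemma cons_thick: "cons (thick w)"
 using vertD(2) by (simp add: cons_def)

lemma group_thick:
 assumes c: "cons \<theta>"
 shows "(\<Sum>j\<in>{i \<in> dn y. ps i y = x}. \<theta> (fst j)) = (\<Sum>j\<in>{i \<in> up y. ps i y = x}. \<theta> (fst j))"
proof -
 have "(\<Sum>e\<in>fst ` {i \<in> dn y. ps i y = x}. \<theta> e) = (\<Sum>e\<in>fst ` {i \<in> up y. ps i y = x}. \<theta> e)"
 proof (cases "ann x y \<in> verts w")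
  case True
  then show ?thesis using dn_vertex_names[OF True] up_vertex_names[OF True] c True by (simp add: cons_def)
 next
  case False
  then show ?thesis using dn_up_names[OF False] by simp
 qed
 then show ?thesis by (simp add: sum.reindex[OF group_inj(1)] sum.reindex[OF group_inj(2)])
qed

lemma points_eq: "(%i. ps i y) ` dn y = (%i. ps i y) ` up y"
proof -
 have key: "{i \<in> dn y. ps i y = x} = {} \<longleftrightarrow> {i \<in> up y. ps i y = x} = {}" for x
 proof (cases "ann x y \<in> verts w")
  case True
  have "in_edges w (ann x y) ~= {}" "out_edges w (ann x y) ~= {}" using vertD(1)[OF True] by auto
  then have "fst ` {i \<in> dn y. ps i y = x} ~= {}" "fst ` {i \<in> up y. ps i y = x} ~= {}"
   unfolding dn_vertex_names[OF True] up_vertex_names[OF True] by blast+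
  then show ?thesis by blast
 next
  case False
  show ?thesis using arg_cong[OF dn_up_names[OF False], of "%S. S = {}"] by (simp only: image_is_empty)
 qed
 show ?thesis
 proof (rule set_eqI)
  fix x
  have "x \<in> (%i. ps i y) ` dn y \<longleftrightarrow> {i \<in> dn y. ps i y = x} ~= {}"
   "x \<in> (%i. ps i y) ` up y \<longleftrightarrow> {i \<in> up y. ps i y = x} ~= {}" by blast+
  then show "x \<in> (%i. ps i y) ` dn y \<longleftrightarrow> x \<in> (%i. ps i y) ` up y" using key[of x] by blast
 qed
qed

lemma left_thick:
 assumes c: "cons \<theta>"
 shows "(\<Sum>j\<in>{j \<in> dn y. ps j y < x}. \<theta> (fst j)) = (\<Sum>j\<in>{j \<in> up y. ps j y < x}. \<theta> (fst j))"
proof -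
 have G: "(\<Sum>j\<in>{j \<in> J. ps j y < x}. \<theta> (fst j)) =
   (\<Sum>z\<in>(%j. ps j y) ` J \<inter> {..<x}. \<Sum>j\<in>{i \<in> J. ps i y = z}. \<theta> (fst j))" if "finite J" for J
 proof -
  have "(\<Sum>j\<in>{j \<in> J. ps j y < x}. \<theta> (fst j)) =
    (\<Sum>z\<in>(%j. ps j y) ` {j \<in> J. ps j y < x}. \<Sum>j\<in>{j. j \<in> {j \<in> J. ps j y < x} \<and> ps j y = z}. \<theta> (fst j))"
   by (rule sum.image_gen) (use that in simp)
  also have "(%j. ps j y) ` {j \<in> J. ps j y < x} = (%j. ps j y) ` J \<inter> {..<x}" by blast
  also have "(\<Sum>z\<in>(%j. ps j y) ` J \<inter> {..<x}. \<Sum>j\<in>{j. j \<in> {j \<in> J. ps j y < x} \<and> ps j y = z}. \<theta> (fst j)) =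
    (\<Sum>z\<in>(%j. ps j y) ` J \<inter> {..<x}. \<Sum>j\<in>{i \<in> J. ps i y = z}. \<theta> (fst j))"
  proof (rule sum.cong[OF refl])
   fix z assume "z \<in> (%j. ps j y) ` J \<inter> {..<x}"
   then have "{j. j \<in> {j \<in> J. ps j y < x} \<and> ps j y = z} = {i \<in> J. ps i y = z}" by blast
   then show "(\<Sum>j\<in>{j. j \<in> {j \<in> J. ps j y < x} \<and> ps j y = z}. \<theta> (fst j)) = (\<Sum>j\<in>{i \<in> J. ps i y = z}. \<theta> (fst j))"
    by (simp only:)
  qed
  finally show ?thesis .
 qed
 show ?thesis unfolding G[OF finite_dn] G[OF finite_up] points_eq group_thick[OF c] by (rule refl)
qed

text \<open>The total weight to the left of an edge does not change along the edge.  Hence positive weights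
 show that the names of the edges in a slice are distinct, and the weight of one colour numbers the
 circles of that colour.\<close>

definition lam :: "('e => nat) => 'e \<times> int => real => nat" where
 "lam \<theta> i a = (\<Sum>j\<in>{j \<in> up a. \<forall>\<^sub>F z in at_right a. ps j z < ps i z}. \<theta> (fst j))"

lemma lam_list:
 assumes L: "set L = up a" "distinct L" "sorted_wrt (%i j. \<forall>y\<in>S. ps i y < ps j y) L"
  and S: "\<forall>\<^sub>F z in at_right a. z \<in> S" and s: "L = A @ i # B"
 shows "lam \<theta> i a = sum_list (map (%j. \<theta> (fst j)) A)"
proof -
 have "{j \<in> up a. \<forall>\<^sub>F z in at_right a. ps j z < ps i z} = set A"
 proof (intro equalityI subsetI)
  fix j assume "j \<in> set A"
  then have "\<forall>y\<in>S. ps j y < ps i y" using L(3) s by (simp add: sorted_wrt_append)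
  then have "\<forall>\<^sub>F z in at_right a. ps j z < ps i z" using S by (simp add: eventually_mono)
  then show "j \<in> {j \<in> up a. \<forall>\<^sub>F z in at_right a. ps j z < ps i z}" using L(1) s \<open>j \<in> set A\<close> by auto
 next
  fix j assume j: "j \<in> {j \<in> up a. \<forall>\<^sub>F z in at_right a. ps j z < ps i z}"
  then have "j \<in> set L" using L(1) by simp
  moreover have "j ~= i" using j eventually_asym[of "ps i" "ps i" a] by auto
  moreover have "j \<notin> set B"
  proof
   assume "j \<in> set B"
   then have "\<forall>y\<in>S. ps i y < ps j y" using L(3) s by (simp add: sorted_wrt_append)
   then have "\<forall>\<^sub>F z in at_right a. ps i z < ps j z" using S by (simp add: eventually_mono)
   then show False using j eventually_asym by blast
  qed
  ultimately show "j \<in> set A" using s by auto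
 qed
 then show ?thesis unfolding lam_def using L(2) s by (simp add: sum_list_distinct_conv_sum_set)
qed

lemma split_at_point:
 assumes L: "sorted (map (%i. ps i y0) L)" "distinct L" "L = A @ i # B"
  and alone: "\<And>j. j \<in> set L ==> ps j y0 = ps i y0 ==> j = i"
 shows "set A = {j \<in> set L. ps j y0 < ps i y0}"
proof (intro equalityI subsetI)
 fix j assume j: "j \<in> set A"
 then have "ps j y0 \<le> ps i y0" using L(1,3) by (auto simp: sorted_append)
 moreover have "j ~= i" using L(2,3) j by auto
 ultimately show "j \<in> {j \<in> set L. ps j y0 < ps i y0}" using alone[of j] j L(3) by force
next
 fix j assume "j \<in> {j \<in> set L. ps j y0 < ps i y0}"
 then show "j \<in> set A" using L(1,3) by (auto simp: sorted_append)
qed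

lemma lam_local:
 assumes c: "cons \<theta>" and ld: "local_data y0 d LB LA" and e: "e \<in> edges w" and i: "lo w e + of_int k < y0" "y0 < hi w e + of_int k"
 obtains n where "\<And>a. y0 - d < a ==> a < y0 + d ==> lam \<theta> (e, k) a = n"
proof -
 let ?i = "(e, k)"
 have D: "?i \<in> dn y0" and U: "?i \<in> up y0" using e i by (auto simp: dn_def up_def)
 have nv: "ann (ps ?i y0) y0 \<notin> verts w"
  using edgeD(7)[OF e interior_dom[of e "y0 - of_int k"]] i by (simp add: edge_pt_ps)
 note ld' = ld[unfolded local_data_def]
 obtain A B where sB: "LB = A @ ?i # B" using split_list[of ?i LB] D ld' by metis
 obtain A' B' where sA: "LA = A' @ ?i # B'" using split_list[of ?i LA] U ld' by metis
 have A: "set A = {j \<in> dn y0. ps j y0 < ps ?i y0}"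
 proof -
  have "set A = {j \<in> set LB. ps j y0 < ps ?i y0}"
  proof (rule split_at_point[OF _ _ sB])
   show "j = ?i" if "j \<in> set LB" "ps j y0 = ps ?i y0" for j
    using dn_inj[of j y0 ?i] that D nv ld' by simp
  qed (use ld' in blast)+
  then show ?thesis using ld' by simp
 qed
 have A': "set A' = {j \<in> up y0. ps j y0 < ps ?i y0}"
 proof -
  have "set A' = {j \<in> set LA. ps j y0 < ps ?i y0}"
  proof (rule split_at_point[OF _ _ sA])
   show "j = ?i" if "j \<in> set LA" "ps j y0 = ps ?i y0" for j
    using up_inj[of j y0 ?i] that U nv ld' by simp
  qed (use ld' in blast)+
  then show ?thesis using ld' by simp
 qed
 have dA: "distinct A" "distinct A'" using ld' sA sB by auto
 have eq: "sum_list (map (%j. \<theta> (fst j)) A) = sum_list (map (%j. \<theta> (fst j)) A')"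
  using left_thick[OF c, of y0 "ps ?i y0"] dA by (simp add: sum_list_distinct_conv_sum_set A A')
 show ?thesis
 proof (rule that)
  fix a assume a: "y0 - d < a" "a < y0 + d"
  show "lam \<theta> ?i a = sum_list (map (%j. \<theta> (fst j)) A)"
  proof (cases "a < y0")
   case True
   then have "\<forall>\<^sub>F z in at_right a. z \<in> {y0 - d<..<y0}"
    using right_open[OF True] a by (auto elim: eventually_mono)
   then show ?thesis using lam_list[of LB a "{y0 - d<..<y0}" A ?i B] ld' sB a True by auto
  next
   case False
   then have "\<forall>\<^sub>F z in at_right a. z \<in> {y0<..<y0 + d}"
    using right_open[OF a(2)] by (auto elim: eventually_mono)
   moreover have "set LA = up a" using ld' False a by (cases "a = y0") auto
   ultimately show ?thesis using lam_list[of LA a "{y0<..<y0 + d}" A' ?i B'] ld' sA unfolding eq by auto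
  qed
 qed
qed

lemma lam_const:
 assumes c: "cons \<theta>" and e: "e \<in> edges w" and a: "lo w e + of_int k < a" "a \<le> b" "b < hi w e + of_int k"
 shows "lam \<theta> (e, k) a = lam \<theta> (e, k) b"
 using a(2)
proof (induction rule: Bolzano)
 case (local x)
 obtain d LB LA where ld: "local_data x d LB LA" using local_data_ex by blast
 have x: "lo w e + of_int k < x" "x < hi w e + of_int k" using local a by auto
 obtain n where n: "\<And>a. x - d < a ==> a < x + d ==> lam \<theta> (e, k) a = n" using lam_local[OF c ld e x] by blast
 show ?case
  by (rule exI[of _ d]) (use ld n in \<open>auto simp: local_data_def\<close>)
qed simp

lemma lam_shift: "lam \<theta> (e, k) y = lam \<theta> (e, 0) (y - of_int k)"
 unfolding lam_def
proof (rule sum.reindex_bij_witness[where i = "%(f, m). (f, m + k)" and j = "%(f, m). (f, m - k)"])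
 have sh: "ps (f, m - k) (z - of_int k) = ps (f, m) z" for f m z by (simp add: ps_def)
 have ev: "(\<forall>\<^sub>F z in at_right (y - of_int k). ps (f, m - k) z < ps (e, 0) z) \<longleftrightarrow> (\<forall>\<^sub>F z in at_right y. ps (f, m) z < ps (e, k) z)" for f m
 proof -
  have "(\<forall>\<^sub>F z in at_right (y - of_int k). ps (f, m - k) z < ps (e, 0) z) \<longleftrightarrow>
    (\<forall>\<^sub>F z in at_right y. ps (f, m - k) (z - of_int k) < ps (e, 0) (z - of_int k))"
   unfolding filtermap_at_right_shift[of "of_int k" y, symmetric] eventually_filtermap by (rule refl)
  also have "\<dots> \<longleftrightarrow> (\<forall>\<^sub>F z in at_right y. ps (f, m) z < ps (e, k) z)"
   using sh[of e k] by (simp only: sh diff_self)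
  finally show ?thesis .
 qed
 show "(case j of (f, m) => (f, m - k)) \<in> {j \<in> up (y - of_int k). \<forall>\<^sub>F z in at_right (y - of_int k). ps j z < ps (e, 0) z}"
  if "j \<in> {j \<in> up y. \<forall>\<^sub>F z in at_right y. ps j z < ps (e, k) z}" for j
  using that ev by (cases j) (auto simp: up_def)
 show "(case j of (f, m) => (f, m + k)) \<in> {j \<in> up y. \<forall>\<^sub>F z in at_right y. ps j z < ps (e, k) z}"
  if "j \<in> {j \<in> up (y - of_int k). \<forall>\<^sub>F z in at_right (y - of_int k). ps j z < ps (e, 0) z}" for j
 proof (cases j)
  case (Pair f m)
  then show ?thesis using that ev[of f "m + k"] by (auto simp: up_def)
 qed
qed auto

definition Lam :: "('e => nat) => 'e => nat" where "Lam \<theta> e = lam \<theta> (e, 0) ((lo w e + hi w e) / 2)"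

lemma lam_Lam:
 assumes c: "cons \<theta>" and e: "e \<in> edges w" and a: "lo w e + of_int k < a" "a < hi w e + of_int k"
 shows "lam \<theta> (e, k) a = Lam \<theta> e"
proof -
 let ?m = "(lo w e + hi w e) / 2"
 have m: "lo w e + of_int 0 < ?m" "?m < hi w e + of_int 0" using edgeD(1)[OF e] by auto
 have "lo w e + of_int 0 < a - of_int k" "a - of_int k < hi w e + of_int 0" using a by auto
 then have "lam \<theta> (e, 0) (a - of_int k) = lam \<theta> (e, 0) ?m"
  using lam_const[OF c e, of 0 "a - of_int k" ?m] lam_const[OF c e, of 0 ?m "a - of_int k"] m
  by (cases "a - of_int k \<le> ?m") auto
 then show ?thesis unfolding lam_shift[of \<theta> e k] Lam_def .
qed

text \<open>The invariant of all slices. It refers to the list alone and to no height, so it also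
  makes sense for the intermediate lists between two vertices at the same height.\<close>

definition good :: "'e list => bool" where
 "good L \<longleftrightarrow> set L \<subseteq> edges w \<and> (\<forall>\<theta> A e B. cons \<theta> --> L = A @ e # B --> sum_list (map \<theta> A) = Lam \<theta> e)"

text \<open>An edge that winds round the annulus more than once would occur twice in a slice. The
  left weight would be the same at both places although the positive thickness of the edge lies
  between them.\<close>

lemma good_distinct:
 assumes "good L"
 shows "distinct L"
proof (rule ccontr)
 assume "\<not> distinct L"
 then obtain A B C e where L: "L = A @ [e] @ B @ [e] @ C" using not_distinct_decomp by blast
 then have "L = A @ e # (B @ e # C)" "L = (A @ e # B) @ e # C" by simp_all
 then have "sum_list (map (thick w) A) = Lam (thick w) e" "sum_list (map (thick w) (A @ e # B)) = Lam (thick w) e"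
  using assms using cons_thick unfolding good_def by blast+
 moreover have "thick w e > 0" using assms L edgeD(4) by (auto simp: good_def)
 ultimately show False by simp
qed

lemma good_local:
 assumes ld: "local_data y0 d LB LA"
 shows "good (map fst LB)" "good (map fst LA)"
proof -
 note ld' = ld[unfolded local_data_def]
 have dpos: "d > 0" using ld' by simp
 have key: "good (map fst L)" if L: "set L = up a" "distinct L" "sorted_wrt (%i j. \<forall>y\<in>S. ps i y < ps j y) L"
  and S: "\<forall>\<^sub>F z in at_right a. z \<in> S" and int: "\<And>i. i \<in> set L ==> lo w (fst i) + snd i < a" for L a S
  unfolding good_def
 proof (intro conjI allI impI)
  show "set (map fst L) \<subseteq> edges w" using L(1) by (auto simp: up_def)
  fix \<theta> A e B assume c: "cons \<theta>" and "map fst L = A @ e # B"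
  then obtain A2 k B2 where s: "L = A2 @ (e, k) # B2" "map fst A2 = A"
   by (auto simp: map_eq_append_conv map_eq_Cons_conv)
  then have ek: "(e, k) \<in> up a" using L(1) by auto
  have "lam \<theta> (e, k) a = Lam \<theta> e" using ek int[of "(e, k)"] s(1) by (intro lam_Lam c) (auto simp: up_def)
  moreover have "lam \<theta> (e, k) a = sum_list (map (%j. \<theta> (fst j)) A2)" by (rule lam_list[OF L S s(1)])
  moreover have "sum_list (map \<theta> A) = sum_list (map (%j. \<theta> (fst j)) A2)"
   unfolding s(2)[symmetric] by (simp add: comp_def)
  ultimately show "sum_list (map \<theta> A) = Lam \<theta> e" by simp
 qed
 \<comment> \<open>The left weight is read off at heights away from \<open>y0\<close>. The lower
   height \<open>?a'\<close> shows that the instances in \<open>LB\<close> start strictly below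
   \<open>?a\<close>.\<close>
 let ?a = "y0 - d / 2" and ?a' = "y0 - 3 * d / 4" and ?b = "y0 + d / 2"
 show "good (map fst LB)"
 proof (rule key[of _ ?a "{y0 - d<..<y0}"])
  have u: "up ?a = dn y0" "up ?a' = dn y0" using ld' dpos by auto
  show "set LB = up ?a" using ld' u by simp
  show "\<forall>\<^sub>F z in at_right ?a. z \<in> {y0 - d<..<y0}"
   using right_open[of ?a y0] dpos by (auto elim: eventually_mono)
  show "lo w (fst i) + snd i < ?a" if "i \<in> set LB" for i
  proof -
   have "i \<in> up ?a'" using that ld' u by simp
   then show ?thesis using dpos by (auto simp: up_def)
  qed
 qed (use ld' in auto)
 show "good (map fst LA)"
 proof (rule key[of _ ?b "{y0<..<y0 + d}"])
  show "set LA = up ?b" using ld' dpos by auto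
  show "\<forall>\<^sub>F z in at_right ?b. z \<in> {y0<..<y0 + d}"
   using right_open[of ?b "y0 + d"] dpos by (auto elim: eventually_mono)
  show "lo w (fst i) + snd i < ?b" if "i \<in> set LA" for i
  proof -
   have "i \<in> up y0" using that ld' by simp
   then show ?thesis using dpos by (auto simp: up_def)
  qed
 qed (use ld' in auto)
qed

end

section \<open>Passing the vertices one at a time\<close>

lemma singleton_list: "set xs = {x} ==> distinct xs ==> xs = [x]"
 by (cases xs) (auto simp: subset_singleton_iff)

context ann_web
begin

text \<open>Part of the way through a level the list consists of a left part from above and a right
  part from below. Exchanging left parts of equal weight does not affect the left weights further
  right.\<close>

lemma good_mix:
 assumes "good (A @ B')" "good (A' @ B)" "\<And>\<theta>. cons \<theta> ==> sum_list (map \<theta> A) = sum_list (map \<theta> A')"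
 shows "good (A @ B)"
 unfolding good_def
proof (intro conjI allI impI)
 show "set (A @ B) \<subseteq> edges w" using assms(1,2) by (auto simp: good_def)
 fix \<theta> C e D assume c: "cons \<theta>" and "A @ B = C @ e # D"
 then obtain us where us: "A = C @ us \<and> us @ B = e # D \<or> A @ us = C \<and> B = us @ e # D"
  unfolding append_eq_append_conv2 by blast
 then have "(\<exists>D1. A = C @ e # D1) \<or> (\<exists>C1. C = A @ C1 \<and> B = C1 @ e # D)" by (cases us) auto
 then consider D1 where "A = C @ e # D1" | C1 where "C = A @ C1" "B = C1 @ e # D" by blast
 then show "sum_list (map \<theta> C) = Lam \<theta> e"
 proof cases
  case 1
  then have "A @ B' = C @ e # (D1 @ B')" by simp
  then show ?thesis using assms(1) c unfolding good_def by blast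
 next
  case 2
  then have "A' @ B = (A' @ C1) @ e # D" by simp
  then have "sum_list (map \<theta> (A' @ C1)) = Lam \<theta> e" using assms(2) c unfolding good_def by blast
  then show ?thesis using 2 assms(3)[OF c] by simp
 qed
qed

primrec chain :: "'e list => (real \<times> complex) list => 'e list => bool" where
 "chain L [] M \<longleftrightarrow> L = M \<and> good L"
| "chain L (v # vs) M \<longleftrightarrow> good L \<and> (\<exists>A B. L = A @ ins v @ B \<and> chain (A @ outs v @ B) vs M)"

lemma chain_append: "chain L vs M ==> chain M vs' N ==> chain L (vs @ vs') N"
 by (induction vs arbitrary: L) auto

text \<open>Vertices at the same height are passed from left to right; groups that are not vertices
  have the same names below and above, so nothing happens there.\<close>

lemma chain_level:
 assumes g: "good (concat (map D xs))" "good (concat (map U xs))"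
  and x: "\<And>x. x \<in> set xs ==> if V x then D x = ins (f x) \<and> U x = outs (f x) else D x = U x"
  and th: "\<And>\<theta> x. cons \<theta> ==> x \<in> set xs ==> sum_list (map \<theta> (D x)) = sum_list (map \<theta> (U x))"
 shows "chain (concat (map D xs)) (map f (filter V xs)) (concat (map U xs))"
proof -
 have "chain (concat (map U ys) @ concat (map D zs)) (map f (filter V zs)) (concat (map U xs))" if "xs = ys @ zs" for ys zs
  using that
 proof (induction zs arbitrary: ys)
  case Nil
  then show ?case using g(2) by simp
 next
  case (Cons z zs)
  have "sum_list (map \<theta> (concat (map U ys))) = sum_list (map \<theta> (concat (map D ys)))" if "cons \<theta>" for \<theta>
  proof -
   have "set ys \<subseteq> set xs" using Cons.prems by auto
   then show ?thesis using th[OF that] by (induction ys) auto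
  qed
  then have gm: "good (concat (map U ys) @ concat (map D (z # zs)))"
   using good_mix[of "concat (map U ys)" "concat (map U (z # zs))" "concat (map D ys)" "concat (map D (z # zs))"]
    g Cons.prems by simp
  have ih: "chain (concat (map U (ys @ [z])) @ concat (map D zs)) (map f (filter V zs)) (concat (map U xs))"
   by (rule Cons.IH) (use Cons.prems in simp)
  have zx: "z \<in> set xs" using Cons.prems by simp
  show ?case
  proof (cases "V z")
   case True
   then have "D z = ins (f z)" "U z = outs (f z)" using x[OF zx] by auto
   then show ?thesis using True gm ih by auto
  next
   case False
   then show ?thesis using x[OF zx] ih by simp
  qed
 qed
 from this[of "[]" xs] show ?thesis by simp
qed

lemma group_names:
 assumes ld: "local_data y0 d LB LA" and x: "x \<in> (%i. ps i y0) ` dn y0"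
 shows "if ann x y0 \<in> verts w then map fst (filter (%i. ps i y0 = x) LB) = ins (ann x y0) \<and>
   map fst (filter (%i. ps i y0 = x) LA) = outs (ann x y0)
  else map fst (filter (%i. ps i y0 = x) LB) = map fst (filter (%i. ps i y0 = x) LA)"
  "\<And>\<theta>. cons \<theta> ==> sum_list (map \<theta> (map fst (filter (%i. ps i y0 = x) LB))) = sum_list (map \<theta> (map fst (filter (%i. ps i y0 = x) LA)))"
  "ann x y0 \<in> verts w ==> set (ins (ann x y0)) = in_edges w (ann x y0) \<and> sorted_wrt (left_of_below w) (ins (ann x y0)) \<and>
   set (outs (ann x y0)) = out_edges w (ann x y0) \<and> sorted_wrt left_of_above (outs (ann x y0))"
proof -
 note ld' = ld[unfolded local_data_def]
 have dpos: "d > 0" using ld' by simp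
 let ?B = "filter (%i. ps i y0 = x) LB" and ?A = "filter (%i. ps i y0 = x) LA"
 have sB: "set ?B = {i \<in> dn y0. ps i y0 = x}" and sA: "set ?A = {i \<in> up y0. ps i y0 = x}" using ld' by auto
 have dB: "distinct ?B" and dA: "distinct ?A" using ld' by auto
 show "sum_list (map \<theta> (map fst ?B)) = sum_list (map \<theta> (map fst ?A))" if "cons \<theta>" for \<theta>
  using group_thick[OF that, of y0 x] dB dA unfolding sB[symmetric] sA[symmetric]
  by (simp add: sum_list_distinct_conv_sum_set comp_def)
 have V: "map fst ?B = ins (ann x y0)" "map fst ?A = outs (ann x y0)" "set (ins (ann x y0)) = in_edges w (ann x y0)"
   "sorted_wrt (left_of_below w) (ins (ann x y0))" "set (outs (ann x y0)) = out_edges w (ann x y0)"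
   "sorted_wrt left_of_above (outs (ann x y0))" if True: "ann x y0 \<in> verts w"
 proof -
  have 1: "sorted_wrt (left_of_below w) (map fst ?B)"
   unfolding sorted_wrt_map
  proof (rule sorted_wrt_mono_rel)
   show "sorted_wrt (%i j. \<forall>y\<in>{y0 - d<..<y0}. ps i y < ps j y) ?B" by (rule sorted_wrt_filter) (use ld' in blast)
   fix i j assume ij: "i \<in> set ?B" "j \<in> set ?B" "\<forall>y\<in>{y0 - d<..<y0}. ps i y < ps j y"
   have "y0 = hi w (fst i) + snd i" "y0 = hi w (fst j) + snd j" using dn_vertex(1)[OF True] ij(1,2) sB by blast+
   then have e: "y0 - s - of_int (snd i) = hi w (fst i) - s" "y0 - s - of_int (snd j) = hi w (fst j) - s" for s by linarith+
   have h: "ps i (y0 - s) = pos w (fst i) (hi w (fst i) - s)" "ps j (y0 - s) = pos w (fst j) (hi w (fst j) - s)" for s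
    unfolding ps_def e by (rule refl)+
   have "\<forall>\<^sub>F s in at_right 0. s \<in> {0<..<d}" using right_open[OF dpos] .
   then show "left_of_below w (fst i) (fst j)" unfolding left_of_below_def
   proof (rule eventually_mono)
    fix s assume "s \<in> {0<..<d}"
    then have "y0 - s \<in> {y0 - d<..<y0}" by auto
    then show "pos w (fst i) (hi w (fst i) - s) < pos w (fst j) (hi w (fst j) - s)" using ij(3) h by metis
   qed
  qed
  have 2: "set (map fst ?B) = in_edges w (ann x y0)" using dn_vertex_names[OF True] sB by simp
  have B: "ins (ann x y0) = map fst ?B" by (rule ins_eq[OF 2 1])
  have 3: "sorted_wrt left_of_above (map fst ?A)"
   unfolding sorted_wrt_map
  proof (rule sorted_wrt_mono_rel)
   show "sorted_wrt (%i j. \<forall>y\<in>{y0<..<y0 + d}. ps i y < ps j y) ?A" by (rule sorted_wrt_filter) (use ld' in blast)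
   fix i j assume ij: "i \<in> set ?A" "j \<in> set ?A" "\<forall>y\<in>{y0<..<y0 + d}. ps i y < ps j y"
   have "y0 = lo w (fst i) + snd i" "y0 = lo w (fst j) + snd j" using up_vertex(1)[OF True] ij(1,2) sA by blast+
   then have e: "y0 + s - of_int (snd i) = lo w (fst i) + s" "y0 + s - of_int (snd j) = lo w (fst j) + s" for s by linarith+
   have h: "ps i (y0 + s) = pos w (fst i) (lo w (fst i) + s)" "ps j (y0 + s) = pos w (fst j) (lo w (fst j) + s)" for s
    unfolding ps_def e by (rule refl)+
   have "\<forall>\<^sub>F s in at_right 0. s \<in> {0<..<d}" using right_open[OF dpos] .
   then show "left_of_above (fst i) (fst j)" unfolding left_of_above_def
   proof (rule eventually_mono)
    fix s assume "s \<in> {0<..<d}"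
    then have "y0 + s \<in> {y0<..<y0 + d}" by auto
    then show "pos w (fst i) (lo w (fst i) + s) < pos w (fst j) (lo w (fst j) + s)" using ij(3) h by metis
   qed
  qed
  have 4: "set (map fst ?A) = out_edges w (ann x y0)" using up_vertex_names[OF True] sA by simp
  have A: "outs (ann x y0) = map fst ?A" by (rule outs_eq[OF 4 3])
  show "map fst ?B = ins (ann x y0)" "map fst ?A = outs (ann x y0)" "set (ins (ann x y0)) = in_edges w (ann x y0)"
   "sorted_wrt (left_of_below w) (ins (ann x y0))" "set (outs (ann x y0)) = out_edges w (ann x y0)"
   "sorted_wrt left_of_above (outs (ann x y0))" unfolding A B using 1 2 3 4 by simp_all
 qed
 show "ann x y0 \<in> verts w ==> set (ins (ann x y0)) = in_edges w (ann x y0) \<and> sorted_wrt (left_of_below w) (ins (ann x y0)) \<and>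
   set (outs (ann x y0)) = out_edges w (ann x y0) \<and> sorted_wrt left_of_above (outs (ann x y0))"
  using V by blast
 show "if ann x y0 \<in> verts w then map fst ?B = ins (ann x y0) \<and> map fst ?A = outs (ann x y0) else map fst ?B = map fst ?A"
 proof (cases "ann x y0 \<in> verts w")
  case True
  then show ?thesis using V(1,2) by simp
 next
  case False
  obtain i where i: "i \<in> dn y0" "ps i y0 = x" using x by auto
  have "j = i" if "j \<in> set ?B" for j using dn_inj[of j y0 i] that i sB False by auto
  then have "set ?B = {i}" using i sB by auto
  then have B: "?B = [i]" by (rule singleton_list[OF _ dB])
  have "fst i \<in> fst ` {j \<in> up y0. ps j y0 = x}" using i unfolding dn_up_names[OF False, symmetric] by blast
  then obtain i' where i': "i' \<in> up y0" "ps i' y0 = x" "fst i' = fst i" by auto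
  have "j = i'" if "j \<in> set ?A" for j using up_inj[of j y0 i'] that i' sA False by auto
  then have "set ?A = {i'}" using i' sA by auto
  then have A: "?A = [i']" by (rule singleton_list[OF _ dA])
  show ?thesis using False i'(3) unfolding A B by simp
 qed
qed

text \<open>Open at the bottom and closed at the top, so that adjacent levels share no height;
  correspondingly \<open>cr\<close> is the slice just above a height.\<close>

definition lev :: "real => real => (real \<times> complex) set" where
 "lev a b = {v \<in> verts w. \<exists>x y. a < y \<and> y \<le> b \<and> v = ann x y}"

lemma cut_right:
 obtains L where "\<forall>\<^sub>F z in at_right y. cut_edges w z = L"
proof -
 obtain d LB LA where ld: "local_data y d LB LA" using local_data_ex by blast
 have "\<forall>\<^sub>F z in at_right y. z \<in> {y<..<y + d}" using ld by (intro right_open) (simp add: local_data_def)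
 then have "\<forall>\<^sub>F z in at_right y. cut_edges w z = map fst LA" by (rule eventually_mono) (use ld in \<open>simp add: local_data_def\<close>)
 then show ?thesis by (rule that)
qed

definition cr :: "real => 'e list" where "cr y = (THE L. \<forall>\<^sub>F z in at_right y. cut_edges w z = L)"

lemma cr_eqI:
 assumes "\<forall>\<^sub>F z in at_right y. cut_edges w z = L"
 shows "cr y = L"
 unfolding cr_def
proof (rule the_equality)
 show "\<forall>\<^sub>F z in at_right y. cut_edges w z = L" by (rule assms)
 fix M assume "\<forall>\<^sub>F z in at_right y. cut_edges w z = M"
 with assms have "\<forall>\<^sub>F z in at_right y. M = L" by eventually_elim simp
 then show "M = L" by simp
qed

lemma cr_local:
 assumes ld: "local_data y0 d LB LA"
 shows "y0 - d < y ==> y < y0 ==> cr y = map fst LB" "y0 \<le> y ==> y < y0 + d ==> cr y = map fst LA"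
proof -
 note ld' = ld[unfolded local_data_def]
 show "cr y = map fst LB" if y: "y0 - d < y" "y < y0"
 proof (rule cr_eqI, rule eventually_mono[OF right_open[OF y(2)]])
  show "cut_edges w z = map fst LB" if "z \<in> {y<..<y0}" for z using that y ld' by auto
 qed
 show "cr y = map fst LA" if y: "y0 \<le> y" "y < y0 + d"
 proof (rule cr_eqI, rule eventually_mono[OF right_open[OF y(2)]])
  show "cut_edges w z = map fst LA" if "z \<in> {y<..<y0 + d}" for z using that y ld' by auto
 qed
qed

lemma cr_radial: "radial_cut w y ==> cr y = cut_edges w y"
 using local_data_ex[of y] cr_local(2)[of y _ _ _ y] by (auto simp: local_data_def)

text \<open>Bisection reduces the claim to short intervals around one height, where all vertices
  have that height. The bound b \<le> a + 1 prevents a vertex from being met at two lifts of its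
  height.\<close>

lemma chain_ex:
 assumes "a \<le> b"
 shows "b \<le> a + 1 --> (\<exists>vs. distinct vs \<and> set vs = lev a b \<and> chain (cr a) vs (cr b))"
 using assms
proof (induction rule: Bolzano)
 case (trans a b c)
 show ?case
 proof
  assume c: "c \<le> a + 1"
  then obtain vs vs' where vs: "distinct vs" "set vs = lev a b" "chain (cr a) vs (cr b)"
   and vs': "distinct vs'" "set vs' = lev b c" "chain (cr b) vs' (cr c)"
   using trans by (auto simp: le_imp_less_Suc)
  have "lev a b \<inter> lev b c = {}"
  proof (rule ccontr)
   assume "\<not> ?thesis"
   then obtain v where v: "v \<in> lev a b" "v \<in> lev b c" by blast
   obtain x y where 1: "a < y" "y \<le> b" "v = ann x y" using v(1) unfolding lev_def by blast
   obtain x' y' where 2: "b < y'" "y' \<le> c" "v = ann x' y'" using v(2) unfolding lev_def by blast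
   have y: "a < y" "y \<le> b" "b < y'" "y' \<le> c" "ann x y = ann x' y'" using 1 2 by simp_all
   then have "y' - y \<in> \<int>" using ann_eq_iff[of x' y' x y] by simp
   then obtain n :: int where "y' - y = n" by (auto elim: Ints_cases)
   moreover have "0 < y' - y" "y' - y < 1" using y c by linarith+
   ultimately have "0 < n \<and> n < 1" by simp
   then show False by linarith
  qed
  moreover have "lev a c = lev a b \<union> lev b c" using trans(3,4) unfolding lev_def by force
  ultimately show "\<exists>vs. distinct vs \<and> set vs = lev a c \<and> chain (cr a) vs (cr c)"
   using vs vs' by (intro exI[of _ "vs @ vs'"]) (auto intro: chain_append)
 qed
next
 case (local y0)
 obtain d LB LA where ld: "local_data y0 d LB LA" using local_data_ex by blast
 note ld' = ld[unfolded local_data_def]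
 have "\<exists>vs. distinct vs \<and> set vs = lev a b \<and> chain (cr a) vs (cr b)" if ab: "a \<le> y0" "y0 \<le> b" "b - a < d" for a b
 proof (cases "a = y0")
  \<comment> \<open>An interval that starts at \<open>y0\<close> excludes the vertices at height
    \<open>y0\<close>, and \<open>cr\<close> is already the slice above them.\<close>
  case True
  have "v \<notin> lev a b" for v
  proof
   assume "v \<in> lev a b"
   then obtain x y where "v \<in> verts w" "a < y" "y \<le> b" "v = ann x y" unfolding lev_def by blast
   moreover have "y ~= y0" "\<bar>y - y0\<bar> < d" using calculation(2,3) ab True by linarith+
   ultimately show False using ld' by blast
  qed
  then have "lev a b = {}" by blast
  moreover have "cr a = map fst LA" "cr b = map fst LA" using cr_local(2)[OF ld] ab True ld' by auto
  ultimately show ?thesis using good_local(2)[OF ld] by (intro exI[of _ "[]"]) simp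
 next
  case False
  then have a: "a < y0" using ab by simp
  have cr: "cr a = map fst LB" "cr b = map fst LA" using cr_local(1)[OF ld, of a] cr_local(2)[OF ld, of b] ab a by auto
  define xs where "xs = sorted_list_of_set ((%i. ps i y0) ` dn y0)"
  have xs: "set xs = (%i. ps i y0) ` dn y0" "sorted_wrt (<) xs" "distinct xs"
   unfolding xs_def using finite_dn by simp_all
  let ?D = "%x. map fst (filter (%i. ps i y0 = x) LB)" and ?U = "%x. map fst (filter (%i. ps i y0 = x) LA)"
  have B: "concat (map ?D xs) = map fst LB" and A: "concat (map ?U xs) = map fst LA"
  proof -
   have "concat (map (%x. filter (%i. ps i y0 = x) LB) xs) = LB" "concat (map (%x. filter (%i. ps i y0 = x) LA) xs) = LA"
    using concat_filter_sorted[of "%i. ps i y0" LB xs] concat_filter_sorted[of "%i. ps i y0" LA xs] xs ld' points_eq[of y0] by simp_all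
   then show "concat (map ?D xs) = map fst LB" "concat (map ?U xs) = map fst LA"
    using map_concat[of fst "map (%x. filter (%i. ps i y0 = x) LB) xs"] map_concat[of fst "map (%x. filter (%i. ps i y0 = x) LA) xs"]
    by (simp_all add: comp_def)
  qed
  let ?V = "%x. ann x y0 \<in> verts w"
  have ch: "chain (concat (map ?D xs)) (map (%x. ann x y0) (filter ?V xs)) (concat (map ?U xs))"
  proof (rule chain_level)
   show "good (concat (map ?D xs))" "good (concat (map ?U xs))" unfolding A B using good_local[OF ld] .
   show "if ?V x then ?D x = ins (ann x y0) \<and> ?U x = outs (ann x y0) else ?D x = ?U x" if "x \<in> set xs" for x
    by (rule group_names(1)[OF ld]) (use that xs(1) in simp)
   show "sum_list (map \<theta> (?D x)) = sum_list (map \<theta> (?U x))" if "cons \<theta>" "x \<in> set xs" for \<theta> x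
    by (rule group_names(2)[OF ld _ that(1)]) (use that(2) xs(1) in simp)
  qed
  have "inj_on (%x. ann x y0) (set (filter ?V xs))" by (auto simp: inj_on_def ann_eq_iff)
  then have "distinct (map (%x. ann x y0) (filter ?V xs))" using xs(3) by (simp add: distinct_map)
  moreover have "set (map (%x. ann x y0) (filter ?V xs)) = lev a b"
  proof (intro equalityI subsetI)
   fix v assume "v \<in> set (map (%x. ann x y0) (filter ?V xs))"
   then show "v \<in> lev a b" using a ab unfolding lev_def by auto
  next
   fix v assume "v \<in> lev a b"
   then obtain x y where xy: "v \<in> verts w" "a < y" "y \<le> b" "v = ann x y" unfolding lev_def by blast
   have "y = y0"
   proof (rule ccontr)
    assume "y ~= y0"
    moreover have "\<bar>y - y0\<bar> < d" using xy ab by linarith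
    ultimately show False using ld' xy by blast
   qed
   then have v: "ann x y0 \<in> verts w" using xy by simp
   then have "in_edges w (ann x y0) ~= {}" using vertD(1)[OF v] by auto
   then have "{i \<in> dn y0. ps i y0 = x} ~= {}" unfolding dn_vertex_names[OF v, symmetric] by blast
   then have "x \<in> set xs" unfolding xs by blast
   then show "v \<in> set (map (%x. ann x y0) (filter ?V xs))" using v xy \<open>y = y0\<close> by auto
  qed
  ultimately show ?thesis using ch unfolding A B cr by blast
 qed
 then show ?case using ld' by (intro exI[of _ d]) simp
qed

lemma cr_shift: "cr (y + 1) = cr y"
proof -
 obtain L where L: "\<forall>\<^sub>F z in at_right y. cut_edges w z = L" by (rule cut_right)
 have "cut_edges w (z + 1) = cut_edges w z" for z
 proof -
  have "ann x (z + 1) = ann x z" for x by (simp add: ann_eq_iff)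
  then show ?thesis unfolding cut_edges_def by simp
 qed
 then have "\<forall>\<^sub>F z in at_right y. cut_edges w (z - - 1) = L" using L by simp
 then have "\<forall>\<^sub>F z in at_right (y - - 1). cut_edges w z = L"
  unfolding filtermap_at_right_shift[symmetric] eventually_filtermap by simp
 then show ?thesis using cr_eqI[OF L] cr_eqI[where y = "y + 1" and L = L] by simp
qed

lemma lev_all: "lev h (h + 1) = verts w"
proof -
 have "\<exists>x y. h < y \<and> y \<le> h + 1 \<and> v = ann x y" if v: "v \<in> verts w" for v
 proof -
  have "in_edges w v ~= {}" using vertD(1)[OF v] by auto
  then obtain e where e: "v = ann (pos w e (hi w e)) (hi w e)" by (auto simp: in_edges_def edge_end_def edge_pt_def)
  define k where "k = \<lceil>hi w e - h\<rceil> - 1"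
  have "h < hi w e - of_int k" "hi w e - of_int k \<le> h + 1" unfolding k_def by linarith+
  then show ?thesis using e ann_shift[of "pos w e (hi w e)" "hi w e" k] by metis
 qed
 then show ?thesis unfolding lev_def by blast
qed

lemma closed_chain:
 assumes "radial_cut w h"
 obtains vs where "distinct vs" "set vs = verts w" "chain (cut_edges w h) vs (cut_edges w h)"
 using chain_ex[of h "h + 1"] cr_radial[OF assms] cr_shift[of h] lev_all[of h] that by auto

end

section \<open>Colour curves and the two generating functions\<close>

lemma one_at_index:
 fixes f :: "'a => nat"
 assumes "j < sum_list (map f L)" "\<And>x. f x \<le> 1"
 shows "\<exists>A e B. L = A @ e # B \<and> f e = 1 \<and> sum_list (map f A) = j"
 using assms(1)
proof (induction L rule: rev_induct)
 case (snoc x L)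
 show ?case
 proof (cases "j < sum_list (map f L)")
  case True
  then obtain A e B where "L = A @ e # B" "f e = 1" "sum_list (map f A) = j" using snoc.IH by blast
  then have "L @ [x] = A @ e # (B @ [x])" by simp
  then show ?thesis using \<open>f e = 1\<close> \<open>sum_list (map f A) = j\<close> by blast
 next
  case False
  then have "f x = 1" "sum_list (map f L) = j" using snoc.prems assms(2)[of x] by auto
  then show ?thesis by blast
 qed
qed simp

lemma components_disjoint_union:
 fixes Z :: "'i => 'a :: topological_space set"
 assumes I: "finite I" and Z: "\<And>i. i \<in> I ==> closed (Z i) \<and> connected (Z i) \<and> Z i ~= {}"
  and dis: "\<And>i j. i \<in> I ==> j \<in> I ==> i ~= j ==> Z i \<inter> Z j = {}"
 shows "card (components (\<Union>i\<in>I. Z i)) = card I"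
proof -
 let ?S = "\<Union>i\<in>I. Z i"
 have sub: "C = Z i" if C: "C \<in> components ?S" and i: "i \<in> I" and m: "C \<inter> Z i ~= {}" for C i
 proof
  have con: "connected C" and CS: "C \<subseteq> ?S" using C in_components_connected in_components_subset by blast+
  let ?R = "\<Union>j\<in>I - {i}. Z j"
  have "closed ?R" using I Z by (intro closed_UN) auto
  moreover have "closed (Z i)" using Z i by blast
  moreover have "C \<subseteq> Z i \<union> ?R" using CS by blast
  moreover have "Z i \<inter> ?R \<inter> C = {}" using dis[OF i] by blast
  ultimately have "Z i \<inter> C = {} \<or> ?R \<inter> C = {}" using connected_closedD[OF con, of "Z i" ?R] by blast
  then have "?R \<inter> C = {}" using m by blast
  then show "C \<subseteq> Z i" using CS by blast
  show "Z i \<subseteq> C" by (rule components_maximal[OF C]) (use Z i m in auto)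
 qed
 have "components ?S = Z ` I"
 proof (intro equalityI subsetI)
  fix C assume C: "C \<in> components ?S"
  then have "C ~= {}" "C \<subseteq> ?S" using in_components_nonempty in_components_subset by blast+
  then obtain i where "i \<in> I" "C \<inter> Z i ~= {}" by blast
  then show "C \<in> Z ` I" using sub[OF C] by blast
 next
  fix D assume "D \<in> Z ` I"
  then obtain i where i: "i \<in> I" "D = Z i" by blast
  then obtain x where x: "x \<in> Z i" using Z by blast
  then have "x \<in> ?S" using i by blast
  then have "x \<in> \<Union> (components ?S)" by (metis Union_components)
  then obtain C where C: "C \<in> components ?S" "x \<in> C" by blast
  then have "C = Z i" using sub[OF C(1) i(1)] x by blast
  then show "D \<in> components ?S" using C i by simp
 qed
 moreover have "inj_on Z I"
 proof (rule inj_onI)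
  fix i j assume ij: "i \<in> I" "j \<in> I" "Z i = Z j"
  then show "i = j" using dis[of i j] Z[of i] by auto
 qed
 ultimately show ?thesis by (simp add: card_image)
qed

section \<open>From the web to its cut-open form\<close>

context ann_web
begin

lemma vertex_lists:
 assumes v: "v \<in> verts w"
 shows "set (ins v) = in_edges w v" "distinct (ins v)" "sorted_wrt (left_of_below w) (ins v)"
  "set (outs v) = out_edges w v" "distinct (outs v)"
proof -
 have "in_edges w v ~= {}" using vertD(1)[OF v] by auto
 then obtain e where e: "e \<in> edges w" "edge_end w e = v" by (auto simp: in_edges_def)
 let ?y = "hi w e" and ?x = "ps (e, 0) (hi w e)"
 have va: "v = ann ?x ?y" using e(2) edge_pt_ps[of e ?y 0] by (simp add: edge_end_def)
 obtain d LB LA where ld: "local_data ?y d LB LA" using local_data_ex by blast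
 have "(e, 0) \<in> dn ?y" using e(1) edgeD(1)[OF e(1)] by (simp add: dn_def)
 then have "?x \<in> (%i. ps i ?y) ` dn ?y" by blast
 then have a: "set (ins v) = in_edges w v \<and> sorted_wrt (left_of_below w) (ins v) \<and>
   set (outs v) = out_edges w v \<and> sorted_wrt left_of_above (outs v)"
  using group_names(3)[OF ld] v unfolding va by blast
 then show "set (ins v) = in_edges w v" "sorted_wrt (left_of_below w) (ins v)" "set (outs v) = out_edges w v" by blast+
 show "distinct (ins v)" by (rule distinct_of_sorted_wrt[of "left_of_below w"]) (use a below_asym in blast)+
 show "distinct (outs v)" by (rule distinct_of_sorted_wrt[of left_of_above]) (use a above_asym in blast)+
qed

lemma length_ins: "v \<in> verts w ==> length (ins v) = card (in_edges w v)"
 and length_outs: "v \<in> verts w ==> length (outs v) = card (out_edges w v)"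
 using vertex_lists distinct_card by metis+

lemma vertex_shape:
 assumes "v \<in> verts w"
 shows "(\<exists>l r c. ins v = [l, r] \<and> outs v = [c]) \<or> (\<exists>l r c. ins v = [c] \<and> outs v = [l, r])"
 using vertD(1)[OF assms] length_ins[OF assms] length_outs[OF assms]
 by (auto simp: length_Suc_conv numeral_2_eq_2)

lemma sum_ins: "v \<in> verts w ==> sum_list (map f (ins v)) = (\<Sum>e\<in>in_edges w v. f e)"
 and sum_outs: "v \<in> verts w ==> sum_list (map f (outs v)) = (\<Sum>e\<in>out_edges w v. f e)" for f :: "'e => nat"
 using vertex_lists[of v] sum_list_distinct_conv_sum_set by metis+

lemma cons_vertex: "cons \<theta> ==> v \<in> verts w ==> sum_list (map \<theta> (ins v)) = sum_list (map \<theta> (outs v))"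
 by (simp add: cons_def sum_ins sum_outs)

text \<open>An edge from a trivalent vertex to itself would leave thickness 0 for the third edge
  there.\<close>

lemma no_loop:
 assumes "v \<in> verts w"
 shows "set (ins v) \<inter> set (outs v) = {}"
proof -
 have s: "sum_list (map (thick w) (ins v)) = sum_list (map (thick w) (outs v))"
  using cons_vertex[OF cons_thick assms] .
 have pos: "thick w e > 0" if "e \<in> set (ins v) \<union> set (outs v)" for e
  using that vertex_lists(1,4)[OF assms] edgeD(4) by (auto simp: in_edges_def out_edges_def)
 from vertex_shape[OF assms] show ?thesis
 proof
  assume "\<exists>l r c. ins v = [l, r] \<and> outs v = [c]"
  then obtain l r c where e: "ins v = [l, r]" "outs v = [c]" by blast
  then show ?thesis using s pos[of l] pos[of r] by auto
 next
  assume "\<exists>l r c. ins v = [c] \<and> outs v = [l, r]"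
  then obtain l r c where e: "ins v = [c]" "outs v = [l, r]" by blast
  then show ?thesis using s pos[of l] pos[of r] by auto
 qed
qed

lemma chain_slices:
 "chain L vs M ==> \<exists>sl. sl 0 = L \<and> sl (length vs) = M \<and> (\<forall>k\<le>length vs. good (sl k)) \<and>
   (\<forall>k<length vs. \<exists>A B. sl k = A @ ins (vs ! k) @ B \<and> sl (Suc k) = A @ outs (vs ! k) @ B)"
proof (induction vs arbitrary: L)
 case Nil
 then have "L = M" "good L" unfolding chain.simps by blast+
 then show ?case by (intro exI[of _ "%_. M"]) simp
next
 case (Cons v vs)
 then obtain A B where g: "good L" and L: "L = A @ ins v @ B" "chain (A @ outs v @ B) vs M" by auto
 obtain sl where sl: "sl 0 = A @ outs v @ B" "sl (length vs) = M" "\<forall>k\<le>length vs. good (sl k)"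
  "\<forall>k<length vs. \<exists>A B. sl k = A @ ins (vs ! k) @ B \<and> sl (Suc k) = A @ outs (vs ! k) @ B"
  using Cons.IH[OF L(2)] by blast
 let ?s = "%k. case k of 0 => L | Suc j => sl j"
 show ?case
 proof (intro exI[of _ ?s] conjI allI impI)
  show "good (?s k)" if "k \<le> length (v # vs)" for k using that g sl(3) by (cases k) auto
  show "\<exists>A B. ?s k = A @ ins ((v # vs) ! k) @ B \<and> ?s (Suc k) = A @ outs ((v # vs) ! k) @ B" if "k < length (v # vs)" for k
  proof (cases k)
   case 0
   then show ?thesis using L(1) sl(1) by auto
  next
   case (Suc j)
   then show ?thesis using sl(4) that by auto
  qed
 qed (use sl in simp_all)
qed

lemma cut_names:
 assumes "radial_cut w h"
 shows "set (cut_edges w h) = fst ` up h"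
proof -
 obtain d LB LA where "local_data h d LB LA" using local_data_ex by blast
 then have "cut_edges w h = map fst LA" "set LA = up h" using assms unfolding local_data_def by blast+
 then show ?thesis by simp
qed

lemma web_cweb:
 assumes rad: "radial_cut w h"
 obtains vs sl where "cweb (edges w) ins outs vs sl" "sl 0 = cut_edges w h" "set vs = verts w"
  "\<And>k. k \<le> length vs ==> good (sl k)"
proof -
 obtain vs where vs: "distinct vs" "set vs = verts w" "chain (cut_edges w h) vs (cut_edges w h)"
  by (rule closed_chain[OF rad])
 obtain sl where sl: "sl 0 = cut_edges w h" "sl (length vs) = cut_edges w h" "\<forall>k\<le>length vs. good (sl k)"
  and st: "\<forall>k<length vs. \<exists>A B. sl k = A @ ins (vs ! k) @ B \<and> sl (Suc k) = A @ outs (vs ! k) @ B"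
  using chain_slices[OF vs(3)] by blast
 have "cweb (edges w) ins outs vs sl"
 proof
  show "finite (edges w)" by (rule fin_E)
  show "distinct vs" by (rule vs(1))
  show "(\<exists>l r c. ins v = [l, r] \<and> outs v = [c]) \<or> (\<exists>l r c. ins v = [c] \<and> outs v = [l, r])" if "v \<in> set vs" for v
   using that vs(2) vertex_shape by simp
  show "\<exists>A B. sl k = A @ ins (vs ! k) @ B \<and> sl (Suc k) = A @ outs (vs ! k) @ B" if "k < length vs" for k
   using st that by blast
  show "sl (length vs) = sl 0" using sl by simp
  show "distinct (sl k)" if "k \<le> length vs" for k using sl(3) that good_distinct by blast
  show "set (sl k) \<subseteq> edges w" if "k \<le> length vs" for k using sl(3) that by (simp add: good_def)
  show "v = v'" if "v \<in> set vs" "v' \<in> set vs" "e \<in> set (ins v)" "e \<in> set (ins v')" for v v' e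
   using that vs(2) vertex_lists(1)[of v] vertex_lists(1)[of v'] by (simp add: in_edges_def)
  show "v = v'" if "v \<in> set vs" "v' \<in> set vs" "e \<in> set (outs v)" "e \<in> set (outs v')" for v v' e
   using that vs(2) vertex_lists(4)[of v] vertex_lists(4)[of v'] by (simp add: out_edges_def)
  show "set (ins v) \<inter> set (outs v) = {}" if "v \<in> set vs" for v using that vs(2) no_loop by simp
  show "\<exists>k\<le>length vs. e \<in> set (sl k)" if e: "e \<in> edges w" for e
  proof (cases "edge_start w e \<in> verts w")
   case True
   then obtain k where k: "k < length vs" "vs ! k = edge_start w e" using vs(2) by (metis in_set_conv_nth)
   then have "e \<in> set (outs (vs ! k))" using vertex_lists(4)[OF True] e by (simp add: out_edges_def)
   moreover obtain A B where "sl (Suc k) = A @ outs (vs ! k) @ B" using st k(1) by blast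
   ultimately have "e \<in> set (sl (Suc k))" by simp
   then show ?thesis using k(1) by (intro exI[of _ "Suc k"]) simp
  next
   case False
   \<comment> \<open>The height of a vertex-free circle grows by a positive integer, so the circle
     meets the cut.\<close>
   have "edge_pt w e (hi w e) = ann (pos w e (lo w e)) (lo w e)"
    using edgeD(6)[OF e False] by (simp add: edge_end_def edge_start_def edge_pt_def)
   then have "hi w e - lo w e \<in> \<int>" by (simp add: edge_pt_def ann_eq_iff)
   then obtain n :: int where n: "hi w e - lo w e = of_int n" by (auto elim: Ints_cases)
   then have "real_of_int n > 0" using edgeD(1)[OF e] by linarith
   then have "n \<ge> 1" by simp
   then have n1: "real_of_int n \<ge> 1" by linarith
   define k where "k = \<lfloor>h - lo w e\<rfloor>"
   have "lo w e + of_int k \<le> h" "h < lo w e + of_int k + 1" unfolding k_def by linarith+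
   then have "(e, k) \<in> up h" using e n n1 by (simp add: up_def)
   then have "e \<in> set (sl 0)" unfolding sl(1) cut_names[OF rad] by force
   then show ?thesis by blast
  qed
 qed
 then show ?thesis using that sl vs(2) by blast
qed

lemma chain_sum: "chain L vs M ==> set vs \<subseteq> verts w ==> sum_list (map (thick w) L) = sum_list (map (thick w) M)"
proof (induction vs arbitrary: L)
 case (Cons v vs)
 then obtain A B where L: "L = A @ ins v @ B" "chain (A @ outs v @ B) vs M" by auto
 have "sum_list (map (thick w) (A @ outs v @ B)) = sum_list (map (thick w) M)"
  by (rule Cons.IH[OF L(2)]) (use Cons.prems in simp)
 then show ?case using L(1) cons_vertex[OF cons_thick, of v] Cons.prems(2) by simp
qed simp

lemma web_degree_eq:
 assumes rad: "radial_cut w h"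
 shows "web_degree w = sum_list (cut_thickness w h)"
proof -
 have eq: "sum_list (cut_thickness w h') = sum_list (cut_thickness w h)" if r': "radial_cut w h'" for h'
 proof -
  \<comment> \<open>An integer shift brings \<open>h'\<close> to within one turn above
    \<open>h\<close>; a cut depends on its height only modulo 1.\<close>
  define n where "n = \<lfloor>h' - h\<rfloor>"
  let ?h = "h' - of_int n"
  have sh: "ann x ?h = ann x h'" for x by (rule ann_shift)
  have b: "h \<le> ?h" "?h \<le> h + 1" unfolding n_def by linarith+
  have r: "radial_cut w ?h" using r' unfolding radial_cut_def sh .
  have c: "cut_edges w ?h = cut_edges w h'" unfolding cut_edges_def sh by (rule refl)
  obtain vs where vs: "set vs = lev h ?h" "chain (cr h) vs (cr ?h)" using chain_ex[OF b(1)] b(2) by blast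
  have "sum_list (map (thick w) (cr h)) = sum_list (map (thick w) (cr ?h))"
   by (rule chain_sum[OF vs(2)]) (auto simp: vs(1) lev_def)
  then show ?thesis unfolding cut_thickness_def cr_radial[OF rad] cr_radial[OF r] c by simp
 qed
 show ?thesis unfolding web_degree_def
 proof (rule the_equality)
  show "\<forall>h'. radial_cut w h' --> sum_list (cut_thickness w h) = sum_list (cut_thickness w h')" using eq by simp
  show "n = sum_list (cut_thickness w h)" if "\<forall>h. radial_cut w h --> n = sum_list (cut_thickness w h)" for n
   using that rad by blast
 qed
qed

lemma merge_ins:
 assumes m: "m \<in> merges w"
 shows "ins m = [left_in w m, right_in w m]"
proof -
 have v: "m \<in> verts w" "card (in_edges w m) = 2" using m by (auto simp: merges_def)
 obtain l r where lr: "ins m = [l, r]" using length_ins[OF v(1)] v(2) by (auto simp: length_Suc_conv numeral_2_eq_2)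
 have s: "in_edges w m = {l, r}" and ne: "l ~= r" and o: "left_of_below w l r"
  using vertex_lists(1-3)[OF v(1)] lr by auto
 have no: "\<not> left_of_below w r l" using below_asym[OF o] by blast
 have "left_in w m = l" unfolding left_in_def s by (rule the_equality) (use o no ne in auto)
 moreover have "right_in w m = r" unfolding right_in_def s by (rule the_equality) (use o no ne in auto)
 ultimately show ?thesis using lr by simp
qed

lemma edge_curve_props:
 assumes e: "e \<in> edges w"
 shows "compact (edge_curve w e)" "connected (edge_curve w e)" "edge_start w e \<in> edge_curve w e" "edge_end w e \<in> edge_curve w e"
proof -
 have "continuous_on {lo w e..hi w e} (edge_pt w e)"
  unfolding edge_pt_def ann_def by (intro continuous_intros edgeD(2)[OF e])
 then show "compact (edge_curve w e)" "connected (edge_curve w e)" unfolding edge_curve_def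
  by (auto intro: compact_continuous_image connected_continuous_image)
 show "edge_start w e \<in> edge_curve w e" "edge_end w e \<in> edge_curve w e"
  using edgeD(1)[OF e] unfolding edge_curve_def edge_start_def edge_end_def by auto
qed

lemma curve_vertex:
 assumes e: "e \<in> edges w" and p: "p \<in> edge_curve w e" "p \<in> verts w"
 shows "e \<in> in_edges w p \<union> out_edges w p"
proof -
 obtain y where y: "lo w e \<le> y" "y \<le> hi w e" "p = edge_pt w e y" using p(1) by (auto simp: edge_curve_def)
 have "\<not> (lo w e < y \<and> y < hi w e)" using interior_dom[of e y] edgeD(7)[OF e, of y] p(2) y(3) by auto
 then have "y = lo w e \<or> y = hi w e" using y by linarith
 then show ?thesis using e y(3) by (auto simp: in_edges_def out_edges_def edge_start_def edge_end_def)
qed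

lemma curves_meet:
 assumes e: "e \<in> edges w" "e' \<in> edges w" "e ~= e'" and p: "p \<in> edge_curve w e" "p \<in> edge_curve w e'"
 shows "p \<in> verts w"
proof (rule ccontr)
 assume nv: "p \<notin> verts w"
 have "\<exists>z\<in>edge_dom w e. p = edge_pt w e z" if e: "e \<in> edges w" and p: "p \<in> edge_curve w e" for e
 proof -
  obtain y where y: "lo w e \<le> y" "y \<le> hi w e" "p = edge_pt w e y" using p by (auto simp: edge_curve_def)
  show ?thesis
  proof (cases "lo w e < y \<and> y < hi w e")
   case True
   then show ?thesis using interior_dom[of e y] y(3) by blast
  next
   case False
   then have "p = edge_start w e \<or> p = edge_end w e" using y unfolding edge_start_def edge_end_def by force
   then have "edge_start w e \<notin> verts w \<and> p = edge_start w e" using nv edgeD(5,6)[OF e] by metis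
   then show ?thesis using edgeD(1)[OF e] by (intro bexI[of _ "lo w e"]) (auto simp: edge_dom_def edge_start_def)
  qed
 qed
 then show False using edge_inj[OF e(1,2)] e p by metis
qed

end

section \<open>Circles of one colour\<close>

locale web_cut = ann_web w + cw: cweb "edges w" "ann_web.ins w" "ann_web.outs w" vs sl
 for w :: "'e web" and vs sl +
 fixes h :: real
 assumes rad: "radial_cut w h" and sl0: "sl 0 = cut_edges w h" and set_vs: "set vs = verts w"
  and good_sl: "k \<le> length vs ==> good (sl k)"
begin

lemma flow_cons: "cw.flow f ==> cons f"
 unfolding cw.flow_def cons_def set_vs by (simp add: sum_ins sum_outs)

text \<open>Each circle consists of the edges of \<open>K\<close> with a common left weight j below
  the degree. Every slice contains exactly one such edge, and the edges of successive slices
  coincide or share a vertex, so the circle is connected. Since at most one strand passes a vertex,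
  edges with different left weights never meet there.\<close>

lemma card_components:
 assumes K: "K \<subseteq> edges w" and f: "f = (%e. if e \<in> K then 1 else 0)" and fl: "cw.flow f"
  and le: "\<And>v. v \<in> verts w ==> sum_list (map f (ins v)) \<le> 1"
 shows "card (components (\<Union>e\<in>K. edge_curve w e)) = cw.deg f"
proof -
 let ?n = "cw.deg f"
 let ?Z = "%j. \<Union>e\<in>{e \<in> K. Lam f e = j}. edge_curve w e"
 have co: "cons f" by (rule flow_cons[OF fl])
 have f1: "f x \<le> 1" for x by (simp add: f)
 have pre: "sum_list (map f A) = Lam f e" if s: "sl k = A @ e # B" and k: "k \<le> length vs" for k A e B
  using good_sl[OF k] s co unfolding good_def by blast
 have uniq: "e = e'" if k: "k \<le> length vs" and e: "e \<in> set (sl k)" "e \<in> K" "e' \<in> set (sl k)" "e' \<in> K" "Lam f e = Lam f e'" for k e e'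
 proof (rule ccontr)
  assume ne: "e ~= e'"
  have wlog: False if w: "sl k = A @ x # B" "y \<in> set A" "x \<in> K" "y \<in> K" "Lam f x = Lam f y" for A x B y
  proof -
   obtain A1 A2 where A: "A = A1 @ y # A2" using split_list[OF w(2)] by blast
   have "sum_list (map f A) = Lam f x" by (rule pre[OF w(1) k])
   moreover have "sum_list (map f A1) = Lam f y" by (rule pre[of k A1 y "A2 @ x # B", OF _ k]) (use w(1) A in simp)
   ultimately show False using A w(4,5) by (simp add: f)
  qed
  obtain A B where s: "sl k = A @ e # B" using split_list[OF e(1)] by blast
  then have "e' \<in> set A \<or> e' \<in> set B" using e(3) ne by auto
  then show False
  proof
   assume "e' \<in> set A"
   then show False using wlog[OF s] e by blast
  next
   assume "e' \<in> set B"
   then obtain B1 B2 where "B = B1 @ e' # B2" using split_list by metis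
   then have "sl k = (A @ e # B1) @ e' # B2" using s by simp
   then show False using wlog[of "A @ e # B1" e' B2 e] e by simp
  qed
 qed
 have at: "\<exists>e. e \<in> set (sl k) \<and> e \<in> K \<and> Lam f e = j" if k: "k \<le> length vs" and j: "j < ?n" for k j
 proof -
  have "j < sum_list (map f (sl k))" using j cw.flow_slice[OF fl k] by simp
  then obtain A e B where s: "sl k = A @ e # B" "f e = 1" "sum_list (map f A) = j" using one_at_index[of j f "sl k"] f1 by blast
  then have "e \<in> K" by (auto simp: f split: if_splits)
  then show ?thesis using s pre[OF s(1) k] by (intro exI[of _ e]) simp
 qed
 have small: "Lam f e < ?n" if k: "k \<le> length vs" "e \<in> set (sl k)" "e \<in> K" for k e
 proof -
  obtain A B where s: "sl k = A @ e # B" using split_list[OF k(2)] by blast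
  then have "sum_list (map f (sl k)) \<ge> Lam f e + 1" using pre[OF s k(1)] k(3) by (simp add: f)
  then show ?thesis using cw.flow_slice[OF fl k(1)] by simp
 qed
 have ends: "Lam f e = Lam f e'" if v: "v \<in> verts w" and e: "e \<in> in_edges w v \<union> out_edges w v" "e' \<in> in_edges w v \<union> out_edges w v"
  and eK: "e \<in> K" "e' \<in> K" for v e e'
 proof -
  obtain k where k: "k < length vs" "vs ! k = v" using v set_vs by (metis in_set_conv_nth)
  obtain A B where s: "sl k = A @ ins v @ B" "sl (Suc k) = A @ outs v @ B" using cw.step[OF k(1)] k(2) by blast
  have le': "sum_list (map f (outs v)) \<le> 1" using le[OF v] cons_vertex[OF co v] by simp
  have key: "Lam f x = sum_list (map f A)" if x: "x \<in> K" "x \<in> set M" and M: "sl l = A @ M @ B" "l \<le> length vs" "sum_list (map f M) \<le> 1" for x M l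
  proof -
   obtain C D where M': "M = C @ x # D" using split_list[OF x(2)] by blast
   have "sum_list (map f (A @ C)) = Lam f x" by (rule pre[of l _ x "D @ B", OF _ M(2)]) (use M(1) M' in simp)
   moreover have "f x = 1" unfolding f using x(1) by simp
   then have "sum_list (map f C) = 0" using M(3) unfolding M' by simp
   ultimately show ?thesis by simp
  qed
  have "Lam f x = sum_list (map f A)" if "x \<in> K" "x \<in> in_edges w v \<union> out_edges w v" for x
   using that vertex_lists(1,4)[OF v] key[OF that(1) _ s(1) _ le[OF v]] key[OF that(1) _ s(2) _ le'] k(1) by auto
  then show ?thesis using e eK by simp
 qed
 have cov: "\<exists>k\<le>length vs. e \<in> set (sl k)" if "e \<in> K" for e using cw.cover K that by blast
 have dis: "?Z i \<inter> ?Z j = {}" if "i ~= j" for i j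
 proof (rule ccontr)
  assume "\<not> ?thesis"
  then obtain p e e' where p: "e \<in> K" "e' \<in> K" "Lam f e = i" "Lam f e' = j" "p \<in> edge_curve w e" "p \<in> edge_curve w e'" by blast
  have E: "e \<in> edges w" "e' \<in> edges w" "e ~= e'" using p K that by auto
  have v: "p \<in> verts w" using curves_meet[OF E p(5,6)] .
  show False using ends[OF v curve_vertex[OF E(1) p(5) v] curve_vertex[OF E(2) p(6) v] p(1,2)] p that by simp
 qed
 have con: "connected (?Z j)" if j: "j < ?n" for j
 proof -
  define s where "s k = (SOME e. e \<in> set (sl k) \<and> e \<in> K \<and> Lam f e = j)" for k
  have s: "s k \<in> set (sl k)" "s k \<in> K" "Lam f (s k) = j" if "k \<le> length vs" for k
   using someI_ex[OF at[OF that j]] unfolding s_def by blast+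
  have su: "e = s k" if "k \<le> length vs" "e \<in> set (sl k)" "e \<in> K" "Lam f e = j" for e k
   using uniq[OF that(1-3) s(1,2)[OF that(1)]] s(3)[OF that(1)] that(4) by simp
  have sE: "s k \<in> edges w" if "k \<le> length vs" for k using s(2)[OF that] K by blast
  have "connected (\<Union>l\<in>{..k}. edge_curve w (s l))" if "k \<le> length vs" for k
   using that
  proof (induction k)
   case 0
   then show ?case using edge_curve_props(2)[OF sE[of 0]] by simp
  next
   case (Suc k)
   let ?v = "vs ! k"
   have k: "k \<le> length vs" "k < length vs" using Suc.prems by auto
   have v: "?v \<in> verts w" using nth_mem[OF k(2)] unfolding set_vs .
   obtain A B where AB: "sl k = A @ ins ?v @ B" "sl (Suc k) = A @ outs ?v @ B" using cw.step[OF k(2)] by blast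
   \<comment> \<open>If the representative changes, the old edge ends and the new one starts at the
     vertex just passed.\<close>
   have "edge_curve w (s k) \<inter> edge_curve w (s (Suc k)) ~= {}"
   proof (cases "s k = s (Suc k)")
    case True
    then show ?thesis using edge_curve_props(3)[OF sE[OF k(1)]] by auto
   next
    case False
    have "s (Suc k) \<notin> set (sl k)" using su[OF k(1) _ s(2,3)[OF Suc.prems]] False by auto
    then have o: "s (Suc k) \<in> out_edges w ?v" using s(1)[OF Suc.prems] AB vertex_lists(4)[OF v] by auto
    have "s k \<notin> set (sl (Suc k))" using su[OF Suc.prems _ s(2,3)[OF k(1)]] False by auto
    then have i: "s k \<in> in_edges w ?v" using s(1)[OF k(1)] AB vertex_lists(1)[OF v] by auto
    show ?thesis using edge_curve_props(4)[OF sE[OF k(1)]] edge_curve_props(3)[OF sE[OF Suc.prems]] o i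
     by (auto simp: in_edges_def out_edges_def)
   qed
   then have "(\<Union>l\<in>{..k}. edge_curve w (s l)) \<inter> edge_curve w (s (Suc k)) ~= {}" by blast
   then have "connected ((\<Union>l\<in>{..k}. edge_curve w (s l)) \<union> edge_curve w (s (Suc k)))"
    using Suc.IH[OF k(1)] edge_curve_props(2)[OF sE[OF Suc.prems]] by (intro connected_Un) auto
   then show ?case by (simp add: atMost_Suc Un_commute)
  qed
  moreover have "?Z j = (\<Union>l\<in>{..length vs}. edge_curve w (s l))"
  proof (intro equalityI subsetI)
   fix p assume "p \<in> ?Z j"
   then obtain e where e: "e \<in> K" "Lam f e = j" "p \<in> edge_curve w e" by blast
   obtain k where k: "k \<le> length vs" "e \<in> set (sl k)" using cov[OF e(1)] by blast
   then show "p \<in> (\<Union>l\<in>{..length vs}. edge_curve w (s l))" using su[OF k e(1,2)] e(3) by auto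
  next
   fix p assume "p \<in> (\<Union>l\<in>{..length vs}. edge_curve w (s l))"
   then obtain l where "l \<le> length vs" "p \<in> edge_curve w (s l)" by auto
   then show "p \<in> ?Z j" using s(2,3) by blast
  qed
  ultimately show ?thesis by simp
 qed
 have finK: "finite K" using K fin_E finite_subset by blast
 have clo: "closed (?Z j)" for j
  using finK K edge_curve_props(1) by (intro closed_UN) (auto intro: compact_imp_closed)
 have ne: "?Z j ~= {}" if j: "j < ?n" for j
 proof -
  obtain e where "e \<in> K" "Lam f e = j" using at[OF _ j, of 0] by auto
  then show ?thesis using edge_curve_props(3)[of e] K by blast
 qed
 have "(\<Union>e\<in>K. edge_curve w e) = (\<Union>j\<in>{..<?n}. ?Z j)"
 proof (intro equalityI subsetI)
  fix p assume "p \<in> (\<Union>e\<in>K. edge_curve w e)"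
  then obtain e where e: "e \<in> K" "p \<in> edge_curve w e" by blast
  obtain k where "k \<le> length vs" "e \<in> set (sl k)" using cov[OF e(1)] by blast
  then show "p \<in> (\<Union>j\<in>{..<?n}. ?Z j)" using small e by blast
 qed blast
 moreover have "card (components (\<Union>j\<in>{..<?n}. ?Z j)) = card {..<?n}"
  by (rule components_disjoint_union) (use clo con ne dis in auto)
 ultimately show ?thesis by simp
qed

end

section \<open>The coefficients of the colouring series\<close>

lemma sum_indicator:
 fixes g :: "nat => int"
 assumes "C \<subseteq> {1..K}"
 shows "(\<Sum>a\<in>C. g a) = (\<Sum>a=1..K. int (if a \<in> C then 1 else 0) * g a)"
proof -
 have "(\<Sum>a=1..K. int (if a \<in> C then 1 else 0) * g a) = (\<Sum>a\<in>{1..K}. if a \<in> C then g a else 0)"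
  by (rule sum.cong) auto
 also have "\<dots> = (\<Sum>a\<in>{1..K} \<inter> C. g a)" by (simp add: sum.inter_restrict)
 also have "{1..K} \<inter> C = C" using assms by blast
 finally show ?thesis by simp
qed

lemma sum_01: "C \<subseteq> {1..K} ==> (\<Sum>i=1..K. if i \<in> C then 1 else 0 :: nat) = card C"
 for C :: "nat set"
proof -
 assume "C \<subseteq> {1..K}"
 then have e: "{1..K} \<inter> C = C" by blast
 have "(\<Sum>i\<in>{1..K} \<inter> C. 1 :: nat) = (\<Sum>i=1..K. if i \<in> C then 1 else 0)" by (rule sum.inter_restrict) simp
 then show ?thesis unfolding e by simp
qed

context cweb
begin

lemma pc_sum: "pc K T = (\<Sum>v\<in>mgs. \<Sum>a=1..K. \<Sum>b=1..K. int (T a (ins v ! 1)) * (int (T b (ins v ! 0)) * sgn (int a - int b)))"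
proof (induction K)
 case (Suc K)
 have per: "(\<Sum>a=1..Suc K. \<Sum>b=1..Suc K. int (x a) * (int (y b) * sgn (int a - int b))) =
   (\<Sum>a=1..K. \<Sum>b=1..K. int (x a) * (int (y b) * sgn (int a - int b))) +
   (\<Sum>i=1..K. int (y i) * int (x (Suc K)) - int (y (Suc K)) * int (x i))" for x y :: "nat => nat"
 proof -
  have s: "(\<Sum>a=1..Suc K. g a) = (\<Sum>a=1..K. g a) + g (Suc K)" for g :: "nat => int" by simp
  have 1: "(\<Sum>a=1..K. int (x a) * (int (y (Suc K)) * sgn (int a - int (Suc K)))) = (\<Sum>a=1..K. - (int (y (Suc K)) * int (x a)))"
   by (rule sum.cong) (auto simp: sgn_if)
  have 2: "(\<Sum>b=1..K. int (x (Suc K)) * (int (y b) * sgn (int (Suc K) - int b))) = (\<Sum>b=1..K. int (y b) * int (x (Suc K)))"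
   by (rule sum.cong) (auto simp: sgn_if)
  show ?thesis unfolding s sum.distrib 1 2 by (simp add: sum_subtractf sum_negf)
 qed
 have "(\<Sum>i=1..K. cross (T i) (T (Suc K))) =
   (\<Sum>v\<in>mgs. \<Sum>i=1..K. int (T i (ins v ! 0)) * int (T (Suc K) (ins v ! 1)) - int (T (Suc K) (ins v ! 0)) * int (T i (ins v ! 1)))"
  unfolding cross_def by (rule sum.swap)
 then show ?case unfolding pc.simps Suc.IH per sum.distrib by simp
qed simp

end

context web_cut
begin

text \<open>The field \<open>thick\<close> is unconstrained off the edges, whereas a flow has to
  vanish there.\<close>

definition t0 :: "'e => nat" where "t0 e = (if e \<in> edges w then thick w e else 0)"

lemma in_out_edges: "v \<in> verts w ==> set (ins v) \<subseteq> edges w" "v \<in> verts w ==> set (outs v) \<subseteq> edges w"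
 using vertex_lists(1,4)[of v] by (auto simp: in_edges_def out_edges_def)

lemma flow_t0: "cw.flow t0"
 unfolding cw.flow_def set_vs
proof (intro conjI ballI allI impI)
 fix v assume v: "v \<in> verts w"
 have m: "map t0 (ins v) = map (thick w) (ins v)" "map t0 (outs v) = map (thick w) (outs v)"
  using in_out_edges[OF v] by (auto simp: t0_def)
 show "sum_list (map t0 (ins v)) = sum_list (map t0 (outs v))" unfolding m by (rule cons_vertex[OF cons_thick v])
qed (simp add: t0_def)

lemma sl0_edges: "set (sl 0) \<subseteq> edges w"
 using cw.sl_E[of 0] by simp

lemma deg_t0: "cw.deg t0 = web_degree w"
proof -
 have "map t0 (sl 0) = map (thick w) (cut_edges w h)" using sl0_edges by (auto simp: t0_def sl0)
 then show ?thesis unfolding cw.deg_def web_degree_eq[OF rad] cut_thickness_def by simp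
qed

lemma mgs_merges: "cw.mgs = merges w"
 unfolding cw.mgs_def set_vs merges_def using length_ins vertD(1) by fastforce

text \<open>Colourings only demand equal unions at a vertex. Disjointness follows by counting:
  thickness is conserved, and one side of the vertex is a single edge.\<close>

lemma coloring_vertex:
 assumes c: "c \<in> colorings w" and v: "v \<in> verts w"
 shows "(\<Union>e\<in>set (ins v). c e) = (\<Union>e\<in>set (outs v). c e)" "disjoint_family_on c (set (ins v))" "disjoint_family_on c (set (outs v))"
proof -
 show u: "(\<Union>e\<in>set (ins v). c e) = (\<Union>e\<in>set (outs v). c e)"
  using c v vertex_lists(1,4)[OF v] by (simp add: colorings_def)
 have cd: "finite (c e) \<and> card (c e) = thick w e" if "e \<in> set (ins v) \<union> set (outs v)" for e
  using c that in_out_edges[OF v] by (auto simp: colorings_def)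
 have th: "sum_list (map (thick w) (ins v)) = sum_list (map (thick w) (outs v))" by (rule cons_vertex[OF cons_thick v])
 have two: "c l \<inter> c r = {}" if "finite (c l)" "finite (c r)" "card (c l \<union> c r) = card (c l) + card (c r)" for l r
  using card_Un_Int[OF that(1,2)] that by simp
 have dj: "disjoint_family_on c {l, r}" if "c l \<inter> c r = {}" for l r
  using that by (auto simp: disjoint_family_on_def)
 from vertex_shape[OF v] have "disjoint_family_on c (set (ins v)) \<and> disjoint_family_on c (set (outs v))"
 proof
  assume "\<exists>l r c. ins v = [l, r] \<and> outs v = [c]"
  then obtain l r d where e: "ins v = [l, r]" "outs v = [d]" by blast
  have "c l \<inter> c r = {}" by (rule two) (use cd[of l] cd[of r] cd[of d] th u e in simp_all)
  then show ?thesis using e dj[of l r] by (simp add: disjoint_family_on_def)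
 next
  assume "\<exists>l r c. ins v = [c] \<and> outs v = [l, r]"
  then obtain l r d where e: "ins v = [d]" "outs v = [l, r]" by blast
  have "c l \<inter> c r = {}" by (rule two) (use cd[of l] cd[of r] cd[of d] th u e in simp_all)
  then show ?thesis using e dj[of l r] by (simp add: disjoint_family_on_def)
 qed
 then show "disjoint_family_on c (set (ins v))" "disjoint_family_on c (set (outs v))" by blast+
qed

definition cfl :: "('e => nat set) => nat => 'e => nat" where
 "cfl c i = (%e. if e \<in> edges w \<and> i \<in> c e then 1 else 0)"

lemma coloring_flow:
 assumes c: "c \<in> colorings w"
 shows "cw.flow (cfl c i)" "card (components (color_curves w c i)) = cw.deg (cfl c i)"
proof -
 have s: "sum_list (map (cfl c i) (ins v)) = (if i \<in> (\<Union>e\<in>set (ins v). c e) then 1 else 0)"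
  "sum_list (map (cfl c i) (outs v)) = (if i \<in> (\<Union>e\<in>set (outs v). c e) then 1 else 0)" if v: "v \<in> verts w" for v
 proof -
  have m: "map (cfl c i) (ins v) = map (%e. if i \<in> c e then 1 else 0) (ins v)"
   "map (cfl c i) (outs v) = map (%e. if i \<in> c e then 1 else 0) (outs v)"
   using in_out_edges[OF v] by (auto simp: cfl_def)
  show "sum_list (map (cfl c i) (ins v)) = (if i \<in> (\<Union>e\<in>set (ins v). c e) then 1 else 0)"
   "sum_list (map (cfl c i) (outs v)) = (if i \<in> (\<Union>e\<in>set (outs v). c e) then 1 else 0)"
   unfolding m by (rule sum_list_indicator[OF vertex_lists(2)[OF v] coloring_vertex(2)[OF c v]],
    rule sum_list_indicator[OF vertex_lists(5)[OF v] coloring_vertex(3)[OF c v]])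
 qed
 show fl: "cw.flow (cfl c i)"
  unfolding cw.flow_def set_vs using s coloring_vertex(1)[OF c] by (auto simp: cfl_def)
 have "card (components (\<Union>e\<in>{e \<in> edges w. i \<in> c e}. edge_curve w e)) = cw.deg (cfl c i)"
 proof (rule card_components)
  show "sum_list (map (cfl c i) (ins v)) \<le> 1" if "v \<in> verts w" for v using s(1)[OF that] by simp
 qed (use fl in \<open>auto simp: cfl_def\<close>)
 then show "card (components (color_curves w c i)) = cw.deg (cfl c i)" by (simp add: color_curves_def)
qed

lemma coloring_colours:
 assumes c: "c \<in> colorings w" and \<mu>: "\<And>i. lkp \<mu> i = card (components (color_curves w c i))"
  and K: "pkeys \<mu> \<subseteq> {1..K}" and e: "e \<in> edges w"
 shows "c e \<subseteq> {1..K}"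
proof
 fix i assume "i \<in> c e"
 then have "cfl c i e = 1" using e by (simp add: cfl_def)
 then have "cw.deg (cfl c i) \<ge> 1" using cw.flow_le_deg[OF coloring_flow(1)[OF c], of i e] by simp
 then have "lkp \<mu> i ~= 0" using \<mu>[of i] coloring_flow(2)[OF c, of i] by simp
 then have "i \<in> pkeys \<mu>" by (simp add: in_keys_iff)
 then show "i \<in> {1..K}" using K by blast
qed

lemma thin_family:
 assumes T: "T \<in> cw.fam K t0" and i: "i \<in> {1..K}" and th: "cw.thin (T i)"
 shows "card (components (\<Union>e\<in>{e \<in> edges w. T i e = 1}. edge_curve w e)) = cw.deg (T i)"
proof (rule card_components)
 have fl: "cw.flow (T i)" by (rule cw.fam_flow[OF T i])
 have t1: "T i e \<le> 1" for e using th by (simp add: cw.thin_def)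
 show "cw.flow (T i)" by (rule fl)
 show "T i = (%e. if e \<in> {e \<in> edges w. T i e = 1} then 1 else 0)"
 proof
  fix e show "T i e = (if e \<in> {e \<in> edges w. T i e = 1} then 1 else 0)"
   using t1[of e] fl by (cases "e \<in> edges w") (auto simp: cw.flow_def)
 qed
 show "sum_list (map (T i) (ins v)) \<le> 1" if v: "v \<in> verts w" for v
 proof -
  have eq: "sum_list (map (T i) (ins v)) = sum_list (map (T i) (outs v))" using fl v set_vs by (simp add: cw.flow_def)
  from vertex_shape[OF v] show ?thesis
  proof
   assume "\<exists>l r c. ins v = [l, r] \<and> outs v = [c]"
   then obtain l r d where e: "ins v = [l, r]" "outs v = [d]" by blast
   show ?thesis unfolding eq using e t1[of d] by simp
  next
   assume "\<exists>l r c. ins v = [c] \<and> outs v = [l, r]"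
   then obtain l r d where e: "ins v = [d]" "outs v = [l, r]" by blast
   then show ?thesis using t1[of d] by simp
  qed
 qed
qed auto

lemma sum_positive: "sum_list (map f xs) > 0 \<longleftrightarrow> (\<exists>x\<in>set xs. f x > 0)" for f :: "'e => nat"
 by (induction xs) auto

text \<open>A colouring is the same as the family of its colour flows, which are thin and add up to
  the thickness. The circles of a colour are counted by the degree of its flow, and the exponent
  becomes \<open>pc\<close>.\<close>

lemma X_web_coeff:
 assumes K: "pkeys \<mu> \<subseteq> {1..K}"
 shows "X_web w \<mu> = (\<Sum>T\<in>{T \<in> cw.fam K t0. \<forall>i\<in>{1..K}. cw.thin (T i) \<and> cw.deg (T i) = lkp \<mu> i}. qp (cw.pc K T))"
 unfolding X_web_def
proof (rule sum.reindex_bij_witness[where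
  j = "%c. \<lambda>i\<in>{1..K}. cfl c i" and i = "%T. \<lambda>e\<in>edges w. {i \<in> {1..K}. T i e = 1}"])
 fix c assume "c \<in> {c \<in> colorings w. \<forall>i. lkp \<mu> i = card (components (color_curves w c i))}"
 then have c: "c \<in> colorings w" and \<mu>: "\<And>i. lkp \<mu> i = card (components (color_curves w c i))" by auto
 let ?T = "\<lambda>i\<in>{1..K}. cfl c i"
 have sub: "c e \<subseteq> {1..K}" if "e \<in> edges w" for e using coloring_colours[OF c \<mu> K that] .
 show "(\<lambda>e\<in>edges w. {i \<in> {1..K}. ?T i e = 1}) = c"
 proof
  fix e show "(\<lambda>e\<in>edges w. {i \<in> {1..K}. ?T i e = 1}) e = c e"
  proof (cases "e \<in> edges w")
   case True
   then show ?thesis using sub[OF True] by (auto simp: cfl_def)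
  next
   case False
   then show ?thesis using c by (simp add: colorings_def extensional_def)
  qed
 qed
 have "(\<Sum>i=1..K. ?T i) = t0"
 proof
  fix e
  have "(\<Sum>i=1..K. ?T i) e = (\<Sum>i=1..K. cfl c i e)" unfolding sum_apply by (rule sum.cong) auto
  also have "\<dots> = t0 e"
  proof (cases "e \<in> edges w")
   case True
   then have "(\<Sum>i=1..K. cfl c i e) = (\<Sum>i=1..K. if i \<in> c e then 1 else 0)" by (simp add: cfl_def)
   also have "\<dots> = card (c e)" by (rule sum_01[OF sub[OF True]])
   finally show ?thesis using c True by (simp add: t0_def colorings_def)
  qed (simp add: cfl_def t0_def)
  finally show "(\<Sum>i=1..K. ?T i) e = t0 e" .
 qed
 moreover have "?T \<in> {1..K} \<rightarrow>\<^sub>E {f. cw.flow f}" using coloring_flow(1)[OF c] by simp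
 ultimately have fam: "?T \<in> cw.fam K t0" unfolding cw.fam_def by blast
 have "cw.thin (cfl c i)" for i by (simp add: cw.thin_def cfl_def)
 then show "?T \<in> {T \<in> cw.fam K t0. \<forall>i\<in>{1..K}. cw.thin (T i) \<and> cw.deg (T i) = lkp \<mu> i}"
  using fam \<mu> coloring_flow(2)[OF c] by simp
 have "cw.pc K ?T = coloring_inv w c"
  unfolding cw.pc_sum coloring_inv_def mgs_merges
 proof (rule sum.cong[OF refl])
  fix m assume m: "m \<in> merges w"
  let ?l = "left_in w m" and ?r = "right_in w m"
  have mv: "m \<in> verts w" using m by (simp add: merges_def)
  have lr: "?l \<in> edges w" "?r \<in> edges w" using in_out_edges(1)[OF mv] merge_ins[OF m] by auto
  have "(\<Sum>a=1..K. \<Sum>b=1..K. int (?T a ?r) * (int (?T b ?l) * sgn (int a - int b))) =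
    (\<Sum>a=1..K. int (if a \<in> c ?r then 1 else 0) * (\<Sum>b=1..K. int (if b \<in> c ?l then 1 else 0) * sgn (int a - int b)))"
   unfolding sum_distrib_left by (intro sum.cong refl) (use lr in \<open>simp add: cfl_def\<close>)
  also have "\<dots> = (\<Sum>a\<in>c ?r. \<Sum>b\<in>c ?l. sgn (int a - int b))"
   unfolding sum_indicator[OF sub[OF lr(2)]] sum_indicator[OF sub[OF lr(1)]] by (rule refl)
  finally show "(\<Sum>a=1..K. \<Sum>b=1..K. int (?T a (ins m ! 1)) * (int (?T b (ins m ! 0)) * sgn (int a - int b))) =
    (\<Sum>a\<in>c ?r. \<Sum>b\<in>c ?l. sgn (int a - int b))" using merge_ins[OF m] by simp
 qed
 then show "qp (cw.pc K ?T) = q powi coloring_inv w c" by simp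
next
 fix T assume "T \<in> {T \<in> cw.fam K t0. \<forall>i\<in>{1..K}. cw.thin (T i) \<and> cw.deg (T i) = lkp \<mu> i}"
 then have T: "T \<in> cw.fam K t0" and th: "\<And>i. i \<in> {1..K} ==> cw.thin (T i)" and dg: "\<And>i. i \<in> {1..K} ==> cw.deg (T i) = lkp \<mu> i" by auto
 let ?c = "\<lambda>e\<in>edges w. {i \<in> {1..K}. T i e = 1}"
 have fl: "cw.flow (T i)" if "i \<in> {1..K}" for i by (rule cw.fam_flow[OF T that])
 have t1: "T i e = (if T i e = 1 then 1 else 0)" "T i e > 0 \<longleftrightarrow> T i e = 1" if "i \<in> {1..K}" for i e
 proof -
  have "T i e \<le> 1" using th[OF that] unfolding cw.thin_def by blast
  then show "T i e = (if T i e = 1 then 1 else 0)" "T i e > 0 \<longleftrightarrow> T i e = 1" by auto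
 qed
 have Tx: "T \<in> extensional {1..K}" and Ts: "(\<Sum>i=1..K. T i) = t0" using T unfolding cw.fam_def PiE_def by auto
 show "(\<lambda>i\<in>{1..K}. cfl ?c i) = T"
 proof
  fix i show "(\<lambda>i\<in>{1..K}. cfl ?c i) i = T i"
  proof (cases "i \<in> {1..K}")
   case True
   have "cfl ?c i e = T i e" for e
    using t1[OF True, of e] fl[OF True] True by (cases "e \<in> edges w") (auto simp: cfl_def cw.flow_def)
   then have "cfl ?c i = T i" by (rule ext)
   then show ?thesis using True by simp
  next
   case False
   then have "T i = undefined" using Tx unfolding extensional_def by blast
   then show ?thesis by (simp only: restrict_apply False if_False)
  qed
 qed
 have cd: "card (?c e) = thick w e" if e: "e \<in> edges w" for e
 proof -
  have "card (?c e) = (\<Sum>i=1..K. if i \<in> ?c e then 1 else 0)" by (rule sum_01[symmetric]) (use e in auto)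
  also have "\<dots> = (\<Sum>i=1..K. T i e)"
  proof (rule sum.cong[OF refl])
   fix i assume "i \<in> {1..K}"
   then show "(if i \<in> ?c e then 1 else 0) = T i e" using t1(1)[of i e] e by simp
  qed
  also have "\<dots> = t0 e" unfolding Ts[symmetric] sum_apply by (rule refl)
  finally show ?thesis using e by (simp add: t0_def)
 qed
 have un: "(\<Union>e\<in>in_edges w v. ?c e) = (\<Union>e\<in>out_edges w v. ?c e)" if v: "v \<in> verts w" for v
 proof -
  have m: "i \<in> (\<Union>e\<in>set xs. ?c e) \<longleftrightarrow> i \<in> {1..K} \<and> sum_list (map (T i) xs) > 0" if xs: "set xs \<subseteq> edges w" for xs i
  proof (cases "i \<in> {1..K}")
   case True
   have "i \<in> (\<Union>e\<in>set xs. ?c e) \<longleftrightarrow> (\<exists>e\<in>set xs. T i e = 1)" using xs True by auto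
   then show ?thesis unfolding sum_positive t1(2)[OF True] using True by blast
  next
   case False
   then show ?thesis using xs by auto
  qed
  have "(\<Union>e\<in>set (ins v). ?c e) = (\<Union>e\<in>set (outs v). ?c e)"
  proof (rule set_eqI)
   fix i
   have "sum_list (map (T i) (ins v)) = sum_list (map (T i) (outs v))" if "i \<in> {1..K}"
    using fl[OF that] v set_vs unfolding cw.flow_def by blast
   then show "i \<in> (\<Union>e\<in>set (ins v). ?c e) \<longleftrightarrow> i \<in> (\<Union>e\<in>set (outs v). ?c e)"
    unfolding m[OF in_out_edges(1)[OF v]] m[OF in_out_edges(2)[OF v]] by metis
  qed
  then show ?thesis unfolding vertex_lists(1,4)[OF v] .
 qed
 have col: "?c \<in> colorings w"
  unfolding colorings_def
 proof (intro CollectI conjI ballI)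
  fix e assume e: "e \<in> edges w"
  show "finite (?c e)" "?c e \<subseteq> {1..}" using e by auto
  show "card (?c e) = thick w e" by (rule cd[OF e])
 next
  show "(\<Union>e\<in>in_edges w v. ?c e) = (\<Union>e\<in>out_edges w v. ?c e)" if "v \<in> verts w" for v by (rule un[OF that])
 qed simp
 have "lkp \<mu> i = card (components (color_curves w ?c i))" for i
 proof (cases "i \<in> {1..K}")
  case True
  have "{e \<in> edges w. i \<in> ?c e} = {e \<in> edges w. T i e = 1}" using True by auto
  then have "color_curves w ?c i = (\<Union>e\<in>{e \<in> edges w. T i e = 1}. edge_curve w e)" unfolding color_curves_def by (simp only:)
  then show ?thesis using thin_family[OF T True th[OF True]] dg[OF True] by simp
 next
  case False
  then have "{e \<in> edges w. i \<in> ?c e} = {}" by auto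
  then have "color_curves w ?c i = {}" unfolding color_curves_def by (simp only: UN_empty)
  moreover have "lkp \<mu> i = 0" using False K by (meson in_keys_iff subsetD)
  ultimately show ?thesis by (simp add: components_empty)
 qed
 then show "?c \<in> {c \<in> colorings w. \<forall>i. lkp \<mu> i = card (components (color_curves w c i))}" using col by blast
qed

interpretation sX: newton_family "edges w" ins outs vs sl cw.X "%_. 1" by (rule cw.newton_family_X)

lemma X_web_ser: "X_web w = sX.ser t0"
proof
 fix \<mu>
 show "X_web w \<mu> = sX.ser t0 \<mu>"
 proof (cases "pkeys \<mu> \<subseteq> {1..}")
  case True
  let ?K = "sX.kmax \<mu>"
  have K: "pkeys \<mu> \<subseteq> {1..?K}" by (rule sX.keys_kmax[OF True])
  have "sX.ser t0 \<mu> = (\<Sum>T\<in>cw.fam ?K t0. qp (cw.pc ?K T) * (\<Prod>i=1..?K. cw.X (lkp \<mu> i) (T i)))"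
   unfolding sX.ser_eq[OF K] by (rule cw.sp_fam[OF flow_t0])
  also have "\<dots> = (\<Sum>T\<in>cw.fam ?K t0. if \<forall>i\<in>{1..?K}. cw.thin (T i) \<and> cw.deg (T i) = lkp \<mu> i then qp (cw.pc ?K T) else 0)"
  proof (rule sum.cong[OF refl])
   fix T assume T: "T \<in> cw.fam ?K t0"
   have X: "cw.X (lkp \<mu> i) (T i) = (if cw.thin (T i) \<and> cw.deg (T i) = lkp \<mu> i then 1 else 0)" if "i \<in> {1..?K}" for i
    using cw.fam_flow[OF T that] by (simp add: cw.X_def)
   show "qp (cw.pc ?K T) * (\<Prod>i=1..?K. cw.X (lkp \<mu> i) (T i)) =
     (if \<forall>i\<in>{1..?K}. cw.thin (T i) \<and> cw.deg (T i) = lkp \<mu> i then qp (cw.pc ?K T) else 0)"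
   proof (cases "\<forall>i\<in>{1..?K}. cw.thin (T i) \<and> cw.deg (T i) = lkp \<mu> i")
    case True
    then have "(\<Prod>i=1..?K. cw.X (lkp \<mu> i) (T i)) = 1" by (intro prod.neutral ballI) (simp add: X)
    then show ?thesis using True by simp
   next
    case False
    then obtain i where "i \<in> {1..?K}" "cw.X (lkp \<mu> i) (T i) = 0" using X by (metis (full_types))
    then have "(\<Prod>i=1..?K. cw.X (lkp \<mu> i) (T i)) = 0" by (intro prod_zero) auto
    then show ?thesis unfolding if_not_P[OF False] by simp
   qed
  qed
  also have "\<dots> = (\<Sum>T\<in>{T \<in> cw.fam ?K t0. \<forall>i\<in>{1..?K}. cw.thin (T i) \<and> cw.deg (T i) = lkp \<mu> i}. qp (cw.pc ?K T))"
   by (rule sum.inter_filter[symmetric, OF cw.finite_fam[OF flow_t0]])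
  finally show ?thesis using X_web_coeff[OF K] by simp
 next
  case False
  \<comment> \<open>The only excluded variable is x_0, and colours start at 1, so both coefficients
    are 0.\<close>
  then have z: "0 \<in> pkeys \<mu>" by (metis One_nat_def atLeast_iff not_less_eq_eq le_zero_eq subsetI not_less0 linorder_not_le less_one)
  have "{c \<in> colorings w. \<forall>i. lkp \<mu> i = card (components (color_curves w c i))} = {}"
  proof (rule ccontr)
   assume "\<not> ?thesis"
   then obtain c where c: "c \<in> colorings w" "lkp \<mu> 0 = card (components (color_curves w c 0))" by blast
   have "0 \<notin> c e" if "e \<in> edges w" for e using c(1) that unfolding colorings_def by force
   then have "color_curves w c 0 = {}" unfolding color_curves_def by blast
   then show False using z c(2) by (simp add: in_keys_iff components_empty)
  qed
  then show ?thesis unfolding X_web_def sX.ser_def if_not_P[OF False] by (simp only: sum.empty)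
 qed
qed

end

section \<open>The coefficients of the LLT series\<close>

lemma sum_mset_mset_set: "finite A ==> (\<Sum>p\<in>#mset_set A. g p) = (\<Sum>p\<in>A. g p)"
 by (simp add: sum_unfold_sum_mset)

lemma sum_mset_sum: "(\<Sum>p\<in>#(\<Sum>i\<in>I. M i). g p) = (\<Sum>i\<in>I. \<Sum>p\<in>#M i. g p)"
 by (induction I rule: infinite_finite_induct) simp_all

lemma blocks_union:
 "m \<le> length ts ==> (\<Union>j<m. {sum_list (take j ts)<..sum_list (take (Suc j) ts)}) = {0<..sum_list (take m ts) :: nat}"
proof (induction m)
 case (Suc m)
 have "take (Suc m) ts = take m ts @ [ts ! m]" using Suc.prems by (simp add: take_Suc_conv_app_nth)
 then have s: "sum_list (take (Suc m) ts) = sum_list (take m ts) + ts ! m" by simp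
 have "(\<Union>j<Suc m. {sum_list (take j ts)<..sum_list (take (Suc j) ts)}) =
   {sum_list (take m ts)<..sum_list (take (Suc m) ts)} \<union> {0<..sum_list (take m ts)}"
  unfolding lessThan_Suc UN_insert using Suc by simp
 also have "\<dots> = {0<..sum_list (take (Suc m) ts)}" unfolding s by auto
 finally show ?case .
qed simp

lemma sum_take_mono: "i \<le> j ==> sum_list (take i ts) \<le> sum_list (take j ts)" for ts :: "nat list"
proof -
 assume "i \<le> j"
 then obtain d where "j = i + d" using le_Suc_ex by blast
 then show ?thesis by (simp add: take_add)
qed

lemma qfact_nz: "qfact k ~= 0"
proof -
 have "q ^ i - inverse q ^ i ~= 0" if "i \<ge> 1" for i using q_diff_nz[of i] that by simp
 moreover have "q - inverse q ~= 0" using q_diff_nz[of 1] by simp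
 ultimately show ?thesis by (auto simp: qfact_def qint_def prod_zero_iff)
qed

lemma lookup_monomial:
 assumes "finite S"
 shows "lkp (\<Sum>u\<in>S. sgl (\<sigma> u) (1 :: nat)) i = card {u \<in> S. \<sigma> u = i}"
proof -
 have "lkp (\<Sum>u\<in>S. sgl (\<sigma> u) (1 :: nat)) i = (\<Sum>u\<in>S. if \<sigma> u = i then 1 else 0)"
  unfolding Poly_Mapping.lookup_sum by (rule sum.cong) (simp_all add: lookup_single when_def)
 then show ?thesis using assms by (simp add: sum.If_cases Int_def)
qed

context cweb
begin

lemma cf_value: "i \<in> {1..K} ==> cf K L \<sigma> i e = card {u \<in> L e. \<sigma> u = i}"
 by (simp add: cf_def)

lemma card_union_list:
 assumes "distinct xs" "disjoint_family_on L (set xs)" "\<And>e. e \<in> set xs ==> finite (L e)"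
 shows "sum_list (map (%e. card {u \<in> L e. \<sigma> u = i}) xs) = card {u \<in> (\<Union>e\<in>set xs. L e). \<sigma> u = i}"
proof -
 have "{u \<in> (\<Union>e\<in>set xs. L e). \<sigma> u = i} = (\<Union>e\<in>set xs. {u \<in> L e. \<sigma> u = i})" by blast
 moreover have "card (\<Union>e\<in>set xs. {u \<in> L e. \<sigma> u = i}) = (\<Sum>e\<in>set xs. card {u \<in> L e. \<sigma> u = i})"
  by (rule card_UN_disjoint) (use assms(2,3) in \<open>auto simp: disjoint_family_on_def\<close>)
 ultimately show ?thesis using assms(1) by (simp add: sum_list_distinct_conv_sum_set)
qed

lemma cf_fam:
 assumes gb: "gb t S bl" and L: "L \<in> SL t S bl" and \<sigma>: "\<sigma> \<in> S \<rightarrow>\<^sub>E {1..K}" and t: "flow t"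
 shows "cf K L \<sigma> \<in> fam K t" "i \<in> {1..K} ==> deg (cf K L \<sigma> i) = card {u \<in> S. \<sigma> u = i}"
proof -
 have finS: "finite S" and S: "S = (\<Union>e\<in>set (sl 0). bl e)" using gb unfolding gb_def by blast+
 have fL: "finite (L e)" for e using finS SL_D(2)[OF L] finite_subset by blast
 have fl: "flow (cf K L \<sigma> i)" if i: "i \<in> {1..K}" for i
  unfolding flow_def
 proof (intro conjI ballI allI impI)
  show "cf K L \<sigma> i e = 0" if "e \<notin> E" for e using SL_D(1)[OF L that] by (simp add: cf_value[OF i])
  fix v assume v: "v \<in> set vs"
  have c: "sum_list (map (cf K L \<sigma> i) xs) = card {u \<in> (\<Union>e\<in>set xs. L e). \<sigma> u = i}"
   if "distinct xs" "disjoint_family_on L (set xs)" for xs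
   using card_union_list[OF that fL] by (simp add: cf_value[OF i] cong: map_cong)
  show "sum_list (map (cf K L \<sigma> i) (ins v)) = sum_list (map (cf K L \<sigma> i) (outs v))"
   unfolding c[OF distinct_ins_outs(1)[OF v] SL_D(6)[OF L v]] c[OF distinct_ins_outs(2)[OF v] SL_D(7)[OF L v]]
    SL_D(5)[OF L v] by (rule refl)
 qed
 have "(\<Sum>i=1..K. cf K L \<sigma> i) = t"
 proof
  fix e
  have "(\<Sum>i=1..K. cf K L \<sigma> i e) = (\<Sum>i=1..K. card {u \<in> L e. \<sigma> u = i})"
   by (rule sum.cong[OF refl]) (rule cf_value)
  also have "\<dots> = card (L e)"
  proof -
   have c: "\<sigma> v \<in> {1..K}" if "v \<in> L e" for v using PiE_mem[OF \<sigma>] SL_D(2)[OF L, of e] that by blast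
   have "int (card (L e)) = int (\<Sum>i=1..K. card {u \<in> L e. \<sigma> u = i})"
    using sum_by_colour[of "L e" \<sigma> K "%_. 1", OF fL c] by simp
   then show ?thesis by (simp only: of_nat_eq_iff)
  qed
  also have "card (L e) = t e" using SL_D(1,3)[OF L, of e] t by (cases "e \<in> E") (auto simp: flow_def)
  finally show "(\<Sum>i=1..K. cf K L \<sigma> i) e = t e" unfolding sum_apply .
 qed
 moreover have "cf K L \<sigma> \<in> {1..K} \<rightarrow>\<^sub>E {f. flow f}" using fl by (intro PiE_I) (auto simp: cf_out)
 ultimately show "cf K L \<sigma> \<in> fam K t" unfolding fam_def by blast
 show "deg (cf K L \<sigma> i) = card {u \<in> S. \<sigma> u = i}" if i: "i \<in> {1..K}"
 proof -
  have "disjoint_family_on L (set (sl 0))" using gb_disjoint[OF gb] SL_D(4)[OF L] by (simp add: disjoint_family_on_def)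
  from card_union_list[OF dist_sl[of 0] this fL]
  have "deg (cf K L \<sigma> i) = card {u \<in> (\<Union>e\<in>set (sl 0). L e). \<sigma> u = i}"
   unfolding deg_def by (simp add: cf_value[OF i] cong: map_cong)
  also have "(\<Union>e\<in>set (sl 0). L e) = S" unfolding S using SL_D(4)[OF L] by simp
  finally show ?thesis .
 qed
qed

text \<open>The pairs of a decomposition and a map \<sigma> are sorted by their colour flows. Each
  label lies in exactly one block of the cut, so the degree of a colour flow is the number of labels
  with that colour.\<close>

lemma labelings_total:
 assumes t: "flow t" and gb: "gb t S bl"
 shows "(\<Sum>L\<in>SL t S bl. \<Sum>\<sigma>\<in>{\<sigma> \<in> S \<rightarrow>\<^sub>E {1..K}. \<forall>i\<in>{1..K}. card {u \<in> S. \<sigma> u = i} = d i}. qp (linv L \<sigma>)) =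
  (\<Prod>e\<in>set (sl 0). qfact (t e)) * sp (%i. H (d i)) K t"
proof -
 have finS: "finite S" using gb unfolding gb_def by blast
 let ?G = "{\<sigma> \<in> S \<rightarrow>\<^sub>E {1..K}. \<forall>i\<in>{1..K}. card {u \<in> S. \<sigma> u = i} = d i}"
 let ?P = "SL t S bl \<times> ?G"
 let ?TT = "{T \<in> fam K t. \<forall>i\<in>{1..K}. deg (T i) = d i}"
 let ?R = "\<Prod>e\<in>set (sl 0). qfact (t e)"
 have finG: "finite ?G" by (rule finite_subset[of _ "S \<rightarrow>\<^sub>E {1..K}"]) (use finS in \<open>auto intro!: finite_PiE\<close>)
 have "(\<Sum>L\<in>SL t S bl. \<Sum>\<sigma>\<in>?G. qp (linv L \<sigma>)) = (\<Sum>p\<in>?P. qp (linv (fst p) (snd p)))"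
  by (simp add: sum.cartesian_product split_def)
 also have "\<dots> = (\<Sum>T\<in>?TT. \<Sum>p\<in>{p \<in> ?P. cf K (fst p) (snd p) = T}. qp (linv (fst p) (snd p)))"
 proof (rule sum.group[symmetric])
  show "finite ?P" using finite_SL[OF finS] finG by simp
  show "finite ?TT" using finite_fam[OF t] by simp
  show "(%p. cf K (fst p) (snd p)) ` ?P \<subseteq> ?TT"
  proof clarify
   fix L \<sigma> assume L: "L \<in> SL t S bl" and \<sigma>: "\<sigma> \<in> S \<rightarrow>\<^sub>E {1..K}" and d: "\<forall>i\<in>{1..K}. card {u \<in> S. \<sigma> u = i} = d i"
   show "cf K (fst (L, \<sigma>)) (snd (L, \<sigma>)) \<in> fam K t \<and> (\<forall>i\<in>{1..K}. deg (cf K (fst (L, \<sigma>)) (snd (L, \<sigma>)) i) = d i)"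
    using cf_fam[OF gb L \<sigma> t] d by simp
  qed
 qed
 also have "\<dots> = (\<Sum>T\<in>?TT. ?R * qp (pc K T) * (\<Prod>i=1..K. Hf (T i)))"
 proof (rule sum.cong[OF refl])
  fix T assume T: "T \<in> ?TT"
  have "{p \<in> ?P. cf K (fst p) (snd p) = T} = PP K T t S bl"
  proof (intro equalityI subsetI)
   fix p assume "p \<in> {p \<in> ?P. cf K (fst p) (snd p) = T}"
   then show "p \<in> PP K T t S bl" unfolding PP_def by auto
  next
   fix p assume "p \<in> PP K T t S bl"
   then obtain L \<sigma> where p: "p = (L, \<sigma>)" "L \<in> SL t S bl" "\<sigma> \<in> S \<rightarrow>\<^sub>E {1..K}" "cf K L \<sigma> = T" unfolding PP_def by blast
   have "\<forall>i\<in>{1..K}. card {u \<in> S. \<sigma> u = i} = d i" using cf_fam(2)[OF gb p(2,3) t] p(4) T by simp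
   then show "p \<in> {p \<in> ?P. cf K (fst p) (snd p) = T}" using p by simp
  qed
  then have "(\<Sum>p\<in>{p \<in> ?P. cf K (fst p) (snd p) = T}. qp (linv (fst p) (snd p))) = (\<Sum>(L, \<sigma>)\<in>PP K T t S bl. qp (linv L \<sigma>))"
   by (simp only: split_def)
  also have "\<dots> = ?R * qp (pc K T) * (\<Prod>i=1..K. Hf (T i))" by (rule labelings_sum[OF t _ gb]) (use T in blast)
  finally show "(\<Sum>p\<in>{p \<in> ?P. cf K (fst p) (snd p) = T}. qp (linv (fst p) (snd p))) = ?R * qp (pc K T) * (\<Prod>i=1..K. Hf (T i))" .
 qed
 also have "\<dots> = (\<Sum>T\<in>fam K t. if \<forall>i\<in>{1..K}. deg (T i) = d i then ?R * qp (pc K T) * (\<Prod>i=1..K. Hf (T i)) else 0)"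
  by (rule sum.inter_filter[OF finite_fam[OF t]])
 also have "\<dots> = (\<Sum>T\<in>fam K t. ?R * (qp (pc K T) * (\<Prod>i=1..K. H (d i) (T i))))"
 proof (rule sum.cong[OF refl])
  fix T assume T: "T \<in> fam K t"
  have Hd: "H (d i) (T i) = (if deg (T i) = d i then Hf (T i) else 0)" if "i \<in> {1..K}" for i
   using fam_flow[OF T that] by (auto simp: H_def Hf_def)
  show "(if \<forall>i\<in>{1..K}. deg (T i) = d i then ?R * qp (pc K T) * (\<Prod>i=1..K. Hf (T i)) else 0) =
    ?R * (qp (pc K T) * (\<Prod>i=1..K. H (d i) (T i)))"
  proof (cases "\<forall>i\<in>{1..K}. deg (T i) = d i")
   case True
   then have "(\<Prod>i=1..K. H (d i) (T i)) = (\<Prod>i=1..K. Hf (T i))" by (intro prod.cong refl) (simp add: Hd)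
   then show ?thesis unfolding if_P[OF True] by (simp only: mult.assoc)
  next
   case False
   then obtain i where i: "i \<in> {1..K}" "deg (T i) ~= d i" by blast
   then have "H (d i) (T i) = 0" using Hd by simp
   then have "(\<Prod>i=1..K. H (d i) (T i)) = 0" using i(1) by (intro prod_zero) auto
   then show ?thesis unfolding if_not_P[OF False] by simp
  qed
 qed
 also have "\<dots> = ?R * sp (%i. H (d i)) K t" unfolding sp_fam[OF t] sum_distrib_left by (rule refl)
 finally show ?thesis .
qed

end

context web_cut
begin

text \<open>The block as a function of the edge instead of its position in the cut. For an edge of
  the cut the index set has one element, since no slice repeats an edge.\<close>

definition bl :: "'e => nat set" where
 "bl e = (\<Union>j\<in>{j. j < length (sl 0) \<and> sl 0 ! j = e}. cut_block w h j)"

abbreviation S0 :: "nat set" where "S0 \<equiv> {1..web_degree w}"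

lemma bl_nth: "j < length (sl 0) ==> bl (sl 0 ! j) = cut_block w h j"
proof -
 assume j: "j < length (sl 0)"
 have "{i. i < length (sl 0) \<and> sl 0 ! i = sl 0 ! j} = {j}"
  using j cw.dist_sl[of 0] by (auto simp: nth_eq_iff_index_eq)
 then show ?thesis by (simp add: bl_def)
qed

lemma gb_web: "cw.gb t0 S0 bl"
proof -
 let ?ts = "cut_thickness w h"
 have len: "length ?ts = length (sl 0)" by (simp add: cut_thickness_def sl0)
 have U: "(\<Union>e\<in>set (sl 0). bl e) = (\<Union>j<length (sl 0). cut_block w h j)"
  using bl_nth by (force simp: set_conv_nth)
 have "(\<Union>j<length (sl 0). cut_block w h j) = {0<..sum_list ?ts}"
  using blocks_union[of "length ?ts" ?ts] unfolding cut_block_def len by (simp add: len)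
 then have S: "S0 = (\<Union>e\<in>set (sl 0). bl e)" unfolding U web_degree_eq[OF rad] by auto
 have card: "card (bl e) = t0 e" if e: "e \<in> set (sl 0)" for e
 proof -
  obtain j where j: "j < length (sl 0)" "sl 0 ! j = e" using e by (auto simp: in_set_conv_nth)
  have "take (Suc j) ?ts = take j ?ts @ [?ts ! j]" using j len by (simp add: take_Suc_conv_app_nth)
  then have "card (cut_block w h j) = ?ts ! j" unfolding cut_block_def by simp
  also have "\<dots> = thick w e" using j by (simp add: cut_thickness_def sl0)
  finally show ?thesis using bl_nth[OF j(1)] j(2) sl0_edges e by (auto simp: t0_def)
 qed
 have ord: "u < v" if s: "sl 0 = A @ e # B" and x: "x \<in> set A" and u: "u \<in> bl x" and v: "v \<in> bl e" for A e B x u v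
 proof -
  obtain i where i: "i < length A" "A ! i = x" using x by (auto simp: in_set_conv_nth)
  have xi: "sl 0 ! i = x" "i < length (sl 0)" using s i by (simp_all add: nth_append)
  have ej: "sl 0 ! length A = e" "length A < length (sl 0)" using s by simp_all
  have "u \<le> sum_list (take (Suc i) ?ts)" using u bl_nth[OF xi(2)] xi(1) by (simp add: cut_block_def)
  also have "\<dots> \<le> sum_list (take (length A) ?ts)" by (rule sum_take_mono) (use i in simp)
  also have "\<dots> < v" using v bl_nth[OF ej(2)] ej(1) by (simp add: cut_block_def)
  finally show ?thesis .
 qed
 show ?thesis unfolding cw.gb_def
 proof (intro conjI ballI allI impI)
  show "S0 = (\<Union>e\<in>set (sl 0). bl e)" by (rule S)
 qed (use card ord in \<open>blast | simp\<close>)+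
qed

text \<open>Apart from ordering the edges at a vertex, only the default value off the edges differs:
  \<open>undefined\<close> in \<open>SLD\<close>, {} in \<open>SL\<close>.\<close>

lemma SLD_bij: "bij_betw (%L e. if e \<in> edges w then L e else {}) (SLD w h) (cw.SL t0 S0 bl)"
proof (rule bij_betw_byWitness[where f' = "%L. restrict L (edges w)"])
 have cut: "(\<forall>j<length (cut_edges w h). L (cut_edges w h ! j) = cut_block w h j) \<longleftrightarrow> (\<forall>e\<in>set (sl 0). L e = bl e)" for L
  using bl_nth unfolding sl0[symmetric] by (auto simp: all_set_conv_all_nth)
 have vert: "(\<Union>e\<in>in_edges w v. L' e) = (\<Union>e\<in>out_edges w v. L' e) \<and> disjoint_family_on L' (in_edges w v) \<and> disjoint_family_on L' (out_edges w v)"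
  if "(\<Union>e\<in>in_edges w v. L e) = (\<Union>e\<in>out_edges w v. L e)" "disjoint_family_on L (in_edges w v)" "disjoint_family_on L (out_edges w v)"
   "\<And>e. e \<in> edges w ==> L' e = L e" for L L' v
 proof -
  have "L' e = L e" if "e \<in> in_edges w v \<or> e \<in> out_edges w v" for e using that \<open>\<And>e. e \<in> edges w ==> L' e = L e\<close> by (auto simp: in_edges_def out_edges_def)
  then show ?thesis using that(1-3) by (simp add: disjoint_family_on_def)
 qed
 show "\<forall>L\<in>SLD w h. restrict (%e. if e \<in> edges w then L e else {}) (edges w) = L"
 proof
  fix L assume "L \<in> SLD w h"
  then have "L \<in> extensional (edges w)" by (simp add: SLD_def PiE_def)
  then show "restrict (%e. if e \<in> edges w then L e else {}) (edges w) = L" by (auto simp: fun_eq_iff extensional_def)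
 qed
 show "\<forall>L\<in>cw.SL t0 S0 bl. (%e. if e \<in> edges w then restrict L (edges w) e else {}) = L"
 proof
  fix L assume L: "L \<in> cw.SL t0 S0 bl"
  show "(%e. if e \<in> edges w then restrict L (edges w) e else {}) = L"
  proof
   fix e show "(if e \<in> edges w then restrict L (edges w) e else {}) = L e" using cw.SL_D(1)[OF L, of e] by simp
  qed
 qed
 show "(%L e. if e \<in> edges w then L e else {}) ` SLD w h \<subseteq> cw.SL t0 S0 bl"
 proof clarify
  fix L assume "L \<in> SLD w h"
  then have 1: "\<And>e. e \<in> edges w ==> L e \<subseteq> S0" and 2: "\<forall>e\<in>set (sl 0). L e = bl e" and 3: "\<And>e. e \<in> edges w ==> card (L e) = thick w e"
   and 4: "\<And>v. v \<in> verts w ==> (\<Union>e\<in>in_edges w v. L e) = (\<Union>e\<in>out_edges w v. L e)"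
    "\<And>v. v \<in> verts w ==> disjoint_family_on L (in_edges w v)" "\<And>v. v \<in> verts w ==> disjoint_family_on L (out_edges w v)"
   unfolding SLD_def cut by auto
  let ?L = "%e. if e \<in> edges w then L e else {}"
  show "?L \<in> cw.SL t0 S0 bl" unfolding cw.SL_def set_vs
  proof (intro CollectI conjI allI impI ballI)
   show "?L e = bl e" if "e \<in> set (sl 0)" for e using 2 that sl0_edges by auto
   show "?L e \<subseteq> S0" "card (?L e) = t0 e" if "e \<in> edges w" for e using 1 3 that by (simp_all add: t0_def)
   fix v assume v: "v \<in> verts w"
   have "(\<Union>e\<in>in_edges w v. ?L e) = (\<Union>e\<in>out_edges w v. ?L e) \<and> disjoint_family_on ?L (in_edges w v) \<and> disjoint_family_on ?L (out_edges w v)"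
    by (rule vert[OF 4(1,2,3)[OF v]]) simp
   then show "(\<Union>e\<in>set (ins v). ?L e) = (\<Union>e\<in>set (outs v). ?L e)" "disjoint_family_on ?L (set (ins v))" "disjoint_family_on ?L (set (outs v))"
    unfolding vertex_lists(1,4)[OF v] by blast+
  qed simp
 qed
 show "(%L. restrict L (edges w)) ` cw.SL t0 S0 bl \<subseteq> SLD w h"
 proof clarify
  fix L assume L: "L \<in> cw.SL t0 S0 bl"
  let ?L = "restrict L (edges w)"
  have c2: "\<forall>e\<in>set (sl 0). ?L e = bl e" using cw.SL_D(4)[OF L] sl0_edges by auto
  show "?L \<in> SLD w h" unfolding SLD_def cut
  proof (intro CollectI conjI ballI)
   show "?L \<in> edges w \<rightarrow>\<^sub>E Pow S0" using cw.SL_D(2)[OF L] by auto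
   show "?L e = bl e" if "e \<in> set (sl 0)" for e using c2 that by blast
   show "card (?L e) = thick w e" if "e \<in> edges w" for e using cw.SL_D(3)[OF L that] that by (simp add: t0_def)
   fix v assume v: "v \<in> verts w"
   have vv: "v \<in> set vs" using v set_vs by simp
   have "(\<Union>e\<in>in_edges w v. ?L e) = (\<Union>e\<in>out_edges w v. ?L e) \<and> disjoint_family_on ?L (in_edges w v) \<and> disjoint_family_on ?L (out_edges w v)"
    by (rule vert[OF cw.SL_D(5-7)[OF L vv, unfolded vertex_lists(1,4)[OF v]]]) simp
   then show "(\<Union>e\<in>in_edges w v. ?L e) = (\<Union>e\<in>out_edges w v. ?L e)" "disjoint_family_on ?L (in_edges w v)" "disjoint_family_on ?L (out_edges w v)" by blast+
  qed
 qed
qed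

lemma loop_inv_linv:
 assumes L: "L \<in> cw.SL t0 S0 bl" and eq: "\<And>e. e \<in> edges w ==> M e = L e"
 shows "loop_inv w h M \<sigma> = cw.linv L \<sigma>"
proof -
 have fL: "finite (L e)" for e using cw.SL_D(2)[OF L, of e] finite_subset by blast
 have fin: "finite {(u, v). u \<in> B \<and> v \<in> B \<and> u < v}" if "finite B" for B :: "nat set"
  by (rule finite_subset[of _ "B \<times> B"]) (use that in auto)
 have finB: "finite (cut_block w h j)" for j by (simp add: cut_block_def)
 have a: "(\<Sum>j<length (cut_edges w h). \<Sum>p\<in>{(u, v). u \<in> cut_block w h j \<and> v \<in> cut_block w h j \<and> u < v}. attack_sign \<sigma> p) =
   (\<Sum>e\<in>set (sl 0). \<Sum>p\<in>{(u, v). u \<in> L e \<and> v \<in> L e \<and> u < v}. attack_sign \<sigma> p)" (is "?A = ?B")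
 proof -
  have "?B = (\<Sum>j<length (sl 0). \<Sum>p\<in>{(u, v). u \<in> L (sl 0 ! j) \<and> v \<in> L (sl 0 ! j) \<and> u < v}. attack_sign \<sigma> p)"
   by (rule sum.reindex_bij_betw[symmetric, OF bij_betw_nth]) (use cw.dist_sl[of 0] in auto)
  also have "\<dots> = ?A" unfolding sl0[symmetric]
  proof (rule sum.cong[OF refl])
   fix j assume "j \<in> {..<length (sl 0)}"
   then have "L (sl 0 ! j) = cut_block w h j" using cw.SL_D(4)[OF L, of "sl 0 ! j"] bl_nth[of j] by simp
   then show "(\<Sum>p\<in>{(u, v). u \<in> L (sl 0 ! j) \<and> v \<in> L (sl 0 ! j) \<and> u < v}. attack_sign \<sigma> p) =
     (\<Sum>p\<in>{(u, v). u \<in> cut_block w h j \<and> v \<in> cut_block w h j \<and> u < v}. attack_sign \<sigma> p)" by (simp only:)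
  qed
  finally show ?thesis by (rule sym)
 qed
 have b: "(\<Sum>m\<in>merges w. \<Sum>p\<in>#mset_set (M (left_in w m) \<times> M (right_in w m)). attack_sign \<sigma> p) =
   (\<Sum>m\<in>merges w. \<Sum>p\<in>L (ins m ! 0) \<times> L (ins m ! 1). attack_sign \<sigma> p)"
 proof (rule sum.cong[OF refl])
  fix m assume m: "m \<in> merges w"
  have mv: "m \<in> verts w" using m by (simp add: merges_def)
  have i: "ins m ! 0 = left_in w m" "ins m ! 1 = right_in w m" using merge_ins[OF m] by simp_all
  have "left_in w m \<in> edges w" "right_in w m \<in> edges w" using in_out_edges(1)[OF mv] merge_ins[OF m] by auto
  then have e: "M (left_in w m) = L (left_in w m)" "M (right_in w m) = L (right_in w m)" using eq by blast+
  show "(\<Sum>p\<in>#mset_set (M (left_in w m) \<times> M (right_in w m)). attack_sign \<sigma> p) = (\<Sum>p\<in>L (ins m ! 0) \<times> L (ins m ! 1). attack_sign \<sigma> p)"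
   unfolding e i by (rule sum_mset_mset_set) (use fL in simp)
 qed
 have "loop_inv w h M \<sigma> =
   (\<Sum>j<length (cut_edges w h). \<Sum>p\<in>#mset_set {(u, v). u \<in> cut_block w h j \<and> v \<in> cut_block w h j \<and> u < v}. attack_sign \<sigma> p) +
   (\<Sum>m\<in>merges w. \<Sum>p\<in>#mset_set (M (left_in w m) \<times> M (right_in w m)). attack_sign \<sigma> p)"
  unfolding loop_inv_def attacking_pairs_def image_mset_union sum_mset.union sum_mset_sum by (rule refl)
 also have "\<dots> = cw.linv L \<sigma>"
  unfolding b sum_mset_mset_set[OF fin[OF finB]] a cw.linv_def mgs_merges by (rule refl)
 finally show ?thesis .
qed

lemma LLT_web_sum:
 "LLT_web w h \<mu> = 1 / (\<Prod>e\<in>set (sl 0). qfact (t0 e)) *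
  (\<Sum>L\<in>cw.SL t0 S0 bl. \<Sum>\<sigma>\<in>{\<sigma> \<in> S0 \<rightarrow>\<^sub>E {1..}. (\<Sum>u\<in>S0. sgl (\<sigma> u) 1) = \<mu>}. qp (cw.linv L \<sigma>))"
proof -
 have "qfact_comp (cut_thickness w h) = (\<Prod>e\<in>set (sl 0). qfact (thick w e))"
  unfolding qfact_comp_def cut_thickness_def map_map sl0[symmetric]
  using prod.distinct_set_conv_list[OF cw.dist_sl[of 0], of "qfact \<circ> thick w"] by simp
 also have "\<dots> = (\<Prod>e\<in>set (sl 0). qfact (t0 e))" by (rule prod.cong) (use sl0_edges in \<open>auto simp: t0_def\<close>)
 finally have q: "qfact_comp (cut_thickness w h) = (\<Prod>e\<in>set (sl 0). qfact (t0 e))" .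
 let ?r = "%L e. if e \<in> edges w then L e else {}"
 let ?G = "{\<sigma> \<in> S0 \<rightarrow>\<^sub>E {1..}. (\<Sum>u\<in>S0. sgl (\<sigma> u) 1) = \<mu>}"
 have "(\<Sum>L\<in>SLD w h. \<Sum>\<sigma>\<in>?G. qp (loop_inv w h L \<sigma>)) = (\<Sum>L\<in>SLD w h. \<Sum>\<sigma>\<in>?G. qp (cw.linv (?r L) \<sigma>))"
 proof (intro sum.cong refl)
  fix L \<sigma> assume "L \<in> SLD w h"
  then have "?r L \<in> cw.SL t0 S0 bl" using bij_betwE[OF SLD_bij] by blast
  then have "loop_inv w h L \<sigma> = cw.linv (?r L) \<sigma>" by (rule loop_inv_linv) simp
  then show "qp (loop_inv w h L \<sigma>) = qp (cw.linv (?r L) \<sigma>)" by (simp only:)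
 qed
 also have "\<dots> = (\<Sum>L\<in>cw.SL t0 S0 bl. \<Sum>\<sigma>\<in>?G. qp (cw.linv L \<sigma>))"
  by (rule sum.reindex_bij_betw[OF SLD_bij])
 finally show ?thesis unfolding LLT_web_def q by (simp only:)
qed

interpretation sH: newton_family "edges w" ins outs vs sl cw.H cw.hc by (rule cw.newton_family_H)

text \<open>A map \<sigma> with monomial x^\<mu> takes only values that occur in \<mu>. The
  unbounded range may thus be cut down to \<open>kmax \<mu>\<close> colours,
  \<open>labelings_total\<close> applies, and the quantum factorials of the cut cancel.\<close>

lemma LLT_web_ser: "LLT_web w h = sH.ser t0"
proof
 fix \<mu>
 show "LLT_web w h \<mu> = sH.ser t0 \<mu>"
 proof (cases "pkeys \<mu> \<subseteq> {1..}")
  case True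
  let ?K = "sH.kmax \<mu>"
  have K: "pkeys \<mu> \<subseteq> {1..?K}" by (rule sH.keys_kmax[OF True])
  have eq: "{\<sigma> \<in> S0 \<rightarrow>\<^sub>E {1..}. (\<Sum>u\<in>S0. sgl (\<sigma> u) 1) = \<mu>} =
    {\<sigma> \<in> S0 \<rightarrow>\<^sub>E {1..?K}. \<forall>i\<in>{1..?K}. card {u \<in> S0. \<sigma> u = i} = lkp \<mu> i}" (is "?G = ?G'")
  proof (intro equalityI subsetI)
   fix \<sigma> assume "\<sigma> \<in> ?G"
   then have \<sigma>: "\<sigma> \<in> S0 \<rightarrow>\<^sub>E {1..}" and m: "(\<Sum>u\<in>S0. sgl (\<sigma> u) 1) = \<mu>" by auto
   have c: "card {u \<in> S0. \<sigma> u = i} = lkp \<mu> i" for i using lookup_monomial[of S0 \<sigma> i] m by simp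
   have "\<sigma> u \<in> {1..?K}" if u: "u \<in> S0" for u
   proof -
    have "u \<in> {v \<in> S0. \<sigma> v = \<sigma> u}" using u by simp
    moreover have "finite {v \<in> S0. \<sigma> v = \<sigma> u}" by simp
    ultimately have "card {v \<in> S0. \<sigma> v = \<sigma> u} ~= 0" by (metis card_0_eq empty_iff)
    then have "\<sigma> u \<in> pkeys \<mu>" unfolding c by (simp add: in_keys_iff)
    then show ?thesis using K by blast
   qed
   then have "\<sigma> \<in> S0 \<rightarrow>\<^sub>E {1..?K}" using \<sigma> by (intro PiE_I) (auto simp: PiE_def extensional_def)
   then show "\<sigma> \<in> ?G'" using c by blast
  next
   fix \<sigma> assume "\<sigma> \<in> ?G'"
   then have \<sigma>: "\<sigma> \<in> S0 \<rightarrow>\<^sub>E {1..?K}" and c: "\<And>i. i \<in> {1..?K} ==> card {u \<in> S0. \<sigma> u = i} = lkp \<mu> i" by auto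
   have "lkp (\<Sum>u\<in>S0. sgl (\<sigma> u) 1) i = lkp \<mu> i" for i
   proof (cases "i \<in> {1..?K}")
    case True
    show ?thesis unfolding lookup_monomial[OF finite_atLeastAtMost] by (rule c[OF True])
   next
    case False
    then have "{u \<in> S0. \<sigma> u = i} = {}" using \<sigma> by auto
    moreover have "lkp \<mu> i = 0" using False K by (meson in_keys_iff subsetD)
    ultimately show ?thesis unfolding lookup_monomial[OF finite_atLeastAtMost] by simp
   qed
   then have "(\<Sum>u\<in>S0. sgl (\<sigma> u) 1) = \<mu>" by (rule poly_mapping_eqI)
   moreover have "\<sigma> \<in> S0 \<rightarrow>\<^sub>E {1..}" using \<sigma> by (intro PiE_I) (auto simp: PiE_def extensional_def Pi_def)
   ultimately show "\<sigma> \<in> ?G" by blast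
  qed
  have nz: "(\<Prod>e\<in>set (sl 0). qfact (t0 e)) ~= 0" using qfact_nz by simp
  show ?thesis
   unfolding LLT_web_sum eq cw.labelings_total[OF flow_t0 gb_web] sH.ser_eq[OF K] using nz by simp
 next
  case False
  have "{\<sigma> \<in> S0 \<rightarrow>\<^sub>E {1..}. (\<Sum>u\<in>S0. sgl (\<sigma> u) 1) = \<mu>} = {}"
  proof (rule ccontr)
   assume "\<not> ?thesis"
   then obtain \<sigma> where \<sigma>: "\<sigma> \<in> S0 \<rightarrow>\<^sub>E {1..}" and m: "(\<Sum>u\<in>S0. sgl (\<sigma> u) 1) = \<mu>" by blast
   have "i \<in> {1..}" if "i \<in> pkeys \<mu>" for i
   proof -
    have "lkp \<mu> i ~= 0" using that by (simp add: in_keys_iff)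
    then have "card {u \<in> S0. \<sigma> u = i} ~= 0" unfolding m[symmetric] lookup_monomial[OF finite_atLeastAtMost] .
    then have "{u \<in> S0. \<sigma> u = i} ~= {}" by (metis card.empty)
    then obtain u where "u \<in> S0" "\<sigma> u = i" by blast
    then show ?thesis using PiE_mem[OF \<sigma>, of u] by simp
   qed
   then show False using False by blast
  qed
  then show ?thesis unfolding LLT_web_sum sH.ser_def if_not_P[OF False] by (simp only: sum.empty sum.neutral_const mult_zero_right)
 qed
qed

interpretation sX: newton_family "edges w" ins outs vs sl cw.X "%_. 1" by (rule cw.newton_family_X)

lemma LLT_web_plethysm: "LLT_web w h = series_scale ((q - inverse q) ^ web_degree w) (plethysm (X_web w))"
 unfolding LLT_web_ser X_web_ser deg_t0[symmetric] by (rule cw.plethysm_ser_X[OF flow_t0, symmetric])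

lemma LLT_web_sym: "LLT_web w h \<in> sym_functions"
 unfolding LLT_web_ser by (rule sH.ser_sym[OF flow_t0])

end

theorem proposition5p2:
  fixes w :: "'e web" and n :: nat
  assumes "annular_web w"
    and "web_degree w = n"
  shows "(\<forall>h. radial_cut w h \<longrightarrow>
            LLT_web w h = series_scale ((q - inverse q) ^ n) (plethysm (X_web w))) \<and>
         (\<forall>h. radial_cut w h \<longrightarrow> LLT_web w h \<in> sym_functions) \<and>
         (\<forall>h h'. radial_cut w h \<longrightarrow> radial_cut w h' \<longrightarrow> LLT_web w h = LLT_web w h')"
proof -
  interpret ann_web w by unfold_locales (rule assms(1))
  have main: "LLT_web w h = series_scale ((q - inverse q) ^ n) (plethysm (X_web w)) \<and> LLT_web w h \<in> sym_functions"
    if rad: "radial_cut w h" for h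
  proof -
    obtain vs sl where s: "cweb (edges w) ins outs vs sl" "sl 0 = cut_edges w h" "set vs = verts w"
      "\<And>k. k \<le> length vs \<Longrightarrow> good (sl k)" using web_cweb[OF rad] by blast
    interpret cw: cweb "edges w" ins outs vs sl by (rule s(1))
    interpret web_cut w vs sl h by unfold_locales (fact rad s(2-4))+
    show ?thesis using LLT_web_plethysm LLT_web_sym assms(2) by simp
  qed
  show ?thesis
  proof (intro conjI allI impI)
    \<comment> \<open>The plethystic side of the formula does not mention the cut.\<close>
    show "LLT_web w h = LLT_web w h'" if "radial_cut w h" "radial_cut w h'" for h h'
      using main[OF that(1)] main[OF that(2)] by simp
  qed (use main in blast)+
qed

end
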